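(* For every integer $N\ge1$, define $$V_N=\{u_0\in\mathcal M(N)\;:\;\det(J_{2(m+n)}(u_0))_{1\le m,n\le N}=0\}.$$ Then $V_N$ is a proper real analytic subvariety of $\mathcal M(N)$ and, for every $u_0\in\mathcal M(N)\setminus V_N$ and every $s\ge0$, the solution $u$ of $i\partial_tu=\Pi(|u|^2u)$ with $u(0)=u_0$ satisfies $$\sup_{t\in\mathbb R}\|u(t)\|_{H^s}<+\infty.\qquad( * )$$ In particular, $( * )$ holds for every $u_0\in\mathcal M(N)$ outside a closed subset of measure $0$. Similarly, setting $\tilde V_{N-1}:=V_N\cap\tilde{\mathcal M}(N-1)$, $\tilde V_{N-1}$ is a proper real analytic subvariety of $\tilde{\mathcal M}(N-1)$ and, for every $u_0\in\tilde{\mathcal M}(N-1)\setminus\tilde V_{N-1}$ and every $s\ge0$, $( * )$ holds; in particular $( * )$ holds for every $u_0\in\tilde{\mathcal M}(N-1)$ outside a closed subset of measure $0$.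
   Context: $\mathbb S^1$ is the unit circle, $(u|v)=\int_{\mathbb S^1}u\overline v\,\frac{d\theta}{2\pi}$; $E_+$ denotes the elements $u$ of a space $E$ of distributions on $\mathbb S^1$ with $\hat u(k)=0$ for $k<0$; $\Pi:L^2(\mathbb S^1)\to L^2_+$ is the orthogonal projector; $H^s$ is the Sobolev space. For $u\in H^{1/2}_+$, $H_u(h)=\Pi(u\overline h)$ is the ($\mathbb C$-antilinear) Hankel operator on $L^2_+$, and $J_n(u)=(H_u^n(1)|1)$ for $n\ge1$. For each $u_0\in H^{1/2}_+$ the equation $i\partial_tu=\Pi(|u|^2u)$ has a unique solution in $C(\mathbb R,H^{1/2}_+)$. $\mathbb C_D[z]$ is the set of complex polynomials of degree at most $D$, $d(A)$ the degree of $A$. $\mathcal M(N)$ is the set of rational functions $u=A/B$ with $A\in\mathbb C_{N-1}[z]$, $B\in\mathbb C_N[z]$, $B(0)=1$, $d(A)=N-1$ or $d(B)=N$, $A$ and $B$ without common factors, and $B(z)\ne0$ if $|z|\le1$; it is a $2N$-dimensional complex submanifold of $L^2_+$. $\tilde{\mathcal M}(N-1)$ is the complex hypersurface of $\mathcal M(N)$ consisting of those $u=A/B\in\mathcal M(N)$ with $d(B)\le N-1$ (hence $d(A)=N-1$ exactly). *)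

theory Defs
  imports
    "HOL-Analysis.Analysis"
    "HOL-Computational_Algebra.Computational_Algebra"
    "HOL-Computational_Algebra.Field_as_Ring"
    "Jordan_Normal_Form.Determinant"
begin

section \<open>Function spaces on the unit circle\<close>

text \<open>
  Elements of the function spaces are represented by Borel functions on the complex plane of
  which only the almost-everywhere class on the unit circle matters.
\<close>

definition circle :: "complex measure" where
  "circle = distr (uniform_measure lborel {0..2 * pi}) borel cis"

lemma integral_circle:
  fixes f :: "complex \<Rightarrow> complex"
  assumes [measurable]: "f \<in> borel_measurable borel"
  shows "(\<integral>z. f z \<partial>circle) = (LINT \<theta>:{0..2 * pi}|lborel. f (cis \<theta>)) / (2 * pi)"
proof -
  have [measurable]: "cis \<in> borel_measurable borel"
    by (intro borel_measurable_continuous_onI continuous_intros)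
  have "(\<integral>z. f z \<partial>circle) = (\<integral>\<theta>. f (cis \<theta>) \<partial>uniform_measure lborel {0..2 * pi})"
    unfolding circle_def by (rule integral_distr) (auto simp: uniform_measure_def)
  also have "uniform_measure lborel {0..2 * pi} =
      density lborel (\<lambda>\<theta>. ennreal (indicator {0..2 * pi} \<theta> / (2 * pi)))"
    unfolding uniform_measure_def
    by (intro density_cong) (auto simp: divide_ennreal[symmetric] ennreal_indicator split: split_indicator)
  also have "(\<integral>\<theta>. f (cis \<theta>) \<partial>\<dots>) = (\<integral>\<theta>. (indicator {0..2 * pi} \<theta> / (2 * pi)) *\<^sub>R f (cis \<theta>) \<partial>lborel)"
    by (rule integral_density) auto
  also have "\<dots> = (LINT \<theta>:{0..2 * pi}|lborel. f (cis \<theta>)) / (2 * pi)"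
    unfolding set_lebesgue_integral_def
    by (subst integral_divide_zero[symmetric]) (auto intro!: Bochner_Integration.integral_cong simp: scaleR_conv_of_real)
  finally show ?thesis .
qed

definition cinner :: "(complex \<Rightarrow> complex) \<Rightarrow> (complex \<Rightarrow> complex) \<Rightarrow> complex" where
  "cinner u v = (\<integral>z. u z * cnj (v z) \<partial>circle)"

definition fourier :: "(complex \<Rightarrow> complex) \<Rightarrow> int \<Rightarrow> complex" where
  "fourier u k = cinner u (\<lambda>z. z powi k)"

definition L2 :: "(complex \<Rightarrow> complex) set" where
  "L2 = {u \<in> borel_measurable borel. integrable circle (\<lambda>z. (cmod (u z))\<^sup>2)}"

definition l2_dist :: "(complex \<Rightarrow> complex) \<Rightarrow> (complex \<Rightarrow> complex) \<Rightarrow> real" where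
  "l2_dist u v = sqrt (\<integral>z. (cmod (u z - v z))\<^sup>2 \<partial>circle)"

definition plus_part :: "(complex \<Rightarrow> complex) set \<Rightarrow> (complex \<Rightarrow> complex) set" where
  "plus_part E = {u \<in> E. \<forall>k<0. fourier u k = 0}"

text \<open>
  \<open>sobolev s\<close> is the Sobolev space of order \<open>s\<close> for \<open>s \<ge> 0\<close> only (then it lies in \<open>L2\<close>);
  \<open>sobolev_norm s u\<close> is meaningful for \<open>u \<in> sobolev s\<close>.
\<close>

definition sobolev :: "real \<Rightarrow> (complex \<Rightarrow> complex) set" where
  "sobolev s = {u \<in> L2. (\<lambda>k::int. (1 + (of_int k)\<^sup>2) powr s * (cmod (fourier u k))\<^sup>2) summable_on UNIV}"

definition sobolev_norm :: "real \<Rightarrow> (complex \<Rightarrow> complex) \<Rightarrow> real" where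
  "sobolev_norm s u =
     sqrt (\<Sum>\<^sub>\<infinity>k::int. (1 + (of_int k)\<^sup>2) powr s * (cmod (fourier u k))\<^sup>2)"


section \<open>Szego projector, Hankel operators and the cubic Szego equation\<close>

text \<open>
  The orthogonal projection onto \<open>plus_part L2\<close>; the choice only selects a representative of its
  almost-everywhere class. For \<open>u\<close> of class \<open>H\<^sup>1\<^sup>/\<^sup>2\<close>, the product of \<open>u\<close> and the conjugate of a
  square integrable \<open>h\<close> need only be integrable. Its projection, i.e. the square integrable function
  having its Fourier coefficients of index \<open>k \<ge> 0\<close>, satisfies the same condition (by Smirnov's
  theorem, the integral being \<open>0\<close> by convention when the integrand is not integrable).
\<close>

definition szego_proj :: "(complex \<Rightarrow> complex) \<Rightarrow> (complex \<Rightarrow> complex)" where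
  "szego_proj f =
     (SOME g. g \<in> plus_part L2 \<and> (\<forall>h\<in>plus_part L2. cinner (\<lambda>z. f z - g z) h = 0))"

definition hankel :: "(complex \<Rightarrow> complex) \<Rightarrow> (complex \<Rightarrow> complex) \<Rightarrow> (complex \<Rightarrow> complex)" where
  "hankel u h = szego_proj (\<lambda>z. u z * cnj (h z))"

definition moment :: "nat \<Rightarrow> (complex \<Rightarrow> complex) \<Rightarrow> complex" where
  "moment n u = cinner ((hankel u ^^ n) (\<lambda>_. 1)) (\<lambda>_. 1)"

text \<open>
  Solutions in \<open>C(\<real>, H\<^sup>1\<^sup>/\<^sup>2\<^sub>+)\<close>, where the equation is understood in the sense of
  distributions on the circle, i.e. for every Fourier coefficient.
\<close>

definition szego_solution :: "(real \<Rightarrow> complex \<Rightarrow> complex) \<Rightarrow> bool" where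
  "szego_solution u \<longleftrightarrow>
     (\<forall>t. u t \<in> plus_part (sobolev (1/2))) \<and>
     (\<forall>t. ((\<lambda>\<tau>. sobolev_norm (1/2) (\<lambda>z. u \<tau> z - u t z)) \<longlongrightarrow> 0) (at t)) \<and>
     (\<forall>t k. ((\<lambda>\<tau>. \<i> * fourier (u \<tau>) k) has_vector_derivative
        fourier (szego_proj (\<lambda>z. complex_of_real ((cmod (u t z))\<^sup>2) * u t z)) k) (at t))"

definition sobolev_bounded :: "real \<Rightarrow> (real \<Rightarrow> complex \<Rightarrow> complex) \<Rightarrow> bool" where
  "sobolev_bounded s u \<longleftrightarrow>
     (\<forall>t. u t \<in> sobolev s) \<and> bdd_above (range (\<lambda>t. sobolev_norm s (u t)))"

definition solution_bounded_from :: "real \<Rightarrow> (complex \<Rightarrow> complex) \<Rightarrow> bool" where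
  "solution_bounded_from s u0 \<longleftrightarrow>
     (\<forall>u. szego_solution u \<and> (AE z in circle. u 0 z = u0 z) \<longrightarrow> sobolev_bounded s u)"


section \<open>The manifolds of rational functions\<close>

text \<open>\<open>A \<noteq> 0\<close> is needed since \<open>degree 0 = 0\<close>, which is \<open>N - 1\<close> for \<open>N = 1\<close>.\<close>

definition rat_pair :: "nat \<Rightarrow> complex poly \<Rightarrow> complex poly \<Rightarrow> bool" where
  "rat_pair N A B \<longleftrightarrow>
     degree A \<le> N - 1 \<and> degree B \<le> N \<and> poly B 0 = 1 \<and>
     (A \<noteq> 0 \<and> degree A = N - 1 \<or> degree B = N) \<and>
     coprime A B \<and> (\<forall>z. cmod z \<le> 1 \<longrightarrow> poly B z \<noteq> 0)"

definition ratM :: "nat \<Rightarrow> (complex \<Rightarrow> complex) set" where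
  "ratM N = {\<lambda>z. poly A z / poly B z | A B. rat_pair N A B}"

definition ratM_tilde :: "nat \<Rightarrow> (complex \<Rightarrow> complex) set" where
  "ratM_tilde n = {\<lambda>z. poly A z / poly B z | A B. rat_pair (Suc n) A B \<and> degree B \<le> n}"

text \<open>
  Global holomorphic coordinates: the coefficients \<open>x 0, \<dots>, x (N - 1)\<close> of \<open>A\<close>, followed by the
  nonconstant coefficients \<open>x N, \<dots>, x (d - 1)\<close> of \<open>B\<close>. The value \<open>d = 2 * N\<close> gives \<open>ratM N\<close> and
  \<open>d = 2 * N - 1\<close> gives \<open>ratM_tilde (N - 1)\<close>.
\<close>

definition numer :: "nat \<Rightarrow> (nat \<Rightarrow> complex) \<Rightarrow> complex poly" where
  "numer N x = Poly (map x [0..<N])"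

definition denom :: "nat \<Rightarrow> nat \<Rightarrow> (nat \<Rightarrow> complex) \<Rightarrow> complex poly" where
  "denom N d x = pCons 1 (Poly (map x [N..<d]))"

definition coord_dom :: "nat \<Rightarrow> nat \<Rightarrow> (nat \<Rightarrow> complex) set" where
  "coord_dom N d = {x \<in> {..<d} \<rightarrow>\<^sub>E UNIV. rat_pair N (numer N x) (denom N d x)}"

definition param :: "nat \<Rightarrow> nat \<Rightarrow> (nat \<Rightarrow> complex) \<Rightarrow> (complex \<Rightarrow> complex)" where
  "param N d x = (\<lambda>z. poly (numer N x) z / poly (denom N d x) z)"

abbreviation manifold :: "nat \<Rightarrow> nat \<Rightarrow> (complex \<Rightarrow> complex) set" where
  "manifold N d \<equiv> param N d ` coord_dom N d"

lemma numer_coeffs: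
  assumes "degree A \<le> N - 1" "N \<ge> 1" "\<And>i. i < N \<Longrightarrow> x i = coeff A i"
  shows "numer N x = A"
  using assms
  by (intro poly_eqI) (auto simp: numer_def coeff_Poly_eq nth_default_def intro!: coeff_eq_0)

lemma denom_coeffs:
  assumes "degree B \<le> d - N" "N \<le> d" "coeff B 0 = 1" "\<And>i. i < d - N \<Longrightarrow> x (N + i) = coeff B (Suc i)"
  shows "denom N d x = B"
proof (rule poly_eqI)
  fix i show "coeff (denom N d x) i = coeff B i"
    using assms
    by (cases i) (auto simp: denom_def coeff_Poly_eq nth_default_def intro!: coeff_eq_0)
qed

lemma degree_denom: "degree (denom N d x) \<le> d - N"
  by (rule degree_le)
    (auto simp: denom_def coeff_pCons coeff_Poly_eq nth_default_def split: nat.split)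

lemma rat_pair_coords:
  assumes "N \<ge> 1" "N \<le> d" "rat_pair N A B" "degree B \<le> d - N"
  obtains x where "x \<in> coord_dom N d" "numer N x = A" "denom N d x = B"
proof -
  define x where "x = (\<lambda>i\<in>{..<d}. if i < N then coeff A i else coeff B (Suc (i - N)))"
  have A: "numer N x = A"
    using assms by (intro numer_coeffs) (auto simp: x_def rat_pair_def)
  have B: "denom N d x = B"
    using assms by (intro denom_coeffs) (auto simp: x_def rat_pair_def poly_0_coeff_0)
  have "x \<in> {..<d} \<rightarrow>\<^sub>E UNIV" by (simp add: x_def)
  with A B assms(3) show ?thesis by (intro that[of x]) (auto simp: coord_dom_def)
qed

lemma ratM_eq_manifold:
  assumes "N \<ge> 1"
  shows "ratM N = manifold N (2 * N)"
proof
  show "ratM N \<subseteq> manifold N (2 * N)"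
  proof
    fix u assume "u \<in> ratM N"
    then obtain A B where u: "u = (\<lambda>z. poly A z / poly B z)" and "rat_pair N A B"
      by (auto simp: ratM_def)
    with assms obtain x where "x \<in> coord_dom N (2 * N)" "numer N x = A" "denom N (2 * N) x = B"
      using rat_pair_coords[of N "2 * N" A B] by (auto simp: rat_pair_def)
    then show "u \<in> manifold N (2 * N)"
      using u by (auto simp: param_def intro!: image_eqI[of _ _ x])
  qed
qed (auto simp: ratM_def coord_dom_def param_def)

lemma ratM_tilde_eq_manifold:
  assumes "N \<ge> 1"
  shows "ratM_tilde (N - 1) = manifold N (2 * N - 1)"
proof
  show "ratM_tilde (N - 1) \<subseteq> manifold N (2 * N - 1)"
  proof
    fix u assume "u \<in> ratM_tilde (N - 1)"
    then obtain A B where u: "u = (\<lambda>z. poly A z / poly B z)"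
      and "rat_pair N A B" "degree B \<le> N - 1"
      using assms by (auto simp: ratM_tilde_def)
    with assms obtain x where "x \<in> coord_dom N (2 * N - 1)" "numer N x = A" "denom N (2 * N - 1) x = B"
      by (elim rat_pair_coords[of N "2 * N - 1" A B, rotated 2]) auto
    then show "u \<in> manifold N (2 * N - 1)"
      using u by (auto simp: param_def intro!: image_eqI[of _ _ x])
  qed
next
  show "manifold N (2 * N - 1) \<subseteq> ratM_tilde (N - 1)"
    using degree_denom[of N "2 * N - 1"] assms
    by (fastforce simp: ratM_tilde_def coord_dom_def param_def)
qed

lemma inj_on_param:
  assumes "N \<le> d"
  shows "inj_on (param N d) (coord_dom N d)"
proof (rule inj_onI)
  fix x y assume x: "x \<in> coord_dom N d" and y: "y \<in> coord_dom N d"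
    and eq: "param N d x = param N d y"
  let ?A = "numer N x" and ?B = "denom N d x" and ?A' = "numer N y" and ?B' = "denom N d y"
  have nz: "poly ?B z \<noteq> 0" "poly ?B' z \<noteq> 0" if "cmod z \<le> 1" for z
    using x y that by (auto simp: coord_dom_def rat_pair_def)
  have "poly (?A * ?B' - ?A' * ?B) z = 0" if "cmod z \<le> 1" for z
    using fun_cong[OF eq, of z] nz[OF that] by (simp add: param_def field_simps)
  then have "cball 0 1 \<subseteq> {z. poly (?A * ?B' - ?A' * ?B) z = 0}" by auto
  moreover have "infinite (cball (0::complex) 1)"
    using finite_subset[OF ball_subset_cball, of "0::complex" 1]
      finite_imp_not_open[of "ball (0::complex) 1"] by auto
  ultimately have "infinite {z. poly (?A * ?B' - ?A' * ?B) z = 0}"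
    by (meson finite_subset)
  then have "?A * ?B' - ?A' * ?B = 0"
    using poly_roots_finite by blast
  then have cross: "?A * ?B' = ?A' * ?B" by simp
  have cop: "coprime ?A ?B" "coprime ?A' ?B'"
    using x y by (auto simp: coord_dom_def rat_pair_def)
  have B0: "poly ?B 0 = 1" "poly ?B' 0 = 1" by (simp_all add: denom_def)
  have "?B dvd ?B'"
    using cop(1) cross coprime_dvd_mult_right_iff[of ?B ?A ?B']
    by (simp add: coprime_commute)
  moreover have "?B' dvd ?B"
    using cop(2) cross coprime_dvd_mult_right_iff[of ?B' ?A' ?B]
    by (metis coprime_commute dvd_triv_right)
  ultimately obtain c where c: "?B' = ?B * c" and dvd: "?B' dvd ?B" by (blast elim: dvdE)
  have "?B \<noteq> 0" by (simp add: denom_def)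
  moreover have "?B * c dvd ?B * 1" using c dvd by simp
  ultimately have "c dvd 1" by (simp only: dvd_mult_cancel_left) simp
  then obtain a where a: "c = [:a:]" by (auto elim: is_unit_polyE)
  with B0 c have "a = 1" by simp
  with a c have B: "?B = ?B'" by (simp add: one_pCons[symmetric])
  with cross \<open>?B \<noteq> 0\<close> have A: "?A = ?A'" by simp
  have "x i = y i" if "i < d" for i
  proof (cases "i < N")
    case True
    with arg_cong[OF A, of "\<lambda>p. coeff p i"] show ?thesis
      by (simp add: numer_def coeff_Poly_eq nth_default_def)
  next
    case False
    with that have "i - N < d - N" by simp
    with False arg_cong[OF B, of "\<lambda>p. coeff p (Suc (i - N))"] show ?thesis
      by (simp add: denom_def coeff_Poly_eq nth_default_def)
  qed
  then show "x = y"
    using x y by (intro PiE_ext[of x "{..<d}" "\<lambda>_. UNIV" y]) (auto simp: coord_dom_def)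
qed

text \<open>
  The manifolds carry the topology of submanifolds of \<open>L2\<close>. Real analyticity and Lebesgue null
  sets are read in the global coordinates \<open>param N d\<close>, whose injectivity is shown above.
\<close>

definition l2_open_in :: "(complex \<Rightarrow> complex) set \<Rightarrow> (complex \<Rightarrow> complex) set \<Rightarrow> bool" where
  "l2_open_in M U \<longleftrightarrow> U \<subseteq> M \<and> (\<forall>u\<in>U. \<exists>e>0. \<forall>v\<in>M. l2_dist u v < e \<longrightarrow> v \<in> U)"

definition l2_closed_in :: "(complex \<Rightarrow> complex) set \<Rightarrow> (complex \<Rightarrow> complex) set \<Rightarrow> bool" where
  "l2_closed_in M F \<longleftrightarrow> F \<subseteq> M \<and> l2_open_in M (M - F)"

text \<open>
  Real analyticity at \<open>p\<close> of a function on \<open>\<complex>\<^sup>d\<close>: it is the sum of a power series in the real and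
  imaginary parts of the coordinates, with multi-indices \<open>\<alpha>\<close> and \<open>\<beta>\<close>, near \<open>p\<close>.
\<close>

definition real_analytic_at :: "nat \<Rightarrow> ((nat \<Rightarrow> complex) \<Rightarrow> real) \<Rightarrow> (nat \<Rightarrow> complex) \<Rightarrow> bool" where
  "real_analytic_at d f p \<longleftrightarrow>
     (\<exists>r>0. \<exists>c. \<forall>w \<in> {..<d} \<rightarrow>\<^sub>E UNIV. (\<forall>i<d. cmod (w i - p i) < r) \<longrightarrow>
        ((\<lambda>(\<alpha>, \<beta>). c \<alpha> \<beta> * (\<Prod>i<d. Re (w i - p i) ^ \<alpha> i * Im (w i - p i) ^ \<beta> i)) has_sum f w)
          (({..<d} \<rightarrow>\<^sub>E (UNIV :: nat set)) \<times> ({..<d} \<rightarrow>\<^sub>E (UNIV :: nat set))))"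

definition real_analytic_on :: "nat \<Rightarrow> nat \<Rightarrow> ((complex \<Rightarrow> complex) \<Rightarrow> real) \<Rightarrow> (complex \<Rightarrow> complex) set \<Rightarrow> bool" where
  "real_analytic_on N d f U \<longleftrightarrow>
     (\<forall>x\<in>coord_dom N d. param N d x \<in> U \<longrightarrow> real_analytic_at d (f \<circ> param N d) x)"

definition real_analytic_subvariety :: "nat \<Rightarrow> nat \<Rightarrow> (complex \<Rightarrow> complex) set \<Rightarrow> bool" where
  "real_analytic_subvariety N d V \<longleftrightarrow>
     l2_closed_in (manifold N d) V \<and>
     (\<forall>p\<in>manifold N d. \<exists>U F. l2_open_in (manifold N d) U \<and> p \<in> U \<and>
        finite F \<and> (\<forall>f\<in>F. real_analytic_on N d f U) \<and>
        V \<inter> U = {u \<in> U. \<forall>f\<in>F. f u = 0})"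

definition measure_zero :: "nat \<Rightarrow> nat \<Rightarrow> (complex \<Rightarrow> complex) set \<Rightarrow> bool" where
  "measure_zero N d S \<longleftrightarrow>
     (\<exists>Z \<in> null_sets (\<Pi>\<^sub>M i\<in>{..<d}. (lborel :: complex measure)).
        {x \<in> coord_dom N d. param N d x \<in> S} \<subseteq> Z)"

definition variety_V :: "nat \<Rightarrow> (complex \<Rightarrow> complex) set" where
  "variety_V N = {u0 \<in> ratM N.
     Determinant.det (Matrix.mat N N (\<lambda>(i, j). moment (2 * ((i + 1) + (j + 1))) u0)) = 0}"

definition variety_V_tilde :: "nat \<Rightarrow> (complex \<Rightarrow> complex) set" where
  "variety_V_tilde n = variety_V (Suc n) \<inter> ratM_tilde n"

end

theory Submission imports Defs "HOL-Complex_Analysis.Complex_Analysis" "Jordan_Normal_Form.Spectral_Radius" begin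

text \<open>
  For \<open>u\<^sub>0 = A / B\<close> the polynomials of degree \<open>< N\<close>, divided by \<open>B\<close>, form an \<open>N\<close>-dimensional space
  invariant under the backward shift and the Hankel operator. In an orthonormal basis let \<open>T\<close> and \<open>G\<close>
  be their matrices, let \<open>e\<close> represent evaluation at \<open>0\<close>, and put \<open>M = G cnj(G)\<close>, \<open>C = T M T*\<close>. Then
  \<open>\<langle>(exp(- i t M) exp(i t C) T)^n exp(- i t M) G e, e\<rangle>\<close> are the Fourier coefficients at time \<open>t\<close> of the
  solution. The determinant is the Gram determinant of \<open>M e, \<dots>, M^N e\<close>; if it does not vanish, \<open>e\<close> is cyclic
  for \<open>M\<close>, no product \<open>U V T\<close> with unitary \<open>U\<close>, \<open>V\<close> commuting with \<open>M\<close>, \<open>C\<close> has an eigenvalue of modulus \<open>1\<close>,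
  and by compactness of the set of these products the coefficients decay geometrically, uniformly in
  time. Uniqueness of solutions of finite energy then bounds all Sobolev norms.

  The determinant is a quotient of polynomials in the coordinates and their conjugates, since the
  Hankel operator is obtained by solving a Sylvester system. Hence its zero set is analytic, and null
  as soon as it is proper. It does not contain \<open>z^(N - 1) + z^(N - 2)\<close>, whose squared Hankel matrix is
  tridiagonal.
\<close>

section \<open>Finite complex matrices\<close>

text \<open>The claim concerns every solution of finite energy, so the explicit formula has to be
  identified with it, although H^{1/2} does not embed into the bounded functions. Uniqueness works
  because one of the two solutions is bounded: with w = u - v, the term |u|^2 w of |u|^2 u - |v|^2 v
  pairs with w to a real number and does not affect the growth of the L2 norm; the rest involves at
  worst the fourth power of w, which is controlled by the energy times the squared L2 norm. The
  formula solves the equation because C = M - b b* with b the vector of the initial symbol: the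
  derivative of exp(- i t M) exp(i t C) T is then of rank one, and this yields the convolution with
  the coefficients of |u|^2. Analyticity and null sets are read in the coefficients of numerator and
  denominator, closedness in L2. The two are linked by 2 N Fourier coefficients, which are
  continuous in L2 and determine the coordinates through a linear system. The matrix M of the
  overview is \<open>A\<close> in \<open>szego_model\<close> and \<open>AA\<close> in
  \<open>rational_data\<close>, where \<open>A\<close> is the numerator.\<close>

definition mm :: "nat \<Rightarrow> (nat \<Rightarrow> nat \<Rightarrow> complex) \<Rightarrow> (nat \<Rightarrow> nat \<Rightarrow> complex) \<Rightarrow> (nat \<Rightarrow> nat \<Rightarrow> complex)" where
  "mm N X Y = (\<lambda>i j. \<Sum>k<N. X i k * Y k j)"

definition mv :: "nat \<Rightarrow> (nat \<Rightarrow> nat \<Rightarrow> complex) \<Rightarrow> (nat \<Rightarrow> complex) \<Rightarrow> (nat \<Rightarrow> complex)" where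
  "mv N X v = (\<lambda>i. \<Sum>k<N. X i k * v k)"

definition ip :: "nat \<Rightarrow> (nat \<Rightarrow> complex) \<Rightarrow> (nat \<Rightarrow> complex) \<Rightarrow> complex" where
  "ip N v w = (\<Sum>k<N. v k * cnj (w k))"

definition adj :: "(nat \<Rightarrow> nat \<Rightarrow> complex) \<Rightarrow> (nat \<Rightarrow> nat \<Rightarrow> complex)" where
  "adj X = (\<lambda>i j. cnj (X j i))"

definition cj :: "(nat \<Rightarrow> nat \<Rightarrow> complex) \<Rightarrow> (nat \<Rightarrow> nat \<Rightarrow> complex)" where
  "cj X = (\<lambda>i j. cnj (X i j))"

definition tp :: "(nat \<Rightarrow> nat \<Rightarrow> complex) \<Rightarrow> (nat \<Rightarrow> nat \<Rightarrow> complex)" where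
  "tp X = (\<lambda>i j. X j i)"

definition cv :: "(nat \<Rightarrow> complex) \<Rightarrow> (nat \<Rightarrow> complex)" where
  "cv v = (\<lambda>i. cnj (v i))"

definition idm :: "nat \<Rightarrow> (nat \<Rightarrow> nat \<Rightarrow> complex)" where
  "idm N = (\<lambda>i j. if i = j \<and> i < N then 1 else 0)"

text \<open>Matrices and vectors are total functions. Vanishing outside the first \<open>N\<close>
  indices turns matrix identities into equalities of functions and makes \<open>idm N\<close> a
  unit.\<close>

definition supp :: "nat \<Rightarrow> (nat \<Rightarrow> nat \<Rightarrow> complex) \<Rightarrow> bool" where
  "supp N X \<longleftrightarrow> (\<forall>i j. i < N \<and> j < N \<or> X i j = 0)"

definition suppv :: "nat \<Rightarrow> (nat \<Rightarrow> complex) \<Rightarrow> bool" where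
  "suppv N v \<longleftrightarrow> (\<forall>i. i < N \<or> v i = 0)"

definition nrm2 :: "nat \<Rightarrow> (nat \<Rightarrow> complex) \<Rightarrow> real" where
  "nrm2 N v = (\<Sum>k<N. (cmod (v k))\<^sup>2)"

primrec mpow :: "nat \<Rightarrow> (nat \<Rightarrow> nat \<Rightarrow> complex) \<Rightarrow> nat \<Rightarrow> (nat \<Rightarrow> nat \<Rightarrow> complex)" where
  "mpow N X 0 = idm N"
| "mpow N X (Suc k) = mm N X (mpow N X k)"

lemma mm_assoc: "mm N (mm N X Y) Z = mm N X (mm N Y Z)"
proof (intro ext)
  fix i j
  have "mm N (mm N X Y) Z i j = (\<Sum>k<N. \<Sum>l<N. X i l * Y l k * Z k j)"
    by (simp add: mm_def sum_distrib_right)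
  also have "\<dots> = (\<Sum>l<N. \<Sum>k<N. X i l * Y l k * Z k j)" by (rule sum.swap)
  also have "\<dots> = mm N X (mm N Y Z) i j" by (simp add: mm_def sum_distrib_left mult.assoc)
  finally show "mm N (mm N X Y) Z i j = mm N X (mm N Y Z) i j" .
qed

lemma mv_mm: "mv N (mm N X Y) v = mv N X (mv N Y v)"
proof
  fix i
  have "mv N (mm N X Y) v i = (\<Sum>k<N. \<Sum>l<N. X i l * Y l k * v k)"
    by (simp add: mm_def mv_def sum_distrib_right)
  also have "\<dots> = (\<Sum>l<N. \<Sum>k<N. X i l * Y l k * v k)" by (rule sum.swap)
  also have "\<dots> = mv N X (mv N Y v) i" by (simp add: mv_def sum_distrib_left mult.assoc)
  finally show "mv N (mm N X Y) v i = mv N X (mv N Y v) i" .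
qed

lemma ip_adj: "ip N (mv N X v) w = ip N v (mv N (adj X) w)"
proof -
  have "ip N (mv N X v) w = (\<Sum>k<N. \<Sum>l<N. X k l * v l * cnj (w k))"
    by (simp add: ip_def mv_def sum_distrib_right)
  also have "\<dots> = (\<Sum>l<N. \<Sum>k<N. X k l * v l * cnj (w k))" by (rule sum.swap)
  also have "\<dots> = ip N v (mv N (adj X) w)"
    by (simp add: ip_def mv_def adj_def sum_distrib_left mult_ac)
  finally show ?thesis .
qed

lemma adj_mm: "adj (mm N X Y) = mm N (adj Y) (adj X)"
  by (auto simp: adj_def mm_def mult.commute)
lemma tp_mm: "tp (mm N X Y) = mm N (tp Y) (tp X)"
  by (auto simp: tp_def mm_def mult.commute)
lemma cj_mm: "cj (mm N X Y) = mm N (cj X) (cj Y)"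
  by (auto simp: cj_def mm_def)
lemma cv_mv: "cv (mv N X v) = mv N (cj X) (cv v)"
  by (auto simp: cj_def cv_def mv_def)
lemma adj_adj[simp]: "adj (adj X) = X" by (simp add: adj_def)
lemma cj_cj[simp]: "cj (cj X) = X" by (simp add: cj_def)
lemma tp_tp[simp]: "tp (tp X) = X" by (simp add: tp_def)
lemma cv_cv[simp]: "cv (cv X) = X" by (simp add: cv_def)
lemma adj_eq: "adj X = cj (tp X)" by (simp add: adj_def cj_def tp_def)
lemma cj_tp: "cj (tp X) = tp (cj X)" by (simp add: cj_def tp_def)
lemma cj_adj: "cj (adj X) = tp X" by (simp add: adj_def cj_def tp_def)

lemma mm_idm: "supp N X \<Longrightarrow> mm N X (idm N) = X"
  by (intro ext) (auto simp: mm_def idm_def supp_def if_distrib[of "\<lambda>x. _ * x"] cong: if_cong)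
lemma idm_mm: "supp N X \<Longrightarrow> mm N (idm N) X = X"
proof (intro ext)
  fix i j assume "supp N X"
  moreover have "mm N (idm N) X i j = (\<Sum>k<N. if k = i then X i j else 0)"
    unfolding mm_def by (rule sum.cong) (auto simp: idm_def)
  ultimately show "mm N (idm N) X i j = X i j" by (auto simp: supp_def)
qed
lemma mv_idm: "suppv N v \<Longrightarrow> mv N (idm N) v = v"
proof
  fix i assume "suppv N v"
  moreover have "mv N (idm N) v i = (\<Sum>k<N. if k = i then v i else 0)"
    unfolding mv_def by (rule sum.cong) (auto simp: idm_def)
  ultimately show "mv N (idm N) v i = v i" by (auto simp: suppv_def)
qed

lemma supp_mm:
  assumes "supp N X" "supp N Y" shows "supp N (mm N X Y)"
proof -
  have "mm N X Y i j = 0" if "\<not> (i < N \<and> j < N)" for i j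
  proof -
    have "X i k * Y k j = 0" for k
      using that assms unfolding supp_def by (metis mult_eq_0_iff)
    then show ?thesis by (simp add: mm_def)
  qed
  then show ?thesis unfolding supp_def by blast
qed
lemma suppv_mv:
  assumes "supp N X" shows "suppv N (mv N X v)"
proof -
  have "mv N X v i = 0" if "\<not> i < N" for i
  proof -
    have "X i k = 0" for k using that assms unfolding supp_def by blast
    then show ?thesis by (simp add: mv_def)
  qed
  then show ?thesis unfolding suppv_def by blast
qed
lemma supp_idm: "supp N (idm N)" by (auto simp: supp_def idm_def)
lemma supp_adj: "supp N X \<Longrightarrow> supp N (adj X)" by (auto simp: supp_def adj_def)
lemma supp_cj: "supp N X \<Longrightarrow> supp N (cj X)" by (auto simp: supp_def cj_def)
lemma supp_tp: "supp N X \<Longrightarrow> supp N (tp X)" by (auto simp: supp_def tp_def)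
lemma suppv_cv: "suppv N v \<Longrightarrow> suppv N (cv v)" by (auto simp: suppv_def cv_def)
lemma supp_mpow: "supp N X \<Longrightarrow> supp N (mpow N X k)"
  by (induct k) (auto simp: supp_idm supp_mm)
lemmas supp_intros = supp_mm suppv_mv supp_idm supp_adj supp_cj supp_tp suppv_cv supp_mpow

lemma mv_mpow: "suppv N v \<Longrightarrow> mv N (mpow N X k) v = (mv N X ^^ k) v"
  by (induct k) (auto simp: mv_idm mv_mm)

lemma ip_self: "ip N v v = of_real (nrm2 N v)"
  unfolding ip_def nrm2_def of_real_sum by (intro sum.cong refl complex_norm_square[symmetric])
lemma ip_cnj: "cnj (ip N v w) = ip N w v" by (simp add: ip_def mult.commute)
lemma ip_cv: "ip N (cv v) (cv w) = cnj (ip N v w)" by (simp add: ip_def cv_def)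
lemma ip_diff: "ip N (\<lambda>i. v i - v' i) w = ip N v w - ip N v' w"
  by (simp add: ip_def algebra_simps sum_subtractf)
lemma ip_scale: "ip N (\<lambda>i. c * v i) w = c * ip N v w"
  by (simp add: ip_def sum_distrib_left mult_ac)
lemma ip_scale_right: "ip N v (\<lambda>i. c * w i) = cnj c * ip N v w"
  by (simp add: ip_def sum_distrib_left mult_ac)
lemma nrm2_nonneg: "nrm2 N v \<ge> 0" by (simp add: nrm2_def sum_nonneg)
lemma nrm2_0: "suppv N v \<Longrightarrow> nrm2 N v = 0 \<longleftrightarrow> v = (\<lambda>_. 0)"
  by (auto simp: nrm2_def sum_nonneg_eq_0_iff suppv_def fun_eq_iff)
lemma nrm2_scale: "nrm2 N (\<lambda>i. c * v i) = (cmod c)\<^sup>2 * nrm2 N v"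
  by (simp add: nrm2_def norm_mult power_mult_distrib sum_distrib_left)

lemma cauchy_ip: "(cmod (ip N v w))\<^sup>2 \<le> nrm2 N v * nrm2 N w"
proof -
  have "cmod (ip N v w) \<le> (\<Sum>k<N. cmod (v k) * cmod (w k))"
    unfolding ip_def by (rule order_trans[OF norm_sum]) (simp add: norm_mult)
  then have "(cmod (ip N v w))\<^sup>2 \<le> (\<Sum>k<N. cmod (v k) * cmod (w k))\<^sup>2"
    by (intro power_mono) auto
  also have "\<dots> \<le> nrm2 N v * nrm2 N w"
    unfolding nrm2_def by (rule Cauchy_Schwarz_ineq_sum)
  finally show ?thesis .
qed

lemma mv_scale: "mv N X (\<lambda>i. c * v i) = (\<lambda>i. c * mv N X v i)"
  by (auto simp: mv_def sum_distrib_left mult_ac)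
lemma mv_diff: "mv N X (\<lambda>i. v i - w i) = (\<lambda>i. mv N X v i - mv N X w i)"
  by (auto simp: mv_def algebra_simps sum_subtractf)
lemma mv_add: "mv N X (\<lambda>i. v i + w i) = (\<lambda>i. mv N X v i + mv N X w i)"
  by (auto simp: mv_def algebra_simps sum.distrib)
lemma mv_sum: "mv N X (\<lambda>i. \<Sum>k\<in>K. f k i) = (\<lambda>i. \<Sum>k\<in>K. mv N X (f k) i)"
  unfolding mv_def sum_distrib_left by (intro ext sum.swap)
lemma ip_sum: "ip N (\<lambda>i. \<Sum>k\<in>K. f k i) w = (\<Sum>k\<in>K. ip N (f k) w)"
  unfolding ip_def sum_distrib_right by (rule sum.swap)
lemma mv_mdiff: "mv N (\<lambda>i j. X i j - Y i j) v = (\<lambda>i. mv N X v i - mv N Y v i)"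
  by (auto simp: mv_def algebra_simps sum_subtractf)
lemma mv_rank1: "mv N (\<lambda>i j. v i * cnj (w j)) h = (\<lambda>i. ip N h w * v i)"
  by (auto simp: mv_def ip_def sum_distrib_left mult_ac)
lemma mm_diff_left: "mm N (\<lambda>i j. X i j - Y i j) Z = (\<lambda>i j. mm N X Z i j - mm N Y Z i j)"
  by (auto simp: mm_def algebra_simps sum_subtractf)
lemma mm_diff_right: "mm N Z (\<lambda>i j. X i j - Y i j) = (\<lambda>i j. mm N Z X i j - mm N Z Y i j)"
  by (auto simp: mm_def algebra_simps sum_subtractf)
lemma mm_rank1_left: "mm N X (\<lambda>i j. v i * cnj (w j)) = (\<lambda>i j. mv N X v i * cnj (w j))"
  by (auto simp: mm_def mv_def sum_distrib_left mult_ac)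
lemma mm_rank1_right: "mm N (\<lambda>i j. v i * cnj (w j)) X = (\<lambda>i j. v i * cnj (mv N (adj X) w j))"
  by (auto simp: mm_def mv_def adj_def sum_distrib_left mult_ac)

section \<open>The matrix exponential as an entrywise power series\<close>

definition mexp :: "nat \<Rightarrow> (nat \<Rightarrow> nat \<Rightarrow> complex) \<Rightarrow> complex \<Rightarrow> (nat \<Rightarrow> nat \<Rightarrow> complex)" where
  "mexp N X s = (\<lambda>i j. \<Sum>k. (mpow N X k i j / fact k) * s ^ k)"

text \<open>The sum of all entry moduli dominates every row sum, so it serves as a submultiplicative
  bound in place of an operator norm.\<close>

lemma mpow_bound:
  assumes "supp N X"
  shows "cmod (mpow N X k i j) \<le> (\<Sum>i<N. \<Sum>j<N. cmod (X i j)) ^ k"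
proof (induct k arbitrary: i j)
  case 0 then show ?case by (simp add: idm_def)
next
  case (Suc k)
  let ?c = "\<Sum>i<N. \<Sum>j<N. cmod (X i j)"
  show ?case
  proof (cases "i < N")
    case True
    have "cmod (mpow N X (Suc k) i j) \<le> (\<Sum>l<N. cmod (X i l) * ?c ^ k)"
      unfolding mpow.simps mm_def
      by (rule order_trans[OF norm_sum]) (auto simp: norm_mult intro!: sum_mono mult_left_mono Suc)
    also have "\<dots> = (\<Sum>l<N. cmod (X i l)) * ?c ^ k" by (simp add: sum_distrib_right)
    also have "\<dots> \<le> ?c * ?c ^ k"
      using True by (intro mult_right_mono member_le_sum[of i "{..<N}" "\<lambda>i. \<Sum>l<N. cmod (X i l)"])
        (auto intro!: sum_nonneg zero_le_power)
    finally show ?thesis by simp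
  next
    case False
    with supp_mpow[OF assms, of "Suc k"] have "mpow N X (Suc k) i j = 0" unfolding supp_def by blast
    then show ?thesis by (simp del: mpow.simps add: sum_nonneg)
  qed
qed

lemma mexp_summable:
  assumes "supp N X"
  shows "summable (\<lambda>k. (mpow N X k i j / fact k) * s ^ k)"
proof (rule summable_comparison_test')
  let ?c = "\<Sum>i<N. \<Sum>j<N. cmod (X i j)"
  show "summable (\<lambda>k. inverse (fact k) * (?c * cmod s) ^ k)" by (rule summable_exp)
  fix k
  show "norm ((mpow N X k i j / fact k) * s ^ k) \<le> inverse (fact k) * (?c * cmod s) ^ k"
    using mult_right_mono[OF mpow_bound[OF assms, of k i j], of "cmod s ^ k / fact k"]
    by (simp add: norm_mult norm_divide norm_power power_mult_distrib field_simps)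
qed

lemma supp_mexp:
  assumes "supp N X" shows "supp N (mexp N X s)"
proof -
  have "mexp N X s i j = 0" if "\<not> (i < N \<and> j < N)" for i j
  proof -
    have "mpow N X k i j = 0" for k
      using supp_mpow[OF assms, of k] that unfolding supp_def by blast
    then show ?thesis by (simp add: mexp_def)
  qed
  then show ?thesis unfolding supp_def by blast
qed

lemma mexp_0: "mexp N X 0 = idm N"
proof (intro ext)
  fix i j
  have "mexp N X 0 i j = mpow N X 0 i j / fact 0" unfolding mexp_def
    using powser_zero[of "\<lambda>k. mpow N X k i j / fact k"] by simp
  then show "mexp N X 0 i j = idm N i j" by simp
qed

lemma mexp_mm_right:
  assumes X: "supp N X"
  shows "mm N (mexp N X s) G i j = (\<Sum>k. (mm N (mpow N X k) G i j / fact k) * s ^ k)"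
proof -
  have "mm N (mexp N X s) G i j = (\<Sum>l<N. \<Sum>k. (mpow N X k i l / fact k) * s ^ k * G l j)"
    unfolding mm_def mexp_def
    by (intro sum.cong refl suminf_mult2 mexp_summable X)
  also have "\<dots> = (\<Sum>k. \<Sum>l<N. (mpow N X k i l / fact k) * s ^ k * G l j)"
    by (intro suminf_sum[symmetric] summable_mult2 mexp_summable X)
  also have "\<dots> = (\<Sum>k. (mm N (mpow N X k) G i j / fact k) * s ^ k)"
    unfolding mm_def by (simp add: sum_divide_distrib sum_distrib_right sum_distrib_left mult_ac)
  finally show ?thesis .
qed

lemma mexp_mm_left:
  assumes X: "supp N X"
  shows "mm N G (mexp N X s) i j = (\<Sum>k. (mm N G (mpow N X k) i j / fact k) * s ^ k)"
proof -
  have "mm N G (mexp N X s) i j = (\<Sum>l<N. \<Sum>k. G i l * ((mpow N X k l j / fact k) * s ^ k))"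
    unfolding mm_def mexp_def
    by (intro sum.cong refl suminf_mult[symmetric] mexp_summable X)
  also have "\<dots> = (\<Sum>k. \<Sum>l<N. G i l * ((mpow N X k l j / fact k) * s ^ k))"
    by (intro suminf_sum[symmetric] summable_mult mexp_summable X)
  also have "\<dots> = (\<Sum>k. (mm N G (mpow N X k) i j / fact k) * s ^ k)"
    unfolding mm_def by (simp add: sum_divide_distrib sum_distrib_right sum_distrib_left mult_ac)
  finally show ?thesis .
qed

lemma mpow_intertwine:
  assumes "supp N G" "mm N X G = mm N G Y"
  shows "mm N (mpow N X k) G = mm N G (mpow N Y k)"
proof (induct k)
  case 0 show ?case using assms by (simp add: mm_idm idm_mm)
next
  case (Suc k)
  have "mm N (mpow N X (Suc k)) G = mm N X (mm N (mpow N X k) G)" by (simp add: mm_assoc)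
  also have "\<dots> = mm N (mm N X G) (mpow N Y k)" by (simp add: Suc mm_assoc)
  also have "\<dots> = mm N G (mpow N Y (Suc k))" by (simp add: assms(2) mm_assoc)
  finally show ?case .
qed

text \<open>Moves an exponential across a matrix that need not commute with its exponent. Later
  \<open>G\<close> turns \<open>A\<close> into \<open>cj A\<close>, which is the exponent of the
  transposed exponential.\<close>

lemma mexp_intertwine:
  assumes "supp N X" "supp N Y" "supp N G" "mm N X G = mm N G Y"
  shows "mm N (mexp N X s) G = mm N G (mexp N Y s)"
  by (intro ext) (simp add: mexp_mm_left mexp_mm_right assms mpow_intertwine[OF assms(3,4)])

lemma mpow_cj: "mpow N (cj X) k = cj (mpow N X k)"
proof (induct k)
  case 0 show ?case by (auto simp: cj_def idm_def fun_eq_iff)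
qed (simp add: cj_mm)

lemma mpow_commute: "supp N X \<Longrightarrow> mm N (mpow N X k) X = mm N X (mpow N X k)"
  by (rule mpow_intertwine) auto

lemma mpow_tp: "supp N X \<Longrightarrow> mpow N (tp X) k = tp (mpow N X k)"
proof (induct k)
  case 0 show ?case by (auto simp: tp_def idm_def fun_eq_iff)
next
  case (Suc k)
  then have "mpow N (tp X) (Suc k) = tp (mm N (mpow N X k) X)" by (simp add: tp_mm)
  then show ?case using mpow_commute[OF Suc(2)] by simp
qed

lemma mexp_cj:
  assumes "supp N X"
  shows "mexp N (cj X) (cnj s) = cj (mexp N X s)"
proof (intro ext)
  fix i j
  have "(\<lambda>k. cnj ((mpow N X k i j / fact k) * s ^ k)) sums cnj (mexp N X s i j)"
    unfolding sums_cnj mexp_def by (rule summable_sums[OF mexp_summable[OF assms]])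
  then have "(\<lambda>k. (mpow N (cj X) k i j / fact k) * cnj s ^ k) sums cnj (mexp N X s i j)"
    unfolding mpow_cj by (simp add: cj_def)
  then show "mexp N (cj X) (cnj s) i j = cj (mexp N X s) i j"
    by (simp add: mexp_def cj_def sums_iff)
qed

lemma mexp_tp: "supp N X \<Longrightarrow> mexp N (tp X) s = tp (mexp N X s)"
  unfolding mexp_def by (simp add: mpow_tp) (simp add: tp_def)

lemma mexp_deriv:
  assumes X: "supp N X"
  shows "((\<lambda>s. mexp N X s i j) has_field_derivative mm N X (mexp N X s) i j) (at s)"
proof -
  have "((\<lambda>s. \<Sum>k. (mpow N X k i j / fact k) * s ^ k) has_field_derivative
      (\<Sum>k. diffs (\<lambda>k. mpow N X k i j / fact k) k * s ^ k)) (at s)"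
    by (rule termdiffs_strong_converges_everywhere) (rule mexp_summable[OF X])
  moreover have "diffs (\<lambda>k. mpow N X k i j / fact k) k = mm N X (mpow N X k) i j / fact k" for k
    by (simp add: diffs_def del: of_nat_Suc)
  ultimately show ?thesis by (simp add: mexp_def[of N X _, THEN fun_cong, THEN fun_cong] mexp_mm_left[OF X])
qed

text \<open>The product is constant in \<open>s\<close>: the two terms of its derivative cancel
  because \<open>X\<close> commutes with its exponential, and at \<open>s = 0\<close> it is the
  identity.\<close>

lemma mexp_inv:
  assumes X: "supp N X"
  shows "mm N (mexp N X s) (mexp N X (- s)) = idm N"
proof (intro ext)
  fix i j
  let ?f = "\<lambda>s. mm N (mexp N X s) (mexp N X (- s)) i j"
  have com: "mm N (mexp N X s) X = mm N X (mexp N X s)" for s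
    by (rule mexp_intertwine) (auto simp: X)
  have "(?f has_field_derivative 0) (at s)" for s
  proof -
    have d: "((\<lambda>s. mexp N X (- s) k j) has_field_derivative - mm N X (mexp N X (- s)) k j) (at s)" for k
    proof -
      have "((\<lambda>s. mexp N X (- s) k j) has_field_derivative mm N X (mexp N X (- s)) k j * (- 1)) (at s)"
        by (rule DERIV_chain2[of "\<lambda>r. mexp N X r k j" _ uminus])
          (auto intro!: mexp_deriv X derivative_eq_intros)
      then show ?thesis by simp
    qed
    have "(?f has_field_derivative (\<Sum>k<N. mm N X (mexp N X s) i k * mexp N X (- s) k j
        + (- mm N X (mexp N X (- s)) k j) * mexp N X s i k)) (at s)"
      unfolding mm_def[of N "mexp N X _"]
      by (intro DERIV_sum DERIV_mult mexp_deriv X d)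
    also have "(\<Sum>k<N. mm N X (mexp N X s) i k * mexp N X (- s) k j
        + (- mm N X (mexp N X (- s)) k j) * mexp N X s i k)
       = mm N (mm N X (mexp N X s)) (mexp N X (-s)) i j - mm N (mexp N X s) (mm N X (mexp N X (-s))) i j"
      by (simp add: mm_def[of N "mm N X (mexp N X s)"] mm_def[of N "mexp N X s" "mm N X (mexp N X (-s))"]
          flip: sum_subtractf) (simp add: mult_ac)
    also have "\<dots> = 0" unfolding com[of s, symmetric] mm_assoc by simp
    finally show ?thesis .
  qed
  then obtain c where c: "\<And>s. ?f s = c"
    using has_field_derivative_zero_constant[of UNIV ?f] by (auto simp: has_field_derivative_at_within)
  have "?f s = ?f 0" by (rule trans[OF c c[symmetric]])
  then show "mm N (mexp N X s) (mexp N X (- s)) i j = idm N i j"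
    by (simp add: mexp_0 mm_idm supp_idm)
qed

section \<open>Powers of matrices with spectrum in the open disc, and limits of unitary
  matrices\<close>

lemma contraction_power_tendsto_0:
  assumes X: "supp N X" and N: "N > 0"
    and ev: "\<And>h c. suppv N h \<Longrightarrow> h \<noteq> (\<lambda>_. 0) \<Longrightarrow> mv N X h = (\<lambda>i. c * h i) \<Longrightarrow> cmod c < 1"
  shows "(\<lambda>k. mpow N X k i j) \<longlonglongrightarrow> 0"
proof -
  define f where "f Y = mat N N (\<lambda>(i, j). Y i j)" for Y :: "nat \<Rightarrow> nat \<Rightarrow> complex"
  have fc: "f Y \<in> carrier_mat N N" for Y by (simp add: f_def)
  have fm: "f (mm N Y Z) = f Y * f Z" for Y Z
    by (rule eq_matI) (auto simp: f_def mm_def scalar_prod_def atLeast0LessThan)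
  have fp: "f (mpow N Y k) = f Y ^\<^sub>m k" for Y k
  proof (induct k)
    case 0 show ?case by (rule eq_matI) (auto simp: f_def idm_def)
  next
    case (Suc k)
    have "f Y * f Y ^\<^sub>m k = f Y ^\<^sub>m k * f Y"
    proof (induct k)
      case 0
      have "f Y * 1\<^sub>m N = f Y" "1\<^sub>m N * f Y = f Y" by (auto simp: f_def)
      moreover have "dim_row (f Y) = N" by (simp add: f_def)
      ultimately show ?case by simp
    next
      case (Suc k)
      have c: "f Y ^\<^sub>m k \<in> carrier_mat N N" using fc[of Y] by (rule pow_carrier_mat)
      have "f Y * f Y ^\<^sub>m Suc k = (f Y * f Y ^\<^sub>m k) * f Y"
        using assoc_mult_mat[OF fc[of Y] c fc[of Y]] by simp
      then show ?case using Suc by simp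
    qed
    with Suc show ?case by (simp add: fm)
  qed
  have evlt: "cmod c < 1" if "c \<in> spectrum (f X)" for c
  proof -
    from that obtain v where v: "eigenvector (f X) v c" by (auto simp: spectrum_def eigenvalue_def)
    then have vc: "v \<in> carrier_vec N" and v0: "v \<noteq> 0\<^sub>v N" and ve: "f X *\<^sub>v v = c \<cdot>\<^sub>v v"
      by (auto simp: eigenvector_def f_def)
    define h where "h i = (if i < N then v $ i else 0)" for i
    show ?thesis
    proof (rule ev)
      show "suppv N h" by (auto simp: suppv_def h_def)
      show "h \<noteq> (\<lambda>_. 0)"
      proof
        assume hz: "h = (\<lambda>_. 0)"
        have "v $ i = 0" if "i < N" for i
        proof -
          have "h i = 0" by (simp only: hz)
          then show ?thesis using that unfolding h_def by simp
        qed
        then have "v = 0\<^sub>v N" using vc by (intro eq_vecI) auto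
        with v0 show False by simp
      qed
      show "mv N X h = (\<lambda>i. c * h i)"
      proof
        fix i show "mv N X h i = c * h i"
        proof (cases "i < N")
          case True
          have "(f X *\<^sub>v v) $ i = mv N X h i" using True vc
            by (auto simp: f_def mv_def scalar_prod_def h_def atLeast0LessThan intro!: sum.cong)
          then show ?thesis using True vc unfolding ve by (simp add: h_def)
        next
          case False
          then show ?thesis using suppv_mv[OF X, of h] by (auto simp: suppv_def h_def)
        qed
      qed
    qed
  qed
  have "spectral_radius (f X) < 1"
    using spectral_radius_mem_max(1)[OF fc[of X] N] evlt by (metis imageE)
  \<comment> \<open>A spectral radius below 1 gives bounded powers through the Jordan form. Applied
    to \<open>X\<close> divided by \<rho>, whose spectral radius is still below 1, this becomes
    decay of order \<open>\<rho> ^ k\<close> for \<open>X\<close> itself.\<close>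
  then obtain \<rho> where \<rho>: "spectral_radius (f X) < \<rho>" "\<rho> < 1" using dense by blast
  obtain d where "spectral_radius (f X) = norm (d :: complex)"
    using spectral_radius_mem_max(1)[OF fc[of X] N] by blast
  then have "0 \<le> spectral_radius (f X)" by simp
  with \<rho> have \<rho>0: "\<rho> > 0" by linarith
  let ?Y = "\<lambda>i j. X i j / of_real \<rho>"
  have Ypow: "mpow N ?Y k i j = mpow N X k i j / of_real \<rho> ^ k" for k i j
    by (induct k arbitrary: i j) (auto simp: mm_def sum_divide_distrib)
  have "cmod c < 1" if "c \<in> spectrum (f ?Y)" for c
  proof -
    from that obtain v where v: "eigenvector (f ?Y) v c" by (auto simp: spectrum_def eigenvalue_def)
    then have vc: "v \<in> carrier_vec N" and v0: "v \<noteq> 0\<^sub>v N" and ve: "f ?Y *\<^sub>v v = c \<cdot>\<^sub>v v"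
      by (auto simp: eigenvector_def f_def)
    have "f X *\<^sub>v v = of_real \<rho> \<cdot>\<^sub>v (f ?Y *\<^sub>v v)" using \<rho>0 vc
      by (intro eq_vecI) (auto simp: f_def scalar_prod_def sum_distrib_left intro!: sum.cong)
    then have "f X *\<^sub>v v = (of_real \<rho> * c) \<cdot>\<^sub>v v"
      using ve by (simp add: smult_smult_assoc)
    then have "eigenvector (f X) v (of_real \<rho> * c)"
      using vc v0 by (auto simp: eigenvector_def f_def)
    then have "of_real \<rho> * c \<in> spectrum (f X)" by (auto simp: spectrum_def eigenvalue_def)
    then have "cmod (of_real \<rho> * c) \<le> spectral_radius (f X)"
      using spectral_radius_mem_max(2)[OF fc[of X] N] by blast
    then have "\<rho> * cmod c \<le> spectral_radius (f X)" using \<rho>0 by (simp add: norm_mult)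
    then have "\<rho> * cmod c < \<rho> * 1" using \<rho> by linarith
    then show ?thesis using \<rho>0 by (simp only: mult_less_cancel_left_pos)
  qed
  then have "spectral_radius (f ?Y) < 1"
    using spectral_radius_mem_max(1)[OF fc[of ?Y] N] by (metis imageE)
  then obtain c where c: "\<And>k. norm_bound (f ?Y ^\<^sub>m k) c"
    using spectral_radius_jnf_norm_bound_less_1_upper_triangular[OF fc[of ?Y]] by auto
  show ?thesis
  proof (cases "i < N \<and> j < N")
    case True
    have "cmod (mpow N X k i j) \<le> c * \<rho> ^ k" for k
    proof -
      have "cmod (f (mpow N ?Y k) $$ (i, j)) \<le> c"
        using c[of k] True unfolding fp[symmetric] norm_bound_def by (auto simp: f_def)
      then have "cmod (mpow N X k i j) / \<rho> ^ k \<le> c"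
        using True \<rho>0 by (simp add: f_def Ypow norm_divide norm_power)
      then show ?thesis using \<rho>0 by (simp add: field_simps)
    qed
    then have ev: "\<forall>\<^sub>F k in sequentially. norm (mpow N X k i j) \<le> c * \<rho> ^ k" by simp
    have "(\<lambda>k. \<rho> ^ k) \<longlonglongrightarrow> 0"
      using \<rho>0 \<rho>(2) by (intro LIMSEQ_realpow_zero) auto
    then have "(\<lambda>k. c * \<rho> ^ k) \<longlonglongrightarrow> 0" by (rule tendsto_mult_right_zero)
    with ev show ?thesis by (rule Lim_null_comparison)
  next
    case False
    then have "mpow N X k i j = 0" for k using supp_mpow[OF X, of k] unfolding supp_def by blast
    then show ?thesis by simp
  qed
qed

lemma common_convergent_subseq:
  fixes f :: "nat \<Rightarrow> 'i \<Rightarrow> complex"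
  assumes "finite I" "\<And>n i. i \<in> I \<Longrightarrow> cmod (f n i) \<le> B"
  shows "\<exists>r l. strict_mono (r :: nat \<Rightarrow> nat) \<and> (\<forall>i\<in>I. (\<lambda>n. f (r n) i) \<longlonglongrightarrow> l i)"
  using assms
proof (induct I)
  case empty
  show ?case by (intro exI[of _ id]) (auto simp: strict_mono_def)
next
  case (insert a I)
  have "\<exists>r l. strict_mono (r :: nat \<Rightarrow> nat) \<and> (\<forall>i\<in>I. (\<lambda>n. f (r n) i) \<longlonglongrightarrow> l i)"
    by (rule insert(3)) (simp add: insert(4))
  then obtain r l where r: "strict_mono (r :: nat \<Rightarrow> nat)" "\<And>i. i \<in> I \<Longrightarrow> (\<lambda>n. f (r n) i) \<longlonglongrightarrow> l i"
    by blast
  have "bounded (range (\<lambda>n. f (r n) a))"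
    using insert(4) by (auto simp: bounded_iff intro!: exI[of _ B])
  then obtain s x where s: "strict_mono (s :: nat \<Rightarrow> nat)" "((\<lambda>n. f (r n) a) \<circ> s) \<longlonglongrightarrow> x"
    using bounded_imp_convergent_subsequence by blast
  have "(\<lambda>n. f ((r \<circ> s) n) i) \<longlonglongrightarrow> (l(a := x)) i" if "i \<in> insert a I" for i
  proof (cases "i = a")
    case True then show ?thesis using s(2) by (simp add: o_def)
  next
    case False
    then have "(\<lambda>n. f (r n) i) \<longlonglongrightarrow> l i" using that r(2) by auto
    from LIMSEQ_subseq_LIMSEQ[OF this s(1)] False show ?thesis by (simp add: o_def)
  qed
  moreover have "strict_mono (r \<circ> s)" using r(1) s(1) by (rule strict_mono_o)
  ultimately show ?case by blast
qed

definition unit :: "nat \<Rightarrow> (nat \<Rightarrow> nat \<Rightarrow> complex) \<Rightarrow> bool" where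
  "unit N U \<longleftrightarrow> supp N U \<and> mm N (adj U) U = idm N \<and> mm N U (adj U) = idm N"

lemma unit_nrm2: "unit N U \<Longrightarrow> suppv N h \<Longrightarrow> nrm2 N (mv N U h) = nrm2 N h"
  using ip_adj[of N U h "mv N U h"] mv_mm[of N "adj U" U h]
  by (simp add: unit_def mv_idm ip_self)

lemma unit_entry: "unit N U \<Longrightarrow> cmod (U i j) \<le> 1"
proof (cases "i < N \<and> j < N")
  case True
  assume "unit N U"
  then have "mm N (adj U) U j j = 1" using True by (simp add: unit_def idm_def)
  then have "(\<Sum>k<N. complex_of_real ((cmod (U k j))\<^sup>2)) = 1"
    unfolding mm_def adj_def by (simp only: complex_norm_square mult.commute)
  then have "complex_of_real (\<Sum>k<N. (cmod (U k j))\<^sup>2) = of_real 1" by simp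
  then have *: "(\<Sum>k<N. (cmod (U k j))\<^sup>2) = 1" by (simp only: of_real_eq_iff)
  have "(cmod (U i j))\<^sup>2 \<le> (\<Sum>k<N. (cmod (U k j))\<^sup>2)"
    using True by (intro member_le_sum) auto
  then have "(cmod (U i j))\<^sup>2 \<le> 1" by (simp add: *)
  then show ?thesis by (simp add: abs_square_le_1)
next
  case False
  assume "unit N U" then have "U i j = 0" using False unfolding unit_def supp_def by blast
  then show ?thesis by simp
qed

lemma tendsto_mm:
  assumes "\<And>i j. (\<lambda>n. X n i j) \<longlonglongrightarrow> X' i j" "\<And>i j. (\<lambda>n. Y n i j) \<longlonglongrightarrow> Y' i j"
  shows "(\<lambda>n. mm N (X n) (Y n) i j) \<longlonglongrightarrow> mm N X' Y' i j"
  unfolding mm_def by (intro tendsto_intros assms)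

lemma tendsto_mv:
  assumes "\<And>i j. (\<lambda>n. X n i j) \<longlonglongrightarrow> X' i j" "\<And>i. (\<lambda>n. v n i) \<longlonglongrightarrow> v' i"
  shows "(\<lambda>n. mv N (X n) (v n) i) \<longlonglongrightarrow> mv N X' v' i"
  unfolding mv_def by (intro tendsto_intros assms)

section \<open>The Szego flow in matrix form\<close>

text \<open>\<open>T\<close> is a compressed backward shift, \<open>G\<close> the matrix of an antilinear Hankel operator, and \<open>e\<close>
  represents evaluation at \<open>0\<close>.\<close>

locale szego_model =
  fixes N :: nat and T G :: "nat \<Rightarrow> nat \<Rightarrow> complex" and e :: "nat \<Rightarrow> complex"
  assumes N_pos: "N > 0"
    and supp_T: "supp N T" and supp_G: "supp N G" and supp_e: "suppv N e"
    and T_defect: "mm N (adj T) T = (\<lambda>i j. idm N i j - e i * cnj (e j))"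
    and G_sym: "tp G = G"
    and TG: "mm N T G = mm N G (tp T)"
begin

text \<open>\<open>A\<close> is the square of the antilinear Hankel operator
  \<open>mv N G (cv v)\<close>, hence linear; \<open>b\<close> is that operator applied to
  \<open>e\<close> and represents the symbol; \<open>C\<close> is the corresponding square for the
  shifted operator with matrix \<open>mm N T G\<close>.\<close>

definition A where "A = mm N G (cj G)"
definition b where "b = mv N G (cv e)"
definition C where "C = mm N T (mm N A (adj T))"

lemma supp_A: "supp N A" and supp_C: "supp N C" and supp_b: "suppv N b"
  by (auto simp: A_def C_def b_def intro!: supp_intros supp_T supp_G)

lemmas supps = supp_intros supp_T supp_G supp_e supp_A supp_C supp_b supp_mexp

lemma tp_cj_G: "tp (cj G) = cj G" by (metis G_sym cj_tp)

lemma adj_A: "adj A = A"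
  unfolding A_def adj_mm by (simp add: adj_eq tp_cj_G G_sym)

lemma adj_C: "adj C = C"
  by (simp add: C_def adj_mm adj_A mm_assoc)

text \<open>Moving \<open>T\<close> through \<open>G\<close> on both sides by \<open>TG\<close> puts
  the conjugate of T* T between \<open>G\<close> and \<open>cj G\<close>; its rank-one defect
  becomes b b*. For the Hankel operator H of the symbol u and the shifted one K this is K^2 = H^2 -
  (. | u) u.\<close>

lemma C_eq: "C = (\<lambda>i j. A i j - b i * cnj (b j))"
proof -
  have "C = mm N (mm N T G) (mm N (cj G) (adj T))" by (simp add: C_def A_def mm_assoc)
  also have "mm N (cj G) (adj T) = mm N (cj T) (cj G)"
    using arg_cong[OF TG, of cj] by (simp add: cj_mm adj_eq)
  also have "mm N (mm N T G) (mm N (cj T) (cj G)) = mm N G (mm N (cj (mm N (adj T) T)) (cj G))"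
    by (simp add: TG mm_assoc cj_mm cj_adj)
  also have "cj (mm N (adj T) T) = (\<lambda>i j. idm N i j - cv e i * cnj (cv e j))"
    by (auto simp: T_defect cj_def cv_def idm_def fun_eq_iff)
  also have "mm N G (mm N \<dots> (cj G)) = (\<lambda>i j. A i j - b i * cnj (b j))"
    unfolding mm_diff_left mm_diff_right mm_rank1_left mm_rank1_right
    by (simp add: idm_mm supps A_def b_def adj_eq tp_cj_G)
  finally show ?thesis .
qed

lemma product_defect:
  assumes U: "unit N U" and V: "unit N V" and M: "M = mm N U (mm N V T)"
  shows "mm N (adj M) M = mm N (adj T) T"
proof -
  have "mm N (adj M) M = mm N (adj T) (mm N (adj V) (mm N (mm N (adj U) U) (mm N V T)))"
    by (simp add: M adj_mm mm_assoc)
  also have "\<dots> = mm N (adj T) (mm N (mm N (adj V) V) T)"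
    using U V unfolding unit_def by (simp add: idm_mm supps mm_assoc[of N "adj V" V T, symmetric])
  also have "\<dots> = mm N (adj T) T" using V by (simp add: unit_def idm_mm supps)
  finally show ?thesis .
qed

text \<open>An eigenvalue of modulus 1 loses no norm, so the rank-one defect forces \<open>h\<close>
  to be orthogonal to \<open>e\<close>. The main point is that \<open>mv N A h\<close> satisfies the
  same eigenvector equation; orthogonality to \<open>e\<close> then passes to all iterates, and
  \<open>A\<close> is hermitian.\<close>

lemma eigenvector_orthogonal:
  assumes U: "unit N U" "mm N U A = mm N A U" and V: "unit N V" "mm N V C = mm N C V"
    and M: "M = mm N U (mm N V T)"
    and h: "suppv N h" "mv N M h = (\<lambda>i. c * h i)" and c: "cmod c = 1"
  shows "ip N (mv N (mpow N A m) e) h = 0"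
proof -
  note MM = product_defect[OF U(1) V(1) M]
  define b' where "b' = mv N U b"
  \<comment> \<open>Conjugating \<open>C_eq\<close> by \<open>U\<close>: since \<open>U\<close>
    commutes with \<open>A\<close>, only the vector of the rank-one term changes.\<close>
  have UCU: "mm N U (mm N C (adj U)) = (\<lambda>i j. A i j - b' i * cnj (b' j))"
  proof -
    have "mm N U (mm N A (adj U)) = mm N A (mm N U (adj U))"
      by (metis U(2) mm_assoc)
    also have "\<dots> = A" using U(1) by (simp add: unit_def mm_idm supps)
    finally show ?thesis unfolding C_eq mm_diff_left mm_diff_right mm_rank1_left mm_rank1_right
      by (simp add: b'_def)
  qed
  have step: "mv N M (mv N A h) = (\<lambda>i. c * mv N A h i) \<and> ip N h e = 0"
    if h: "suppv N h" "mv N M h = (\<lambda>i. c * h i)" for h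
  proof -
    have MMh: "mv N (adj M) (mv N M h) = (\<lambda>i. h i - ip N h e * e i)"
      unfolding mv_mm[symmetric] MM T_defect mv_mdiff mv_rank1 using h by (simp add: mv_idm)
    have "nrm2 N (mv N M h) = nrm2 N h" unfolding h(2) nrm2_scale c by simp
    then have "ip N h h = ip N h (mv N (adj M) (mv N M h))"
      unfolding ip_adj[symmetric] ip_self by simp
    also have "\<dots> = ip N h h - cnj (ip N h e) * ip N h e"
      unfolding MMh by (simp add: ip_def algebra_simps sum_subtractf sum_distrib_left sum_distrib_right)
    finally have he: "ip N h e = 0" by simp
    with MMh have "mv N (adj M) (\<lambda>i. c * h i) = h" using h(2) by simp
    \<comment> \<open>From M* M h = h and M h = c h: the adjoint has \<open>h\<close> as eigenvector
      too, for 1 / c = cnj c.\<close>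
    then have adjh: "(\<lambda>i. c * mv N (adj M) h i) = h" by (simp add: mv_scale)
    have TTh: "mv N (adj T) (mv N T h) = h"
      unfolding mv_mm[symmetric] T_defect mv_mdiff mv_rank1 using h he by (simp add: mv_idm)
    have "mv N M (mv N A h) = mv N U (mv N V (mv N C (mv N T h)))"
      unfolding M C_def mv_mm TTh ..
    also have "\<dots> = mv N U (mv N C (mv N V (mv N T h)))"
      unfolding mv_mm[symmetric, of N V C] V(2) mv_mm ..
    also have "mv N V (mv N T h) = mv N (adj U) (mv N M h)"
    proof -
      have "mv N (adj U) (mv N M h) = mv N (mm N (adj U) U) (mv N V (mv N T h))"
        by (simp add: M mv_mm)
      also have "\<dots> = mv N V (mv N T h)"
        using U(1) V(1) by (simp add: unit_def mv_idm supps)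
      finally show ?thesis by simp
    qed
    also have "mv N U (mv N C (mv N (adj U) (mv N M h))) = mv N (mm N U (mm N C (adj U))) (mv N M h)"
      by (simp add: mv_mm)
    also have "\<dots> = (\<lambda>i. c * (mv N A h i - ip N h b' * b' i))"
      unfolding UCU mv_mdiff mv_rank1 h(2) mv_scale ip_scale by (simp add: algebra_simps)
    finally have MA: "mv N M (mv N A h) = (\<lambda>i. c * (mv N A h i - ip N h b' * b' i))" .
    \<comment> \<open>The pairing of M A h with h is computed twice, through the adjoint eigenvector
      and through \<open>MA\<close>. The two values differ by c times the squared modulus of
      \<open>ip N h b'\<close>, so the correction in \<open>MA\<close> vanishes.\<close>
    have "c * (ip N (mv N A h) h) = ip N (mv N A h) (\<lambda>i. cnj c * h i)"
      by (simp add: ip_scale_right)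
    also have "(\<lambda>i. cnj c * h i) = mv N (adj M) h"
    proof
      fix i
      have "cnj c * c = 1" using complex_norm_square[of c] c by (simp add: mult.commute)
      then show "cnj c * h i = mv N (adj M) h i"
        using fun_cong[OF adjh, of i] by (metis mult.assoc mult_1)
    qed
    also have "ip N (mv N A h) (mv N (adj M) h) = ip N (mv N M (mv N A h)) h" by (simp add: ip_adj)
    also have "\<dots> = c * (ip N (mv N A h) h - ip N h b' * ip N b' h)"
      unfolding MA ip_scale ip_diff ..
    finally have "c * (ip N h b' * ip N b' h) = 0" by (simp add: algebra_simps)
    moreover have "c \<noteq> 0" using c by auto
    ultimately have "ip N h b' = 0" using ip_cnj[of N h b'] by auto
    then show ?thesis using MA he by simp
  qed
  have "suppv N ((mv N A ^^ m) h) \<and> mv N M ((mv N A ^^ m) h) = (\<lambda>i. c * (mv N A ^^ m) h i)"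
    by (induct m) (use h step supps in auto)
  then have "ip N ((mv N A ^^ m) h) e = 0" using step by blast
  then have 0: "ip N (mv N (mpow N A m) h) e = 0" using h by (simp add: mv_mpow)
  have "adj (mpow N A m) = mpow N A m"
    using mpow_tp[OF supp_A, of m] mpow_cj[of N "tp A" m] adj_A by (simp add: adj_eq)
  then show ?thesis using 0 by (metis complex_cnj_zero ip_adj ip_cnj)
qed

lemma norm_defect:
  assumes "mm N (adj M) M = mm N (adj T) T" "suppv N h"
  shows "nrm2 N (mv N M h) = nrm2 N h - (cmod (ip N h e))\<^sup>2"
proof -
  have "mv N (adj M) (mv N M h) = (\<lambda>i. h i - ip N h e * e i)"
    unfolding mv_mm[symmetric] assms(1) T_defect mv_mdiff mv_rank1 using assms(2) by (simp add: mv_idm)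
  then have "ip N (mv N M h) (mv N M h) = ip N h (\<lambda>i. h i - ip N h e * e i)"
    by (simp add: ip_adj)
  also have "\<dots> = ip N h h - cnj (ip N h e) * ip N h e"
    by (simp add: ip_def algebra_simps sum_subtractf sum_distrib_left sum_distrib_right)
  also have "cnj (ip N h e) * ip N h e = of_real ((cmod (ip N h e))\<^sup>2)"
    by (simp only: complex_norm_square mult.commute)
  finally have "complex_of_real (nrm2 N (mv N M h)) = of_real (nrm2 N h - (cmod (ip N h e))\<^sup>2)"
    unfolding ip_self by simp
  then show ?thesis by (simp only: of_real_eq_iff)
qed

end

section \<open>Contraction uniform over all admissible products\<close>

context szego_model begin

definition cyclic :: bool where
  "cyclic \<longleftrightarrow> (\<forall>h. suppv N h \<and> (\<forall>m. ip N (mv N (mpow N A m) e) h = 0) \<longrightarrow> h = (\<lambda>_. 0))"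

text \<open>The pairs reached by the flow are admissible at all times, and unlike the set of times
  the set of admissible pairs is compact.\<close>

definition adm :: "(nat \<Rightarrow> nat \<Rightarrow> complex) \<Rightarrow> (nat \<Rightarrow> nat \<Rightarrow> complex) \<Rightarrow> bool" where
  "adm U V \<longleftrightarrow> unit N U \<and> mm N U A = mm N A U \<and> unit N V \<and> mm N V C = mm N C V"

lemma adm_contraction:
  assumes "adm U V" "suppv N h"
  shows "nrm2 N (mv N (mm N U (mm N V T)) h) \<le> nrm2 N h"
  using norm_defect[OF product_defect, of U V "mm N U (mm N V T)" h] assms by (simp add: adm_def)

lemma adm_antimono:
  assumes "adm U V" "suppv N h" "k \<le> l"
  shows "nrm2 N (mv N (mpow N (mm N U (mm N V T)) l) h) \<le> nrm2 N (mv N (mpow N (mm N U (mm N V T)) k) h)"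
proof -
  have M: "supp N (mm N U (mm N V T))" using assms(1) by (simp add: adm_def unit_def supps)
  show ?thesis
  proof (rule lift_Suc_antimono_le[OF _ assms(3)])
    fix n
    show "nrm2 N (mv N (mpow N (mm N U (mm N V T)) (Suc n)) h) \<le> nrm2 N (mv N (mpow N (mm N U (mm N V T)) n) h)"
      unfolding mpow.simps mv_mm[of N "mm N U (mm N V T)"]
      by (rule adm_contraction[OF assms(1)]) (intro suppv_mv supp_mpow M)
  qed
qed

text \<open>By compactness of the admissible pairs a failure would produce a product with an eigenvalue of
  modulus 1, whose eigenvector is orthogonal to the cyclic space of \<open>e\<close>.\<close>

lemma uniform_contraction:
  assumes cyc: cyclic
  shows "\<exists>m. \<forall>U V h. adm U V \<and> suppv N h \<longrightarrow>
    nrm2 N (mv N (mpow N (mm N U (mm N V T)) m) h) \<le> 1 / 4 * nrm2 N h"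
proof (rule ccontr)
  let ?M = "\<lambda>U V. mm N U (mm N V T)"
  assume "\<not> ?thesis"
  then have "\<forall>m. \<exists>U V h. adm U V \<and> suppv N h \<and> nrm2 N (mv N (mpow N (?M U V) m) h) > 1 / 4 * nrm2 N h"
    by (simp add: not_le)
  then obtain U V h where UV: "\<And>m. adm (U m) (V m)" and h: "\<And>m. suppv N (h m)"
    and gt: "\<And>m. nrm2 N (mv N (mpow N (?M (U m) (V m)) m) (h m)) > 1 / 4 * nrm2 N (h m)" by metis
  have Msupp: "supp N (?M (U m) (V m))" for m using UV[of m] by (simp add: adm_def unit_def supps)
  have hpos: "nrm2 N (h m) > 0" for m
  proof -
    have "nrm2 N (mv N (mpow N (?M (U m) (V m)) m) (h m)) \<le> nrm2 N (h m)"
      using adm_antimono[OF UV[of m] h[of m], of 0 m] by (simp add: mv_idm h)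
    with gt[of m] show ?thesis using nrm2_nonneg[of N "h m"] by linarith
  qed
  define g where "g m = (\<lambda>i. of_real (inverse (sqrt (nrm2 N (h m)))) * h m i)" for m
  have g: "suppv N (g m)" for m using h[of m] by (auto simp: suppv_def g_def)
  have scale: "(cmod (of_real (inverse (sqrt (nrm2 N (h m))))))\<^sup>2 * nrm2 N (h m) = 1" for m
    using hpos[of m] by (simp add: norm_inverse power_inverse)
  have g1: "nrm2 N (g m) = 1" for m unfolding g_def nrm2_scale by (rule scale)
  have ggt: "nrm2 N (mv N (mpow N (?M (U m) (V m)) m) (g m)) \<ge> 1 / 4" for m
  proof -
    have "nrm2 N (mv N (mpow N (?M (U m) (V m)) m) (g m)) =
      (cmod (of_real (inverse (sqrt (nrm2 N (h m))))))\<^sup>2 * nrm2 N (mv N (mpow N (?M (U m) (V m)) m) (h m))"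
      unfolding g_def mv_scale nrm2_scale ..
    also have "\<dots> \<ge> (cmod (of_real (inverse (sqrt (nrm2 N (h m))))))\<^sup>2 * (1 / 4 * nrm2 N (h m))"
      using gt[of m] by (intro mult_left_mono) auto
    also have "(cmod (of_real (inverse (sqrt (nrm2 N (h m))))))\<^sup>2 * (1 / 4 * nrm2 N (h m)) = 1 / 4"
      using scale[of m] by simp
    finally show ?thesis .
  qed
  \<comment> \<open>One tagged family holds the entries of \<open>U\<close>, \<open>V\<close> and
    \<open>g\<close> (the latter constant in \<open>j\<close>), so that a single subsequence makes
    all of them converge.\<close>
  define F where "F m = (\<lambda>(s :: nat, i, j). if s = 0 then U m i j else if s = 1 then V m i j else g m i)" for m
  have gle: "cmod (g m i) \<le> 1" for m i
  proof (cases "i < N")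
    case True
    have "(cmod (g m i))\<^sup>2 \<le> nrm2 N (g m)" unfolding nrm2_def using True by (intro member_le_sum) auto
    then show ?thesis by (simp add: g1 abs_square_le_1)
  qed (use g[of m] in \<open>auto simp: suppv_def\<close>)
  have "cmod (F m x) \<le> 1" for m x
    using UV[of m] gle by (auto simp: F_def adm_def unit_entry split: prod.splits)
  then obtain r l where r: "strict_mono (r :: nat \<Rightarrow> nat)"
    and l: "\<And>x. x \<in> {..<3} \<times> {..<N} \<times> {..<N} \<Longrightarrow> (\<lambda>m. F (r m) x) \<longlonglongrightarrow> l x"
    using common_convergent_subseq[of "{..<3} \<times> {..<N} \<times> {..<N}" F 1] by (meson finite_SigmaI finite_lessThan)
  define U' V' g' where "U' = (\<lambda>i j. if i < N \<and> j < N then l (0, i, j) else 0)"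
    and "V' = (\<lambda>i j. if i < N \<and> j < N then l (1, i, j) else 0)"
    and "g' = (\<lambda>i. if i < N then l (2, i, 0) else 0)"
  have Ulim: "(\<lambda>m. U (r m) i j) \<longlonglongrightarrow> U' i j" for i j
  proof (cases "i < N \<and> j < N")
    case True
    then show ?thesis using l[of "(0, i, j)"] by (simp add: F_def U'_def)
  next
    case False
    then have "U (r m) i j = 0" for m using UV[of "r m"] unfolding adm_def unit_def supp_def by blast
    then show ?thesis using False by (auto simp: U'_def)
  qed
  have Vlim: "(\<lambda>m. V (r m) i j) \<longlonglongrightarrow> V' i j" for i j
  proof (cases "i < N \<and> j < N")
    case True
    then show ?thesis using l[of "(1, i, j)"] by (simp add: F_def V'_def)
  next
    case False
    then have "V (r m) i j = 0" for m using UV[of "r m"] unfolding adm_def unit_def supp_def by blast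
    then show ?thesis using False by (auto simp: V'_def)
  qed
  have glim: "(\<lambda>m. g (r m) i) \<longlonglongrightarrow> g' i" for i
  proof (cases "i < N")
    case True
    then show ?thesis using l[of "(2, i, 0)"] N_pos by (simp add: F_def g'_def)
  next
    case False
    then have "g (r m) i = 0" for m using g[of "r m"] unfolding suppv_def by blast
    then show ?thesis using False by (simp add: g'_def)
  qed
  have lim_unit: "unit N W'" if W: "\<And>m. unit N (W m)" "\<And>i j. (\<lambda>m. W m i j) \<longlonglongrightarrow> W' i j" "supp N W'" for W W'
  proof -
    have a: "(\<lambda>m. adj (W m) i j) \<longlonglongrightarrow> adj W' i j" for i j
      unfolding adj_def by (intro tendsto_intros W)
    have "mm N (adj W') W' i j = idm N i j" for i j
      using tendsto_mm[of "\<lambda>m. adj (W m)" "adj W'" W W', OF a W(2), of N i j] W(1)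
      by (simp add: unit_def LIMSEQ_const_iff)
    moreover have "mm N W' (adj W') i j = idm N i j" for i j
      using tendsto_mm[of W W' "\<lambda>m. adj (W m)" "adj W'", OF W(2) a, of N i j] W(1)
      by (simp add: unit_def LIMSEQ_const_iff)
    ultimately show ?thesis using W(3) by (auto simp: unit_def fun_eq_iff)
  qed
  have lim_comm: "mm N W' B = mm N B W'"
    if W: "\<And>m. mm N (W m) B = mm N B (W m)" "\<And>i j. (\<lambda>m. W m i j) \<longlonglongrightarrow> W' i j" for W W' B
  proof (intro ext)
    fix i j
    have "(\<lambda>m. mm N (W m) B i j) \<longlonglongrightarrow> mm N W' B i j" by (intro tendsto_mm W tendsto_const)
    moreover have "(\<lambda>m. mm N (W m) B i j) \<longlonglongrightarrow> mm N B W' i j"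
      unfolding W(1) by (intro tendsto_mm W tendsto_const)
    ultimately show "mm N W' B i j = mm N B W' i j" by (rule LIMSEQ_unique)
  qed
  have "unit N U'"
    by (rule lim_unit[OF _ Ulim]) (use UV in \<open>auto simp: adm_def U'_def supp_def\<close>)
  moreover have "unit N V'"
    by (rule lim_unit[OF _ Vlim]) (use UV in \<open>auto simp: adm_def V'_def supp_def\<close>)
  moreover have "mm N U' A = mm N A U'"
    by (rule lim_comm[OF _ Ulim]) (use UV in \<open>auto simp: adm_def\<close>)
  moreover have "mm N V' C = mm N C V'"
    by (rule lim_comm[OF _ Vlim]) (use UV in \<open>auto simp: adm_def\<close>)
  ultimately have adm': "adm U' V'" by (simp add: adm_def)
  have g'supp: "suppv N g'" by (auto simp: g'_def suppv_def)
  have powlim: "(\<lambda>m. mpow N (?M (U (r m)) (V (r m))) k i j) \<longlonglongrightarrow> mpow N (?M U' V') k i j" for k i j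
  proof (induct k arbitrary: i j)
    case (Suc k) show ?case unfolding mpow.simps by (intro tendsto_mm Ulim Vlim Suc tendsto_const)
  qed simp
  \<comment> \<open>For fixed \<open>k\<close> the lower bound holds along the subsequence once
    \<open>r m\<close> exceeds \<open>k\<close>, because norms can only decrease under further
    powers.\<close>
  have big: "nrm2 N (mv N (mpow N (?M U' V') k) g') \<ge> 1 / 4" for k
  proof (rule LIMSEQ_le_const)
    show "(\<lambda>m. nrm2 N (mv N (mpow N (?M (U (r m)) (V (r m))) k) (g (r m)))) \<longlonglongrightarrow> nrm2 N (mv N (mpow N (?M U' V') k) g')"
      unfolding nrm2_def by (intro tendsto_intros tendsto_mv powlim glim)
    show "\<exists>n. \<forall>m\<ge>n. 1 / 4 \<le> nrm2 N (mv N (mpow N (?M (U (r m)) (V (r m))) k) (g (r m)))"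
    proof (intro exI allI impI)
      fix m assume "m \<ge> k"
      then have "k \<le> r m" using seq_suble[OF r, of m] by linarith
      from adm_antimono[OF UV[of "r m"] g[of "r m"] this] ggt[of "r m"]
      show "1 / 4 \<le> nrm2 N (mv N (mpow N (?M (U (r m)) (V (r m))) k) (g (r m)))" by linarith
    qed
  qed
  have Ms: "supp N (?M U' V')" using adm' by (simp add: adm_def unit_def supps)
  have "(\<lambda>k. mpow N (?M U' V') k i j) \<longlonglongrightarrow> 0" for i j
  proof (rule contraction_power_tendsto_0[OF Ms N_pos])
    fix h c assume h: "suppv N h" "h \<noteq> (\<lambda>_. 0)" "mv N (?M U' V') h = (\<lambda>i. c * h i)"
    have "(cmod c)\<^sup>2 * nrm2 N h \<le> 1 * nrm2 N h"
      using adm_contraction[OF adm' h(1)] unfolding h(3) nrm2_scale by simp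
    moreover have "nrm2 N h > 0"
      using h(1,2) nrm2_0[OF h(1)] nrm2_nonneg[of N h] by linarith
    ultimately have "(cmod c)\<^sup>2 \<le> 1" by (simp only: mult_le_cancel_right_pos)
    then have le: "cmod c \<le> 1" by (simp add: abs_square_le_1)
    have "cmod c \<noteq> 1"
    proof
      assume c: "cmod c = 1"
      have "ip N (mv N (mpow N A m) e) h = 0" for m
        by (rule eigenvector_orthogonal[OF _ _ _ _ refl h(1) h(3) c]) (use adm' in \<open>auto simp: adm_def\<close>)
      then show False using cyc h(1,2) unfolding cyclic_def by blast
    qed
    with le show "cmod c < 1" by simp
  qed
  then have "(\<lambda>k. nrm2 N (mv N (mpow N (?M U' V') k) g')) \<longlonglongrightarrow> nrm2 N (mv N (\<lambda>_ _. 0) g')"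
    unfolding nrm2_def by (intro tendsto_intros tendsto_mv) auto
  moreover have "nrm2 N (mv N (\<lambda>_ _. 0) g') = 0" by (simp add: nrm2_def mv_def)
  ultimately have "1 / 4 \<le> (0::real)"
    using big by (intro LIMSEQ_le_const[of "\<lambda>k. nrm2 N (mv N (mpow N (?M U' V') k) g')"]) auto
  then show False by simp
qed

end

section \<open>Differential equations satisfied by the explicit formula\<close>

context szego_model begin

definition E1 :: "real \<Rightarrow> nat \<Rightarrow> nat \<Rightarrow> complex" where "E1 t = mexp N A (- \<i> * of_real t)"
definition E2 :: "real \<Rightarrow> nat \<Rightarrow> nat \<Rightarrow> complex" where "E2 t = mexp N C (\<i> * of_real t)"
definition Mt :: "real \<Rightarrow> nat \<Rightarrow> nat \<Rightarrow> complex" where "Mt t = mm N (E1 t) (mm N (E2 t) T)"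
definition Gt :: "real \<Rightarrow> nat \<Rightarrow> nat \<Rightarrow> complex" where "Gt t = mm N (E1 t) G"
definition bt :: "real \<Rightarrow> nat \<Rightarrow> complex" where "bt t = mv N (E1 t) b"
text \<open>The Hankel operator at time \<open>t\<close> in a moving frame in which \<open>e\<close>
  and the square \<open>mv N A\<close> do not depend on time.\<close>

definition hk :: "real \<Rightarrow> (nat \<Rightarrow> complex) \<Rightarrow> (nat \<Rightarrow> complex)" where "hk t v = mv N (Gt t) (cv v)"
definition vseq :: "real \<Rightarrow> nat \<Rightarrow> complex" where "vseq t n = ip N (mv N (mpow N (Mt t) n) (bt t)) e"

lemma supp_flow: "supp N (E1 t)" "supp N (E2 t)" "supp N (Mt t)" "supp N (Gt t)" "suppv N (bt t)" "suppv N (hk t v)"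
  by (auto simp: E1_def E2_def Mt_def Gt_def bt_def hk_def supps)

lemma unit_mexp:
  assumes "supp N X" "adj X = X" "cnj s = - s"
  shows "unit N (mexp N X s)"
proof -
  have "adj (mexp N X s) = cj (mexp N (tp X) s)" using mexp_tp[OF assms(1), of s] by (simp add: adj_eq)
  also have "\<dots> = mexp N (adj X) (cnj s)" using mexp_cj[OF supp_tp[OF assms(1)], of s] by (simp add: adj_eq)
  finally have "adj (mexp N X s) = mexp N X (- s)" by (simp add: assms)
  then show ?thesis
    using mexp_inv[OF assms(1), of s] mexp_inv[OF assms(1), of "- s"] assms(1) by (simp add: unit_def supp_mexp)
qed

lemma adm_flow: "adm (E1 t) (E2 t)"
  unfolding adm_def E1_def E2_def
  by (intro conjI unit_mexp mexp_intertwine supp_A supp_C refl) (simp_all add: adj_A adj_C)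

lemma tp_A: "tp A = cj A" by (metis adj_A adj_eq cj_cj)

text \<open>\<open>A\<close> is G times its conjugate, so A G = G cj A, and \<open>cj A\<close> is
  the transpose of the hermitian \<open>A\<close>. Consequently \<open>Gt t\<close> stays
  symmetric.\<close>

lemma E1_G: "mm N (E1 t) G = mm N G (tp (E1 t))"
proof -
  have "mm N A G = mm N G (cj A)" by (simp add: A_def cj_mm mm_assoc)
  then have "mm N (mexp N A s) G = mm N G (mexp N (cj A) s)" for s
    by (intro mexp_intertwine supps) auto
  then show ?thesis unfolding E1_def using mexp_tp[OF supp_A] by (simp add: tp_A)
qed

lemma C_TG: "C = mm N (mm N T G) (cj (mm N T G))"
proof -
  have "mm N (cj G) (adj T) = cj (mm N T G)"
    using arg_cong[OF TG, of cj] by (simp add: cj_mm adj_eq)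
  then show ?thesis by (simp add: C_def A_def mm_assoc)
qed

lemma E2_TG: "mm N (E2 t) (mm N T G) = mm N (mm N T G) (tp (E2 t))"
proof -
  have c: "mm N C (mm N T G) = mm N (mm N T G) (cj C)" by (simp add: C_TG cj_mm mm_assoc)
  have "tp C = cj C" by (metis adj_C adj_eq cj_cj)
  moreover have "mm N (mexp N C s) (mm N T G) = mm N (mm N T G) (mexp N (cj C) s)" for s
    by (intro mexp_intertwine supps c)
  ultimately show ?thesis unfolding E2_def using mexp_tp[OF supp_C] by simp
qed

lemma tp_Gt: "tp (Gt t) = Gt t"
  by (simp add: Gt_def tp_mm G_sym E1_G)

text \<open>Each exponential crosses \<open>G\<close> or \<open>mm N T G\<close> as its transpose
  (\<open>E1_G\<close>, \<open>E2_TG\<close>), so the Hankel relation \<open>TG\<close> of the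
  initial data survives in the evolved pair.\<close>

lemma Mt_Gt: "mm N (Mt t) (Gt t) = mm N (Gt t) (tp (Mt t))"
proof -
  have "mm N (Mt t) (Gt t) = mm N (E1 t) (mm N (E2 t) (mm N T (mm N (E1 t) G)))"
    by (simp add: Mt_def Gt_def mm_assoc)
  also have "\<dots> = mm N (E1 t) (mm N (mm N (E2 t) (mm N T G)) (tp (E1 t)))"
    unfolding E1_G by (simp add: mm_assoc)
  also have "\<dots> = mm N (E1 t) (mm N (mm N T G) (mm N (tp (E2 t)) (tp (E1 t))))"
    unfolding E2_TG by (simp add: mm_assoc)
  also have "\<dots> = mm N (Gt t) (tp (Mt t))"
    unfolding TG by (simp add: Mt_def Gt_def tp_mm mm_assoc)
  finally show ?thesis .
qed

lemma Gt_cj_Gt: "mm N (Gt t) (cj (Gt t)) = A"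
proof -
  have u: "mm N (E1 t) (adj (E1 t)) = idm N" using adm_flow[of t] by (simp add: adm_def unit_def)
  have "mm N (Gt t) (cj (Gt t)) = mm N (E1 t) (mm N G (cj (mm N (E1 t) G)))"
    by (simp add: Gt_def mm_assoc)
  also have "cj (mm N (E1 t) G) = mm N (cj G) (adj (E1 t))" by (simp add: E1_G cj_mm adj_eq)
  also have "mm N (E1 t) (mm N G (mm N (cj G) (adj (E1 t)))) = mm N (mm N (E1 t) A) (adj (E1 t))"
    by (simp add: A_def mm_assoc)
  also have "mm N (E1 t) A = mm N A (E1 t)" using adm_flow[of t] by (simp add: adm_def)
  finally show ?thesis by (simp add: mm_assoc u mm_idm supps)
qed

lemma bt_hk: "bt t = hk t e"
  by (simp add: bt_def hk_def Gt_def b_def mv_mm)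

lemma hk_hk: "hk t (hk t v) = mv N A v"
  unfolding hk_def cv_mv cv_cv mv_mm[symmetric] Gt_cj_Gt ..

lemma hk_sym: "ip N (hk t v) w = ip N (hk t w) v"
proof -
  have "ip N (hk t v) w = ip N (cv v) (mv N (adj (Gt t)) w)" by (simp add: hk_def ip_adj)
  also have "\<dots> = cnj (ip N v (cv (mv N (adj (Gt t)) w)))" by (metis cv_cv ip_cv)
  also have "\<dots> = ip N (cv (mv N (adj (Gt t)) w)) v" by (rule ip_cnj)
  also have "cv (mv N (adj (Gt t)) w) = hk t w" by (simp add: cv_mv hk_def cj_adj tp_Gt)
  finally show ?thesis .
qed

lemma hk_pow: "mv N (mpow N (Mt t) n) (hk t v) = hk t (mv N (adj (mpow N (Mt t) n)) v)"
proof -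
  have "mm N (mpow N (Mt t) n) (Gt t) = mm N (Gt t) (tp (mpow N (Mt t) n))"
    using mpow_intertwine[OF supp_flow(4)[of t] Mt_Gt, of n] mpow_tp[OF supp_flow(3)[of t], of n] by simp
  then show ?thesis by (simp add: hk_def cv_mv cj_adj mv_mm[symmetric])
qed

text \<open>Both sides stand for the \<open>n\<close>-th Fourier coefficient of |u|^2: the left one
  arises when powers of \<open>Mt t\<close> are differentiated, the right one is the form that
  \<open>hankel_sums\<close> evaluates.\<close>

lemma ip_bt: "ip N (mv N (mpow N (Mt t) n) (bt t)) (bt t) = ip N (mv N (mpow N (Mt t) n) (hk t (bt t))) e"
proof -
  have "ip N (mv N (mpow N (Mt t) n) (hk t e)) (hk t e) = ip N (hk t (hk t e)) (mv N (adj (mpow N (Mt t) n)) e)"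
    unfolding hk_pow by (rule hk_sym)
  then show ?thesis unfolding bt_hk ip_adj .
qed

lemma E_deriv:
  "((\<lambda>t. E1 t i j) has_vector_derivative - \<i> * mm N A (E1 t) i j) (at t)"
  "((\<lambda>t. E2 t i j) has_vector_derivative \<i> * mm N C (E2 t) i j) (at t)"
proof -
  have s: "((\<lambda>t. z * complex_of_real t) has_vector_derivative z) (at t)" for z t
    by (auto intro!: derivative_eq_intros)
  show "((\<lambda>t. E1 t i j) has_vector_derivative - \<i> * mm N A (E1 t) i j) (at t)"
    using field_vector_diff_chain_at[OF s[of "- \<i>" t] mexp_deriv[OF supp_A, of i j]]
    by (simp add: o_def E1_def)
  show "((\<lambda>t. E2 t i j) has_vector_derivative \<i> * mm N C (E2 t) i j) (at t)"
    using field_vector_diff_chain_at[OF s[of \<i> t] mexp_deriv[OF supp_C, of i j]]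
    by (simp add: o_def E2_def)
qed

lemma mv_deriv:
  assumes "\<And>i j. ((\<lambda>t. X t i j) has_vector_derivative X' i j) (at t)"
    and "\<And>i. ((\<lambda>t. v t i) has_vector_derivative v' i) (at t)"
  shows "((\<lambda>t. mv N (X t) (v t) i) has_vector_derivative (mv N X' (v t) i + mv N (X t) v' i)) (at t)"
  unfolding mv_def sum.distrib[symmetric]
  by (intro has_vector_derivative_sum has_vector_derivative_eq_rhs[OF has_vector_derivative_mult[OF assms]])
    (simp add: add.commute)

lemma mm_deriv:
  assumes "\<And>i j. ((\<lambda>t. X t i j) has_vector_derivative X' i j) (at t)"
    and "\<And>i j. ((\<lambda>t. Y t i j) has_vector_derivative Y' i j) (at t)"
  shows "((\<lambda>t. mm N (X t) (Y t) i j) has_vector_derivative (mm N X' (Y t) i j + mm N (X t) Y' i j)) (at t)"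
  unfolding mm_def sum.distrib[symmetric]
  by (intro has_vector_derivative_sum has_vector_derivative_eq_rhs[OF has_vector_derivative_mult[OF assms]])
    (simp add: add.commute)

lemma mm_scale_left: "mm N (\<lambda>i j. c * X i j) Y = (\<lambda>i j. c * mm N X Y i j)"
  by (auto simp: mm_def sum_distrib_left mult_ac)
lemma mm_scale_right: "mm N X (\<lambda>i j. c * Y i j) = (\<lambda>i j. c * mm N X Y i j)"
  by (auto simp: mm_def sum_distrib_left mult_ac)
lemma mv_mscale: "mv N (\<lambda>i j. c * X i j) v = (\<lambda>i. c * mv N X v i)"
  by (auto simp: mv_def sum_distrib_left mult_ac)

lemma Mt_deriv:
  "((\<lambda>t. Mt t i j) has_vector_derivative - \<i> * (bt t i * cnj (mv N (adj (Mt t)) (bt t) j))) (at t)"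
proof -
  let ?U = "E1 t" and ?V = "E2 t"
  have u: "mm N (adj ?U) ?U = idm N" "mm N ?U (adj ?U) = idm N" "mm N ?U A = mm N A ?U"
    using adm_flow[of t] by (auto simp: adm_def unit_def)
  have "((\<lambda>t. Mt t i j) has_vector_derivative
     (mm N (\<lambda>i j. - \<i> * mm N A ?U i j) (mm N ?V T) i j +
      mm N ?U (\<lambda>i j. mm N (\<lambda>i j. \<i> * mm N C ?V i j) T i j + mm N ?V (\<lambda>_ _. 0) i j) i j)) (at t)"
    unfolding Mt_def by (intro mm_deriv E_deriv has_vector_derivative_const)
  also have "mm N (\<lambda>i j. - \<i> * mm N A ?U i j) (mm N ?V T) i j +
      mm N ?U (\<lambda>i j. mm N (\<lambda>i j. \<i> * mm N C ?V i j) T i j + mm N ?V (\<lambda>_ _. 0) i j) i j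
     = - \<i> * (mm N A (Mt t) i j - mm N ?U (mm N C (mm N ?V T)) i j)"
  proof -
    have z: "mm N ?V (\<lambda>_ _. 0) i j = 0" for i j by (simp add: mm_def)
    show ?thesis unfolding z mm_scale_left by (simp add: mm_scale_right Mt_def mm_assoc algebra_simps)
  qed
  also have "mm N ?U (mm N C (mm N ?V T)) = mm N (mm N ?U (mm N C (adj ?U))) (Mt t)"
  proof -
    have "mm N (adj ?U) (Mt t) = mm N ?V T"
      unfolding Mt_def mm_assoc[symmetric, of N "adj ?U" ?U] u by (simp add: idm_mm supps supp_flow)
    then show ?thesis by (simp add: mm_assoc)
  qed
  also have "mm N ?U (mm N C (adj ?U)) = (\<lambda>i j. A i j - bt t i * cnj (bt t j))"
  proof -
    have "mm N ?U (mm N A (adj ?U)) = mm N (mm N A ?U) (adj ?U)" by (simp add: u(3)[symmetric] mm_assoc)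
    also have "\<dots> = A" by (simp add: mm_assoc u mm_idm supps)
    finally show ?thesis unfolding C_eq mm_diff_left mm_diff_right mm_rank1_left mm_rank1_right
      by (simp add: bt_def)
  qed
  finally show ?thesis unfolding mm_diff_left mm_rank1_right by simp
qed

lemma bt_deriv: "((\<lambda>t. bt t i) has_vector_derivative - \<i> * mv N A (bt t) i) (at t)"
proof -
  have "((\<lambda>t. bt t i) has_vector_derivative
      (mv N (\<lambda>i j. - \<i> * mm N A (E1 t) i j) b i + mv N (E1 t) (\<lambda>_. 0) i)) (at t)"
    unfolding bt_def by (intro mv_deriv E_deriv has_vector_derivative_const)
  moreover have "mv N (E1 t) (\<lambda>_. 0) i = 0" by (simp add: mv_def)
  ultimately show ?thesis unfolding mv_mscale by (simp add: bt_def mv_mm)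
qed

text \<open>The product rule inserts the rank-one derivative of \<open>Mt t\<close> at each of the
  \<open>n\<close> positions: the powers to its left act on \<open>bt t\<close>, those to its right
  give the scalar factor.\<close>

lemma pow_deriv:
  "((\<lambda>t. mv N (mpow N (Mt t) n) (bt t) i) has_vector_derivative
     - \<i> * (mv N (mpow N (Mt t) n) (mv N A (bt t)) i +
        (\<Sum>k<n. ip N (mv N (mpow N (Mt t) (n - k)) (bt t)) (bt t) * mv N (mpow N (Mt t) k) (bt t) i))) (at t)"
proof (induct n arbitrary: i)
  case 0
  then show ?case using bt_deriv[of i t] by (simp add: mv_idm supps supp_flow)
next
  case (Suc n)
  let ?y = "\<lambda>n. mv N (mpow N (Mt t) n) (bt t)"
  have ysuc: "mv N (Mt t) (?y k) = ?y (Suc k)" for k by (simp add: mv_mm)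
  have "((\<lambda>t. mv N (Mt t) (mv N (mpow N (Mt t) n) (bt t)) i) has_vector_derivative
     (mv N (\<lambda>i j. - \<i> * (bt t i * cnj (mv N (adj (Mt t)) (bt t) j))) (?y n) i +
      mv N (Mt t) (\<lambda>i. - \<i> * (mv N (mpow N (Mt t) n) (mv N A (bt t)) i +
        (\<Sum>k<n. ip N (?y (n - k)) (bt t) * ?y k i))) i)) (at t)"
    by (intro mv_deriv Mt_deriv Suc)
  also have "mv N (\<lambda>i j. - \<i> * (bt t i * cnj (mv N (adj (Mt t)) (bt t) j))) (?y n) i =
     - \<i> * (ip N (?y (Suc n)) (bt t) * ?y 0 i)"
    unfolding mv_mscale mv_rank1 ip_adj[symmetric] ysuc by (simp add: mv_idm supps supp_flow)
  also have "mv N (Mt t) (\<lambda>i. - \<i> * (mv N (mpow N (Mt t) n) (mv N A (bt t)) i +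
        (\<Sum>k<n. ip N (?y (n - k)) (bt t) * ?y k i))) i =
     - \<i> * (mv N (mpow N (Mt t) (Suc n)) (mv N A (bt t)) i + (\<Sum>k<n. ip N (?y (n - k)) (bt t) * ?y (Suc k) i))"
    unfolding mv_scale mv_add mv_sum ysuc by (simp add: mv_mm)
  also have "- \<i> * (ip N (?y (Suc n)) (bt t) * ?y 0 i) +
     - \<i> * (mv N (mpow N (Mt t) (Suc n)) (mv N A (bt t)) i + (\<Sum>k<n. ip N (?y (n - k)) (bt t) * ?y (Suc k) i))
     = - \<i> * (mv N (mpow N (Mt t) (Suc n)) (mv N A (bt t)) i + (\<Sum>k<Suc n. ip N (?y (Suc n - k)) (bt t) * ?y k i))"
    by (subst sum.lessThan_Suc_shift) (simp add: algebra_simps)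
  finally show ?case by (simp add: mv_mm)
qed

lemma vseq_deriv:
  "((\<lambda>t. vseq t n) has_vector_derivative - \<i> *
     (ip N (mv N (mpow N (Mt t) n) (hk t (hk t (bt t)))) e +
      (\<Sum>k<n. vseq t k * ip N (mv N (mpow N (Mt t) (n - k)) (hk t (bt t))) e))) (at t)"
proof -
  let ?y = "\<lambda>n. mv N (mpow N (Mt t) n) (bt t)"
  have "((\<lambda>t. vseq t n) has_vector_derivative
     (\<Sum>i<N. (- \<i> * (mv N (mpow N (Mt t) n) (mv N A (bt t)) i +
        (\<Sum>k<n. ip N (?y (n - k)) (bt t) * ?y k i))) * cnj (e i))) (at t)"
    unfolding vseq_def ip_def[of N _ e]
    by (intro has_vector_derivative_sum has_vector_derivative_mult_left pow_deriv)
  also have "(\<Sum>i<N. (- \<i> * (mv N (mpow N (Mt t) n) (mv N A (bt t)) i +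
        (\<Sum>k<n. ip N (?y (n - k)) (bt t) * ?y k i))) * cnj (e i))
     = ip N (\<lambda>i. - \<i> * (mv N (mpow N (Mt t) n) (mv N A (bt t)) i +
        (\<Sum>k<n. ip N (?y (n - k)) (bt t) * ?y k i))) e"
    by (simp add: ip_def)
  also have "\<dots> = - \<i> * (ip N (mv N (mpow N (Mt t) n) (mv N A (bt t))) e +
     (\<Sum>k<n. ip N (?y (n - k)) (bt t) * vseq t k))"
  proof -
    have add: "ip N (\<lambda>i. f i + g i) e = ip N f e + ip N g e" for f g
      by (simp add: ip_def algebra_simps sum.distrib)
    show ?thesis unfolding ip_scale add ip_sum vseq_def ..
  qed
  finally show ?thesis by (simp add: ip_bt hk_hk mult.commute)
qed

end

section \<open>Decay uniform in time, and evaluation of the Hankel terms as series in the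
  coefficients\<close>

context szego_model begin

lemma mv_mpow_add: "suppv N h \<Longrightarrow> mv N (mpow N X (m + k)) h = mv N (mpow N X m) (mv N (mpow N X k) h)" if "supp N X"
  using mv_mpow[of N h X "m + k"] mv_mpow[of N h X k] mv_mpow[of N "mv N (mpow N X k) h" X m]
    suppv_mv[OF supp_mpow[OF that], of k h]
  by (simp add: funpow_add)

text \<open>Squared norms shrink by 1/4 in \<open>m\<close> steps. The \<open>m\<close>-th root of
  1/4 spreads this over single steps, and the factor 4 = Q^(-m) pays for an incomplete block. Taking
  a successor for \<open>m\<close> keeps the root meaningful.\<close>

lemma uniform_decay:
  assumes cyclic
  shows "\<exists>Q. 0 < Q \<and> Q < 1 \<and> (\<forall>t h k. suppv N h \<longrightarrow> nrm2 N (mv N (mpow N (Mt t) k) h) \<le> 4 * Q ^ k * nrm2 N h)"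
proof -
  obtain m0 where m0: "\<And>U V h. adm U V \<Longrightarrow> suppv N h \<Longrightarrow>
    nrm2 N (mv N (mpow N (mm N U (mm N V T)) m0) h) \<le> 1 / 4 * nrm2 N h"
    using uniform_contraction[OF assms] by blast
  define m where "m = Suc m0"
  have m: "nrm2 N (mv N (mpow N (Mt t) m) h) \<le> 1 / 4 * nrm2 N h" if "suppv N h" for t h
    using m0[OF adm_flow that, of t] adm_antimono[OF adm_flow that, of m0 m t] by (simp add: Mt_def m_def)
  define Q where "Q = root m (1 / 4)"
  have Q: "0 < Q" "Q < 1" by (auto simp: Q_def m_def)
  have Qm: "Q ^ m = 1 / 4" unfolding Q_def by (rule real_root_pow_pos2) (auto simp: m_def)
  have "nrm2 N (mv N (mpow N (Mt t) k) h) \<le> 4 * Q ^ k * nrm2 N h" if "suppv N h" for t h k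
    using that
  proof (induct k arbitrary: h rule: less_induct)
    case (less k)
    show ?case
    proof (cases "k < m")
      case True
      have "nrm2 N (mv N (mpow N (Mt t) k) h) \<le> nrm2 N h"
        using adm_antimono[OF adm_flow less(2), of 0 k t] less(2) by (simp add: Mt_def mv_idm)
      also have "\<dots> = 4 * Q ^ m * nrm2 N h" by (simp add: Qm)
      also have "\<dots> \<le> 4 * Q ^ k * nrm2 N h"
        using Q True by (intro mult_right_mono mult_left_mono power_decreasing nrm2_nonneg) auto
      finally show ?thesis .
    next
      case False
      then have k: "k = m + (k - m)" "k - m < k" by (auto simp: m_def)
      have "mv N (mpow N (Mt t) k) h = mv N (mpow N (Mt t) m) (mv N (mpow N (Mt t) (k - m)) h)"
        using mv_mpow_add[OF supp_flow(3)[of t] less(2), of m "k - m"] k(1) by simp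
      then have "nrm2 N (mv N (mpow N (Mt t) k) h) \<le> 1 / 4 * nrm2 N (mv N (mpow N (Mt t) (k - m)) h)"
        using m[of "mv N (mpow N (Mt t) (k - m)) h" t] by (simp add: supps supp_flow)
      also have "\<dots> \<le> Q ^ m * (4 * Q ^ (k - m) * nrm2 N h)"
        using less(1)[OF k(2) less(2)] by (simp add: Qm)
      also have "\<dots> = 4 * Q ^ (m + (k - m)) * nrm2 N h" by (simp add: power_add)
      finally show ?thesis using k(1) by simp
    qed
  qed
  with Q show ?thesis by blast
qed

text \<open>Telescoping: M hk = hk M* and M* M = 1 - e e* for M = \<open>Mt t\<close> show that
  raising \<open>K\<close> by one changes the remainder by exactly one summand.\<close>

lemma partial_sum:
  assumes "suppv N h"
  shows "(\<Sum>k<K. vseq t (m + k) * cnj (ip N (mv N (mpow N (Mt t) k) h) e)) =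
    ip N (mv N (mpow N (Mt t) m) (hk t h)) e -
    ip N (mv N (mpow N (Mt t) (m + K)) (hk t (mv N (mpow N (Mt t) K) h))) e"
proof (induct K)
  case 0
  then show ?case using assms by (simp add: mv_idm)
next
  case (Suc K)
  let ?x = "mv N (mpow N (Mt t) K) h" and ?P = "mpow N (Mt t)"
  have x: "suppv N ?x" by (simp add: supps supp_flow)
  have sx: "mv N (?P (Suc K)) h = mv N (Mt t) ?x" by (simp add: mv_mm)
  have MM: "mv N (adj (Mt t)) (mv N (Mt t) ?x) = (\<lambda>i. ?x i - ip N ?x e * e i)"
    unfolding mv_mm[symmetric, of N "adj (Mt t)"]
    using product_defect[of "E1 t" "E2 t" "Mt t"] adm_flow[of t] x
    by (simp add: adm_def Mt_def T_defect mv_mdiff mv_rank1 mv_idm)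
  have hkd: "hk t (\<lambda>i. v i - c * w i) = (\<lambda>i. hk t v i - cnj c * hk t w i)" for v w c
  proof -
    have "cv (\<lambda>i. v i - c * w i) = (\<lambda>i. cv v i - cnj c * cv w i)" by (simp add: cv_def)
    then show ?thesis by (simp add: hk_def mv_diff mv_scale)
  qed
  have "mv N (?P (m + Suc K)) (hk t (mv N (Mt t) ?x)) = mv N (?P (m + K)) (mv N (Mt t) (hk t (mv N (Mt t) ?x)))"
    using mv_mpow_add[OF supp_flow(3)[of t], of "hk t (mv N (Mt t) ?x)" "m + K" 1]
    by (simp add: supp_flow mm_idm)
  also have "mv N (Mt t) (hk t (mv N (Mt t) ?x)) = hk t (mv N (adj (Mt t)) (mv N (Mt t) ?x))"
    using hk_pow[of t 1 "mv N (Mt t) ?x"] by (simp add: mm_idm supp_flow)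
  also have "\<dots> = (\<lambda>i. hk t ?x i - cnj (ip N ?x e) * hk t e i)"
    unfolding MM hkd ..
  finally have "ip N (mv N (?P (m + Suc K)) (hk t (mv N (?P (Suc K)) h))) e =
     ip N (mv N (?P (m + K)) (hk t ?x)) e - cnj (ip N ?x e) * vseq t (m + K)"
    unfolding sx by (simp add: mv_diff mv_scale ip_diff ip_scale vseq_def bt_hk)
  with Suc show ?case by (simp add: mult.commute)
qed

text \<open>In the remainder of \<open>partial_sum\<close> the inner power tends to 0 by
  \<open>uniform_decay\<close>, and the outer power is a contraction.\<close>

lemma hankel_sums:
  assumes cyclic "suppv N h"
  shows "(\<lambda>k. vseq t (m + k) * cnj (ip N (mv N (mpow N (Mt t) k) h) e)) sums
    ip N (mv N (mpow N (Mt t) m) (hk t h)) e"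
proof -
  let ?x = "\<lambda>K. mv N (mpow N (Mt t) K) h" and ?P = "mpow N (Mt t)"
  obtain Q where Q: "0 < Q" "Q < 1" "\<And>h k. suppv N h \<Longrightarrow> nrm2 N (mv N (?P k) h) \<le> 4 * Q ^ k * nrm2 N h"
    using uniform_decay[OF assms(1)] by blast
  have "(\<lambda>k. Q ^ k) \<longlonglongrightarrow> 0" using Q by (intro LIMSEQ_realpow_zero) auto
  then have l: "(\<lambda>k. 4 * Q ^ k * nrm2 N h) \<longlonglongrightarrow> 0"
    by (auto intro!: tendsto_mult_left_zero tendsto_mult_right_zero)
  have n0: "(\<lambda>K. nrm2 N (?x K)) \<longlonglongrightarrow> 0"
    by (rule tendsto_sandwich[OF _ _ tendsto_const l]) (auto simp: nrm2_nonneg Q assms)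
  have x0: "(\<lambda>K. ?x K i) \<longlonglongrightarrow> 0" for i
  proof (cases "i < N")
    case True
    have "norm (?x K i) \<le> sqrt (nrm2 N (?x K))" for K
      unfolding nrm2_def using True
      by (intro real_le_rsqrt member_le_sum[of i "{..<N}" "\<lambda>i. (cmod (?x K i))\<^sup>2"]) auto
    moreover have "(\<lambda>K. sqrt (nrm2 N (?x K))) \<longlonglongrightarrow> 0" using tendsto_real_sqrt[OF n0] by simp
    ultimately show ?thesis by (intro Lim_null_comparison[of "\<lambda>K. ?x K i"] always_eventually) auto
  next
    case False
    have "suppv N (?x K)" for K by (intro supps supp_flow)
    then have "?x K i = 0" for K using False unfolding suppv_def by blast
    then show ?thesis by simp
  qed
  have "(\<lambda>K. hk t (?x K) i) \<longlonglongrightarrow> hk t (\<lambda>_. 0) i" for i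
    unfolding hk_def by (intro tendsto_mv tendsto_const) (unfold cv_def, intro tendsto_intros x0)
  then have hx: "(\<lambda>K. nrm2 N (hk t (?x K))) \<longlonglongrightarrow> nrm2 N (hk t (\<lambda>_. 0))"
    unfolding nrm2_def by (intro tendsto_intros)
  have "nrm2 N (hk t (\<lambda>_. 0)) = 0" by (simp add: hk_def cv_def mv_def nrm2_def)
  with hx have hx: "(\<lambda>K. sqrt (nrm2 N (hk t (?x K)) * nrm2 N e)) \<longlonglongrightarrow> 0"
    using tendsto_real_sqrt[OF tendsto_mult_left_zero, of "\<lambda>K. nrm2 N (hk t (?x K))" sequentially "nrm2 N e"] by simp
  have "(\<lambda>K. ip N (mv N (?P (m + K)) (hk t (?x K))) e) \<longlonglongrightarrow> 0"
  proof (rule Lim_null_comparison[OF always_eventually hx], rule allI)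
    fix K
    have "(cmod (ip N (mv N (?P (m + K)) (hk t (?x K))) e))\<^sup>2 \<le> nrm2 N (mv N (?P (m + K)) (hk t (?x K))) * nrm2 N e"
      by (rule cauchy_ip)
    also have "\<dots> \<le> nrm2 N (hk t (?x K)) * nrm2 N e"
      using adm_antimono[OF adm_flow[of t], of "hk t (?x K)" 0 "m + K"]
      by (intro mult_right_mono nrm2_nonneg) (simp add: Mt_def supp_flow mv_idm)
    finally show "norm (ip N (mv N (?P (m + K)) (hk t (?x K))) e) \<le> sqrt (nrm2 N (hk t (?x K)) * nrm2 N e)"
      by (rule real_le_rsqrt)
  qed
  then have "(\<lambda>K. ip N (mv N (?P m) (hk t h)) e - ip N (mv N (?P (m + K)) (hk t (?x K))) e)
      \<longlonglongrightarrow> ip N (mv N (?P m) (hk t h)) e - 0"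
    by (intro tendsto_intros)
  then show ?thesis unfolding sums_def partial_sum[OF assms(2)] by simp
qed

theorem explicit_flow:
  assumes cyclic
  obtains v :: "real \<Rightarrow> nat \<Rightarrow> complex" and K q :: real where
    "0 < q" "q < 1" "\<And>t k. cmod (v t k) \<le> K * q ^ k"
    "\<And>k. v 0 k = ip N (mv N (mpow N T k) b) e"
    "\<And>t n. ((\<lambda>t. v t n) has_vector_derivative - \<i> *
       ((\<Sum>k. v t (n + k) * cnj (\<Sum>j. v t (k + j) * cnj (v t j))) +
        (\<Sum>k<n. v t k * (\<Sum>j. v t (n - k + j) * cnj (v t j))))) (at t)"
proof -
  obtain Q where Q: "0 < Q" "Q < 1" "\<And>t h k. suppv N h \<Longrightarrow> nrm2 N (mv N (mpow N (Mt t) k) h) \<le> 4 * Q ^ k * nrm2 N h"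
    using uniform_decay[OF assms(1)] by blast
  \<comment> \<open>\<open>Q\<close> controls squared norms, so the coefficients decay like powers
    of its square root.\<close>
  define q where "q = sqrt Q"
  have q: "0 < q" "q < 1" "q\<^sup>2 = Q" using Q by (auto simp: q_def)
  show ?thesis
  proof (rule that[OF q(1,2)])
    fix t k
    have "(cmod (vseq t k))\<^sup>2 \<le> nrm2 N (mv N (mpow N (Mt t) k) (bt t)) * nrm2 N e"
      unfolding vseq_def by (rule cauchy_ip)
    also have "\<dots> \<le> 4 * Q ^ k * nrm2 N (bt t) * nrm2 N e"
      by (intro mult_right_mono Q nrm2_nonneg supp_flow)
    also have "nrm2 N (bt t) = nrm2 N b"
      unfolding bt_def using adm_flow[of t] by (intro unit_nrm2 supps) (auto simp: adm_def)
    also have "4 * Q ^ k * nrm2 N b * nrm2 N e = (2 * sqrt (nrm2 N b * nrm2 N e) * q ^ k)\<^sup>2"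
      using nrm2_nonneg[of N b] nrm2_nonneg[of N e]
      by (simp add: power_mult_distrib q(3)[symmetric] power_mult[symmetric] mult.commute)
    finally show "cmod (vseq t k) \<le> 2 * sqrt (nrm2 N b * nrm2 N e) * q ^ k"
      using nrm2_nonneg[of N b] nrm2_nonneg[of N e] q by (intro power2_le_imp_le[of "cmod (vseq t k)"]) auto
  next
    fix k
    have "Mt 0 = T" "bt 0 = b"
      by (simp_all add: Mt_def bt_def E1_def E2_def mexp_0 idm_mm mv_idm supps)
    then show "vseq 0 k = ip N (mv N (mpow N T k) b) e" by (simp add: vseq_def)
  next
    fix t n
    have c: "(\<Sum>j. vseq t (k + j) * cnj (vseq t j)) = ip N (mv N (mpow N (Mt t) k) (hk t (bt t))) e" for k
      using hankel_sums[OF assms supp_flow(5), of t k t] by (simp add: vseq_def[symmetric] sums_iff)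
    have d: "(\<Sum>k. vseq t (n + k) * cnj (\<Sum>j. vseq t (k + j) * cnj (vseq t j))) =
        ip N (mv N (mpow N (Mt t) n) (hk t (hk t (bt t)))) e" for n
      unfolding c using hankel_sums[OF assms supp_flow(6), of t n t] by (simp add: sums_iff)
    show "((\<lambda>t. vseq t n) has_vector_derivative - \<i> *
       ((\<Sum>k. vseq t (n + k) * cnj (\<Sum>j. vseq t (k + j) * cnj (vseq t j))) +
        (\<Sum>k<n. vseq t k * (\<Sum>j. vseq t (n - k + j) * cnj (vseq t j))))) (at t)"
      unfolding d unfolding c by (rule vseq_deriv)
  qed
qed

end

section \<open>Fourier analysis on the circle\<close>

lemma cis_measurable [measurable]: "cis \<in> borel_measurable borel"
  by (intro borel_measurable_continuous_onI continuous_intros)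

lemma borel_measurable_cnj [measurable (raw)]:
  "f \<in> borel_measurable M \<Longrightarrow> (\<lambda>x. cnj (f x)) \<in> borel_measurable M"
  by (rule measurable_compose[of f M borel cnj])
    (auto intro!: borel_measurable_continuous_onI continuous_intros)

lemma sets_circle [measurable_cong, simp]: "sets circle = sets borel"
  and space_circle [simp]: "space circle = UNIV"
  by (simp_all add: circle_def)

lemma emeasure_circle_UNIV [simp]: "emeasure circle UNIV = 1"
proof -
  have "emeasure circle UNIV = emeasure (uniform_measure lborel {0..2 * pi}) (cis -` UNIV \<inter> space (uniform_measure lborel {0..2 * pi}))"
    unfolding circle_def by (rule emeasure_distr) (auto simp: uniform_measure_def)
  also have "\<dots> = 1"
    by (subst emeasure_uniform_measure) (auto simp: ennreal_divide_self)
  finally show ?thesis .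
qed

interpretation circle: finite_measure circle
  by (rule finite_measureI) simp

lemma measure_circle [simp]: "measure circle UNIV = 1"
  by (simp add: measure_def)

lemma AE_circle_norm: "AE z in circle. cmod z = 1"
proof -
  have "AE x in uniform_measure lborel {0..2 * pi}. cmod (cis x) = 1" by simp
  then show ?thesis unfolding circle_def by (subst AE_distr_iff) (auto simp: uniform_measure_def)
qed

text \<open>Cauchy's formula at the centre of the disc; the explicit integrals over
  \<open>circle\<close> below come down to it.\<close>

lemma mean_value_circle:
  assumes [measurable]: "f \<in> borel_measurable borel" and f: "f holomorphic_on S" "cball 0 1 \<subseteq> S"
  shows "(\<integral>z. f z \<partial>circle) = f 0"
proof -
  have hol: "f holomorphic_on cball 0 1" using f by (rule holomorphic_on_subset)
  then have "((\<lambda>u. f u / (u - 0)) has_contour_integral (2 * of_real pi * \<i> * f 0)) (circlepath 0 1)"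
    by (rule Cauchy_integral_circlepath_simple) simp
  then have "((\<lambda>t. f (cis t) / cis t * \<i> * cis t) has_integral (2 * of_real pi * \<i> * f 0)) {0..2 * pi}"
    unfolding circlepath_def by (subst (asm) has_contour_integral_part_circlepath_iff) auto
  then have "((\<lambda>t. (- \<i>) * (f (cis t) / cis t * \<i> * cis t)) has_integral (- \<i>) * (2 * of_real pi * \<i> * f 0)) {0..2 * pi}"
    by (rule has_integral_mult_right)
  then have *: "((\<lambda>t. f (cis t)) has_integral (2 * pi * f 0)) {0..2 * pi}"
    by (simp add: field_simps)
  have "continuous_on (cball 0 1) f" using hol by (rule holomorphic_on_imp_continuous_on)
  then have "continuous_on {0..2 * pi} (\<lambda>t. f (cis t))"
    by (rule continuous_on_compose2) (auto intro!: continuous_intros)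
  then have "set_integrable lborel {0..2 * pi} (\<lambda>t. f (cis t))" by (rule borel_integrable_atLeastAtMost')
  then have "(LINT t:{0..2 * pi}|lborel. f (cis t)) = 2 * pi * f 0"
    using set_borel_integral_eq_integral(2) integral_unique[OF *] by metis
  then show ?thesis by (simp add: integral_circle)
qed

lemma powi_measurable [measurable]: "(\<lambda>z::complex. z powi k) \<in> borel_measurable borel"
  by (cases "k \<ge> 0") (auto simp: power_int_def)

lemma cnj_powi: "cmod z = 1 \<Longrightarrow> cnj (z powi k) = z powi (- k)"
proof -
  assume z: "cmod z = 1"
  have "z * cnj z = 1" using complex_norm_square[of z] z by simp
  then have "cnj z = inverse z" by (metis inverse_unique)
  then show ?thesis by (simp add: power_int_minus power_int_inverse)
qed

lemma integral_powi: "(\<integral>z. z powi k \<partial>circle) = (if k = 0 then 1 else 0)"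
proof -
  have pos: "(\<integral>z. z ^ n \<partial>circle) = 0" if "n > 0" for n
    by (subst mean_value_circle[where S=UNIV]) (use that in \<open>auto intro!: holomorphic_intros\<close>)
  show ?thesis
  proof (cases k "0::int" rule: linorder_cases)
    case less
    have "(\<integral>z. z powi k \<partial>circle) = (\<integral>z. cnj (z ^ nat (- k)) \<partial>circle)"
    proof (intro integral_cong_AE)
      show "AE z in circle. z powi k = cnj (z ^ nat (- k))"
        using AE_circle_norm
      proof eventually_elim
        case (elim z)
        from cnj_powi[OF this, of "- k"] less show ?case by (simp add: power_int_def)
      qed
    qed auto
    also have "\<dots> = 0"
    proof -
      have "0 < nat (- k)" using less by simp
      then show ?thesis by (simp only: Bochner_Integration.integral_cnj pos complex_cnj_zero)
    qed
    finally show ?thesis using less by simp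
  next
    case greater
    then show ?thesis using pos[of "nat k"] by (simp add: power_int_def)
  qed simp
qed

lemma integrable_bounded_circle:
  fixes f :: "complex \<Rightarrow> 'a::{banach, second_countable_topology}"
  assumes "f \<in> borel_measurable borel" "AE z in circle. norm (f z) \<le> B"
  shows "integrable circle f"
  using assms by (intro circle.integrable_const_bound[where B=B]) auto

lemma integrable_mult_bounded:
  fixes f g :: "complex \<Rightarrow> complex"
  assumes [measurable]: "g \<in> borel_measurable borel" and g: "AE z in circle. cmod (g z) \<le> B"
    and f: "integrable circle f"
  shows "integrable circle (\<lambda>z. f z * g z)"
proof (rule Bochner_Integration.integrable_bound)
  show "integrable circle (\<lambda>z. of_real B * f z)" using f by simp
  have [measurable]: "f \<in> borel_measurable borel" using borel_measurable_integrable[OF f] by simp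
  show "(\<lambda>z. f z * g z) \<in> borel_measurable circle" by simp
  show "AE z in circle. norm (f z * g z) \<le> norm (of_real B * f z)"
    using g
  proof eventually_elim
    case (elim z)
    then have "cmod (f z) * cmod (g z) \<le> cmod (f z) * \<bar>B\<bar>" by (intro mult_left_mono) auto
    then show ?case by (simp add: norm_mult mult.commute)
  qed
qed

lemma L2_D: "f \<in> L2 \<Longrightarrow> f \<in> borel_measurable borel" "f \<in> L2 \<Longrightarrow> integrable circle (\<lambda>z. (cmod (f z))\<^sup>2)"
  by (auto simp: L2_def)

lemma L2_mult_integrable:
  assumes "f \<in> L2" "g \<in> L2"
  shows "integrable circle (\<lambda>z. f z * cnj (g z))"
proof (rule Bochner_Integration.integrable_bound)
  note [measurable] = L2_D(1)[OF assms(1)] L2_D(1)[OF assms(2)]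
  show "integrable circle (\<lambda>z. (cmod (f z))\<^sup>2 + (cmod (g z))\<^sup>2)" using L2_D(2)[OF assms(1)] L2_D(2)[OF assms(2)] by simp
  show "(\<lambda>z. f z * cnj (g z)) \<in> borel_measurable circle" by simp
  show "AE z in circle. norm (f z * cnj (g z)) \<le> norm ((cmod (f z))\<^sup>2 + (cmod (g z))\<^sup>2)"
  proof (rule AE_I2)
    fix z
    have "0 \<le> (cmod (f z) - cmod (g z))\<^sup>2" by simp
    then have "2 * (cmod (f z) * cmod (g z)) \<le> (cmod (f z))\<^sup>2 + (cmod (g z))\<^sup>2"
      by (simp add: power2_eq_square algebra_simps)
    moreover have "0 \<le> cmod (f z) * cmod (g z)" by simp
    ultimately have "cmod (f z) * cmod (g z) \<le> (cmod (f z))\<^sup>2 + (cmod (g z))\<^sup>2" by linarith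
    then show "norm (f z * cnj (g z)) \<le> norm ((cmod (f z))\<^sup>2 + (cmod (g z))\<^sup>2)"
      by (simp add: norm_mult)
  qed
qed

lemma L2_bounded:
  assumes "f \<in> borel_measurable borel" "AE z in circle. cmod (f z) \<le> B"
  shows "f \<in> L2"
  unfolding L2_def
proof (intro CollectI conjI assms(1) integrable_bounded_circle[where B="B\<^sup>2"])
  show "(\<lambda>z. (cmod (f z))\<^sup>2) \<in> borel_measurable borel" using assms(1) by simp
  show "AE z in circle. norm ((cmod (f z))\<^sup>2) \<le> B\<^sup>2"
    using assms(2) by eventually_elim (auto intro!: power_mono)
qed

lemma L2_powi: "(\<lambda>z. z powi k) \<in> L2"
  by (rule L2_bounded[where B=1]) (use AE_circle_norm in \<open>auto elim: eventually_mono simp: norm_power_int\<close>)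

lemma L2_integrable:
  assumes "f \<in> L2" shows "integrable circle f"
  using L2_mult_integrable[OF assms, of "\<lambda>_. 1"] L2_bounded[of "\<lambda>_. 1" 1] by simp

lemma L2_scale: "f \<in> L2 \<Longrightarrow> (\<lambda>z. c * f z) \<in> L2"
  unfolding L2_def by (auto simp: norm_mult power_mult_distrib)

lemma L2_add:
  assumes "f \<in> L2" "g \<in> L2" shows "(\<lambda>z. f z + g z) \<in> L2"
  unfolding L2_def
proof (intro CollectI conjI)
  note [measurable] = L2_D(1)[OF assms(1)] L2_D(1)[OF assms(2)]
  show "(\<lambda>z. f z + g z) \<in> borel_measurable borel" by simp
  show "integrable circle (\<lambda>z. (cmod (f z + g z))\<^sup>2)"
  proof (rule Bochner_Integration.integrable_bound)
    show "integrable circle (\<lambda>z. 2 * (cmod (f z))\<^sup>2 + 2 * (cmod (g z))\<^sup>2)" using L2_D(2)[OF assms(1)] L2_D(2)[OF assms(2)] by simp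
    show "AE z in circle. norm ((cmod (f z + g z))\<^sup>2) \<le> norm (2 * (cmod (f z))\<^sup>2 + 2 * (cmod (g z))\<^sup>2)"
    proof (rule AE_I2)
      fix z
      have "(cmod (f z + g z))\<^sup>2 \<le> (cmod (f z) + cmod (g z))\<^sup>2"
        by (intro power_mono norm_triangle_ineq) auto
      also have "\<dots> \<le> 2 * (cmod (f z))\<^sup>2 + 2 * (cmod (g z))\<^sup>2"
        using sum_squares_bound[of "cmod (f z)" "cmod (g z)"] by (simp add: power2_sum)
      finally show "norm ((cmod (f z + g z))\<^sup>2) \<le> norm (2 * (cmod (f z))\<^sup>2 + 2 * (cmod (g z))\<^sup>2)" by simp
    qed
  qed simp
qed

lemma L2_diff: "f \<in> L2 \<Longrightarrow> g \<in> L2 \<Longrightarrow> (\<lambda>z. f z - g z) \<in> L2"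
  using L2_add[of f "\<lambda>z. (-1) * g z"] L2_scale[of g "-1"] by simp

lemma L2_sum: "(\<And>i. i \<in> I \<Longrightarrow> f i \<in> L2) \<Longrightarrow> (\<lambda>z. \<Sum>i\<in>I. f i z) \<in> L2"
proof (induct I rule: infinite_finite_induct)
  case (insert x F) then show ?case by (simp add: L2_add)
qed (auto intro: L2_bounded[where B=0])

lemma integrable_powi_mult: "integrable circle f \<Longrightarrow> integrable circle (\<lambda>z. f z * cnj (z powi k))"
  by (rule integrable_mult_bounded[where B=1]) (use AE_circle_norm in \<open>auto elim: eventually_mono simp: norm_power_int\<close>)

lemma cinner_diff_left: "f \<in> L2 \<Longrightarrow> g \<in> L2 \<Longrightarrow> h \<in> L2 \<Longrightarrow> cinner (\<lambda>z. f z - g z) h = cinner f h - cinner g h"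
  by (simp add: cinner_def left_diff_distrib L2_mult_integrable)
lemma cinner_add_left: "f \<in> L2 \<Longrightarrow> g \<in> L2 \<Longrightarrow> h \<in> L2 \<Longrightarrow> cinner (\<lambda>z. f z + g z) h = cinner f h + cinner g h"
  by (simp add: cinner_def distrib_right L2_mult_integrable)
lemma cinner_scale_left: "cinner (\<lambda>z. c * f z) h = c * cinner f h"
  by (simp add: cinner_def mult.assoc)
lemma cinner_cnj: "cnj (cinner f g) = cinner g f"
proof -
  have "cnj (cinner f g) = (\<integral>z. cnj (f z * cnj (g z)) \<partial>circle)" unfolding cinner_def by (rule Bochner_Integration.integral_cnj[symmetric])
  then show ?thesis by (simp only: cinner_def complex_cnj_mult complex_cnj_cnj mult.commute)
qed
lemma cinner_sum_left: "(\<And>i. i \<in> I \<Longrightarrow> f i \<in> L2) \<Longrightarrow> h \<in> L2 \<Longrightarrow> cinner (\<lambda>z. \<Sum>i\<in>I. f i z) h = (\<Sum>i\<in>I. cinner (f i) h)"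
  by (simp add: cinner_def sum_distrib_right L2_mult_integrable)
lemma cinner_self: "cinner f f = of_real (\<integral>z. (cmod (f z))\<^sup>2 \<partial>circle)"
  unfolding cinner_def by (simp only: complex_norm_square[symmetric] integral_complex_of_real)

lemma cinner_cong_AE:
  assumes "f \<in> borel_measurable borel" "f' \<in> borel_measurable borel" "h \<in> borel_measurable borel" "h' \<in> borel_measurable borel"
    "AE z in circle. f z = f' z" "AE z in circle. h z = h' z"
  shows "cinner f h = cinner f' h'"
  unfolding cinner_def by (intro integral_cong_AE) (use assms in auto)

lemma L2_cong_AE:
  assumes "f \<in> borel_measurable borel" "g \<in> L2" "AE z in circle. f z = g z"
  shows "f \<in> L2"
proof -
  have "integrable circle (\<lambda>z. (cmod (f z))\<^sup>2) \<longleftrightarrow> integrable circle (\<lambda>z. (cmod (g z))\<^sup>2)"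
    by (rule integrable_cong_AE) (use assms in \<open>auto dest: L2_D\<close>)
  then show ?thesis using assms by (simp add: L2_def)
qed

lemma fourier_cong_AE:
  assumes "f \<in> borel_measurable borel" "g \<in> borel_measurable borel" "AE z in circle. f z = g z"
  shows "fourier f k = fourier g k"
  unfolding fourier_def by (rule cinner_cong_AE) (use assms in auto)

lemma fourier_diff: "f \<in> L2 \<Longrightarrow> g \<in> L2 \<Longrightarrow> fourier (\<lambda>z. f z - g z) k = fourier f k - fourier g k"
  unfolding fourier_def by (intro cinner_diff_left L2_powi)

lemma cinner_powi: "cinner (\<lambda>z. z powi j) (\<lambda>z. z powi k) = (if j = k then 1 else 0)"
proof -
  have "cinner (\<lambda>z. z powi j) (\<lambda>z. z powi k) = (\<integral>z. z powi (j - k) \<partial>circle)"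
    unfolding cinner_def
  proof (intro integral_cong_AE)
    show "AE z in circle. z powi j * cnj (z powi k) = z powi (j - k)"
      using AE_circle_norm
    proof eventually_elim
      case (elim z)
      then have "z \<noteq> 0" by auto
      then show ?case unfolding cnj_powi[OF elim] by (simp add: power_int_add[symmetric])
    qed
  qed auto
  then show ?thesis by (simp add: integral_powi)
qed

text \<open>Positivity of the squared norm of f - r (f | g) g. Building the inner product into the
  direction lets a real parameter \<open>r\<close> suffice.\<close>

lemma cauchy_cinner:
  assumes "f \<in> L2" "g \<in> L2"
  shows "(cmod (cinner f g))\<^sup>2 \<le> (\<integral>z. (cmod (f z))\<^sup>2 \<partial>circle) * (\<integral>z. (cmod (g z))\<^sup>2 \<partial>circle)"
proof -
  let ?F = "\<integral>z. (cmod (f z))\<^sup>2 \<partial>circle" and ?G = "\<integral>z. (cmod (g z))\<^sup>2 \<partial>circle" and ?c = "cinner f g"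
  have pos: "0 \<le> ?F + r\<^sup>2 * (cmod ?c)\<^sup>2 * ?G - 2 * r * (cmod ?c)\<^sup>2" for r :: real
  proof -
    let ?h = "\<lambda>z. f z - (of_real r * ?c) * g z"
    have h: "?h \<in> L2" using assms by (intro L2_diff L2_scale)
    have e1: "cinner ?h f = cinner f f - of_real r * ?c * cnj ?c"
      using assms by (simp add: cinner_diff_left L2_scale cinner_scale_left cinner_cnj)
    have e2: "cinner ?h g = ?c - of_real r * ?c * cinner g g"
      using assms by (simp add: cinner_diff_left L2_scale cinner_scale_left)
    have "cnj (cinner ?h ?h) = cinner ?h ?h" by (rule cinner_cnj)
    have "cinner ?h ?h = cinner f ?h - of_real r * ?c * cinner g ?h"
      using assms h by (simp add: cinner_diff_left L2_scale cinner_scale_left)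
    also have "cinner f ?h = cnj (cinner ?h f)" by (simp only: cinner_cnj)
    also have "cinner g ?h = cnj (cinner ?h g)" by (simp only: cinner_cnj)
    also have "cnj (cinner ?h f) - of_real r * ?c * cnj (cinner ?h g) =
        of_real ?F + of_real (r\<^sup>2) * (?c * cnj ?c) * of_real ?G - of_real (2 * r) * (?c * cnj ?c)"
      unfolding e1 e2 cinner_self by (simp add: algebra_simps power2_eq_square)
    also have "?c * cnj ?c = of_real ((cmod ?c)\<^sup>2)" by (rule complex_norm_square[symmetric])
    finally have "cinner ?h ?h = of_real (?F + r\<^sup>2 * (cmod ?c)\<^sup>2 * ?G - 2 * r * (cmod ?c)\<^sup>2)"
      by simp
    then have "of_real (\<integral>z. (cmod (?h z))\<^sup>2 \<partial>circle) = complex_of_real (?F + r\<^sup>2 * (cmod ?c)\<^sup>2 * ?G - 2 * r * (cmod ?c)\<^sup>2)"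
      unfolding cinner_self[of ?h] .
    then have "(\<integral>z. (cmod (?h z))\<^sup>2 \<partial>circle) = ?F + r\<^sup>2 * (cmod ?c)\<^sup>2 * ?G - 2 * r * (cmod ?c)\<^sup>2"
      by (simp only: of_real_eq_iff)
    moreover have "0 \<le> (\<integral>z. (cmod (?h z))\<^sup>2 \<partial>circle)" by simp
    ultimately show ?thesis by simp
  qed
  have G: "0 \<le> ?G" by simp
  show ?thesis
  proof (cases "?G = 0")
    case True
    have "(cmod ?c)\<^sup>2 = 0"
    proof (rule ccontr)
      assume x: "(cmod ?c)\<^sup>2 \<noteq> 0"
      \<comment> \<open>If \<open>g\<close> has norm 0, the quadratic expression is linear in
        \<open>r\<close>; this \<open>r\<close> makes it equal to -1.\<close>
      have "2 * ((?F + 1) / (2 * (cmod ?c)\<^sup>2)) * (cmod ?c)\<^sup>2 = ?F + 1" using x by simp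
      then show False using pos[of "(?F + 1) / (2 * (cmod ?c)\<^sup>2)"] unfolding True by linarith
    qed
    then show ?thesis using True by simp
  next
    case False
    with G have G: "?G > 0" by linarith
    have "(1 / ?G)\<^sup>2 * (cmod ?c)\<^sup>2 * ?G = (cmod ?c)\<^sup>2 / ?G" using G by (simp add: power2_eq_square)
    then have "(cmod ?c)\<^sup>2 / ?G \<le> ?F" using pos[of "1 / ?G"] by simp
    with G show ?thesis by (simp add: pos_divide_le_eq)
  qed
qed

section \<open>Integrable functions on the circle are determined by their Fourier
  coefficients\<close>

definition null_coeffs :: "(complex \<Rightarrow> complex) \<Rightarrow> bool" where
  "null_coeffs g \<longleftrightarrow> integrable circle g \<and> (\<forall>k. fourier g k = 0)"

lemma null_coeffs_add: "null_coeffs f \<Longrightarrow> null_coeffs g \<Longrightarrow> null_coeffs (\<lambda>z. f z + g z)"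
proof -
  assume fg: "null_coeffs f" "null_coeffs g"
  have "fourier (\<lambda>z. f z + g z) k = fourier f k + fourier g k" for k
    unfolding fourier_def cinner_def distrib_right
    by (intro Bochner_Integration.integral_add integrable_powi_mult) (use fg in \<open>auto simp: null_coeffs_def\<close>)
  then show ?thesis using fg by (simp add: null_coeffs_def)
qed

lemma null_coeffs_scale: "null_coeffs f \<Longrightarrow> null_coeffs (\<lambda>z. c * f z)"
  by (auto simp: null_coeffs_def fourier_def cinner_scale_left)

lemma null_coeffs_cong:
  assumes "null_coeffs f" "g \<in> borel_measurable borel" "AE z in circle. g z = f z"
  shows "null_coeffs g"
proof -
  have f: "f \<in> borel_measurable borel"
    using assms(1) borel_measurable_integrable[of circle f] by (simp add: null_coeffs_def)
  have "integrable circle g \<longleftrightarrow> integrable circle f"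
    by (rule integrable_cong_AE) (use assms f in auto)
  then show ?thesis using assms fourier_cong_AE[OF assms(2) f assms(3)] by (simp add: null_coeffs_def)
qed

lemma null_coeffs_powi:
  assumes "null_coeffs f" shows "null_coeffs (\<lambda>z. z powi j * f z)"
proof -
  have [measurable]: "f \<in> borel_measurable borel"
    using assms borel_measurable_integrable[of circle f] by (simp add: null_coeffs_def)
  have "integrable circle (\<lambda>z. f z * z powi j)"
    by (rule integrable_mult_bounded[where B=1])
      (use assms AE_circle_norm in \<open>auto simp: null_coeffs_def norm_power_int elim: eventually_mono\<close>)
  moreover have "fourier (\<lambda>z. z powi j * f z) k = fourier f (k - j)" for k
    unfolding fourier_def cinner_def
  proof (intro integral_cong_AE)
    show "AE z in circle. z powi j * f z * cnj (z powi k) = f z * cnj (z powi (k - j))"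
      using AE_circle_norm
    proof eventually_elim
      case (elim z)
      then have "z \<noteq> 0" by auto
      then have "z powi j * z powi (- k) = z powi (- (k - j))" by (simp add: power_int_add[symmetric])
      then show ?case unfolding cnj_powi[OF elim] by (simp add: mult_ac)
    qed
  qed auto
  ultimately show ?thesis using assms by (simp add: null_coeffs_def mult.commute)
qed

text \<open>Multiplication by z or 1/z only shifts coefficients, and on the circle a real-linear
  function is a combination of these two. The weights \<open>?a\<close> and \<open>?b\<close> come
  from Re z = (z + 1/z) / 2 and Im z = (z - 1/z) / (2 i).\<close>

lemma null_coeffs_poly:
  fixes p :: "complex \<Rightarrow> real"
  assumes "real_polynomial_function p" "null_coeffs f"
  shows "null_coeffs (\<lambda>z. of_real (p z) * f z)"
  using assms
proof (induct p arbitrary: f rule: real_polynomial_function.induct)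
  case (linear p)
  let ?a = "complex_of_real (p 1) / 2 + of_real (p \<i>) / (2 * \<i>)" and ?b = "complex_of_real (p 1) / 2 - of_real (p \<i>) / (2 * \<i>)"
  have [measurable]: "f \<in> borel_measurable borel"
    using linear(2) borel_measurable_integrable[of circle f] by (simp add: null_coeffs_def)
  have [measurable]: "p \<in> borel_measurable borel"
    using linear(1) by (intro borel_measurable_continuous_onI linear_continuous_on)
  show ?case
  proof (rule null_coeffs_cong)
    show "null_coeffs (\<lambda>z. ?a * (z powi 1 * f z) + ?b * (z powi (-1) * f z))"
      by (intro null_coeffs_add null_coeffs_scale null_coeffs_powi linear)
    show "AE z in circle. of_real (p z) * f z = ?a * (z powi 1 * f z) + ?b * (z powi (-1) * f z)"
      using AE_circle_norm
    proof eventually_elim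
      case (elim z)
      have c: "z powi (-1) = cnj z" using cnj_powi[OF elim, of 1] by simp
      have "z = Re z *\<^sub>R 1 + Im z *\<^sub>R \<i>" by (simp add: complex_eq_iff)
      then have "p z = p (Re z *\<^sub>R 1 + Im z *\<^sub>R \<i>)" by (rule arg_cong)
      also have "\<dots> = Re z * p 1 + Im z * p \<i>"
        using linear(1) by (simp add: linear_simps bounded_linear.linear)
      finally have pz: "p z = Re z * p 1 + Im z * p \<i>" .
      have "(\<alpha> + \<beta>) * z + (\<alpha> - \<beta>) * cnj z = \<alpha> * (z + cnj z) + \<beta> * (z - cnj z)" for \<alpha> \<beta>
        by (simp add: algebra_simps)
      then have "?a * z + ?b * cnj z =
          of_real (p 1) / 2 * of_real (2 * Re z) + of_real (p \<i>) / (2 * \<i>) * (of_real (2 * Im z) * \<i>)"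
        by (simp only: complex_add_cnj complex_diff_cnj)
      also have "\<dots> = of_real (p z)" unfolding pz by (simp add: complex_eq_iff)
      finally have "complex_of_real (p z) = ?a * z + ?b * cnj z" by (rule sym)
      then have "of_real (p z) * f z = (?a * z + ?b * cnj z) * f z" by simp
      then show ?case unfolding c by (simp add: algebra_simps)
    qed
  qed simp
next
  case (const c) then show ?case by (rule null_coeffs_scale)
next
  case (add p q) then show ?case by (simp add: distrib_right null_coeffs_add)
next
  case (mult p q) then show ?case by (simp add: mult.assoc)
qed

lemma null_coeffs_continuous:
  fixes \<phi> :: "complex \<Rightarrow> real"
  assumes f: "null_coeffs f" and \<phi>: "continuous_on UNIV \<phi>"
  shows "(\<integral>z. of_real (\<phi> z) * f z \<partial>circle) = 0"
proof -
  have fi: "integrable circle f" using f by (simp add: null_coeffs_def)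
  have [measurable]: "f \<in> borel_measurable borel"
    using fi borel_measurable_integrable[of circle f] by simp
  have [measurable]: "\<phi> \<in> borel_measurable borel" using \<phi> by (rule borel_measurable_continuous_onI)
  have "cmod (\<integral>z. of_real (\<phi> z) * f z \<partial>circle) \<le> \<epsilon> * (\<integral>z. cmod (f z) \<partial>circle)" if e: "\<epsilon> > 0" for \<epsilon>
  proof -
    have c: "continuous_on (sphere 0 1) \<phi>" by (rule continuous_on_subset[OF \<phi>]) simp
    obtain p where p: "real_polynomial_function p" "\<And>z. z \<in> sphere 0 1 \<Longrightarrow> \<bar>\<phi> z - p z\<bar> < \<epsilon>"
      by (rule Stone_Weierstrass_real_polynomial_function[OF compact_sphere c e]) blast
    have [measurable]: "p \<in> borel_measurable borel"
      using continuous_real_polymonial_function[OF p(1)]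
      by (intro borel_measurable_continuous_onI) (simp add: continuous_at_imp_continuous_on)
    have pz: "(\<integral>z. of_real (p z) * f z \<partial>circle) = 0" and pi: "integrable circle (\<lambda>z. of_real (p z) * f z)"
    proof -
      have n: "null_coeffs (\<lambda>z. of_real (p z) * f z)" by (rule null_coeffs_poly[OF p(1) f])
      then have "fourier (\<lambda>z. of_real (p z) * f z) 0 = 0" by (simp add: null_coeffs_def)
      then show "(\<integral>z. of_real (p z) * f z \<partial>circle) = 0" by (simp add: fourier_def cinner_def)
      show "integrable circle (\<lambda>z. of_real (p z) * f z)" using n by (simp add: null_coeffs_def)
    qed
    have bd: "AE z in circle. cmod (of_real (\<phi> z - p z) * f z) \<le> \<epsilon> * cmod (f z)"
      using AE_circle_norm
    proof eventually_elim
      case (elim z)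
      then have "\<bar>\<phi> z - p z\<bar> \<le> \<epsilon>" using p(2)[of z] by simp
      then show ?case unfolding norm_mult norm_of_real by (intro mult_right_mono) auto
    qed
    have di: "integrable circle (\<lambda>z. of_real (\<phi> z - p z) * f z)"
    proof (rule Bochner_Integration.integrable_bound)
      show "integrable circle (\<lambda>z. \<epsilon> * cmod (f z))" using fi by simp
      show "AE z in circle. norm (of_real (\<phi> z - p z) * f z) \<le> norm (\<epsilon> * cmod (f z))"
        using bd by eventually_elim (use e in auto)
    qed simp
    have "(\<integral>z. of_real (\<phi> z) * f z \<partial>circle) = (\<integral>z. of_real (\<phi> z - p z) * f z + of_real (p z) * f z \<partial>circle)"
      by (intro Bochner_Integration.integral_cong refl) (simp add: algebra_simps)
    also have "\<dots> = (\<integral>z. of_real (\<phi> z - p z) * f z \<partial>circle)"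
      by (simp only: Bochner_Integration.integral_add[OF di pi] pz add_0_right)
    finally have eq: "(\<integral>z. of_real (\<phi> z) * f z \<partial>circle) = (\<integral>z. of_real (\<phi> z - p z) * f z \<partial>circle)" .
    have "cmod (\<integral>z. of_real (\<phi> z) * f z \<partial>circle) \<le> (\<integral>z. cmod (of_real (\<phi> z - p z) * f z) \<partial>circle)"
      unfolding eq by (rule integral_norm_bound)
    also have "\<dots> \<le> (\<integral>z. \<epsilon> * cmod (f z) \<partial>circle)"
      using fi by (intro integral_mono_AE integrable_norm di bd integrable_mult_right)
    finally show ?thesis by simp
  qed
  note le = this
  let ?I = "\<integral>z. cmod (f z) \<partial>circle"
  have "0 \<le> ?I" by simp
  then have I1: "0 < ?I + 1" by linarith
  have "cmod (\<integral>z. of_real (\<phi> z) * f z \<partial>circle) \<le> 0"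
  proof (rule field_le_epsilon)
    fix \<delta> :: real assume "\<delta> > 0"
    have "cmod (\<integral>z. of_real (\<phi> z) * f z \<partial>circle) \<le> \<delta> / (?I + 1) * ?I"
      using I1 \<open>\<delta> > 0\<close> by (intro le divide_pos_pos)
    also have "\<dots> = \<delta> * ?I / (?I + 1)" by simp
    also have "\<dots> \<le> \<delta>"
      unfolding pos_divide_le_eq[OF I1] using \<open>\<delta> > 0\<close> by (simp add: algebra_simps)
    finally show "cmod (\<integral>z. of_real (\<phi> z) * f z \<partial>circle) \<le> 0 + \<delta>" by simp
  qed
  then show ?thesis by simp
qed

lemma null_coeffs_closed:
  assumes f: "null_coeffs f" and S: "closed S"
  shows "(\<integral>z. indicator S z *\<^sub>R f z \<partial>circle) = 0"
proof (cases "S = {}")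
  case False
  have fi: "integrable circle f" using f by (simp add: null_coeffs_def)
  have [measurable]: "f \<in> borel_measurable borel"
    using fi borel_measurable_integrable[of circle f] by simp
  have [measurable]: "S \<in> sets borel" using S by simp
  \<comment> \<open>Continuous cutoffs, 1 on \<open>S\<close> and 0 at distance at least 1/n; they
    converge to the indicator because \<open>S\<close> is closed.\<close>
  define \<phi> where "\<phi> n z = max 0 (1 - real n * infdist z S)" for n z
  have c: "continuous_on UNIV (\<phi> n)" for n
    unfolding \<phi>_def by (intro continuous_intros)
  have [measurable]: "\<phi> n \<in> borel_measurable borel" for n using c by (rule borel_measurable_continuous_onI)
  have lim: "(\<lambda>n. \<phi> n z) \<longlonglongrightarrow> indicator S z" for z
  proof (cases "z \<in> S")
    case True then show ?thesis by (simp add: \<phi>_def)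
  next
    case zS: False
    then have "infdist z S \<noteq> 0" using in_closed_iff_infdist_zero[OF S False] by blast
    then have "infdist z S > 0" using infdist_nonneg[of z S] by linarith
    then obtain n0 where n0: "1 < real n0 * infdist z S" using reals_Archimedean3 by blast
    have "\<phi> n z = 0" if "n \<ge> n0" for n
    proof -
      have "real n0 * infdist z S \<le> real n * infdist z S" using that by (intro mult_right_mono) (auto simp: infdist_nonneg)
      then show ?thesis using n0 by (simp add: \<phi>_def)
    qed
    then have "\<phi> n z = indicator S z" if "n \<ge> n0" for n using that zS by simp
    then have "\<forall>\<^sub>F n in sequentially. \<phi> n z = indicator S z" unfolding eventually_sequentially by blast
    then show ?thesis by (rule tendsto_eventually)
  qed
  have "(\<lambda>n. \<integral>z. of_real (\<phi> n z) * f z \<partial>circle) \<longlonglongrightarrow> (\<integral>z. indicator S z *\<^sub>R f z \<partial>circle)"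
  proof (rule integral_dominated_convergence[where w="\<lambda>z. cmod (f z)"])
    show "AE z in circle. (\<lambda>n. of_real (\<phi> n z) * f z) \<longlonglongrightarrow> indicator S z *\<^sub>R f z"
      unfolding scaleR_conv_of_real by (intro AE_I2 tendsto_mult tendsto_of_real tendsto_const lim)
    show "AE z in circle. norm (of_real (\<phi> n z) * f z) \<le> cmod (f z)" for n
    proof (rule AE_I2)
      fix z
      have "\<bar>\<phi> n z\<bar> \<le> 1" by (auto simp: \<phi>_def infdist_nonneg)
      then show "norm (of_real (\<phi> n z) * f z) \<le> cmod (f z)"
        unfolding norm_mult norm_of_real by (intro mult_left_le_one_le) auto
    qed
  qed (use fi in auto)
  then show ?thesis using null_coeffs_continuous[OF f c] by (simp add: LIMSEQ_const_iff)
qed simp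

text \<open>The integral of \<open>f\<close> vanishes over closed sets, which generate the Borel
  sets and are stable under intersection, hence over all Borel sets. Completeness of the
  trigonometric system in L2 is drawn from this.\<close>

lemma fourier_uniqueness:
  assumes f: "integrable circle f" "\<And>k. fourier f k = 0"
  shows "AE z in circle. f z = 0"
proof (rule circle.density_zero[OF f(1)])
  have n: "null_coeffs f" using f by (simp add: null_coeffs_def)
  have [measurable]: "f \<in> borel_measurable borel"
    using f borel_measurable_integrable[of circle f] by simp
  have ii: "integrable circle (\<lambda>z. indicator A z *\<^sub>R f z)" if "A \<in> sets borel" for A
    using integrable_mult_indicator[of A circle f] that f(1) by simp
  have f0: "(\<integral>z. f z \<partial>circle) = 0" using f(2)[of 0] by (simp add: fourier_def cinner_def)
  have bc: "sets (borel :: complex measure) = sigma_sets UNIV (Collect closed)"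
    by (subst borel_eq_closed) (rule sets_measure_of, simp)
  fix A assume "A \<in> sets circle"
  then have A: "A \<in> sigma_sets UNIV (Collect closed)" by (simp only: sets_circle bc)
  have "Int_stable (Collect closed :: complex set set)" by (auto simp: Int_stable_def)
  moreover have "Collect closed \<subseteq> Pow (UNIV :: complex set)" by simp
  moreover note A
  ultimately have "(\<integral>z. indicator A z *\<^sub>R f z \<partial>circle) = 0"
  proof (induct rule: sigma_sets_induct_disjoint)
    case (basic A)
    then have "closed A" by simp
    then show ?case by (rule null_coeffs_closed[OF n])
  next
    case empty
    show ?case by simp
  next
    case (compl A)
    have A': "A \<in> sets borel" unfolding bc by (rule compl(1))
    have "(\<integral>z. indicator (UNIV - A) z *\<^sub>R f z \<partial>circle) = (\<integral>z. f z - indicator A z *\<^sub>R f z \<partial>circle)"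
    proof (intro Bochner_Integration.integral_cong refl)
      fix z show "indicator (UNIV - A) z *\<^sub>R f z = f z - indicator A z *\<^sub>R f z"
        by (cases "z \<in> A") simp_all
    qed
    also have "\<dots> = (\<integral>z. f z \<partial>circle) - (\<integral>z. indicator A z *\<^sub>R f z \<partial>circle)"
      by (rule Bochner_Integration.integral_diff[OF f(1) ii[OF A']])
    also have "\<dots> = 0" using f0 by (simp only: compl(2) diff_self)
    finally show ?case .
  next
    case (union A)
    have Ai: "A i \<in> sets borel" for i
    proof -
      have "A i \<in> sigma_sets UNIV (Collect closed)" using union(2) by (rule subsetD) (rule rangeI)
      then show ?thesis unfolding bc .
    qed
    then have "range A \<subseteq> sets borel" by (rule image_subsetI)
    then have U: "(\<Union>i. A i) \<in> sets borel" by (rule sets.countable_UN)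
    have c1: "\<And>i. A i \<in> sets circle" unfolding sets_circle by (rule Ai)
    have c2: "\<And>i j. i \<noteq> j \<Longrightarrow> A i \<inter> A j = {}"
      by (rule disjoint_family_onD[OF union(1) UNIV_I UNIV_I])
    have c3: "set_integrable circle (\<Union>i. A i) f" unfolding set_integrable_def by (rule ii[OF U])
    note c = lebesgue_integral_countable_add[OF c1 c2 c3]
    have "set_lebesgue_integral circle (\<Union>i. A i) f = (\<Sum>i. set_lebesgue_integral circle (A i) f)"
      by (rule c)
    also have "\<dots> = 0" unfolding set_lebesgue_integral_def union(3) by (rule suminf_zero)
    finally show ?case by (simp only: set_lebesgue_integral_def)
  qed
  then show "set_lebesgue_integral circle A f = 0" by (simp add: set_lebesgue_integral_def)
qed

text \<open>Passes bounds on second, fourth and sixth moments from partial sums to their almost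
  everywhere limit.\<close>

lemma fatou_circle:
  fixes f :: "nat \<Rightarrow> complex \<Rightarrow> real"
  assumes f: "\<And>j. integrable circle (f j)" "\<And>j z. 0 \<le> f j z" and lim: "AE z in circle. (\<lambda>j. f j z) \<longlonglongrightarrow> F z"
    and F: "F \<in> borel_measurable borel" and C: "0 \<le> C" "\<forall>\<^sub>F j in sequentially. (\<integral>z. f j z \<partial>circle) \<le> C"
  shows "integrable circle F" "(\<integral>z. F z \<partial>circle) \<le> C"
proof -
  have Fpos: "AE z in circle. 0 \<le> F z"
    using lim
  proof eventually_elim
    case (elim z)
    show ?case by (rule LIMSEQ_le_const[OF elim]) (simp add: f(2))
  qed
  have "(\<integral>\<^sup>+z. ennreal (F z) \<partial>circle) = (\<integral>\<^sup>+z. liminf (\<lambda>j. ennreal (f j z)) \<partial>circle)"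
  proof (rule nn_integral_cong_AE)
    show "AE z in circle. ennreal (F z) = liminf (\<lambda>j. ennreal (f j z))"
      using lim
    proof eventually_elim
      case (elim z)
      show ?case by (rule lim_imp_Liminf[OF sequentially_bot tendsto_ennrealI[OF elim], symmetric])
    qed
  qed
  also have "\<dots> \<le> liminf (\<lambda>j. \<integral>\<^sup>+z. ennreal (f j z) \<partial>circle)"
  proof (rule nn_integral_liminf)
    fix j
    have "f j \<in> borel_measurable circle" by (rule borel_measurable_integrable[OF f(1)])
    then show "(\<lambda>z. ennreal (f j z)) \<in> borel_measurable circle" by simp
  qed
  also have "(\<lambda>j. \<integral>\<^sup>+z. ennreal (f j z) \<partial>circle) = (\<lambda>j. ennreal (\<integral>z. f j z \<partial>circle))"
    by (intro ext nn_integral_eq_integral f AE_I2)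
  also have "liminf (\<lambda>j. ennreal (\<integral>z. f j z \<partial>circle)) \<le> liminf (\<lambda>j. ennreal C)"
    by (intro Liminf_mono eventually_mono[OF C(2)] ennreal_leI)
  also have "\<dots> = ennreal C" by (simp add: Liminf_const)
  finally have le: "(\<integral>\<^sup>+z. ennreal (F z) \<partial>circle) \<le> ennreal C" .
  show i: "integrable circle F"
  proof (rule integrableI_nonneg)
    show "(\<integral>\<^sup>+z. ennreal (F z) \<partial>circle) < \<infinity>" using le by (rule le_less_trans) simp
  qed (use F Fpos in auto)
  have "ennreal (\<integral>z. F z \<partial>circle) = (\<integral>\<^sup>+z. ennreal (F z) \<partial>circle)"
    by (rule nn_integral_eq_integral[OF i Fpos, symmetric])
  then have "ennreal (\<integral>z. F z \<partial>circle) \<le> ennreal C" using le by (simp only:)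
  then show "(\<integral>z. F z \<partial>circle) \<le> C" by (simp only: ennreal_le_iff[OF C(1)])
qed

section \<open>Series with square summable coefficients\<close>

definition psum :: "(nat \<Rightarrow> complex) \<Rightarrow> nat \<Rightarrow> complex \<Rightarrow> complex" where
  "psum a n z = (\<Sum>k<n. a k * z ^ k)"

lemma L2_power: "(\<lambda>z. z ^ k) \<in> L2"
  using L2_powi[of "int k"] by simp

lemma L2_trig: "(\<lambda>z. \<Sum>k\<in>F. a k * z ^ k) \<in> L2"
  by (intro L2_sum L2_scale L2_power)

lemma L2_psum: "psum a n \<in> L2"
  unfolding psum_def[abs_def] by (rule L2_trig)

lemma cinner_trig: "f \<in> L2 \<Longrightarrow> cinner (\<lambda>z. \<Sum>k\<in>F. a k * z ^ k) f = (\<Sum>k\<in>F. a k * cnj (fourier f (int k)))"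
proof -
  assume f: "f \<in> L2"
  have "cinner (\<lambda>z. \<Sum>k\<in>F. a k * z ^ k) f = (\<Sum>k\<in>F. cinner (\<lambda>z. a k * z ^ k) f)"
    by (intro cinner_sum_left L2_scale L2_power f)
  also have "\<dots> = (\<Sum>k\<in>F. a k * cnj (fourier f (int k)))"
    by (intro sum.cong refl) (simp add: cinner_scale_left fourier_def cinner_cnj)
  finally show ?thesis .
qed

lemma fourier_trig:
  assumes "finite F" shows "fourier (\<lambda>z. \<Sum>k\<in>F. a k * z ^ k) j = (if 0 \<le> j \<and> nat j \<in> F then a (nat j) else 0)"
proof -
  have "fourier (\<lambda>z. \<Sum>k\<in>F. a k * z ^ k) j = (\<Sum>k\<in>F. a k * cinner (\<lambda>z. z powi int k) (\<lambda>z. z powi j))"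
    unfolding fourier_def
    by (subst cinner_sum_left) (auto intro!: L2_scale L2_power L2_powi simp: cinner_scale_left)
  also have "\<dots> = (\<Sum>k\<in>F. if k = nat j \<and> 0 \<le> j then a k else 0)"
    by (intro sum.cong refl) (auto simp: cinner_powi simp del: power_int_of_nat)
  also have "\<dots> = (if 0 \<le> j \<and> nat j \<in> F then a (nat j) else 0)"
    using assms by (cases "0 \<le> j") auto
  finally show ?thesis .
qed

lemma trig_norm:
  assumes "finite F" shows "(\<integral>z. (cmod (\<Sum>k\<in>F. a k * z ^ k))\<^sup>2 \<partial>circle) = (\<Sum>k\<in>F. (cmod (a k))\<^sup>2)"
proof -
  let ?s = "\<lambda>z. \<Sum>k\<in>F. a k * z ^ k"
  have "cinner ?s ?s = (\<Sum>k\<in>F. a k * cnj (fourier ?s (int k)))"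
    by (rule cinner_trig[OF L2_trig])
  also have "\<dots> = (\<Sum>k\<in>F. of_real ((cmod (a k))\<^sup>2))"
    unfolding fourier_trig[OF assms] by (intro sum.cong) (simp_all only: complex_norm_square if_True lessThan_iff of_nat_0_le_iff nat_int simp_thms)
  finally have "complex_of_real (\<integral>z. (cmod (?s z))\<^sup>2 \<partial>circle) = of_real (\<Sum>k\<in>F. (cmod (a k))\<^sup>2)"
    unfolding cinner_self by simp
  then show ?thesis by (simp only: of_real_eq_iff)
qed

lemma psum_diff: "n \<le> m \<Longrightarrow> psum a m z - psum a n z = (\<Sum>k\<in>{n..<m}. a k * z ^ k)"
  unfolding psum_def lessThan_atLeast0 using sum_diff_nat_ivl[of 0 n m "\<lambda>k. a k * z ^ k"] by simp

lemma psum_diff_norm: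
  assumes s: "summable (\<lambda>k. (cmod (a k))\<^sup>2)" and "n \<le> m"
  shows "(\<integral>z. (cmod (psum a m z - psum a n z))\<^sup>2 \<partial>circle) \<le> (\<Sum>k. (cmod (a (k + n)))\<^sup>2)"
proof -
  have "(\<integral>z. (cmod (psum a m z - psum a n z))\<^sup>2 \<partial>circle) = (\<Sum>k\<in>{n..<m}. (cmod (a k))\<^sup>2)"
    unfolding psum_diff[OF assms(2)] by (rule trig_norm) simp
  also have "\<dots> = (\<Sum>k<m - n. (cmod (a (k + n)))\<^sup>2)"
    using sum.shift_bounds_nat_ivl[of "\<lambda>k. (cmod (a k))\<^sup>2" 0 n "m - n"] assms(2)
    by (simp add: lessThan_atLeast0)
  also have "\<dots> \<le> (\<Sum>k. (cmod (a (k + n)))\<^sup>2)"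
    by (rule sum_le_suminf[OF summable_ignore_initial_segment[OF s]]) auto
  finally show ?thesis .
qed

lemma tail_tendsto_0:
  fixes f :: "nat \<Rightarrow> real"
  assumes "summable f" shows "(\<lambda>n. \<Sum>k. f (k + n)) \<longlonglongrightarrow> 0"
proof -
  have "(\<lambda>n. suminf f - sum f {..<n}) \<longlonglongrightarrow> suminf f - suminf f"
    by (intro tendsto_intros summable_LIMSEQ assms)
  then show ?thesis by (simp add: suminf_minus_initial_segment[OF assms])
qed

text \<open>A subsequence whose tails are at most 4^(-j) has increments of L1 norm at most 2^(-j),
  so it converges absolutely almost everywhere. The pointwise convergence is recorded because
  Fatou's lemma will be applied along it again.\<close>

lemma riesz_fischer:
  assumes s: "summable (\<lambda>k. (cmod (a k))\<^sup>2)"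
  obtains g r where "g \<in> L2" "strict_mono (r :: nat \<Rightarrow> nat)" "AE z in circle. (\<lambda>j. psum a (r j) z) \<longlonglongrightarrow> g z"
    "\<And>n. (\<integral>z. (cmod (g z - psum a n z))\<^sup>2 \<partial>circle) \<le> (\<Sum>k. (cmod (a (k + n)))\<^sup>2)"
proof -
  define \<tau> where "\<tau> n = (\<Sum>k. (cmod (a (k + n)))\<^sup>2)" for n
  have \<tau>0: "\<tau> \<longlonglongrightarrow> 0" unfolding \<tau>_def using tail_tendsto_0[OF s] by simp
  have \<tau>pos: "0 \<le> \<tau> n" for n
    unfolding \<tau>_def by (rule suminf_nonneg[OF summable_ignore_initial_segment[OF s]]) simp
  have "\<exists>N. \<forall>n\<ge>N. \<tau> n \<le> (1 / 4) ^ j" for j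
  proof -
    have "\<forall>\<^sub>F n in sequentially. \<tau> n < (1 / 4) ^ j" using \<tau>0 by (rule order_tendstoD) simp
    then show ?thesis unfolding eventually_sequentially by (meson less_imp_le)
  qed
  then obtain M where M: "\<And>j n. n \<ge> M j \<Longrightarrow> \<tau> n \<le> (1 / 4) ^ j" by metis
  \<comment> \<open>Strictly increasing and at least \<open>M j\<close>.\<close>
  define r where "r j = j + (\<Sum>i\<le>j. M i)" for j
  have r: "strict_mono r" by (auto simp: strict_mono_Suc_iff r_def)
  have "M j \<le> r j" for j
    using member_le_sum[of j "{..j}" M] by (simp add: r_def)
  then have \<tau>r: "\<tau> (r j) \<le> (1 / 4) ^ j" for j by (rule M)
  have [measurable]: "psum a n \<in> borel_measurable borel" for n using L2_psum by (rule L2_D)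
  define d where "d j z = psum a (r (Suc j)) z - psum a (r j) z" for j z
  have dL2: "d j \<in> L2" for j unfolding d_def[abs_def] by (intro L2_diff L2_psum)
  have [measurable]: "d j \<in> borel_measurable borel" for j using dL2 by (rule L2_D)
  have d2: "(\<integral>z. (cmod (d j z))\<^sup>2 \<partial>circle) \<le> (1 / 4) ^ j" for j
    using psum_diff_norm[OF s, of "r j" "r (Suc j)"] strict_mono_leD[OF r, of j "Suc j"] \<tau>r[of j]
    by (simp add: \<tau>_def d_def)
  have d1: "(\<integral>z. cmod (d j z) \<partial>circle) \<le> (1 / 2) ^ j" for j
  proof -
    \<comment> \<open>The inequality x <= c/2 + x^2 / (2 c) with c = 2^(-j) turns the L2 bound on
      the increments into an L1 bound.\<close>
    have "(\<integral>z. cmod (d j z) \<partial>circle) \<le> (\<integral>z. (1 / 2) ^ j / 2 + 2 ^ j / 2 * (cmod (d j z))\<^sup>2 \<partial>circle)"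
    proof (rule integral_mono)
      show "integrable circle (\<lambda>z. cmod (d j z))" using L2_integrable[OF dL2] by simp
      show "integrable circle (\<lambda>z. (1 / 2) ^ j / 2 + 2 ^ j / 2 * (cmod (d j z))\<^sup>2)"
        using L2_D(2)[OF dL2] by simp
      fix z
      have "0 \<le> 2 ^ j * (cmod (d j z) - (1 / 2) ^ j)\<^sup>2" by simp
      then show "cmod (d j z) \<le> (1 / 2) ^ j / 2 + 2 ^ j / 2 * (cmod (d j z))\<^sup>2"
        by (simp add: power2_eq_square algebra_simps power_one_over)
    qed
    also have "\<dots> = (1 / 2) ^ j / 2 + 2 ^ j / 2 * (\<integral>z. (cmod (d j z))\<^sup>2 \<partial>circle)"
      using L2_D(2)[OF dL2] by (subst Bochner_Integration.integral_add) auto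
    also have "\<dots> \<le> (1 / 2) ^ j / 2 + 2 ^ j / 2 * (1 / 4) ^ j"
      using d2[of j] by (intro add_left_mono mult_left_mono) auto
    also have "(2::real) ^ j / 2 * (1 / 4) ^ j = (2 * (1 / 4)) ^ j / 2"
      unfolding power_mult_distrib by simp
    finally show ?thesis by simp
  qed
  have "(\<integral>\<^sup>+z. (\<Sum>j. ennreal (cmod (d j z))) \<partial>circle) = (\<Sum>j. \<integral>\<^sup>+z. ennreal (cmod (d j z)) \<partial>circle)"
    by (rule nn_integral_suminf) simp
  also have "\<dots> \<le> (\<Sum>j. ennreal ((1 / 2) ^ j))"
  proof (intro suminf_le summableI)
    fix j
    have "(\<integral>\<^sup>+z. ennreal (cmod (d j z)) \<partial>circle) = ennreal (\<integral>z. cmod (d j z) \<partial>circle)"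
      using L2_integrable[OF dL2] by (intro nn_integral_eq_integral) auto
    also have "\<dots> \<le> ennreal ((1 / 2) ^ j)" by (intro ennreal_leI d1)
    finally show "(\<integral>\<^sup>+z. ennreal (cmod (d j z)) \<partial>circle) \<le> ennreal ((1 / 2) ^ j)" .
  qed
  also have "\<dots> < \<infinity>"
    by (subst suminf_ennreal2) (auto intro: summable_geometric)
  finally have fin: "(\<integral>\<^sup>+z. (\<Sum>j. ennreal (cmod (d j z))) \<partial>circle) \<noteq> \<infinity>" by simp
  have "AE z in circle. (\<Sum>j. ennreal (cmod (d j z))) \<noteq> \<infinity>"
    by (rule nn_integral_PInf_AE[OF _ fin]) simp
  then have conv: "AE z in circle. convergent (\<lambda>j. psum a (r j) z)"
  proof eventually_elim
    case (elim z)
    then have "summable (\<lambda>j. cmod (d j z))" by (intro summable_suminf_not_top) auto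
    then have "summable (\<lambda>j. d j z)" by (rule summable_norm_cancel)
    then have "convergent (\<lambda>n. (\<Sum>j<n. d j z) + psum a (r 0) z)"
      by (simp add: summable_iff_convergent convergent_add convergent_const)
    moreover have "(\<Sum>j<n. d j z) + psum a (r 0) z = psum a (r n) z" for n
      unfolding d_def sum_lessThan_telescope[of "\<lambda>j. psum a (r j) z"] by simp
    ultimately show ?case by simp
  qed
  define g where "g z = lim (\<lambda>j. psum a (r j) z)" for z
  have lim: "AE z in circle. (\<lambda>j. psum a (r j) z) \<longlonglongrightarrow> g z"
    using conv by eventually_elim (simp add: g_def convergent_LIMSEQ_iff)
  have [measurable]: "g \<in> borel_measurable borel" unfolding g_def[abs_def] by measurable
  have int: "integrable circle (\<lambda>z. (cmod (g z - psum a n z))\<^sup>2)"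
    and le: "(\<integral>z. (cmod (g z - psum a n z))\<^sup>2 \<partial>circle) \<le> \<tau> n" for n
  proof -
    have a: "integrable circle (\<lambda>z. (cmod (psum a (r j) z - psum a n z))\<^sup>2)" for j
      using L2_D(2)[OF L2_diff[OF L2_psum L2_psum]] .
    have b: "AE z in circle. (\<lambda>j. (cmod (psum a (r j) z - psum a n z))\<^sup>2) \<longlonglongrightarrow> (cmod (g z - psum a n z))\<^sup>2"
      using lim by eventually_elim (intro tendsto_intros)
    have c: "\<forall>\<^sub>F j in sequentially. (\<integral>z. (cmod (psum a (r j) z - psum a n z))\<^sup>2 \<partial>circle) \<le> \<tau> n"
      unfolding eventually_sequentially
    proof (intro exI allI impI)
      fix j assume "n \<le> j"
      then have "n \<le> r j" using seq_suble[OF r, of j] by linarith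
      then show "(\<integral>z. (cmod (psum a (r j) z - psum a n z))\<^sup>2 \<partial>circle) \<le> \<tau> n"
        unfolding \<tau>_def by (rule psum_diff_norm[OF s])
    qed
    show "integrable circle (\<lambda>z. (cmod (g z - psum a n z))\<^sup>2)"
      by (rule fatou_circle(1)[OF a _ b _ \<tau>pos c]) auto
    show "(\<integral>z. (cmod (g z - psum a n z))\<^sup>2 \<partial>circle) \<le> \<tau> n"
      by (rule fatou_circle(2)[OF a _ b _ \<tau>pos c]) auto
  qed
  have "psum a 0 = (\<lambda>_. 0)" by (auto simp: psum_def)
  with int[of 0] have "g \<in> L2" by (simp add: L2_def)
  then show ?thesis using le by (intro that[OF _ r lim]) (auto simp: \<tau>_def)
qed

lemma bessel_sum_le:
  assumes u: "u \<in> L2"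
  shows "(\<Sum>k<n. (cmod (fourier u (int k)))\<^sup>2) \<le> (\<integral>z. (cmod (u z))\<^sup>2 \<partial>circle)"
proof -
  let ?S = "\<Sum>k<n. (cmod (fourier u (int k)))\<^sup>2" and ?s = "psum (\<lambda>k. fourier u (int k)) n"
  have "cinner ?s u = (\<Sum>k<n. of_real ((cmod (fourier u (int k)))\<^sup>2))"
    unfolding psum_def[abs_def] cinner_trig[OF u] by (simp only: complex_norm_square)
  then have eq: "cinner ?s u = of_real ?S" by simp
  have "(cmod (of_real ?S))\<^sup>2 \<le> (\<integral>z. (cmod (?s z))\<^sup>2 \<partial>circle) * (\<integral>z. (cmod (u z))\<^sup>2 \<partial>circle)"
    unfolding eq[symmetric] by (rule cauchy_cinner[OF L2_psum u])
  also have "(\<integral>z. (cmod (?s z))\<^sup>2 \<partial>circle) = ?S" unfolding psum_def by (rule trig_norm) simp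
  finally have *: "?S * ?S \<le> ?S * (\<integral>z. (cmod (u z))\<^sup>2 \<partial>circle)" unfolding norm_of_real power2_abs power2_eq_square[of ?S] .
  have "0 \<le> ?S" by (simp add: sum_nonneg)
  then show ?thesis
  proof (cases "?S = 0")
    case False
    with \<open>0 \<le> ?S\<close> have "0 < ?S" by linarith
    with * show ?thesis by (simp only: mult_le_cancel_left_pos)
  qed simp
qed

lemma bessel: "u \<in> L2 \<Longrightarrow> summable (\<lambda>k. (cmod (fourier u (int k)))\<^sup>2)"
  by (rule summableI_nonneg_bounded[OF _ bessel_sum_le]) simp_all

lemma tendsto_diff_cancel:
  fixes l :: complex
  assumes "(\<lambda>n. l - f n) \<longlonglongrightarrow> 0" shows "f \<longlonglongrightarrow> l"
  using tendsto_diff[OF tendsto_const assms, of l] by simp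

lemma L2_limit_cinner:
  assumes g: "g \<in> L2" and f: "f \<in> L2" and s: "summable (\<lambda>k. (cmod (a k))\<^sup>2)"
    and le: "\<And>n. (\<integral>z. (cmod (g z - psum a n z))\<^sup>2 \<partial>circle) \<le> (\<Sum>k. (cmod (a (k + n)))\<^sup>2)"
  shows "(\<lambda>k. a k * cnj (fourier f (int k))) sums cinner g f"
proof -
  let ?F = "\<integral>z. (cmod (f z))\<^sup>2 \<partial>circle"
  have "norm (cinner g f - (\<Sum>k<n. a k * cnj (fourier f (int k)))) \<le> sqrt ((\<Sum>k. (cmod (a (k + n)))\<^sup>2) * ?F)" for n
  proof -
    have "cinner g f - (\<Sum>k<n. a k * cnj (fourier f (int k))) = cinner (\<lambda>z. g z - psum a n z) f"
      unfolding cinner_diff_left[OF g L2_psum f] unfolding psum_def[abs_def] cinner_trig[OF f] ..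
    moreover have "(cmod (cinner (\<lambda>z. g z - psum a n z) f))\<^sup>2 \<le> (\<integral>z. (cmod (g z - psum a n z))\<^sup>2 \<partial>circle) * ?F"
      by (intro cauchy_cinner L2_diff g f L2_psum)
    moreover have "\<dots> \<le> (\<Sum>k. (cmod (a (k + n)))\<^sup>2) * ?F" by (intro mult_right_mono le) simp
    ultimately have "(cmod (cinner g f - (\<Sum>k<n. a k * cnj (fourier f (int k)))))\<^sup>2 \<le> (\<Sum>k. (cmod (a (k + n)))\<^sup>2) * ?F"
      by (simp only:)
    then show ?thesis by (rule real_le_rsqrt)
  qed
  note b = this
  have t: "(\<lambda>n. \<Sum>k. (cmod (a (k + n)))\<^sup>2) \<longlonglongrightarrow> 0"
    by (rule tail_tendsto_0[of "\<lambda>k. (cmod (a k))\<^sup>2", OF s])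
  have "(\<lambda>n. sqrt ((\<Sum>k. (cmod (a (k + n)))\<^sup>2) * ?F)) \<longlonglongrightarrow> sqrt (0 * ?F)"
    by (rule tendsto_real_sqrt[OF tendsto_mult[OF t tendsto_const]])
  then have z: "(\<lambda>n. sqrt ((\<Sum>k. (cmod (a (k + n)))\<^sup>2) * ?F)) \<longlonglongrightarrow> 0" by simp
  have "(\<lambda>n. cinner g f - (\<Sum>k<n. a k * cnj (fourier f (int k)))) \<longlonglongrightarrow> 0"
    by (rule Lim_null_comparison[OF _ z]) (rule always_eventually, rule allI, rule b)
  then have "(\<lambda>n. \<Sum>k<n. a k * cnj (fourier f (int k))) \<longlonglongrightarrow> cinner g f"
    by (rule tendsto_diff_cancel)
  then show ?thesis by (simp only: sums_def)
qed

lemma L2_limit_fourier: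
  assumes g: "g \<in> L2" and s: "summable (\<lambda>k. (cmod (a k))\<^sup>2)"
    and le: "\<And>n. (\<integral>z. (cmod (g z - psum a n z))\<^sup>2 \<partial>circle) \<le> (\<Sum>k. (cmod (a (k + n)))\<^sup>2)"
  shows "fourier g j = (if 0 \<le> j then a (nat j) else 0)"
proof -
  have "(\<lambda>k. a k * cnj (fourier (\<lambda>z. z powi j) (int k))) sums fourier g j"
    unfolding fourier_def[of g] by (rule L2_limit_cinner[OF g L2_powi s le])
  moreover have "(\<lambda>k. a k * cnj (fourier (\<lambda>z. z powi j) (int k))) = (\<lambda>k. if k = nat j then (if 0 \<le> j then a k else 0) else 0)"
    unfolding fourier_def cinner_powi by (rule ext) auto
  ultimately have "(\<lambda>k. if k = nat j then (if 0 \<le> j then a k else 0) else 0) sums fourier g j" by simp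
  moreover have "(\<lambda>k. if k = nat j then (if 0 \<le> j then a k else 0) else 0) sums (if 0 \<le> j then a (nat j) else 0)"
    by (rule sums_single)
  ultimately show ?thesis by (rule sums_unique2)
qed

text \<open>The limit that \<open>riesz_fischer\<close> builds from the coefficients of
  \<open>u\<close> has the same coefficients as \<open>u\<close>, so by
  \<open>fourier_uniqueness\<close> it is \<open>u\<close> almost everywhere.\<close>

lemma plus_expansion:
  assumes u: "u \<in> plus_part L2"
  defines "a \<equiv> \<lambda>k. fourier u (int k)"
  shows "\<And>n. (\<integral>z. (cmod (u z - psum a n z))\<^sup>2 \<partial>circle) \<le> (\<Sum>k. (cmod (a (k + n)))\<^sup>2)"
    and "\<exists>r. strict_mono (r :: nat \<Rightarrow> nat) \<and> (AE z in circle. (\<lambda>j. psum a (r j) z) \<longlonglongrightarrow> u z)"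
proof -
  have uL: "u \<in> L2" using u by (simp add: plus_part_def)
  have s: "summable (\<lambda>k. (cmod (a k))\<^sup>2)" unfolding a_def by (rule bessel[OF uL])
  obtain g r where g: "g \<in> L2" and r: "strict_mono (r :: nat \<Rightarrow> nat)" "AE z in circle. (\<lambda>j. psum a (r j) z) \<longlonglongrightarrow> g z"
    and le: "\<And>n. (\<integral>z. (cmod (g z - psum a n z))\<^sup>2 \<partial>circle) \<le> (\<Sum>k. (cmod (a (k + n)))\<^sup>2)"
    using riesz_fischer[OF s] by blast
  note [measurable] = L2_D(1)[OF uL] L2_D(1)[OF g] L2_D(1)[OF L2_psum]
  have "fourier (\<lambda>z. u z - g z) j = 0" for j
    unfolding fourier_diff[OF uL g] L2_limit_fourier[OF g s le] using u by (auto simp: a_def plus_part_def)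
  then have "AE z in circle. u z - g z = 0"
    by (intro fourier_uniqueness L2_integrable L2_diff uL g)
  then have AE: "AE z in circle. u z = g z" by eventually_elim simp
  show "\<exists>r. strict_mono (r :: nat \<Rightarrow> nat) \<and> (AE z in circle. (\<lambda>j. psum a (r j) z) \<longlonglongrightarrow> u z)"
    by (intro exI[of _ r] conjI r) (use AE r(2) in eventually_elim, simp)
  fix n
  have "(\<integral>z. (cmod (u z - psum a n z))\<^sup>2 \<partial>circle) = (\<integral>z. (cmod (g z - psum a n z))\<^sup>2 \<partial>circle)"
    by (rule integral_cong_AE) (simp, simp, use AE in eventually_elim, simp)
  then show "(\<integral>z. (cmod (u z - psum a n z))\<^sup>2 \<partial>circle) \<le> (\<Sum>k. (cmod (a (k + n)))\<^sup>2)" using le[of n] by simp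
qed

lemma parseval:
  assumes u: "u \<in> plus_part L2" and f: "f \<in> L2"
  shows "(\<lambda>k. fourier u (int k) * cnj (fourier f (int k))) sums cinner u f"
proof -
  have uL: "u \<in> L2" using u by (simp add: plus_part_def)
  show ?thesis by (rule L2_limit_cinner[OF uL f bessel[OF uL] plus_expansion(1)[OF u]])
qed

lemma parseval_norm:
  assumes u: "u \<in> plus_part L2"
  shows "(\<lambda>k. (cmod (fourier u (int k)))\<^sup>2) sums (\<integral>z. (cmod (u z))\<^sup>2 \<partial>circle)"
proof -
  have uL: "u \<in> L2" using u by (simp add: plus_part_def)
  from parseval[OF u uL]
  have "(\<lambda>k. of_real ((cmod (fourier u (int k)))\<^sup>2)) sums complex_of_real (\<integral>z. (cmod (u z))\<^sup>2 \<partial>circle)"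
    by (simp only: cinner_self complex_norm_square)
  then show ?thesis by (simp only: sums_of_real_iff)
qed

text \<open>The series of the coefficients of nonnegative index shows that the choice in
  \<open>szego_proj\<close> is not empty. Testing the chosen function against z^k then fixes its
  coefficients, whichever representative was picked.\<close>

lemma szego_proj_L2:
  assumes f: "f \<in> L2"
  shows "szego_proj f \<in> plus_part L2" "\<And>k. 0 \<le> k \<Longrightarrow> fourier (szego_proj f) k = fourier f k"
proof -
  let ?P = "\<lambda>g. g \<in> plus_part L2 \<and> (\<forall>h\<in>plus_part L2. cinner (\<lambda>z. f z - g z) h = 0)"
  define a where "a k = fourier f (int k)" for k
  have s: "summable (\<lambda>k. (cmod (a k))\<^sup>2)" unfolding a_def by (rule bessel[OF f])
  obtain g where g: "g \<in> L2"
    and le: "\<And>n. (\<integral>z. (cmod (g z - psum a n z))\<^sup>2 \<partial>circle) \<le> (\<Sum>k. (cmod (a (k + n)))\<^sup>2)"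
    using riesz_fischer[OF s] by blast
  have fg: "fourier g j = (if 0 \<le> j then a (nat j) else 0)" for j by (rule L2_limit_fourier[OF g s le])
  have "?P g"
  proof (intro conjI ballI)
    show "g \<in> plus_part L2" using g fg by (auto simp: plus_part_def)
    fix h assume h: "h \<in> plus_part L2"
    then have hL: "h \<in> L2" by (simp add: plus_part_def)
    have "(\<lambda>k. fourier h (int k) * cnj (fourier (\<lambda>z. f z - g z) (int k))) sums cinner h (\<lambda>z. f z - g z)"
      by (intro parseval h L2_diff f g)
    then have "(\<lambda>k. 0) sums cinner h (\<lambda>z. f z - g z)" by (simp add: fourier_diff f g fg a_def)
    then have "cinner h (\<lambda>z. f z - g z) = 0" by (simp add: sums_iff)
    then show "cinner (\<lambda>z. f z - g z) h = 0" by (metis cinner_cnj complex_cnj_zero)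
  qed
  then have P: "?P (szego_proj f)" unfolding szego_proj_def by (rule someI[of ?P])
  then show "szego_proj f \<in> plus_part L2" by blast
  then have pL: "szego_proj f \<in> L2" by (simp add: plus_part_def)
  fix k :: int assume k: "0 \<le> k"
  have "(\<lambda>z. z powi k) \<in> plus_part L2" using k by (auto simp: plus_part_def L2_powi fourier_def cinner_powi)
  then have "fourier (\<lambda>z. f z - szego_proj f z) k = 0" unfolding fourier_def by (rule bspec[OF conjunct2[OF P]])
  then show "fourier (szego_proj f) k = fourier f k" by (simp add: fourier_diff f pL)
qed

section \<open>Weak-strong uniqueness in the energy space\<close>

lemma conv_sum_le:
  fixes x y :: "nat \<Rightarrow> real"
  assumes "\<And>i. 0 \<le> x i" "\<And>i. 0 \<le> y i"
  shows "(\<Sum>n<M. \<Sum>i\<le>n. x i * y (n - i)) \<le> (\<Sum>i<M. x i) * (\<Sum>i<M. y i)"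
proof -
  have "(\<Sum>n<M. \<Sum>i\<le>n. x i * y (n - i)) = (\<Sum>(i, j)\<in>{(i, j). i + j < M}. x i * y j)"
    by (rule sum.triangle_reindex[symmetric])
  also have "\<dots> \<le> (\<Sum>(i, j)\<in>{..<M} \<times> {..<M}. x i * y j)"
    by (rule sum_mono2) (auto simp: assms)
  also have "\<dots> = (\<Sum>i<M. x i) * (\<Sum>i<M. y i)"
    by (simp add: sum_product sum.cartesian_product)
  finally show ?thesis .
qed

lemma poly_eq_trig:
  fixes p :: "complex poly"
  assumes "degree p < N" shows "poly p z = (\<Sum>k<N. coeff p k * z ^ k)"
proof -
  have "(\<Sum>k\<le>degree p. coeff p k * z ^ k) = (\<Sum>k<N. coeff p k * z ^ k)"
    by (rule sum.mono_neutral_left) (use assms in \<open>auto simp: coeff_eq_0\<close>)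
  then show ?thesis unfolding poly_altdef .
qed

lemma poly_norm_circle:
  fixes p :: "complex poly"
  assumes "degree p < N" shows "(\<integral>z. (cmod (poly p z))\<^sup>2 \<partial>circle) = (\<Sum>k<N. (cmod (coeff p k))\<^sup>2)"
  unfolding poly_eq_trig[OF assms] by (rule trig_norm) simp

text \<open>Cauchy-Schwarz for the \<open>n + 1\<close> terms of a coefficient of
  \<open>p * p\<close>, then 1 + n <= (1 + i) + (1 + (n - i)), so that only one of the two factors
  carries a weight. The other remains a squared L2 norm, which makes the final Gronwall estimate
  linear.\<close>

lemma L4_poly:
  fixes p :: "complex poly"
  assumes "degree (p * p) < N"
  shows "(\<integral>z. (cmod (poly p z)) ^ 4 \<partial>circle) \<le>
    2 * (\<Sum>k<N. (cmod (coeff p k))\<^sup>2) * (\<Sum>k<N. (1 + real k) * (cmod (coeff p k))\<^sup>2)"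
proof -
  define a where "a k = cmod (coeff p k)" for k
  let ?x = "\<lambda>k. (1 + real k) * (a k)\<^sup>2" and ?y = "\<lambda>k. (a k)\<^sup>2"
  have "(\<integral>z. (cmod (poly p z)) ^ 4 \<partial>circle) = (\<integral>z. (cmod (poly (p * p) z))\<^sup>2 \<partial>circle)"
    by (intro Bochner_Integration.integral_cong refl) (simp add: norm_mult power4_eq_xxxx power2_eq_square)
  also have "\<dots> = (\<Sum>n<N. (cmod (coeff (p * p) n))\<^sup>2)" by (rule poly_norm_circle[OF assms])
  also have "\<dots> \<le> (\<Sum>n<N. (\<Sum>i\<le>n. ?x i * ?y (n - i)) + (\<Sum>i\<le>n. ?y i * ?x (n - i)))"
  proof (rule sum_mono)
    fix n
    have "cmod (coeff (p * p) n) \<le> (\<Sum>i\<le>n. a i * a (n - i))"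
      unfolding coeff_mult a_def by (rule order_trans[OF norm_sum]) (simp add: norm_mult)
    then have "(cmod (coeff (p * p) n))\<^sup>2 \<le> (\<Sum>i\<le>n. a i * a (n - i))\<^sup>2" by (rule power_mono) simp
    also have "\<dots> = (\<Sum>i\<le>n. 1 * (a i * a (n - i)))\<^sup>2" by simp
    also have "\<dots> \<le> (\<Sum>i\<le>n. 1\<^sup>2) * (\<Sum>i\<le>n. (a i * a (n - i))\<^sup>2)" by (rule Cauchy_Schwarz_ineq_sum)
    also have "\<dots> = (\<Sum>i\<le>n. (1 + real n) * (a i * a (n - i))\<^sup>2)" by (simp add: sum_distrib_left)
    also have "\<dots> \<le> (\<Sum>i\<le>n. ?x i * ?y (n - i) + ?y i * ?x (n - i))"
    proof (rule sum_mono)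
      fix i assume "i \<in> {..n}"
      then have "1 + real n \<le> (1 + real i) + (1 + real (n - i))" by (simp add: of_nat_diff)
      then have "(1 + real n) * (a i * a (n - i))\<^sup>2 \<le> ((1 + real i) + (1 + real (n - i))) * (a i * a (n - i))\<^sup>2"
        by (rule mult_right_mono) simp
      then show "(1 + real n) * (a i * a (n - i))\<^sup>2 \<le> ?x i * ?y (n - i) + ?y i * ?x (n - i)"
        by (simp add: power_mult_distrib algebra_simps)
    qed
    finally show "(cmod (coeff (p * p) n))\<^sup>2 \<le> (\<Sum>i\<le>n. ?x i * ?y (n - i)) + (\<Sum>i\<le>n. ?y i * ?x (n - i))"
      by (simp only: sum.distrib)
  qed
  also have "\<dots> \<le> (\<Sum>i<N. ?x i) * (\<Sum>i<N. ?y i) + (\<Sum>i<N. ?y i) * (\<Sum>i<N. ?x i)"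
    unfolding sum.distrib by (intro add_mono conv_sum_le) auto
  finally show ?thesis by (simp add: a_def mult_ac)
qed

text \<open>Weaker than the logarithm, but its square is of order \<open>n\<close> and is cancelled
  by 1 / (n + 3) in \<open>triple_weight_le\<close>.\<close>

lemma harmonic_le: "(\<Sum>i\<le>n. 1 / (1 + real i)) \<le> 2 * sqrt (1 + real n)"
proof (induct n)
  case 0 show ?case by simp
next
  case (Suc n)
  let ?s = "sqrt (1 + real n)" and ?t = "sqrt (1 + real (Suc n))"
  have t: "?t \<ge> 1" "?s \<le> ?t" by auto
  have "?t * ?t - ?s * ?s = 1" by simp
  then have "(?t - ?s) * (?t + ?s) = 1" by (simp add: algebra_simps)
  moreover have "(?t - ?s) * (?t + ?s) \<le> (?t - ?s) * (2 * ?t)"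
    using t by (intro mult_left_mono) auto
  moreover have "(?t - ?s) * (2 * ?t) \<le> (?t - ?s) * (2 * (?t * ?t))"
    using t mult_left_mono[of 1 ?t ?t] by (intro mult_left_mono) auto
  ultimately have "1 \<le> (?t - ?s) * (2 * (?t * ?t))" by linarith
  also have "?t * ?t = 1 + real (Suc n)" by simp
  finally have "1 \<le> 2 * (?t - ?s) * (1 + real (Suc n))" by (simp only: mult_ac)
  then have "1 / (1 + real (Suc n)) \<le> 2 * (?t - ?s)" by (subst pos_divide_le_eq) auto
  then show ?case using Suc by simp
qed

text \<open>Partial fractions: 1/(x y z) = (1/(x y) + 1/(y z) + 1/(x z)) / (x + y + z) with x + y +
  z = n + 3. The three double sums are each at most the square of the harmonic sum, hence 12 = 3 *
  4.\<close>

lemma triple_weight_le: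
  "(\<Sum>(i, j)\<in>(SIGMA i:{..n}. {..n - i}). 1 / ((1 + real i) * (1 + real j) * (1 + real (n - i - j)))) \<le> 12"
proof -
  let ?D = "SIGMA i:{..n}. {..n - i}" and ?w = "\<lambda>i. 1 / (1 + real i)"
  have fin: "finite ?D" by auto
  have "(\<Sum>(i, j)\<in>?D. 1 / ((1 + real i) * (1 + real j) * (1 + real (n - i - j)))) =
     (\<Sum>(i, j)\<in>?D. 1 / (real n + 3) * (?w i * ?w j + ?w j * ?w (n - i - j) + ?w i * ?w (n - i - j)))"
  proof (intro sum.cong refl)
    fix x assume "x \<in> ?D"
    then obtain i j k where x: "x = (i, j)" and k: "n = i + j + k"
      by (cases x) (auto dest!: le_Suc_ex simp: le_diff_conv2 add.assoc)
    have e: "1 / (x * y * z) = 1 / (x + y + z) * (1 / x * (1 / y) + 1 / y * (1 / z) + 1 / x * (1 / z))"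
      if "x > 0" "y > 0" "z > 0" for x y z :: real
    proof -
      have "x + y + z \<noteq> 0" using that by linarith
      moreover have "1 / x * (1 / y) + 1 / y * (1 / z) + 1 / x * (1 / z) = (x + y + z) / (x * y * z)"
        using that by (simp add: divide_simps)
      ultimately show ?thesis by simp
    qed
    have "real n + 3 = (1 + real i) + (1 + real j) + (1 + real k)" using k by simp
    then show "(case x of (i, j) \<Rightarrow> 1 / ((1 + real i) * (1 + real j) * (1 + real (n - i - j)))) =
       (case x of (i, j) \<Rightarrow> 1 / (real n + 3) * (?w i * ?w j + ?w j * ?w (n - i - j) + ?w i * ?w (n - i - j)))"
      unfolding x using e[of "1 + real i" "1 + real j" "1 + real k"] k by simp
  qed
  also have "\<dots> = 1 / (real n + 3) * ((\<Sum>(i, j)\<in>?D. ?w i * ?w j) + (\<Sum>(i, j)\<in>?D. ?w j * ?w (n - i - j)) + (\<Sum>(i, j)\<in>?D. ?w i * ?w (n - i - j)))"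
    by (simp add: sum_distrib_left sum.distrib case_prod_unfold distrib_left)
  also have "\<dots> \<le> 1 / (real n + 3) * (3 * (\<Sum>i\<le>n. ?w i)\<^sup>2)"
  proof (rule mult_left_mono)
    have prod: "(\<Sum>i\<le>n. ?w i)\<^sup>2 = (\<Sum>(i, j)\<in>{..n} \<times> {..n}. ?w i * ?w j)"
      by (simp add: power2_eq_square sum_product sum.cartesian_product)
    have "(\<Sum>(i, j)\<in>?D. ?w i * ?w j) \<le> (\<Sum>(i, j)\<in>{..n} \<times> {..n}. ?w i * ?w j)"
      by (rule sum_mono2) auto
    moreover have "(\<Sum>(i, j)\<in>?D. ?w j * ?w (n - i - j)) \<le> (\<Sum>(i, j)\<in>{..n} \<times> {..n}. ?w i * ?w j)"
    proof -
      have inj: "inj_on (\<lambda>(i, j). (j, n - i - j)) ?D" by (auto simp: inj_on_def)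
      have "(\<Sum>(i, j)\<in>?D. ?w j * ?w (n - i - j)) = (\<Sum>(i, j)\<in>(\<lambda>(i, j). (j, n - i - j)) ` ?D. ?w i * ?w j)"
        by (subst sum.reindex[OF inj]) (auto intro!: sum.cong)
      also have "\<dots> \<le> (\<Sum>(i, j)\<in>{..n} \<times> {..n}. ?w i * ?w j)" by (rule sum_mono2) auto
      finally show ?thesis .
    qed
    moreover have "(\<Sum>(i, j)\<in>?D. ?w i * ?w (n - i - j)) \<le> (\<Sum>(i, j)\<in>{..n} \<times> {..n}. ?w i * ?w j)"
    proof -
      have inj: "inj_on (\<lambda>(i, j). (i, n - i - j)) ?D" by (auto simp: inj_on_def)
      have "(\<Sum>(i, j)\<in>?D. ?w i * ?w (n - i - j)) = (\<Sum>(i, j)\<in>(\<lambda>(i, j). (i, n - i - j)) ` ?D. ?w i * ?w j)"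
        by (subst sum.reindex[OF inj]) (auto intro!: sum.cong)
      also have "\<dots> \<le> (\<Sum>(i, j)\<in>{..n} \<times> {..n}. ?w i * ?w j)" by (rule sum_mono2) auto
      finally show ?thesis .
    qed
    ultimately show "(\<Sum>(i, j)\<in>?D. ?w i * ?w j) + (\<Sum>(i, j)\<in>?D. ?w j * ?w (n - i - j)) + (\<Sum>(i, j)\<in>?D. ?w i * ?w (n - i - j))
       \<le> 3 * (\<Sum>i\<le>n. ?w i)\<^sup>2" unfolding prod by linarith
  qed simp
  also have "\<dots> \<le> 1 / (real n + 3) * (3 * (2 * sqrt (1 + real n))\<^sup>2)"
    using harmonic_le[of n] by (intro mult_left_mono power_mono) (auto intro!: sum_nonneg)
  also have "\<dots> = 12 * (1 + real n) / (real n + 3)" by (simp add: power_mult_distrib)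
  also have "\<dots> \<le> 12" by (subst pos_divide_le_eq) auto
  finally show ?thesis .
qed

text \<open>Cauchy-Schwarz over triples of indices, weighted by the product of the three weights,
  whose reciprocals sum to at most 12. It makes |u|^2 u square integrable for \<open>u\<close> of
  finite energy.\<close>

lemma L6_poly:
  fixes p :: "complex poly"
  assumes "degree (p * (p * p)) < N"
  shows "(\<integral>z. (cmod (poly p z)) ^ 6 \<partial>circle) \<le> 12 * (\<Sum>k<N. (1 + real k) * (cmod (coeff p k))\<^sup>2) ^ 3"
proof -
  define a where "a k = cmod (coeff p k)" for k
  let ?x = "\<lambda>k. (1 + real k) * (a k)\<^sup>2"
  let ?y = "\<lambda>m. \<Sum>j\<le>m. ?x j * ?x (m - j)"
  have "(\<integral>z. (cmod (poly p z)) ^ 6 \<partial>circle) = (\<integral>z. (cmod (poly (p * (p * p)) z))\<^sup>2 \<partial>circle)"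
    by (intro Bochner_Integration.integral_cong refl) (simp add: norm_mult power2_eq_square eval_nat_numeral mult_ac)
  also have "\<dots> = (\<Sum>n<N. (cmod (coeff (p * (p * p)) n))\<^sup>2)" by (rule poly_norm_circle[OF assms])
  also have "\<dots> \<le> (\<Sum>n<N. 12 * (\<Sum>i\<le>n. ?x i * ?y (n - i)))"
  proof (rule sum_mono)
    fix n :: nat
    let ?D = "SIGMA i:{..n}. {..n - i}"
    have "cmod (coeff (p * (p * p)) n) \<le> (\<Sum>i\<le>n. \<Sum>j\<le>n - i. a i * (a j * a (n - i - j)))"
      unfolding coeff_mult a_def sum_distrib_left
      by (intro order_trans[OF norm_sum] sum_mono) (simp add: norm_mult)
    also have "\<dots> = (\<Sum>(i, j)\<in>?D. a i * (a j * a (n - i - j)))" by (simp add: sum.Sigma)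
    also have "\<dots> = (\<Sum>x\<in>?D. sqrt (1 / ((1 + real (fst x)) * (1 + real (snd x)) * (1 + real (n - fst x - snd x)))) *
        (sqrt ((1 + real (fst x)) * (1 + real (snd x)) * (1 + real (n - fst x - snd x))) * (a (fst x) * (a (snd x) * a (n - fst x - snd x)))))"
      (is "_ = (\<Sum>x\<in>?D. ?f x * ?g x)")
    proof (intro sum.cong refl)
      fix x
      let ?w = "(1 + real (fst x)) * (1 + real (snd x)) * (1 + real (n - fst x - snd x))"
      have "?w > 0" by (intro mult_pos_pos) auto
      then have "sqrt (1 / ?w) * sqrt ?w = 1" by (simp add: real_sqrt_mult[symmetric])
      then show "(case x of (i, j) \<Rightarrow> a i * (a j * a (n - i - j))) = ?f x * ?g x"
        by (simp only: mult.assoc[symmetric] case_prod_unfold mult_1)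
    qed
    finally have "(cmod (coeff (p * (p * p)) n))\<^sup>2 \<le> (\<Sum>x\<in>?D. ?f x * ?g x)\<^sup>2"
      by (rule power_mono) simp
    also have "\<dots> \<le> (\<Sum>x\<in>?D. (?f x)\<^sup>2) * (\<Sum>x\<in>?D. (?g x)\<^sup>2)" by (rule Cauchy_Schwarz_ineq_sum)
    also have "(\<Sum>x\<in>?D. (?f x)\<^sup>2) \<le> 12"
      using triple_weight_le[of n] by (simp add: case_prod_unfold)
    also have "(\<Sum>x\<in>?D. (?g x)\<^sup>2) = (\<Sum>(i, j)\<in>?D. ?x i * (?x j * ?x (n - i - j)))"
      by (intro sum.cong refl) (simp add: case_prod_unfold power_mult_distrib mult_ac)
    also have "\<dots> = (\<Sum>i\<le>n. ?x i * ?y (n - i))" by (simp add: sum.Sigma[symmetric] sum_distrib_left)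
    finally show "(cmod (coeff (p * (p * p)) n))\<^sup>2 \<le> 12 * (\<Sum>i\<le>n. ?x i * ?y (n - i))"
      by (simp add: mult_right_mono sum_nonneg)
  qed
  also have "\<dots> = 12 * (\<Sum>n<N. \<Sum>i\<le>n. ?x i * ?y (n - i))" by (simp only: sum_distrib_left)
  also have "\<dots> \<le> 12 * ((\<Sum>i<N. ?x i) * (\<Sum>i<N. ?y i))"
    by (intro mult_left_mono conv_sum_le) (auto intro!: sum_nonneg)
  also have "\<dots> \<le> 12 * ((\<Sum>i<N. ?x i) * ((\<Sum>i<N. ?x i) * (\<Sum>i<N. ?x i)))"
    by (intro mult_left_mono conv_sum_le) (auto intro!: sum_nonneg)
  finally show ?thesis by (simp add: a_def power3_eq_cube)
qed

definition Psum :: "(nat \<Rightarrow> complex) \<Rightarrow> nat \<Rightarrow> complex poly" where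
  "Psum a n = Poly (map a [0..<n])"

lemma coeff_Psum: "coeff (Psum a n) k = (if k < n then a k else 0)"
  by (simp add: Psum_def coeff_Poly_eq nth_default_def)

lemma poly_Psum: "poly (Psum a n) z = psum a n z"
proof -
  have "degree (Psum a n) < Suc (n + degree (Psum a n))" by simp
  from poly_eq_trig[OF this, of z]
  have "poly (Psum a n) z = (\<Sum>k<Suc (n + degree (Psum a n)). coeff (Psum a n) k * z ^ k)" .
  also have "\<dots> = (\<Sum>k<n. coeff (Psum a n) k * z ^ k)"
    by (rule sum.mono_neutral_right) (auto simp: coeff_Psum)
  also have "\<dots> = psum a n z" unfolding psum_def by (rule sum.cong) (auto simp: coeff_Psum)
  finally show ?thesis .
qed

lemma coeff_Psum_sum_le:
  assumes s: "summable (\<lambda>k. w k * (cmod (a k))\<^sup>2)" and w: "\<And>k. 0 \<le> (w k :: real)"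
  shows "(\<Sum>k<N. w k * (cmod (coeff (Psum a n) k))\<^sup>2) \<le> (\<Sum>k. w k * (cmod (a k))\<^sup>2)"
proof -
  have "(\<Sum>k<N. w k * (cmod (coeff (Psum a n) k))\<^sup>2) \<le> (\<Sum>k<N. w k * (cmod (a k))\<^sup>2)"
    by (intro sum_mono mult_left_mono w) (simp add: coeff_Psum)
  also have "\<dots> \<le> (\<Sum>k. w k * (cmod (a k))\<^sup>2)"
    by (rule sum_le_suminf[OF s]) (simp_all add: w)
  finally show ?thesis .
qed

text \<open>For functions without negative frequencies this is equivalent to the squared H^{1/2}
  norm; the weight 1 + k is subadditive, as used in \<open>L4_poly\<close>.\<close>

definition energy :: "(complex \<Rightarrow> complex) \<Rightarrow> real" where
  "energy u = (\<Sum>k. (1 + real k) * (cmod (fourier u (int k)))\<^sup>2)"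

definition H12 :: "(complex \<Rightarrow> complex) \<Rightarrow> bool" where
  "H12 u \<longleftrightarrow> u \<in> plus_part L2 \<and> summable (\<lambda>k. (1 + real k) * (cmod (fourier u (int k)))\<^sup>2)"

lemma H12_L2: "H12 u \<Longrightarrow> u \<in> L2"
  by (simp add: H12_def plus_part_def)

lemma energy_nonneg: "H12 u \<Longrightarrow> 0 \<le> energy u"
  unfolding energy_def H12_def by (intro suminf_nonneg) auto

lemma integrable_psum_power: "integrable circle (\<lambda>z. (cmod (psum a n z)) ^ m)"
proof (rule integrable_bounded_circle)
  have [measurable]: "psum a n \<in> borel_measurable borel" using L2_psum by (rule L2_D)
  show "(\<lambda>z. (cmod (psum a n z)) ^ m) \<in> borel_measurable borel" by simp
  show "AE z in circle. norm ((cmod (psum a n z)) ^ m) \<le> (\<Sum>k<n. cmod (a k)) ^ m"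
    using AE_circle_norm
  proof eventually_elim
    case (elim z)
    have "cmod (psum a n z) \<le> (\<Sum>k<n. cmod (a k))"
      unfolding psum_def by (rule order_trans[OF norm_sum]) (simp add: norm_mult norm_power elim)
    then show ?case by (simp add: power_mono)
  qed
qed

lemma H12_L4_L6:
  assumes u: "H12 u"
  shows "integrable circle (\<lambda>z. (cmod (u z)) ^ 4)"
    and "(\<integral>z. (cmod (u z)) ^ 4 \<partial>circle) \<le> 2 * (\<integral>z. (cmod (u z))\<^sup>2 \<partial>circle) * energy u"
    and "integrable circle (\<lambda>z. (cmod (u z)) ^ 6)"
    and "(\<integral>z. (cmod (u z)) ^ 6 \<partial>circle) \<le> 12 * energy u ^ 3"
proof -
  define a where "a k = fourier u (int k)" for k
  have up: "u \<in> plus_part L2" and s: "summable (\<lambda>k. (1 + real k) * (cmod (a k))\<^sup>2)"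
    using u by (auto simp: H12_def a_def)
  have [measurable]: "u \<in> borel_measurable borel" using H12_L2[OF u] by (rule L2_D)
  have s0: "summable (\<lambda>k. 1 * (cmod (a k))\<^sup>2)" using bessel[OF H12_L2[OF u]] by (simp add: a_def)
  have n2: "(\<Sum>k. 1 * (cmod (a k))\<^sup>2) = (\<integral>z. (cmod (u z))\<^sup>2 \<partial>circle)"
    using parseval_norm[OF up] by (simp add: sums_iff a_def)
  have E: "(\<Sum>k. (1 + real k) * (cmod (a k))\<^sup>2) = energy u" by (simp add: energy_def a_def)
  obtain r where r: "AE z in circle. (\<lambda>j. psum a (r j) z) \<longlonglongrightarrow> u z"
    using plus_expansion(2)[OF up] by (auto simp: a_def[abs_def])
  have conv: "AE z in circle. (\<lambda>j. (cmod (psum a (r j) z)) ^ m) \<longlonglongrightarrow> (cmod (u z)) ^ m" for m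
    using r by eventually_elim (intro tendsto_intros)
  have E0: "0 \<le> energy u" by (rule energy_nonneg[OF u])
  have b4: "(\<integral>z. (cmod (psum a n z)) ^ 4 \<partial>circle) \<le> 2 * (\<integral>z. (cmod (u z))\<^sup>2 \<partial>circle) * energy u" for n
  proof -
    let ?p = "Psum a n"
    obtain N where N: "degree (?p * ?p) < N" by blast
    have "(\<integral>z. (cmod (psum a n z)) ^ 4 \<partial>circle) \<le>
        2 * (\<Sum>k<N. (cmod (coeff ?p k))\<^sup>2) * (\<Sum>k<N. (1 + real k) * (cmod (coeff ?p k))\<^sup>2)"
      using L4_poly[OF N] by (simp add: poly_Psum)
    also have "\<dots> \<le> 2 * (\<integral>z. (cmod (u z))\<^sup>2 \<partial>circle) * energy u"
      using coeff_Psum_sum_le[OF s0, where N=N and n=n] coeff_Psum_sum_le[OF s, where N=N and n=n] E0 unfolding n2 E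
      by (intro mult_mono) (auto intro!: sum_nonneg)
    finally show ?thesis .
  qed
  have b6: "(\<integral>z. (cmod (psum a n z)) ^ 6 \<partial>circle) \<le> 12 * energy u ^ 3" for n
  proof -
    let ?p = "Psum a n"
    obtain N where N: "degree (?p * (?p * ?p)) < N" by blast
    have "(\<integral>z. (cmod (psum a n z)) ^ 6 \<partial>circle) \<le> 12 * (\<Sum>k<N. (1 + real k) * (cmod (coeff ?p k))\<^sup>2) ^ 3"
      using L6_poly[OF N] by (simp add: poly_Psum)
    also have "\<dots> \<le> 12 * energy u ^ 3"
      using coeff_Psum_sum_le[OF s, where N=N and n=n] unfolding E
      by (intro mult_left_mono power_mono) (auto intro!: sum_nonneg)
    finally show ?thesis .
  qed
  have c4: "0 \<le> 2 * (\<integral>z. (cmod (u z))\<^sup>2 \<partial>circle) * energy u" using E0 by simp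
  have c6: "0 \<le> 12 * energy u ^ 3" using E0 by simp
  show "integrable circle (\<lambda>z. (cmod (u z)) ^ 4)"
    by (rule fatou_circle(1)[OF integrable_psum_power _ conv[of 4] _ c4 always_eventually]) (use b4 in auto)
  show "(\<integral>z. (cmod (u z)) ^ 4 \<partial>circle) \<le> 2 * (\<integral>z. (cmod (u z))\<^sup>2 \<partial>circle) * energy u"
    by (rule fatou_circle(2)[OF integrable_psum_power _ conv[of 4] _ c4 always_eventually]) (use b4 in auto)
  show "integrable circle (\<lambda>z. (cmod (u z)) ^ 6)"
    by (rule fatou_circle(1)[OF integrable_psum_power _ conv[of 6] _ c6 always_eventually]) (use b6 in auto)
  show "(\<integral>z. (cmod (u z)) ^ 6 \<partial>circle) \<le> 12 * energy u ^ 3"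
    by (rule fatou_circle(2)[OF integrable_psum_power _ conv[of 6] _ c6 always_eventually]) (use b6 in auto)
qed

lemma H12_cubic_L2:
  assumes u: "H12 u"
  shows "(\<lambda>z. complex_of_real ((cmod (u z))\<^sup>2) * u z) \<in> L2"
    and "(\<integral>z. (cmod (complex_of_real ((cmod (u z))\<^sup>2) * u z))\<^sup>2 \<partial>circle) \<le> 12 * energy u ^ 3"
proof -
  have [measurable]: "u \<in> borel_measurable borel" using H12_L2[OF u] by (rule L2_D)
  have e: "(\<lambda>z. (cmod (complex_of_real ((cmod (u z))\<^sup>2) * u z))\<^sup>2) = (\<lambda>z. (cmod (u z)) ^ 6)"
    by (rule ext) (simp add: norm_mult norm_power eval_nat_numeral mult_ac)
  show "(\<lambda>z. complex_of_real ((cmod (u z))\<^sup>2) * u z) \<in> L2"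
    unfolding L2_def using H12_L4_L6(3)[OF u] by (simp only: mem_Collect_eq e) simp
  show "(\<integral>z. (cmod (complex_of_real ((cmod (u z))\<^sup>2) * u z))\<^sup>2 \<partial>circle) \<le> 12 * energy u ^ 3"
    unfolding e by (rule H12_L4_L6(4)[OF u])
qed

lemma sobolev_half_H12:
  assumes u: "u \<in> plus_part (sobolev (1/2))"
  shows "H12 u" "energy u \<le> 2 * (sobolev_norm (1/2) u)\<^sup>2"
proof -
  let ?f = "\<lambda>k::int. (1 + (of_int k)\<^sup>2) powr (1/2) * (cmod (fourier u k))\<^sup>2"
  have f: "?f summable_on UNIV" using u by (simp add: plus_part_def sobolev_def)
  have f0: "0 \<le> ?f k" for k by simp
  have le: "(1 + real k) * (cmod (fourier u (int k)))\<^sup>2 \<le> 2 * ?f (int k)" for k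
  proof -
    have "(1 + real k)\<^sup>2 \<le> 2\<^sup>2 * (1 + (real k)\<^sup>2)"
      using sum_squares_bound[of 1 "real k"] by (simp add: power2_sum)
    then have "1 + real k \<le> sqrt (2\<^sup>2 * (1 + (real k)\<^sup>2))" by (rule real_le_rsqrt)
    also have "\<dots> = 2 * sqrt (1 + (real k)\<^sup>2)"
      by (simp only: real_sqrt_mult real_sqrt_abs abs_numeral)
    also have "sqrt (1 + (real k)\<^sup>2) = (1 + (real_of_int (int k))\<^sup>2) powr (1/2)"
      by (simp add: powr_half_sqrt)
    finally have "1 + real k \<le> 2 * (1 + (real_of_int (int k))\<^sup>2) powr (1/2)" .
    from mult_right_mono[OF this, of "(cmod (fourier u (int k)))\<^sup>2"] show ?thesis by (simp add: mult.assoc)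
  qed
  have fn: "?f summable_on range int" using f by (rule summable_on_subset_banach) simp
  then have fn2: "(?f \<circ> int) summable_on UNIV" by (subst (asm) summable_on_reindex) auto
  then have s: "summable (\<lambda>k. 2 * ?f (int k))"
    by (intro summable_mult) (auto dest!: summable_on_imp_summable simp: o_def)
  have s2: "summable (\<lambda>k. (1 + real k) * (cmod (fourier u (int k)))\<^sup>2)"
    by (rule summable_comparison_test'[OF s, of 0]) (use le in auto)
  have "u \<in> plus_part L2" using u by (auto simp: plus_part_def sobolev_def)
  with s2 show "H12 u" by (simp add: H12_def)
  have "energy u \<le> (\<Sum>k. 2 * ?f (int k))" unfolding energy_def by (rule suminf_le[OF le s2 s])
  also have "\<dots> = 2 * (\<Sum>k. ?f (int k))"
    by (rule suminf_mult) (use fn2 in \<open>auto dest!: summable_on_imp_summable simp: o_def\<close>)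
  also have "(\<Sum>k. ?f (int k)) = infsum (?f \<circ> int) UNIV"
    using has_sum_imp_sums[OF has_sum_infsum[OF fn2]] by (simp add: sums_iff o_def)
  also have "infsum (?f \<circ> int) UNIV = infsum ?f (range int)"
    by (rule infsum_reindex[symmetric]) auto
  also have "\<dots> \<le> infsum ?f UNIV" by (rule infsum_mono_neutral[OF fn f]) auto
  also have "infsum ?f UNIV = (sobolev_norm (1/2) u)\<^sup>2"
    unfolding sobolev_norm_def by (subst real_sqrt_pow2) (auto intro!: infsum_nonneg)
  finally show "energy u \<le> 2 * (sobolev_norm (1/2) u)\<^sup>2" by simp
qed

lemma energy_triangle:
  assumes "H12 u" "H12 v"
  shows "H12 (\<lambda>z. u z - v z)" "energy u \<le> 2 * energy (\<lambda>z. u z - v z) + 2 * energy v"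
    "energy (\<lambda>z. u z - v z) \<le> 2 * energy u + 2 * energy v"
proof -
  let ?w = "\<lambda>z. u z - v z"
  have fw: "fourier ?w k = fourier u k - fourier v k" for k
    by (rule fourier_diff) (auto intro: H12_L2 assms)
  have sq: "(cmod (x - y))\<^sup>2 \<le> 2 * (cmod x)\<^sup>2 + 2 * (cmod y)\<^sup>2" for x y
  proof -
    have "(cmod (x - y))\<^sup>2 \<le> (cmod x + cmod y)\<^sup>2" by (intro power_mono norm_triangle_ineq4) simp
    also have "\<dots> \<le> 2 * (cmod x)\<^sup>2 + 2 * (cmod y)\<^sup>2"
      using sum_squares_bound[of "cmod x" "cmod y"] by (simp add: power2_sum)
    finally show ?thesis .
  qed
  let ?U = "\<lambda>k. (1 + real k) * (cmod (fourier u (int k)))\<^sup>2" and ?V = "\<lambda>k. (1 + real k) * (cmod (fourier v (int k)))\<^sup>2"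
    and ?W = "\<lambda>k. (1 + real k) * (cmod (fourier ?w (int k)))\<^sup>2"
  have s: "summable ?U" "summable ?V" using assms by (auto simp: H12_def)
  have le: "?W k \<le> 2 * ?U k + 2 * ?V k" for k
  proof -
    have "?W k \<le> (1 + real k) * (2 * (cmod (fourier u (int k)))\<^sup>2 + 2 * (cmod (fourier v (int k)))\<^sup>2)"
      unfolding fw by (intro mult_left_mono sq) simp
    then show ?thesis by (simp add: algebra_simps)
  qed
  have s2: "summable (\<lambda>k. 2 * ?U k + 2 * ?V k)" by (intro summable_add summable_mult s)
  have sw: "summable ?W" by (rule summable_comparison_test'[OF s2, of 0]) (use le in auto)
  have "?w \<in> plus_part L2"
    using assms by (auto simp: plus_part_def fw H12_def intro!: L2_diff)
  with sw show "H12 ?w" by (simp add: H12_def)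
  have "energy ?w \<le> (\<Sum>k. 2 * ?U k + 2 * ?V k)" unfolding energy_def by (rule suminf_le[OF le sw s2])
  also have "\<dots> = 2 * energy u + 2 * energy v"
    unfolding energy_def by (simp only: suminf_add[OF summable_mult[OF s(1)] summable_mult[OF s(2)], symmetric] suminf_mult[OF s(1)] suminf_mult[OF s(2)])
  finally show "energy ?w \<le> 2 * energy u + 2 * energy v" .
  have le2: "?U k \<le> 2 * ?W k + 2 * ?V k" for k
  proof -
    have "(cmod (fourier ?w (int k) - (- fourier v (int k))))\<^sup>2 \<le> 2 * (cmod (fourier ?w (int k)))\<^sup>2 + 2 * (cmod (fourier v (int k)))\<^sup>2"
      using sq[of "fourier ?w (int k)" "- fourier v (int k)"] by simp
    then have "(cmod (fourier u (int k)))\<^sup>2 \<le> 2 * (cmod (fourier ?w (int k)))\<^sup>2 + 2 * (cmod (fourier v (int k)))\<^sup>2"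
      by (simp add: fw)
    from mult_left_mono[OF this, of "1 + real k"] show ?thesis by (simp add: algebra_simps)
  qed
  have s3: "summable (\<lambda>k. 2 * ?W k + 2 * ?V k)" by (intro summable_add summable_mult s sw)
  have "energy u \<le> (\<Sum>k. 2 * ?W k + 2 * ?V k)" unfolding energy_def by (rule suminf_le[OF le2 s(1) s3])
  also have "\<dots> = 2 * energy ?w + 2 * energy v"
    unfolding energy_def by (simp only: suminf_add[OF summable_mult[OF sw] summable_mult[OF s(2)], symmetric] suminf_mult[OF sw] suminf_mult[OF s(2)])
  finally show "energy u \<le> 2 * energy ?w + 2 * energy v" .
qed

text \<open>Meant for a squared norm \<open>y\<close> known only as a limit of sums
  \<open>g K\<close> over finitely many coefficients. The uniform bound on their derivatives allows
  dominated convergence, which gives the integral form of the inequality without differentiating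
  \<open>y\<close>.\<close>

lemma gronwall_limit:
  fixes g G :: "nat \<Rightarrow> real \<Rightarrow> real"
  assumes R: "0 \<le> R"
    and der: "\<And>K t. t \<in> {0..R} \<Longrightarrow> (g K has_real_derivative G K t) (at t)"
    and g0: "\<And>K. g K 0 = 0"
    and bound: "\<And>K t. t \<in> {0..R} \<Longrightarrow> \<bar>G K t\<bar> \<le> M"
    and gy: "\<And>t. t \<in> {0..R} \<Longrightarrow> (\<lambda>K. g K t) \<longlonglongrightarrow> y t"
    and GH: "\<And>t. t \<in> {0..R} \<Longrightarrow> (\<lambda>K. G K t) \<longlonglongrightarrow> H t"
    and H: "\<And>t. t \<in> {0..R} \<Longrightarrow> \<bar>H t\<bar> \<le> L * y t" and y: "\<And>t. t \<in> {0..R} \<Longrightarrow> 0 \<le> y t"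
  shows "y R = 0"
proof -
  have gi: "(G K has_integral g K t) {0..t}" if "t \<in> {0..R}" for K t
  proof -
    have "(G K has_integral g K t - g K 0) {0..t}"
    proof (rule fundamental_theorem_of_calculus)
      show "0 \<le> t" using that by simp
      fix x assume "x \<in> {0..t}"
      then have "(g K has_real_derivative G K x) (at x)" using that by (intro der) auto
      then show "(g K has_vector_derivative G K x) (at x within {0..t})"
        unfolding has_real_derivative_iff_has_vector_derivative by (rule has_vector_derivative_at_within)
    qed
    then show ?thesis by (simp add: g0)
  qed
  have yi: "(H has_integral y t) {0..t}" if t: "t \<in> {0..R}" for t
  proof -
    have a: "G K integrable_on {0..t}" for K using gi[OF t] by (rule has_integral_integrable)
    have b: "(\<lambda>_. M) integrable_on {0..t}" by (rule integrable_const_ivl)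
    have c: "norm (G K x) \<le> M" if "x \<in> {0..t}" for K x using bound[of x K] that t by auto
    have d: "(\<lambda>K. G K x) \<longlonglongrightarrow> H x" if "x \<in> {0..t}" for x using GH[of x] that t by auto
    have int: "H integrable_on {0..t}" by (rule dominated_convergence(1)[OF a b c d])
    have lim: "(\<lambda>K. integral {0..t} (G K)) \<longlonglongrightarrow> integral {0..t} H" by (rule dominated_convergence(2)[OF a b c d])
    have "integral {0..t} (G K) = g K t" for K using gi[OF t] by (rule integral_unique)
    with lim have "(\<lambda>K. g K t) \<longlonglongrightarrow> integral {0..t} H" by simp
    with gy[OF t] have "y t = integral {0..t} H" by (rule LIMSEQ_unique)
    with int show ?thesis by (simp add: integrable_integral)
  qed
  have yeq: "y t = integral {0..t} H" if "t \<in> {0..R}" for t using yi[OF that] by (simp add: integral_unique)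
  have "continuous_on {0..R} (\<lambda>t. integral {0..t} H)"
    by (rule indefinite_integral_continuous_1) (use yi[of R] R in auto)
  then have yc: "continuous_on {0..R} y" by (rule continuous_on_eq) (simp add: yeq)
  define z where "z t = integral {0..t} y" for t
  have zd: "(z has_real_derivative y t) (at t within {0..R})" if "t \<in> {0..R}" for t
    unfolding z_def by (rule integral_has_real_derivative[OF yc that])
  have yint: "y integrable_on {0..t}" if "t \<in> {0..R}" for t
    by (rule integrable_continuous_interval, rule continuous_on_subset[OF yc]) (use that in auto)
  have le: "y t \<le> L * z t" if t: "t \<in> {0..R}" for t
  proof -
    have "y t = integral {0..t} H" by (rule yeq[OF t])
    also have "\<dots> \<le> integral {0..t} (\<lambda>s. L * y s)"
    proof (rule integral_le)
      show "H integrable_on {0..t}" using yi[OF t] by (rule has_integral_integrable)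
      show "(\<lambda>s. L * y s) integrable_on {0..t}" using integrable_on_cmult_left[OF yint[OF t], of L] by simp
      fix s assume "s \<in> {0..t}"
      then show "H s \<le> L * y s" using H[of s] t by auto
    qed
    finally show ?thesis by (simp add: z_def)
  qed
  \<comment> \<open>With \<open>z\<close> the primitive of \<open>y\<close>, the function exp (- L
    t) z t is nonincreasing and starts at 0.\<close>
  have "exp (- L * R) * z R \<le> exp (- L * 0) * z 0"
  proof (rule DERIV_nonpos_imp_decreasing_open[of 0 R "\<lambda>t. exp (- L * t) * z t"])
    show "0 \<le> R" by fact
    fix t assume t: "0 < t" "t < R"
    then have "(z has_real_derivative y t) (at t)" using zd[of t] by (simp add: at_within_Icc_at)
    then have "((\<lambda>t. exp (- L * t) * z t) has_real_derivative exp (- L * t) * (y t - L * z t)) (at t)"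
      by (auto intro!: derivative_eq_intros simp: algebra_simps)
    moreover have "exp (- L * t) * (y t - L * z t) \<le> 0" using le[of t] t by (intro mult_nonneg_nonpos) auto
    ultimately show "\<exists>d. ((\<lambda>t. exp (- L * t) * z t) has_real_derivative d) (at t) \<and> d \<le> 0" by blast
  next
    have "continuous_on {0..R} z" using zd by (intro DERIV_continuous_on) auto
    then show "continuous_on {0..R} (\<lambda>t. exp (- L * t) * z t)" by (intro continuous_intros)
  qed
  moreover have "z 0 = 0" by (simp add: z_def)
  ultimately have "exp (- L * R) * z R \<le> 0" by simp
  then have zR: "z R \<le> 0" by (simp add: mult_le_0_iff)
  have "0 \<le> z R" unfolding z_def by (rule integral_nonneg[OF yint]) (use R y in auto)
  with zR have "z R = 0" by simp
  then have "y R \<le> 0" using le[of R] R by simp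
  then show ?thesis using y[of R] R by simp
qed

text \<open>Set to 0 outside the closed disc, where the series may diverge, so that the function is
  measurable and bounded on the whole plane.\<close>

definition ev :: "(nat \<Rightarrow> complex) \<Rightarrow> complex \<Rightarrow> complex" where
  "ev a z = (if cmod z \<le> 1 then \<Sum>k. a k * z ^ k else 0)"

lemma abs_summable_power:
  assumes a: "summable (\<lambda>k. cmod (a k))" and z: "cmod z \<le> 1"
  shows "summable (\<lambda>k. cmod (a k * z ^ k))" "summable (\<lambda>k. a k * z ^ k)"
proof -
  show s: "summable (\<lambda>k. cmod (a k * z ^ k))"
    by (rule summable_comparison_test'[OF a, of 0])
      (use z in \<open>auto simp: norm_mult norm_power intro!: mult_left_le power_le_one\<close>)
  then show "summable (\<lambda>k. a k * z ^ k)" by (rule summable_norm_cancel)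
qed

lemma psum_tendsto_ev:
  assumes "summable (\<lambda>k. cmod (a k))" "cmod z \<le> 1"
  shows "(\<lambda>n. psum a n z) \<longlonglongrightarrow> ev a z"
  using summable_LIMSEQ[OF abs_summable_power(2)[OF assms]] assms(2) by (simp add: psum_def ev_def)

lemma psum_bound:
  assumes a: "summable (\<lambda>k. cmod (a k))" and z: "cmod z \<le> 1"
  shows "cmod (psum a n z) \<le> (\<Sum>k. cmod (a k))"
proof -
  have "cmod (psum a n z) \<le> (\<Sum>k<n. cmod (a k))"
    unfolding psum_def
    by (rule order_trans[OF norm_sum]) (use z in \<open>auto simp: norm_mult norm_power intro!: sum_mono mult_left_le power_le_one\<close>)
  also have "\<dots> \<le> (\<Sum>k. cmod (a k))" by (rule sum_le_suminf[OF a]) auto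
  finally show ?thesis .
qed

lemma ev_bound:
  assumes a: "summable (\<lambda>k. cmod (a k))"
  shows "cmod (ev a z) \<le> (\<Sum>k. cmod (a k))"
proof (cases "cmod z \<le> 1")
  case True
  have "(\<lambda>n. cmod (psum a n z)) \<longlonglongrightarrow> cmod (ev a z)"
    by (intro tendsto_norm psum_tendsto_ev a True)
  then show ?thesis by (rule LIMSEQ_le_const2) (use psum_bound[OF a True] in auto)
next
  case False then show ?thesis by (simp add: ev_def suminf_nonneg a)
qed

lemma ev_measurable:
  assumes a: "summable (\<lambda>k. cmod (a k))"
  shows "ev a \<in> borel_measurable borel"
proof (rule borel_measurable_LIMSEQ_metric)
  fix n
  have [measurable]: "psum a n \<in> borel_measurable borel" using L2_psum by (rule L2_D)
  show "(\<lambda>z. if cmod z \<le> 1 then psum a n z else 0) \<in> borel_measurable borel" by measurable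
next
  fix z show "(\<lambda>n. if cmod z \<le> 1 then psum a n z else 0) \<longlonglongrightarrow> ev a z"
    using psum_tendsto_ev[OF a, of z] by (cases "cmod z \<le> 1") (auto simp: ev_def)
qed

lemma ev_L2: "summable (\<lambda>k. cmod (a k)) \<Longrightarrow> ev a \<in> L2"
  by (rule L2_bounded[OF ev_measurable]) (auto intro: ev_bound)

lemma ev_fourier_mult:
  assumes a: "summable (\<lambda>k. cmod (a k))" and g: "integrable circle g"
  shows "(\<lambda>k. a k * fourier g (j - int k)) sums fourier (\<lambda>z. ev a z * g z) j"
proof -
  have [measurable]: "g \<in> borel_measurable borel" using borel_measurable_integrable[OF g] by simp
  have [measurable]: "ev a \<in> borel_measurable borel" by (rule ev_measurable[OF a])
  have [measurable]: "psum a n \<in> borel_measurable borel" for n using L2_psum by (rule L2_D)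
  let ?S = "\<Sum>k. cmod (a k)"
  have "(\<integral>z. psum a n z * g z * cnj (z powi j) \<partial>circle) = (\<Sum>k<n. a k * fourier g (j - int k))" for n
  proof -
    have "(\<integral>z. psum a n z * g z * cnj (z powi j) \<partial>circle) = (\<integral>z. (\<Sum>k<n. a k * (g z * cnj (z powi (j - int k)))) \<partial>circle)"
    proof (rule integral_cong_AE)
      show "AE z in circle. psum a n z * g z * cnj (z powi j) = (\<Sum>k<n. a k * (g z * cnj (z powi (j - int k))))"
        using AE_circle_norm
      proof eventually_elim
        case (elim z)
        then have z: "z \<noteq> 0" by auto
        have "z ^ k * cnj (z powi j) = cnj (z powi (j - int k))" for k
        proof -
          have "z powi int k * z powi (- j) = z powi (- (j - int k))"
            using z by (simp only: power_int_add[symmetric] simp_thms) (simp add: power_int_add[symmetric] algebra_simps)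
          then show ?thesis unfolding cnj_powi[OF elim] by simp
        qed
        have "a k * z ^ k * (g z * cnj (z powi j)) = a k * (g z * cnj (z powi (j - int k)))" for k
        proof -
          have "a k * z ^ k * (g z * cnj (z powi j)) = a k * (g z * (z ^ k * cnj (z powi j)))"
            by (simp only: mult_ac)
          then show ?thesis by (simp only: \<open>\<And>k. z ^ k * cnj (z powi j) = cnj (z powi (j - int k))\<close>)
        qed
        then show ?case unfolding psum_def mult.assoc sum_distrib_right by (simp only: mult.assoc)
      qed
    qed measurable
    also have "\<dots> = (\<Sum>k<n. \<integral>z. a k * (g z * cnj (z powi (j - int k))) \<partial>circle)"
      by (rule Bochner_Integration.integral_sum) (intro integrable_mult_right integrable_powi_mult g)
    finally show ?thesis by (simp add: fourier_def cinner_def)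
  qed
  moreover have "(\<lambda>n. \<integral>z. psum a n z * g z * cnj (z powi j) \<partial>circle) \<longlonglongrightarrow> (\<integral>z. ev a z * g z * cnj (z powi j) \<partial>circle)"
  proof (rule integral_dominated_convergence[where w="\<lambda>z. ?S * cmod (g z)"])
    show "integrable circle (\<lambda>z. ?S * cmod (g z))" using g by simp
    show "AE z in circle. (\<lambda>n. psum a n z * g z * cnj (z powi j)) \<longlonglongrightarrow> ev a z * g z * cnj (z powi j)"
      using AE_circle_norm
      by eventually_elim (intro tendsto_mult psum_tendsto_ev a tendsto_const, simp)
    show "AE z in circle. norm (psum a n z * g z * cnj (z powi j)) \<le> ?S * cmod (g z)" for n
      using AE_circle_norm
    proof eventually_elim
      case (elim z)
      have "cmod (psum a n z) * cmod (g z) \<le> ?S * cmod (g z)"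
        by (intro mult_right_mono psum_bound a) (simp_all add: elim)
      then show ?case by (simp add: norm_mult norm_power_int elim)
    qed
  qed measurable
  ultimately show ?thesis unfolding sums_def fourier_def[of "\<lambda>z. ev a z * g z"] cinner_def by simp
qed

lemma fourier_1: "fourier (\<lambda>_. 1) k = (if k = 0 then 1 else 0)"
  using cinner_powi[of 0 k] by (simp add: fourier_def)

lemma fourier_ev:
  assumes a: "summable (\<lambda>k. cmod (a k))"
  shows "fourier (ev a) j = (if 0 \<le> j then a (nat j) else 0)"
proof -
  have "(\<lambda>k. a k * fourier (\<lambda>_. 1) (j - int k)) sums fourier (ev a) j"
    using ev_fourier_mult[OF a, of "\<lambda>_. 1" j] by simp
  also have "(\<lambda>k. a k * fourier (\<lambda>_. 1) (j - int k)) = (\<lambda>k. if k = nat j then (if 0 \<le> j then a k else 0) else 0)"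
    unfolding fourier_1 by (rule ext) auto
  finally show ?thesis by (rule sums_unique2[OF _ sums_single])
qed

lemma fourier_cnj:
  assumes [measurable]: "f \<in> borel_measurable borel"
  shows "fourier (\<lambda>z. cnj (f z)) k = cnj (fourier f (- k))"
proof -
  have "fourier (\<lambda>z. cnj (f z)) k = (\<integral>z. cnj (f z * z powi k) \<partial>circle)"
    unfolding fourier_def cinner_def by (simp only: complex_cnj_mult)
  also have "\<dots> = cnj (\<integral>z. f z * z powi k \<partial>circle)" by (rule Bochner_Integration.integral_cnj)
  also have "(\<integral>z. f z * z powi k \<partial>circle) = (\<integral>z. f z * cnj (z powi (- k)) \<partial>circle)"
  proof (rule integral_cong_AE)
    show "AE z in circle. f z * z powi k = f z * cnj (z powi (- k))"
      using AE_circle_norm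
    proof eventually_elim
      case (elim z) from cnj_powi[OF this, of "- k"] show ?case by simp
    qed
  qed measurable
  finally show ?thesis by (simp add: fourier_def cinner_def)
qed

text \<open>|u|^2 is real, so its coefficients of negative index are the conjugates of
  \<open>c\<close>. Splitting the convolution at \<open>k = n\<close> separates the signs and gives
  the right-hand side found in \<open>explicit_flow\<close>.\<close>

lemma fourier_ev_cubic:
  assumes a: "summable (\<lambda>k. cmod (a k))"
  defines "c \<equiv> \<lambda>m. \<Sum>j. a (m + j) * cnj (a j)"
  shows "fourier (\<lambda>z. complex_of_real ((cmod (ev a z))\<^sup>2) * ev a z) (int n) =
    (\<Sum>k. a (n + k) * cnj (c k)) + (\<Sum>k<n. a k * c (n - k))"
proof -
  have m[measurable]: "ev a \<in> borel_measurable borel" by (rule ev_measurable[OF a])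
  let ?S = "\<Sum>k. cmod (a k)"
  define g where "g z = ev a z * cnj (ev a z)" for z
  have [measurable]: "g \<in> borel_measurable borel" unfolding g_def[abs_def] by measurable
  have ci: "integrable circle (\<lambda>z. cnj (ev a z))"
    by (rule integrable_bounded_circle[where B="?S"]) (auto intro: ev_bound[OF a])
  have gi: "integrable circle g"
    unfolding g_def[abs_def]
    by (rule L2_mult_integrable) (auto intro: ev_L2 a)
  have gpos: "fourier g (int m) = c m" for m
  proof -
    have "(\<lambda>k. a k * fourier (\<lambda>z. cnj (ev a z)) (int m - int k)) sums fourier g (int m)"
      unfolding g_def[abs_def] by (rule ev_fourier_mult[OF a ci])
    then have "(\<lambda>k. a (k + m) * fourier (\<lambda>z. cnj (ev a z)) (int m - int (k + m))) sums
        (fourier g (int m) - (\<Sum>k<m. a k * fourier (\<lambda>z. cnj (ev a z)) (int m - int k)))"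
      by (subst sums_iff_shift) simp
    moreover have "(\<Sum>k<m. a k * fourier (\<lambda>z. cnj (ev a z)) (int m - int k)) = 0"
      by (rule sum.neutral) (auto simp: fourier_cnj[OF m] fourier_ev[OF a])
    moreover have "fourier (\<lambda>z. cnj (ev a z)) (int m - int (k + m)) = cnj (a k)" for k
      by (simp add: fourier_cnj[OF m] fourier_ev[OF a])
    ultimately have "(\<lambda>k. a (k + m) * cnj (a k)) sums fourier g (int m)" by simp
    then show ?thesis by (simp add: c_def sums_iff add.commute)
  qed
  have gneg: "fourier g (- int m) = cnj (c m)" for m
  proof -
    have "(\<lambda>z. cnj (g z)) = g" by (rule ext) (simp add: g_def mult.commute)
    then have "fourier g (- int m) = cnj (fourier g (int m))"
      using fourier_cnj[of g "- int m"] by simp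
    then show ?thesis by (simp add: gpos)
  qed
  have s: "(\<lambda>k. a k * fourier g (int n - int k)) sums fourier (\<lambda>z. ev a z * g z) (int n)"
    by (rule ev_fourier_mult[OF a gi])
  have "(\<lambda>z. complex_of_real ((cmod (ev a z))\<^sup>2) * ev a z) = (\<lambda>z. ev a z * g z)"
    unfolding g_def complex_norm_square by (rule ext) (simp only: mult_ac)
  then have "fourier (\<lambda>z. complex_of_real ((cmod (ev a z))\<^sup>2) * ev a z) (int n) = (\<Sum>k. a k * fourier g (int n - int k))"
    using s by (simp add: sums_iff)
  also have "\<dots> = (\<Sum>k. a (k + n) * fourier g (int n - int (k + n))) + (\<Sum>k<n. a k * fourier g (int n - int k))"
    using s by (intro suminf_split_initial_segment) (simp add: sums_iff)
  also have "(\<Sum>k. a (k + n) * fourier g (int n - int (k + n))) = (\<Sum>k. a (n + k) * cnj (c k))"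
    by (simp add: gneg add.commute)
  also have "(\<Sum>k<n. a k * fourier g (int n - int k)) = (\<Sum>k<n. a k * c (n - k))"
  proof (rule sum.cong[OF refl])
    fix k assume "k \<in> {..<n}"
    then have e: "int (n - k) = int n - int k" by (simp add: of_nat_diff)
    show "a k * fourier g (int n - int k) = a k * c (n - k)" unfolding e[symmetric] gpos ..
  qed
  finally show ?thesis .
qed

section \<open>Sobolev norms under geometric decay of the coefficients\<close>

lemma sobolev_plus:
  assumes w: "w \<in> plus_part L2" and s: "summable (\<lambda>k. (1 + (real k)\<^sup>2) powr s * (cmod (fourier w (int k)))\<^sup>2)"
  shows "w \<in> sobolev s" "sobolev_norm s w = sqrt (\<Sum>k. (1 + (real k)\<^sup>2) powr s * (cmod (fourier w (int k)))\<^sup>2)"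
proof -
  let ?f = "\<lambda>k::int. (1 + (of_int k)\<^sup>2) powr s * (cmod (fourier w k))\<^sup>2"
  let ?S = "\<Sum>k. (1 + (real k)\<^sup>2) powr s * (cmod (fourier w (int k)))\<^sup>2"
  have s1: "summable (\<lambda>k. norm ((?f \<circ> int) k))" using s by simp
  have s2: "summable (?f \<circ> int)" using s by (simp add: o_def)
  have "((?f \<circ> int) has_sum (\<Sum>k. (?f \<circ> int) k)) UNIV"
    by (rule norm_summable_imp_has_sum[OF s1 summable_sums[OF s2]])
  then have r: "(?f has_sum ?S) (range int)"
    by (subst has_sum_reindex) (auto simp: o_def)
  have "?f k = 0" if "k \<notin> range int" for k
  proof -
    have "k < 0"
    proof (rule ccontr)
      assume "\<not> k < 0"
      then have "k = int (nat k)" by simp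
      then show False using that by blast
    qed
    then show ?thesis using w by (simp add: plus_part_def)
  qed
  note z = this
  have "(?f has_sum ?S) (range int) \<longleftrightarrow> (?f has_sum ?S) UNIV"
    by (rule has_sum_cong_neutral) (simp_all add: z)
  with r have h: "(?f has_sum ?S) UNIV" by blast
  then show "w \<in> sobolev s" using w by (auto simp: sobolev_def plus_part_def summable_on_def)
  show "sobolev_norm s w = sqrt ?S" unfolding sobolev_norm_def using h by (simp add: infsumI)
qed

lemma H12_sobolev: "H12 w \<Longrightarrow> w \<in> plus_part (sobolev (1/2))"
proof -
  assume w: "H12 w"
  have "summable (\<lambda>k. (1 + (real k)\<^sup>2) powr (1/2) * (cmod (fourier w (int k)))\<^sup>2)"
  proof (rule summable_comparison_test'[where N=0])
    show "summable (\<lambda>k. (1 + real k) * (cmod (fourier w (int k)))\<^sup>2)" using w by (simp add: H12_def)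
    fix k
    have "(1 + (real k)\<^sup>2) powr (1/2) = sqrt (1 + (real k)\<^sup>2)" by (simp add: powr_half_sqrt)
    also have "\<dots> \<le> 1 + real k" by (rule real_le_lsqrt) (auto simp: power2_sum)
    finally show "norm ((1 + (real k)\<^sup>2) powr (1/2) * (cmod (fourier w (int k)))\<^sup>2) \<le> (1 + real k) * (cmod (fourier w (int k)))\<^sup>2"
      by (simp add: mult_right_mono)
  qed
  then show ?thesis using sobolev_plus(1)[of w "1/2"] w by (auto simp: H12_def plus_part_def)
qed

text \<open>With \<open>M\<close> even and s <= M/2, (1 + k^2)^s is at most (1 + k)^M. Writing q =
  y^M reduces the claim to the boundedness of k y^k.\<close>

lemma poly_geometric_bounded:
  fixes q :: real
  assumes "0 < q" "q < 1"
  shows "\<exists>B. \<forall>k. (1 + (real k)\<^sup>2) powr s * q ^ k \<le> B"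
proof -
  obtain m :: nat where "s \<le> real m" using real_arch_simple by blast
  define M where "M = 2 * Suc m"
  have M: "M > 0" by (simp add: M_def)
  define y where "y = root M q"
  have y: "0 < y" "y < 1" using assms M by (simp_all add: y_def)
  have yM: "y ^ M = q" unfolding y_def by (rule real_root_pow_pos[OF M assms(1)])
  have "(\<lambda>k. of_nat k * y ^ k) \<longlonglongrightarrow> 0" using y by (intro powser_times_n_limit_0) simp
  then have "Bseq (\<lambda>k. real k * y ^ k)" by (intro convergent_imp_Bseq convergentI)
  then obtain B where B: "\<And>k. norm (real k * y ^ k) \<le> B" unfolding Bseq_def by blast
  have "(1 + (real k)\<^sup>2) powr s * q ^ k \<le> (B + 1) ^ M" for k
  proof -
    have "(1 + (real k)\<^sup>2) powr s \<le> (1 + (real k)\<^sup>2) powr real (Suc m)"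
      using \<open>s \<le> real m\<close> by (intro powr_mono) auto
    also have "\<dots> = (1 + (real k)\<^sup>2) ^ Suc m" by (rule powr_realpow) (simp add: add_pos_nonneg)
    also have "\<dots> \<le> ((1 + real k)\<^sup>2) ^ Suc m"
      by (intro power_mono) (auto simp: power2_sum)
    also have "\<dots> = (1 + real k) ^ M" by (simp only: power_mult[symmetric] M_def)
    finally have "(1 + (real k)\<^sup>2) powr s * q ^ k \<le> (1 + real k) ^ M * q ^ k"
      by (rule mult_right_mono) (use assms in simp)
    also have "(1 + real k) ^ M * q ^ k = (y ^ k + real k * y ^ k) ^ M"
    proof -
      have "q ^ k = (y ^ k) ^ M" unfolding yM[symmetric] by (simp only: power_mult[symmetric] mult.commute)
      then show ?thesis by (simp only: power_mult_distrib[symmetric] distrib_right mult_1)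
    qed
    also have "\<dots> \<le> (1 + B) ^ M"
    proof (intro power_mono add_mono)
      show "y ^ k \<le> 1" using y by (intro power_le_one) auto
      show "real k * y ^ k \<le> B" using B[of k] unfolding real_norm_def by linarith
      show "0 \<le> y ^ k + real k * y ^ k" using y by simp
    qed
    finally show ?thesis by (simp add: add.commute)
  qed
  then show ?thesis by blast
qed

lemma poly_geometric_summable:
  fixes q :: real
  assumes q: "0 < q" "q < 1"
  shows "summable (\<lambda>k. (1 + (real k)\<^sup>2) powr s * (q ^ k)\<^sup>2)"
proof -
  obtain B where B: "\<And>k. (1 + (real k)\<^sup>2) powr s * q ^ k \<le> B" using poly_geometric_bounded[OF q] by blast
  show ?thesis
  proof (rule summable_comparison_test'[where N=0])
    show "summable (\<lambda>k. B * q ^ k)" using q by (intro summable_mult summable_geometric) auto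
    fix k
    have "(1 + (real k)\<^sup>2) powr s * q ^ k * q ^ k \<le> B * q ^ k" using q by (intro mult_right_mono B) auto
    then show "norm ((1 + (real k)\<^sup>2) powr s * (q ^ k)\<^sup>2) \<le> B * q ^ k"
      using q by (simp add: power2_eq_square mult.assoc)
  qed
qed

lemma sobolev_bounded_of_decay:
  assumes u: "\<And>t. u t \<in> plus_part L2" and q: "0 < q" "q < 1"
    and le: "\<And>t k. cmod (fourier (u t) (int k)) \<le> K * q ^ k"
  shows "sobolev_bounded s u"
proof -
  let ?w = "\<lambda>k. (1 + (real k)\<^sup>2) powr s"
  have "summable (\<lambda>k. K\<^sup>2 * (?w k * (q ^ k)\<^sup>2))" by (intro summable_mult poly_geometric_summable q)
  then have sK: "summable (\<lambda>k. ?w k * (K * q ^ k)\<^sup>2)" by (simp add: power_mult_distrib mult_ac)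
  have le2: "?w k * (cmod (fourier (u t) (int k)))\<^sup>2 \<le> ?w k * (K * q ^ k)\<^sup>2" for t k
    by (intro mult_left_mono power_mono le) auto
  have su: "summable (\<lambda>k. ?w k * (cmod (fourier (u t) (int k)))\<^sup>2)" for t
    by (rule summable_comparison_test'[OF sK, of 0]) (use le2 in auto)
  have "sobolev_norm s (u t) \<le> sqrt (\<Sum>k. ?w k * (K * q ^ k)\<^sup>2)" for t
    unfolding sobolev_plus(2)[OF u su] by (intro real_sqrt_le_mono suminf_le le2 su sK)
  then have "bdd_above (range (\<lambda>t. sobolev_norm s (u t)))" by (rule bdd_aboveI2)
  then show ?thesis
    unfolding sobolev_bounded_def by (intro conjI allI sobolev_plus(1)[OF u su])
qed

section \<open>Uniqueness from an L2 estimate of the difference of two solutions\<close>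

definition szego_rhs :: "(nat \<Rightarrow> complex) \<Rightarrow> nat \<Rightarrow> complex" where
  "szego_rhs a n = (\<Sum>k. a (n + k) * cnj (\<Sum>j. a (k + j) * cnj (a j))) + (\<Sum>k<n. a k * (\<Sum>j. a (n - k + j) * cnj (a j)))"

text \<open>Split |u|^2 u - |v|^2 v as |u|^2 w + (|u|^2 - |v|^2) v with w = u - v. The first part
  pairs with w to a real number and leaves the imaginary part; in the second only \<open>v\<close>
  has to be bounded. The resulting cubic term in |w| is shared between the second and fourth
  powers.\<close>

lemma cubic_difference_bound:
  fixes u v :: complex
  assumes v: "cmod v \<le> S"
  shows "\<bar>Im ((u - v) * cnj (complex_of_real ((cmod u)\<^sup>2) * u - complex_of_real ((cmod v)\<^sup>2) * v))\<bar>
    \<le> (S / 2 + 2 * S\<^sup>2) * (cmod (u - v))\<^sup>2 + S / 2 * (cmod (u - v)) ^ 4"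
proof -
  let ?w = "u - v"
  let ?d = "(cmod u)\<^sup>2 - (cmod v)\<^sup>2"
  have S: "0 \<le> S" using v norm_ge_zero order_trans by blast
  have "complex_of_real ((cmod u)\<^sup>2) * u - complex_of_real ((cmod v)\<^sup>2) * v =
      complex_of_real ((cmod u)\<^sup>2) * ?w + complex_of_real ?d * v"
    by (simp add: algebra_simps)
  then have "?w * cnj (complex_of_real ((cmod u)\<^sup>2) * u - complex_of_real ((cmod v)\<^sup>2) * v) =
      complex_of_real ((cmod u)\<^sup>2) * (?w * cnj ?w) + complex_of_real ?d * (?w * cnj v)"
    by (simp only: complex_cnj_add complex_cnj_mult complex_cnj_complex_of_real) (simp add: algebra_simps)
  also have "?w * cnj ?w = complex_of_real ((cmod ?w)\<^sup>2)" by (rule complex_norm_square[symmetric])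
  finally have e: "?w * cnj (complex_of_real ((cmod u)\<^sup>2) * u - complex_of_real ((cmod v)\<^sup>2) * v) =
      complex_of_real ((cmod u)\<^sup>2) * complex_of_real ((cmod ?w)\<^sup>2) + complex_of_real ?d * (?w * cnj v)" .
  have g: "Im (complex_of_real a * complex_of_real b + complex_of_real d * y) = d * Im y" for a b d y by simp
  have "Im (?w * cnj (complex_of_real ((cmod u)\<^sup>2) * u - complex_of_real ((cmod v)\<^sup>2) * v)) = ?d * Im (?w * cnj v)"
    unfolding e g ..
  then have "\<bar>Im (?w * cnj (complex_of_real ((cmod u)\<^sup>2) * u - complex_of_real ((cmod v)\<^sup>2) * v))\<bar> = \<bar>?d\<bar> * \<bar>Im (?w * cnj v)\<bar>"
    by (simp only: abs_mult)
  also have "\<dots> \<le> (cmod ?w * (cmod ?w + 2 * S)) * (cmod ?w * S)"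
  proof (rule mult_mono)
    have "?d = (cmod u - cmod v) * (cmod u + cmod v)" by (simp add: power2_eq_square algebra_simps)
    then have "\<bar>?d\<bar> = \<bar>cmod u - cmod v\<bar> * (cmod u + cmod v)" by (simp add: abs_mult)
    also have "\<dots> \<le> cmod ?w * (cmod ?w + 2 * S)"
    proof (rule mult_mono)
      show "\<bar>cmod u - cmod v\<bar> \<le> cmod ?w" by (rule norm_triangle_ineq3)
      have "cmod u \<le> cmod ?w + cmod v" using norm_triangle_ineq[of ?w v] by simp
      then show "cmod u + cmod v \<le> cmod ?w + 2 * S" using v by linarith
    qed auto
    finally show "\<bar>?d\<bar> \<le> cmod ?w * (cmod ?w + 2 * S)" .
    have "\<bar>Im (?w * cnj v)\<bar> \<le> cmod (?w * cnj v)" by (rule abs_Im_le_cmod)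
    also have "\<dots> \<le> cmod ?w * S" unfolding norm_mult complex_mod_cnj by (intro mult_left_mono v) simp
    finally show "\<bar>Im (?w * cnj v)\<bar> \<le> cmod ?w * S" .
  qed (use S in auto)
  also have "\<dots> = S * (cmod ?w) ^ 3 + 2 * S\<^sup>2 * (cmod ?w)\<^sup>2"
    by (simp add: power2_eq_square power3_eq_cube algebra_simps)
  also have "\<dots> \<le> S * (((cmod ?w)\<^sup>2 + (cmod ?w) ^ 4) / 2) + 2 * S\<^sup>2 * (cmod ?w)\<^sup>2"
  proof (intro add_right_mono mult_left_mono S)
    have "0 \<le> (cmod ?w)\<^sup>2 * (cmod ?w - 1)\<^sup>2" by simp
    then show "(cmod ?w) ^ 3 \<le> ((cmod ?w)\<^sup>2 + (cmod ?w) ^ 4) / 2"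
      by (simp add: power2_eq_square eval_nat_numeral algebra_simps)
  qed
  also have "\<dots> = (S / 2 + 2 * S\<^sup>2) * (cmod ?w)\<^sup>2 + S / 2 * (cmod ?w) ^ 4" by (simp add: algebra_simps)
  finally show ?thesis .
qed

text \<open>\<open>H12_L4_L6\<close> trades the fourth power of the difference for its energy times
  the squared L2 norm, so the bound becomes linear in the latter.\<close>

lemma Im_cubic_le:
  assumes u: "H12 u" and V: "H12 V" "\<And>z. cmod (V z) \<le> S"
  defines "w \<equiv> \<lambda>z. u z - V z"
  defines "\<Phi> \<equiv> \<lambda>z. complex_of_real ((cmod (u z))\<^sup>2) * u z - complex_of_real ((cmod (V z))\<^sup>2) * V z"
  shows "\<bar>Im (cinner w \<Phi>)\<bar> \<le> (S / 2 + 2 * S\<^sup>2 + S * energy w) * (\<integral>z. (cmod (w z))\<^sup>2 \<partial>circle)"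
proof -
  have w: "H12 w" unfolding w_def by (rule energy_triangle(1)[OF u V(1)])
  have PL: "\<Phi> \<in> L2" unfolding \<Phi>_def by (rule L2_diff[OF H12_cubic_L2(1)[OF u] H12_cubic_L2(1)[OF V(1)]])
  have S: "0 \<le> S" using V(2)[of 0] norm_ge_zero order_trans by blast
  have int: "integrable circle (\<lambda>z. w z * cnj (\<Phi> z))" by (rule L2_mult_integrable[OF H12_L2[OF w] PL])
  have i2: "integrable circle (\<lambda>z. (cmod (w z))\<^sup>2)" using H12_L2[OF w] by (rule L2_D)
  have i4: "integrable circle (\<lambda>z. (cmod (w z)) ^ 4)" by (rule H12_L4_L6(1)[OF w])
  have "\<bar>Im (cinner w \<Phi>)\<bar> = \<bar>\<integral>z. Im (w z * cnj (\<Phi> z)) \<partial>circle\<bar>"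
    unfolding cinner_def using integral_Im[OF int] by simp
  also have "\<dots> \<le> (\<integral>z. \<bar>Im (w z * cnj (\<Phi> z))\<bar> \<partial>circle)"
    using integral_norm_bound[of circle "\<lambda>z. Im (w z * cnj (\<Phi> z))"] unfolding real_norm_def .
  also have "\<dots> \<le> (\<integral>z. (S / 2 + 2 * S\<^sup>2) * (cmod (w z))\<^sup>2 + S / 2 * (cmod (w z)) ^ 4 \<partial>circle)"
  proof (rule integral_mono)
    show "integrable circle (\<lambda>z. \<bar>Im (w z * cnj (\<Phi> z))\<bar>)" by (intro integrable_abs integrable_Im int)
    show "integrable circle (\<lambda>z. (S / 2 + 2 * S\<^sup>2) * (cmod (w z))\<^sup>2 + S / 2 * (cmod (w z)) ^ 4)"
      by (intro Bochner_Integration.integrable_add integrable_mult_right i2 i4)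
    show "\<bar>Im (w z * cnj (\<Phi> z))\<bar> \<le> (S / 2 + 2 * S\<^sup>2) * (cmod (w z))\<^sup>2 + S / 2 * (cmod (w z)) ^ 4" for z
      unfolding w_def \<Phi>_def by (rule cubic_difference_bound[OF V(2)])
  qed
  also have "\<dots> = (S / 2 + 2 * S\<^sup>2) * (\<integral>z. (cmod (w z))\<^sup>2 \<partial>circle) + S / 2 * (\<integral>z. (cmod (w z)) ^ 4 \<partial>circle)"
    by (subst Bochner_Integration.integral_add) (auto intro!: integrable_mult_right i2 i4)
  also have "\<dots> \<le> (S / 2 + 2 * S\<^sup>2) * (\<integral>z. (cmod (w z))\<^sup>2 \<partial>circle) + S / 2 * (2 * (\<integral>z. (cmod (w z))\<^sup>2 \<partial>circle) * energy w)"
    using S by (intro add_left_mono mult_left_mono H12_L4_L6(2)[OF w]) simp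
  also have "\<dots> = (S / 2 + 2 * S\<^sup>2 + S * energy w) * (\<integral>z. (cmod (w z))\<^sup>2 \<partial>circle)" by (simp add: algebra_simps)
  finally show ?thesis .
qed

lemma locally_bounded_compact:
  fixes f :: "real \<Rightarrow> real"
  assumes "\<And>t. \<exists>d>0. \<exists>B. \<forall>s. \<bar>s - t\<bar> < d \<longrightarrow> f s \<le> B"
  shows "\<exists>B. \<forall>t\<in>{a..b}. f t \<le> B"
proof -
  obtain d B where d: "\<And>t. d t > 0" and B: "\<And>t s. \<bar>s - t\<bar> < d t \<Longrightarrow> f s \<le> B t"
    using assms by metis
  have "compact {a..b}" by simp
  moreover have "\<And>t. t \<in> {a..b} \<Longrightarrow> open (ball t (d t))" by simp
  moreover have "{a..b} \<subseteq> (\<Union>t\<in>{a..b}. ball t (d t))" using d by force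
  ultimately obtain C where C: "C \<subseteq> {a..b}" "finite C" "{a..b} \<subseteq> (\<Union>t\<in>C. ball t (d t))"
    by (rule compactE_image)
  have "f t \<le> (\<Sum>c\<in>C. \<bar>B c\<bar>)" if "t \<in> {a..b}" for t
  proof -
    obtain c where c: "c \<in> C" "t \<in> ball c (d c)" using C(3) \<open>t \<in> {a..b}\<close> by blast
    have "f t \<le> B c" using c(2) by (intro B) (simp add: dist_real_def abs_minus_commute)
    also have "\<dots> \<le> \<bar>B c\<bar>" by simp
    also have "\<dots> \<le> (\<Sum>c\<in>C. \<bar>B c\<bar>)" using C(2) c(1) by (intro member_le_sum) auto
    finally show ?thesis .
  qed
  then show ?thesis by blast
qed

text \<open>\<open>szego_solution\<close> states continuity at each time separately: this bounds the
  energy near every time, and compactness extends the bound to an interval.\<close>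

lemma solution_energy_bounded:
  assumes sol: "szego_solution u"
  shows "\<exists>B. \<forall>t\<in>{a..b}. energy (u t) \<le> B"
proof (rule locally_bounded_compact)
  fix t
  have up: "H12 (u s)" for s using sol by (intro sobolev_half_H12) (simp add: szego_solution_def)
  have "((\<lambda>\<tau>. sobolev_norm (1/2) (\<lambda>z. u \<tau> z - u t z)) \<longlongrightarrow> 0) (at t)"
    using sol by (simp add: szego_solution_def)
  then have "\<forall>\<^sub>F \<tau> in at t. dist (sobolev_norm (1/2) (\<lambda>z. u \<tau> z - u t z)) 0 < 1"
    by (rule tendstoD) simp
  then obtain d where d: "d > 0" and lt: "\<And>\<tau>. \<tau> \<noteq> t \<Longrightarrow> dist \<tau> t < d \<Longrightarrow> dist (sobolev_norm (1/2) (\<lambda>z. u \<tau> z - u t z)) 0 < 1"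
    unfolding eventually_at by auto
  \<comment> \<open>The difference to \<open>u t\<close> has Sobolev norm below 1, hence energy at
    most 2; doubled by \<open>energy_triangle\<close> this is the 4.\<close>
  have "energy (u s) \<le> 4 + 2 * energy (u t)" if "\<bar>s - t\<bar> < d" for s
  proof (cases "s = t")
    case True then show ?thesis using energy_nonneg[OF up[of t]] by simp
  next
    case False
    let ?w = "\<lambda>z. u s z - u t z"
    have w: "H12 ?w" by (rule energy_triangle(1)[OF up up])
    have "\<bar>sobolev_norm (1/2) ?w\<bar> < 1" using lt[OF False] that by (simp add: dist_real_def)
    then have "(sobolev_norm (1/2) ?w)\<^sup>2 \<le> 1" by (simp add: abs_square_le_1)
    then have "energy ?w \<le> 2" using sobolev_half_H12(2)[OF H12_sobolev[OF w]] by linarith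
    then show ?thesis using energy_triangle(2)[OF up[of s] up[of t]] by linarith
  qed
  then show "\<exists>d>0. \<exists>B. \<forall>s. \<bar>s - t\<bar> < d \<longrightarrow> energy (u s) \<le> B" using d by blast
qed

lemma norm_sq_deriv:
  fixes f :: "real \<Rightarrow> complex"
  assumes "(f has_vector_derivative f') (at t)"
  shows "((\<lambda>t. (cmod (f t))\<^sup>2) has_real_derivative 2 * Re (cnj (f t) * f')) (at t)"
proof -
  have "((\<lambda>t. f t \<bullet> f t) has_vector_derivative (f t \<bullet> f' + f' \<bullet> f t)) (at t)"
    by (rule bounded_bilinear.has_vector_derivative[OF bounded_bilinear_inner assms assms])
  moreover have "f t \<bullet> f' + f' \<bullet> f t = 2 * Re (cnj (f t) * f')" by (simp add: inner_complex_def)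
  ultimately show ?thesis
    by (simp only: dot_square_norm has_real_derivative_iff_has_vector_derivative)
qed

text \<open>The decaying coefficients \<open>v\<close> sum to a bounded function \<open>V\<close> of
  finite energy, which is the strong solution. Gronwall's inequality is applied to the squared L2
  norm of its difference from \<open>u\<close>, approximated by finitely many coefficients.\<close>

theorem weak_strong_uniqueness:
  assumes sol: "szego_solution u"
    and q: "0 < q" "q < 1" and vle: "\<And>t k. cmod (v t k) \<le> K * q ^ k"
    and vder: "\<And>t n. ((\<lambda>t. v t n) has_vector_derivative - \<i> * szego_rhs (v t) n) (at t)"
    and init: "\<And>k. fourier (u 0) (int k) = v 0 k"
  shows "fourier (u t) (int k) = v t k"
proof -
  have K: "0 \<le> K" using order_trans[OF norm_ge_zero vle[of 0 0]] by simp
  have sg: "summable (\<lambda>k. K * q ^ k)" using q by (intro summable_mult summable_geometric) simp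
  have sv: "summable (\<lambda>k. cmod (v t k))" for t
    by (rule summable_comparison_test'[OF sg, of 0]) (use vle in auto)
  define S where "S = (\<Sum>k. K * q ^ k)"
  define V where "V t = ev (v t)" for t
  have VS: "cmod (V t z) \<le> S" for t z
  proof -
    have "cmod (V t z) \<le> (\<Sum>k. cmod (v t k))" unfolding V_def by (rule ev_bound[OF sv])
    also have "\<dots> \<le> S" unfolding S_def by (rule suminf_le[OF vle sv sg])
    finally show ?thesis .
  qed
  have fV: "fourier (V t) (int k) = v t k" for t k unfolding V_def by (simp add: fourier_ev[OF sv])
  have "summable (\<lambda>k. K\<^sup>2 * 2 * ((1 + (real k)\<^sup>2) powr 1 * (q ^ k)\<^sup>2))"
    by (intro summable_mult poly_geometric_summable q)
  note s1 = this
  let ?E = "\<lambda>k. K\<^sup>2 * 2 * ((1 + (real k)\<^sup>2) powr 1 * (q ^ k)\<^sup>2)"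
  have Ele: "(1 + real k) * (cmod (fourier (V t) (int k)))\<^sup>2 \<le> ?E k" for t k
  proof -
    have "0 \<le> (real k - 1)\<^sup>2" by simp
    then have "2 * real k \<le> (real k)\<^sup>2 + 1" by (simp add: power2_eq_square algebra_simps)
    moreover have "1 + x \<le> 2 * (1 + z)" if "2 * x \<le> z + 1" "0 \<le> z" for x z :: real using that by argo
    ultimately have a: "1 + real k \<le> 2 * (1 + (real k)\<^sup>2)" using zero_le_power2[of "real k"] by blast
    have "(cmod (v t k))\<^sup>2 \<le> (K * q ^ k)\<^sup>2" by (rule power_mono[OF vle]) simp
    then have "(1 + real k) * (cmod (v t k))\<^sup>2 \<le> (2 * (1 + (real k)\<^sup>2)) * (K * q ^ k)\<^sup>2"
      by (rule mult_mono[OF a]) simp_all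
    also have "\<dots> = ?E k"
    proof -
      have "(1 + (real k)\<^sup>2) powr 1 = 1 + (real k)\<^sup>2" by (rule powr_one) simp
      then show ?thesis by (simp only: power_mult_distrib mult_ac)
    qed
    finally show ?thesis unfolding fV .
  qed
  have HV: "H12 (V t)" for t
  proof -
    have "summable (\<lambda>k. (1 + real k) * (cmod (fourier (V t) (int k)))\<^sup>2)"
      by (rule summable_comparison_test'[OF s1, of 0]) (use Ele in auto)
    moreover have "V t \<in> plus_part L2"
      unfolding V_def plus_part_def using ev_L2[OF sv] by (auto simp: fourier_ev[OF sv])
    ultimately show ?thesis by (simp add: H12_def)
  qed
  define EV where "EV = (\<Sum>k. ?E k)"
  have EV: "energy (V t) \<le> EV" for t
    unfolding energy_def EV_def by (rule suminf_le[OF Ele _ s1]) (use HV[of t] in \<open>simp add: H12_def\<close>)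
  have Hu: "H12 (u s)" for s using sol by (intro sobolev_half_H12) (simp add: szego_solution_def)
  define w where "w t = (\<lambda>z. u t z - V t z)" for t
  define \<Phi> where "\<Phi> t = (\<lambda>z. complex_of_real ((cmod (u t z))\<^sup>2) * u t z - complex_of_real ((cmod (V t z))\<^sup>2) * V t z)" for t
  have Hw: "H12 (w t)" for t unfolding w_def by (rule energy_triangle(1)[OF Hu HV])
  have wL: "w t \<in> plus_part L2" for t using Hw by (simp add: H12_def)
  have PL: "\<Phi> t \<in> L2" for t
    unfolding \<Phi>_def by (rule L2_diff[OF H12_cubic_L2(1)[OF Hu] H12_cubic_L2(1)[OF HV]])
  have fw: "fourier (w t) (int k) = fourier (u t) (int k) - v t k" for t k
    unfolding w_def fourier_diff[OF H12_L2[OF Hu] H12_L2[OF HV]] fV ..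
  have fP: "fourier (\<Phi> t) (int k) = fourier (szego_proj (\<lambda>z. complex_of_real ((cmod (u t z))\<^sup>2) * u t z)) (int k) - szego_rhs (v t) k" for t k
  proof -
    have "fourier (\<lambda>z. complex_of_real ((cmod (V t z))\<^sup>2) * V t z) (int k) = szego_rhs (v t) k"
      unfolding V_def szego_rhs_def by (rule fourier_ev_cubic[OF sv])
    moreover have "fourier (szego_proj (\<lambda>z. complex_of_real ((cmod (u t z))\<^sup>2) * u t z)) (int k) =
        fourier (\<lambda>z. complex_of_real ((cmod (u t z))\<^sup>2) * u t z) (int k)"
      by (rule szego_proj_L2(2)[OF H12_cubic_L2(1)[OF Hu]]) simp
    ultimately show ?thesis
      unfolding \<Phi>_def fourier_diff[OF H12_cubic_L2(1)[OF Hu] H12_cubic_L2(1)[OF HV]] by simp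
  qed
  have wder: "((\<lambda>t. fourier (w t) (int k)) has_vector_derivative - \<i> * fourier (\<Phi> t) (int k)) (at t)" for t k
  proof -
    have "((\<lambda>\<tau>. \<i> * fourier (u \<tau>) (int k)) has_vector_derivative
        fourier (szego_proj (\<lambda>z. complex_of_real ((cmod (u t z))\<^sup>2) * u t z)) (int k)) (at t)"
      using sol by (simp add: szego_solution_def)
    then have "((\<lambda>\<tau>. - \<i> * (\<i> * fourier (u \<tau>) (int k))) has_vector_derivative
        - \<i> * fourier (szego_proj (\<lambda>z. complex_of_real ((cmod (u t z))\<^sup>2) * u t z)) (int k)) (at t)"
      by (rule has_vector_derivative_mult_right)
    then have "((\<lambda>\<tau>. fourier (u \<tau>) (int k)) has_vector_derivative
        - \<i> * fourier (szego_proj (\<lambda>z. complex_of_real ((cmod (u t z))\<^sup>2) * u t z)) (int k)) (at t)"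
      by (simp add: mult.assoc[symmetric])
    from has_vector_derivative_diff[OF this vder[of k t]]
    show ?thesis unfolding fw fP by (simp only: right_diff_distrib)
  qed
  define y where "y t = (\<integral>z. (cmod (w t z))\<^sup>2 \<partial>circle)" for t
  have ysums: "(\<lambda>k. (cmod (fourier (w t) (int k)))\<^sup>2) sums y t" for t
    unfolding y_def by (rule parseval_norm[OF wL])
  \<comment> \<open>The sign treats both time directions at once: \<open>\<sigma> * s\<close> runs
    over [0, R] or [- R, 0].\<close>
  have y0: "y (\<sigma> * R) = 0" if \<sigma>: "\<sigma> = 1 \<or> \<sigma> = -1" and R: "0 \<le> R" for \<sigma> R :: real
  proof -
    obtain B where B: "\<And>t. t \<in> {- R..R} \<Longrightarrow> energy (u t) \<le> B"
      using solution_energy_bounded[OF sol, of "- R" R] by blast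
    define D where "D = 2 * B + 2 * EV"
    have in_R: "\<sigma> * s \<in> {- R..R}" if "s \<in> {0..R}" for s using that \<sigma> by auto
    have Ew: "energy (w (\<sigma> * s)) \<le> D" if "s \<in> {0..R}" for s
    proof -
      have "energy (w (\<sigma> * s)) \<le> 2 * energy (u (\<sigma> * s)) + 2 * energy (V (\<sigma> * s))"
        unfolding w_def by (rule energy_triangle(3)[OF Hu HV])
      then show ?thesis using B[OF in_R[OF that]] EV[of "\<sigma> * s"] by (simp add: D_def)
    qed
    \<comment> \<open>The sixth moments enter here: they bound the derivatives of the finite sums
      uniformly, as \<open>gronwall_limit\<close> demands.\<close>
    define P where "P t = (\<integral>z. (cmod (\<Phi> t z))\<^sup>2 \<partial>circle)" for t
    have Pb: "P (\<sigma> * s) \<le> 2 * (12 * B ^ 3) + 2 * (12 * EV ^ 3)" if "s \<in> {0..R}" for s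
    proof -
      let ?t = "\<sigma> * s"
      let ?f = "\<lambda>z. complex_of_real ((cmod (u ?t z))\<^sup>2) * u ?t z" and ?g = "\<lambda>z. complex_of_real ((cmod (V ?t z))\<^sup>2) * V ?t z"
      have fi: "integrable circle (\<lambda>z. (cmod (?f z))\<^sup>2)" and gi: "integrable circle (\<lambda>z. (cmod (?g z))\<^sup>2)"
        by (rule L2_D(2)[OF H12_cubic_L2(1)[OF Hu]], rule L2_D(2)[OF H12_cubic_L2(1)[OF HV]])
      have "P ?t \<le> (\<integral>z. 2 * (cmod (?f z))\<^sup>2 + 2 * (cmod (?g z))\<^sup>2 \<partial>circle)"
        unfolding P_def
      proof (rule integral_mono)
        show "integrable circle (\<lambda>z. (cmod (\<Phi> ?t z))\<^sup>2)" by (rule L2_D(2)[OF PL])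
        show "integrable circle (\<lambda>z. 2 * (cmod (?f z))\<^sup>2 + 2 * (cmod (?g z))\<^sup>2)"
          by (intro Bochner_Integration.integrable_add integrable_mult_right fi gi)
        fix z
        have "(cmod (\<Phi> ?t z))\<^sup>2 \<le> (cmod (?f z) + cmod (?g z))\<^sup>2"
          unfolding \<Phi>_def by (intro power_mono norm_triangle_ineq4) simp
        also have "\<dots> \<le> 2 * (cmod (?f z))\<^sup>2 + 2 * (cmod (?g z))\<^sup>2"
          using sum_squares_bound[of "cmod (?f z)" "cmod (?g z)"] by (simp only: power2_sum)
        finally show "(cmod (\<Phi> ?t z))\<^sup>2 \<le> 2 * (cmod (?f z))\<^sup>2 + 2 * (cmod (?g z))\<^sup>2" .
      qed
      also have "\<dots> = 2 * (\<integral>z. (cmod (?f z))\<^sup>2 \<partial>circle) + 2 * (\<integral>z. (cmod (?g z))\<^sup>2 \<partial>circle)"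
        by (simp only: Bochner_Integration.integral_add[OF integrable_mult_right[OF fi] integrable_mult_right[OF gi]]
            Bochner_Integration.integral_mult_right_zero)
      also have "\<dots> \<le> 2 * (12 * B ^ 3) + 2 * (12 * EV ^ 3)"
      proof (intro add_mono mult_left_mono)
        show "(\<integral>z. (cmod (?f z))\<^sup>2 \<partial>circle) \<le> 12 * B ^ 3"
          by (rule order_trans[OF H12_cubic_L2(2)[OF Hu]])
            (intro mult_left_mono power_mono B in_R that energy_nonneg[OF Hu], simp)
        show "(\<integral>z. (cmod (?g z))\<^sup>2 \<partial>circle) \<le> 12 * EV ^ 3"
          by (rule order_trans[OF H12_cubic_L2(2)[OF HV]])
            (intro mult_left_mono power_mono EV energy_nonneg[OF HV], simp)
      qed simp_all
      finally show ?thesis .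
    qed
    have yE: "y t \<le> energy (w t)" for t
    proof -
      have "(\<Sum>k. (cmod (fourier (w t) (int k)))\<^sup>2) \<le> energy (w t)"
        unfolding energy_def
      proof (rule suminf_le)
        show "(cmod (fourier (w t) (int k)))\<^sup>2 \<le> (1 + real k) * (cmod (fourier (w t) (int k)))\<^sup>2" for k
          by (simp add: distrib_right)
      qed (use ysums[of t] Hw[of t] in \<open>simp_all add: sums_iff H12_def\<close>)
      then show ?thesis using ysums[of t] by (simp add: sums_iff)
    qed
    define x where "x k t = fourier (w t) (int k)" for k t
    define \<phi> where "\<phi> k t = fourier (\<Phi> t) (int k)" for k t
    define g where "g n s = (\<Sum>k<n. (cmod (x k (\<sigma> * s)))\<^sup>2)" for n s
    define G where "G n s = \<sigma> * (\<Sum>k<n. 2 * Re (cnj (x k (\<sigma> * s)) * (- \<i> * \<phi> k (\<sigma> * s))))" for n s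
    have xder: "((\<lambda>t. (cmod (x k t))\<^sup>2) has_real_derivative 2 * Re (cnj (x k t) * (- \<i> * \<phi> k t))) (at t)" for k t
      unfolding x_def \<phi>_def by (rule norm_sq_deriv[OF wder])
    have gder: "(g n has_real_derivative G n s) (at s)" for n s
    proof -
      have "((\<lambda>t. \<Sum>k<n. (cmod (x k t))\<^sup>2) has_real_derivative (\<Sum>k<n. 2 * Re (cnj (x k (\<sigma> * s)) * (- \<i> * \<phi> k (\<sigma> * s))))) (at (\<sigma> * s))"
        by (intro DERIV_sum xder)
      moreover have "((\<lambda>s. \<sigma> * s) has_real_derivative \<sigma>) (at s)" by (auto intro!: derivative_eq_intros)
      ultimately have "((\<lambda>s. \<Sum>k<n. (cmod (x k (\<sigma> * s)))\<^sup>2) has_real_derivative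
          (\<Sum>k<n. 2 * Re (cnj (x k (\<sigma> * s)) * (- \<i> * \<phi> k (\<sigma> * s)))) * \<sigma>) (at s)"
        by (rule DERIV_chain2)
      then show ?thesis unfolding g_def[abs_def] G_def by (simp only: mult.commute)
    qed
    have ReIm: "2 * Re (cnj x * (- \<i> * p)) = - 2 * Im (x * cnj p)" for x p by simp
    have lim: "(\<lambda>n. G n s) \<longlonglongrightarrow> \<sigma> * (- 2 * Im (cinner (w (\<sigma> * s)) (\<Phi> (\<sigma> * s))))" for s
    proof -
      have "(\<lambda>k. x k (\<sigma> * s) * cnj (\<phi> k (\<sigma> * s))) sums cinner (w (\<sigma> * s)) (\<Phi> (\<sigma> * s))"
        unfolding x_def \<phi>_def by (rule parseval[OF wL PL])
      then have "(\<lambda>k. Im (x k (\<sigma> * s) * cnj (\<phi> k (\<sigma> * s)))) sums Im (cinner (w (\<sigma> * s)) (\<Phi> (\<sigma> * s)))"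
        by (rule sums_Im)
      then have "(\<lambda>n. \<Sum>k<n. Im (x k (\<sigma> * s) * cnj (\<phi> k (\<sigma> * s)))) \<longlonglongrightarrow> Im (cinner (w (\<sigma> * s)) (\<Phi> (\<sigma> * s)))"
        unfolding sums_def .
      then have "(\<lambda>n. \<sigma> * (- 2 * (\<Sum>k<n. Im (x k (\<sigma> * s) * cnj (\<phi> k (\<sigma> * s)))))) \<longlonglongrightarrow> \<sigma> * (- 2 * Im (cinner (w (\<sigma> * s)) (\<Phi> (\<sigma> * s))))"
        by (intro tendsto_mult tendsto_const)
      then show ?thesis unfolding G_def ReIm sum_distrib_left[symmetric] .
    qed
    have abs\<sigma>: "\<bar>\<sigma> * r\<bar> = \<bar>r\<bar>" for r using \<sigma> by (auto simp: abs_mult)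
    have "y (\<sigma> * R) = 0"
    proof (rule gronwall_limit[OF R, of g G "D + (2 * (12 * B ^ 3) + 2 * (12 * EV ^ 3))" "\<lambda>s. y (\<sigma> * s)"
          "\<lambda>s. \<sigma> * (- 2 * Im (cinner (w (\<sigma> * s)) (\<Phi> (\<sigma> * s))))" "2 * (S / 2 + 2 * S\<^sup>2 + S * D)"])
      show "(g n has_real_derivative G n s) (at s)" for n s by (rule gder)
      show "g n 0 = 0" for n unfolding g_def x_def fw by (simp add: init)
      show "(\<lambda>n. g n s) \<longlonglongrightarrow> y (\<sigma> * s)" for s
        unfolding g_def x_def using ysums[of "\<sigma> * s"] unfolding sums_def .
      show "(\<lambda>n. G n s) \<longlonglongrightarrow> \<sigma> * (- 2 * Im (cinner (w (\<sigma> * s)) (\<Phi> (\<sigma> * s))))" for s by (rule lim)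
      show "0 \<le> y (\<sigma> * s)" for s by (simp add: y_def)
      fix s assume s: "s \<in> {0..R}"
      let ?t = "\<sigma> * s"
      have "\<bar>\<sigma> * (- 2 * Im (cinner (w ?t) (\<Phi> ?t)))\<bar> = 2 * \<bar>Im (cinner (w ?t) (\<Phi> ?t))\<bar>"
        unfolding abs\<sigma> by (simp add: abs_mult)
      also have "\<dots> \<le> 2 * ((S / 2 + 2 * S\<^sup>2 + S * energy (w ?t)) * y ?t)"
        unfolding y_def w_def \<Phi>_def by (rule mult_left_mono[OF Im_cubic_le[OF Hu HV VS]]) simp
      also have "\<dots> \<le> 2 * ((S / 2 + 2 * S\<^sup>2 + S * D) * y ?t)"
      proof (intro mult_left_mono mult_right_mono add_left_mono Ew s)
        show "0 \<le> y ?t" by (simp add: y_def)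
        show "0 \<le> S" using VS[of 0 0] norm_ge_zero order_trans by blast
      qed simp
      finally show "\<bar>\<sigma> * (- 2 * Im (cinner (w ?t) (\<Phi> ?t)))\<bar> \<le> 2 * (S / 2 + 2 * S\<^sup>2 + S * D) * y ?t"
        by (simp only: mult.assoc)
      fix n
      have "\<bar>G n s\<bar> \<le> (\<Sum>k<n. \<bar>2 * Re (cnj (x k ?t) * (- \<i> * \<phi> k ?t))\<bar>)"
        unfolding G_def abs\<sigma> by (rule sum_abs)
      also have "\<dots> \<le> (\<Sum>k<n. (cmod (x k ?t))\<^sup>2 + (cmod (\<phi> k ?t))\<^sup>2)"
      proof (rule sum_mono)
        fix k
        have "\<bar>Re (cnj (x k ?t) * (- \<i> * \<phi> k ?t))\<bar> \<le> cmod (cnj (x k ?t) * (- \<i> * \<phi> k ?t))" by (rule abs_Re_le_cmod)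
        also have "\<dots> = cmod (x k ?t) * cmod (\<phi> k ?t)" by (simp add: norm_mult)
        finally have "\<bar>2 * Re (cnj (x k ?t) * (- \<i> * \<phi> k ?t))\<bar> \<le> 2 * (cmod (x k ?t) * cmod (\<phi> k ?t))"
          unfolding abs_mult by simp
        also have "\<dots> \<le> (cmod (x k ?t))\<^sup>2 + (cmod (\<phi> k ?t))\<^sup>2"
          using sum_squares_bound[of "cmod (x k ?t)" "cmod (\<phi> k ?t)"] by (simp only: mult.assoc)
        finally show "\<bar>2 * Re (cnj (x k ?t) * (- \<i> * \<phi> k ?t))\<bar> \<le> (cmod (x k ?t))\<^sup>2 + (cmod (\<phi> k ?t))\<^sup>2" .
      qed
      also have "\<dots> = (\<Sum>k<n. (cmod (x k ?t))\<^sup>2) + (\<Sum>k<n. (cmod (\<phi> k ?t))\<^sup>2)" by (rule sum.distrib)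
      also have "\<dots> \<le> y ?t + P ?t"
        unfolding x_def \<phi>_def y_def P_def by (intro add_mono bessel_sum_le PL H12_L2[OF Hw])
      also have "\<dots> \<le> D + (2 * (12 * B ^ 3) + 2 * (12 * EV ^ 3))"
        using yE[of ?t] Ew[OF s] Pb[OF s] by linarith
      finally show "\<bar>G n s\<bar> \<le> D + (2 * (12 * B ^ 3) + 2 * (12 * EV ^ 3))" .
    qed
    then show ?thesis .
  qed
  have yt: "y t = 0"
    using y0[of 1 t] y0[of "-1" "- t"] by (cases "0 \<le> t") auto
  have "(cmod (fourier (w t) (int k)))\<^sup>2 \<le> (\<integral>z. (cmod (w t z))\<^sup>2 \<partial>circle)"
    using bessel_sum_le[OF H12_L2[OF Hw[of t]], of "Suc k"]
      member_le_sum[of k "{..<Suc k}" "\<lambda>k. (cmod (fourier (w t) (int k)))\<^sup>2"] by auto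
  then have "fourier (w t) (int k) = 0" using yt by (simp add: y_def)
  then show ?thesis by (simp add: fw)
qed

section \<open>Hankel operators with rational symbol\<close>

definition dt :: "nat \<Rightarrow> (nat \<Rightarrow> nat \<Rightarrow> complex) \<Rightarrow> complex" where
  "dt n M = Determinant.det (Matrix.mat n n (\<lambda>(i, j). M i j))"

text \<open>Cramer's rule, so that solutions of linear systems are visibly rational in the entries
  of matrix and right-hand side.\<close>

definition linsolve :: "nat \<Rightarrow> (nat \<Rightarrow> nat \<Rightarrow> complex) \<Rightarrow> (nat \<Rightarrow> complex) \<Rightarrow> nat \<Rightarrow> complex" where
  "linsolve n M r i = (\<Sum>j<n. cofactor (Matrix.mat n n (\<lambda>(i, j). M i j)) j i * r j) / dt n M"

lemma linsolve:
  assumes "dt n M \<noteq> 0" "k < n"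
  shows "(\<Sum>i<n. M k i * linsolve n M r i) = r k"
proof -
  let ?M = "Matrix.mat n n (\<lambda>(i, j). M i j)"
  have c: "?M \<in> carrier_mat n n" by simp
  have e: "(\<Sum>i<n. M k i * cofactor ?M j i) = (if j = k then dt n M else 0)" if "j < n" for j
  proof -
    have "(?M * adj_mat ?M) $$ (k, j) = (\<Sum>i<n. M k i * cofactor ?M j i)"
      using that assms(2) adj_mat(1)[OF c]
      by (auto simp: scalar_prod_def adj_mat_def atLeast0LessThan intro!: sum.cong)
    then show ?thesis using adj_mat(2)[OF c] that assms(2) by (auto simp: dt_def)
  qed
  have "(\<Sum>i<n. M k i * linsolve n M r i) = (\<Sum>i<n. \<Sum>j<n. M k i * cofactor ?M j i * r j) / dt n M"
  proof -
    have "M k i * linsolve n M r i = (\<Sum>j<n. M k i * cofactor ?M j i * r j) / dt n M" for i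
      by (simp add: linsolve_def sum_distrib_left mult.assoc)
    then show ?thesis by (simp only: sum_divide_distrib[symmetric])
  qed
  also have "(\<Sum>i<n. \<Sum>j<n. M k i * cofactor ?M j i * r j) = (\<Sum>j<n. \<Sum>i<n. M k i * cofactor ?M j i * r j)"
    by (rule sum.swap)
  also have "\<dots> = (\<Sum>j<n. (if j = k then dt n M else 0) * r j)"
    unfolding sum_distrib_right[symmetric] by (rule sum.cong) (simp_all add: e)
  also have "\<dots> = dt n M * r k"
    using assms(2) by (simp add: if_distrib[of "\<lambda>x. x * _"] sum.delta cong: if_cong)
  finally show ?thesis using assms(1) by simp
qed

lemma dt_eq_0_iff:
  "dt n M = 0 \<longleftrightarrow> (\<exists>y. (\<exists>i<n. y i \<noteq> 0) \<and> (\<forall>k<n. (\<Sum>i<n. M k i * y i) = 0))"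
proof -
  let ?M = "Matrix.mat n n (\<lambda>(i, j). M i j)"
  have c: "?M \<in> carrier_mat n n" by simp
  show ?thesis
  proof
    assume "dt n M = 0"
    then obtain v where v: "v \<in> carrier_vec n" "v \<noteq> 0\<^sub>v n" "?M *\<^sub>v v = 0\<^sub>v n"
      using det_0_iff_vec_prod_zero[OF c] by (auto simp: dt_def)
    have "\<exists>i<n. v $ i \<noteq> 0"
    proof (rule ccontr)
      assume "\<not> (\<exists>i<n. v $ i \<noteq> 0)"
      then have "v = 0\<^sub>v n" using v(1) by (intro eq_vecI) auto
      with v(2) show False by simp
    qed
    moreover have "(\<Sum>i<n. M k i * v $ i) = 0" if "k < n" for k
    proof -
      have "(?M *\<^sub>v v) $ k = (\<Sum>i<n. M k i * v $ i)"
        using that v(1) by (auto simp: scalar_prod_def atLeast0LessThan intro!: sum.cong)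
      then show ?thesis using v(3) that by simp
    qed
    ultimately show "\<exists>y. (\<exists>i<n. y i \<noteq> 0) \<and> (\<forall>k<n. (\<Sum>i<n. M k i * y i) = 0)" by blast
  next
    assume "\<exists>y. (\<exists>i<n. y i \<noteq> 0) \<and> (\<forall>k<n. (\<Sum>i<n. M k i * y i) = 0)"
    then obtain y i where y: "i < n" "y i \<noteq> 0" "\<And>k. k < n \<Longrightarrow> (\<Sum>i<n. M k i * y i) = 0" by blast
    have "vec n y \<noteq> 0\<^sub>v n"
    proof
      assume "vec n y = 0\<^sub>v n"
      then have "vec n y $ i = 0\<^sub>v n $ i" by simp
      with y(1,2) show False by simp
    qed
    moreover have "?M *\<^sub>v vec n y = 0\<^sub>v n"
      using y(3) by (intro eq_vecI) (auto simp: scalar_prod_def atLeast0LessThan)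
    ultimately have "\<exists>v. v \<in> carrier_vec n \<and> v \<noteq> 0\<^sub>v n \<and> ?M *\<^sub>v v = 0\<^sub>v n"
      by (intro exI[of _ "vec n y"] conjI vec_carrier)
    then show "dt n M = 0" unfolding dt_def by (simp only: det_0_iff_vec_prod_zero[OF c])
  qed
qed

section \<open>Reversed polynomials and the Sylvester system\<close>

lemma no_common_root_coprime:
  fixes p q :: "complex poly"
  assumes "p \<noteq> 0" "\<And>z. poly p z = 0 \<Longrightarrow> poly q z \<noteq> 0"
  shows "coprime p q"
proof (rule coprimeI)
  fix d assume d: "d dvd p" "d dvd q"
  then have "d \<noteq> 0" using assms(1) by auto
  have "degree d = 0"
  proof (rule ccontr)
    assume "degree d \<noteq> 0"
    then have "\<exists>z. poly d z = 0" by (intro Fundamental_Theorem_Algebra.fundamental_theorem_of_algebra) (simp add: constant_degree)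
    then obtain z where z: "poly d z = 0" ..
    have "poly p z = 0" "poly q z = 0" using d z by (auto elim!: dvdE)
    with assms(2)[of z] show False by simp
  qed
  then show "is_unit d" using \<open>d \<noteq> 0\<close> by (simp add: is_unit_iff_degree)
qed

text \<open>The reciprocal polynomial z^n conj (P (1 / conj z)). On the circle it is z^n times the
  conjugate of \<open>P\<close>, and its nonzero roots are the reflections of those of
  \<open>P\<close> in the circle.\<close>

definition rev_cnj :: "nat \<Rightarrow> complex poly \<Rightarrow> complex poly" where
  "rev_cnj n P = Poly (map (\<lambda>k. cnj (coeff P (n - k))) [0..<Suc n])"

lemma coeff_rev_cnj: "coeff (rev_cnj n P) k = (if k \<le> n then cnj (coeff P (n - k)) else 0)"
  by (simp add: rev_cnj_def coeff_Poly_eq nth_default_def del: upt_Suc)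

lemma degree_rev_cnj: "degree (rev_cnj n P) \<le> n"
  by (rule degree_le) (simp add: coeff_rev_cnj)

lemma poly_rev_cnj:
  assumes "degree P \<le> n" "z \<noteq> 0"
  shows "poly (rev_cnj n P) z = z ^ n * cnj (poly P (inverse (cnj z)))"
proof -
  have "poly (rev_cnj n P) z = (\<Sum>k<Suc n. coeff (rev_cnj n P) k * z ^ k)"
    using degree_rev_cnj[of n P] by (intro poly_eq_trig) simp
  also have "\<dots> = (\<Sum>k<Suc n. coeff (rev_cnj n P) (n - k) * z ^ (n - k))"
    using sum.nat_diff_reindex[of "\<lambda>k. coeff (rev_cnj n P) k * z ^ k" "Suc n"] by simp
  also have "\<dots> = (\<Sum>k<Suc n. z ^ n * cnj (coeff P k * inverse (cnj z) ^ k))"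
  proof (rule sum.cong[OF refl])
    fix k assume "k \<in> {..<Suc n}"
    then have k: "k \<le> n" by simp
    have "z ^ (n - k) = z ^ n * inverse z ^ k"
      by (simp only: power_diff[OF assms(2) k] divide_inverse power_inverse)
    moreover have "coeff (rev_cnj n P) (n - k) = cnj (coeff P k)" using k by (simp add: coeff_rev_cnj)
    ultimately show "coeff (rev_cnj n P) (n - k) * z ^ (n - k) = z ^ n * cnj (coeff P k * inverse (cnj z) ^ k)"
      by simp
  qed
  also have "\<dots> = z ^ n * cnj (poly P (inverse (cnj z)))"
    using poly_eq_trig[of P "Suc n" "inverse (cnj z)"] assms(1) by (simp add: sum_distrib_left del: sum.lessThan_Suc)
  finally show ?thesis .
qed

lemma poly_rev_cnj_circle:
  assumes "degree P \<le> n" "cmod z = 1"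
  shows "poly (rev_cnj n P) z = z ^ n * cnj (poly P z)"
proof -
  have "z \<noteq> 0" using assms(2) by auto
  moreover have "cnj z * z = 1" using complex_norm_square[of z] assms(2) by (simp add: mult.commute)
  then have "inverse (cnj z) = z" by (rule inverse_unique)
  ultimately show ?thesis using poly_rev_cnj[OF assms(1), of z] by simp
qed

definition disc_free :: "complex poly \<Rightarrow> bool" where
  "disc_free B \<longleftrightarrow> (\<forall>z. cmod z \<le> 1 \<longrightarrow> poly B z \<noteq> 0)"

text \<open>The matrix of the map \<open>(C, D) \<mapsto> C * rev_cnj N B + D * B\<close>.\<close>

definition syl :: "nat \<Rightarrow> complex poly \<Rightarrow> nat \<Rightarrow> nat \<Rightarrow> complex" where
  "syl N B k j = (if j < N then (if j \<le> k then coeff (rev_cnj N B) (k - j) else 0)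
     else (if j - N \<le> k then coeff B (k - (j - N)) else 0))"

lemma coeff_mult_Psum:
  "coeff (Psum y N * Q) k = (\<Sum>j<N. (if j \<le> k then coeff Q (k - j) else 0) * y j)"
proof -
  have "coeff (Psum y N * Q) k = (\<Sum>j\<le>k. coeff (Psum y N) j * coeff Q (k - j))" by (rule coeff_mult)
  also have "\<dots> = (\<Sum>j\<in>{..k} \<inter> {..<N}. y j * coeff Q (k - j))"
    by (rule sum.mono_neutral_cong_right) (auto simp: coeff_Psum)
  also have "\<dots> = (\<Sum>j<N. (if j \<le> k then coeff Q (k - j) else 0) * y j)"
    by (rule sum.mono_neutral_cong_left) auto
  finally show ?thesis .
qed

lemma syl_apply:
  "(\<Sum>j<2 * N. syl N B k j * y j) = coeff (Psum y N * rev_cnj N B + Psum (\<lambda>j. y (N + j)) N * B) k"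
proof -
  have "(\<Sum>j<2 * N. syl N B k j * y j) = (\<Sum>j<N. syl N B k j * y j) + (\<Sum>j<N. syl N B k (N + j) * y (N + j))"
    using sum.nat_group[of "\<lambda>j. syl N B k j * y j" N 2] sum.atLeastLessThan_concat[of 0 N "2 * N" "\<lambda>j. syl N B k j * y j"]
      sum.shift_bounds_nat_ivl[of "\<lambda>j. syl N B k j * y j" 0 N N]
    by (simp add: lessThan_atLeast0 add.commute mult_2)
  then show ?thesis unfolding coeff_add coeff_mult_Psum by (simp add: syl_def cong: if_cong)
qed

lemma degree_Psum_less: "N > 0 \<Longrightarrow> degree (Psum y N) < N"
  by (rule degree_lessI) (auto simp: coeff_Psum)

text \<open>\<open>rev_cnj N B\<close> has its zeros in the open disc and \<open>B\<close> outside
  the closed one, so the two are coprime. The former has degree exactly \<open>N\<close>, with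
  leading coefficient conj B(0) = 1, and cannot divide a nonzero polynomial of smaller
  degree.\<close>

lemma syl_nonsingular:
  assumes N: "N > 0" and B: "degree B \<le> N" "poly B 0 = 1" "disc_free B"
  shows "dt (2 * N) (syl N B) \<noteq> 0"
proof
  assume "dt (2 * N) (syl N B) = 0"
  then obtain y i where y: "i < 2 * N" "y i \<noteq> 0" "\<And>k. k < 2 * N \<Longrightarrow> (\<Sum>j<2 * N. syl N B k j * y j) = 0"
    unfolding dt_eq_0_iff by blast
  let ?C = "Psum y N" and ?D = "Psum (\<lambda>j. y (N + j)) N" and ?R = "rev_cnj N B"
  have dC: "degree ?C < N" and dD: "degree ?D < N" by (auto intro: degree_Psum_less N)
  have B0: "coeff B 0 = 1" using B(2) by (simp add: poly_0_coeff_0)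
  have "coeff ?R N = 1" by (simp add: coeff_rev_cnj B0)
  then have dR: "degree ?R = N" using degree_rev_cnj[of N B] le_degree[of ?R N] by simp
  have z: "?C * ?R + ?D * B = 0"
  proof (rule poly_eqI)
    fix k
    show "coeff (?C * ?R + ?D * B) k = coeff 0 k"
    proof (cases "k < 2 * N")
      case True then show ?thesis using y(3)[OF True] by (simp add: syl_apply)
    next
      case False
      have "degree (?C * ?R) < k" using degree_mult_le[of ?C ?R] dC dR False by linarith
      moreover have "degree (?D * B) < k" using degree_mult_le[of ?D B] dD B(1) False by linarith
      ultimately show ?thesis by (simp add: coeff_eq_0)
    qed
  qed
  have Rnz: "?R \<noteq> 0" using \<open>coeff ?R N = 1\<close> by auto
  have "coprime ?R B"
  proof (rule no_common_root_coprime[OF Rnz])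
    fix z assume 0: "poly ?R z = 0"
    have "cmod z < 1"
    proof (rule ccontr)
      assume "\<not> cmod z < 1"
      then have z: "z \<noteq> 0" "cmod (inverse (cnj z)) \<le> 1" by (auto simp: norm_inverse inverse_le_1_iff)
      have "poly B (inverse (cnj z)) \<noteq> 0" using B(3) z(2) by (simp add: disc_free_def)
      then show False using 0 z(1) poly_rev_cnj[OF B(1) z(1)] by simp
    qed
    then show "poly B z \<noteq> 0" using B(3) by (simp add: disc_free_def)
  qed
  moreover have "?R dvd ?D * B"
  proof -
    have e: "?C * ?R = - (?D * B)" using z by (simp only: eq_neg_iff_add_eq_0)
    have "?R dvd ?C * ?R" by simp
    then show ?thesis unfolding e by (simp only: dvd_minus_iff)
  qed
  ultimately have "?R dvd ?D" by (simp add: coprime_dvd_mult_left_iff)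
  note dvd = this
  have D0: "?D = 0"
  proof (rule ccontr)
    assume "?D \<noteq> 0"
    with dvd have "degree ?R \<le> degree ?D" by (rule dvd_imp_degree_le)
    with dD dR show False by linarith
  qed
  with z Rnz have C0: "?C = 0" by simp
  have "y i = 0"
  proof (cases "i < N")
    case True
    have "coeff ?C i = 0" by (simp add: C0)
    then show ?thesis using True by (simp add: coeff_Psum)
  next
    case False
    then have i: "i - N < N" "N + (i - N) = i" using y(1) by linarith+
    have "coeff ?D (i - N) = 0" by (simp add: D0)
    then show ?thesis using i by (simp add: coeff_Psum)
  qed
  with y(2) show False by simp
qed

text \<open>The right-hand side of C B# + D B = z A P#, with # for reversal. Divided by z^N B cnj B
  on the circle, the equation splits (A / B) cnj (P / B) into the analytic part C / B and an
  antianalytic part.\<close>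

definition hank_rhs :: "nat \<Rightarrow> complex poly \<Rightarrow> (nat \<Rightarrow> complex) \<Rightarrow> nat \<Rightarrow> complex" where
  "hank_rhs N A p k = coeff (pCons 0 (A * rev_cnj (N - 1) (Psum p N))) k"

definition hank_sol :: "nat \<Rightarrow> complex poly \<Rightarrow> complex poly \<Rightarrow> (nat \<Rightarrow> complex) \<Rightarrow> nat \<Rightarrow> complex" where
  "hank_sol N A B p = linsolve (2 * N) (syl N B) (hank_rhs N A p)"

definition Hk :: "nat \<Rightarrow> complex poly \<Rightarrow> complex poly \<Rightarrow> complex poly \<Rightarrow> complex poly" where
  "Hk N A B P = Psum (hank_sol N A B (coeff P)) N"

text \<open>The conjugate term has no Fourier coefficients of nonnegative index, so \<open>Hk N A B P / B\<close> is the
  image of \<open>P / B\<close> under the Hankel operator of \<open>A / B\<close>.\<close>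

lemma Hk_decomposition:
  assumes N: "N > 0" and B: "degree B \<le> N" "poly B 0 = 1" "disc_free B" and A: "degree A < N" and P: "degree P < N"
  shows "degree (Hk N A B P) < N"
    and "\<exists>D. \<forall>z. cmod z = 1 \<longrightarrow> poly A z / poly B z * cnj (poly P z / poly B z) =
      poly (Hk N A B P) z / poly B z + cnj (z * poly D z / poly B z)"
proof -
  let ?y = "hank_sol N A B (coeff P)"
  let ?C = "Hk N A B P" and ?D = "Psum (\<lambda>j. ?y (N + j)) N" and ?R = "rev_cnj N B"
  show "degree ?C < N" unfolding Hk_def by (rule degree_Psum_less[OF N])
  have dC: "degree ?C < N" and dD: "degree ?D < N" unfolding Hk_def by (auto intro: degree_Psum_less N)
  have PP: "Psum (coeff P) N = P"
    by (rule poly_eqI) (use P in \<open>auto simp: coeff_Psum coeff_eq_0\<close>)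
  let ?rhs = "pCons 0 (A * rev_cnj (N - 1) P)"
  have eq: "?C * ?R + ?D * B = ?rhs"
  proof (rule poly_eqI)
    fix k
    show "coeff (?C * ?R + ?D * B) k = coeff ?rhs k"
    proof (cases "k < 2 * N")
      case True
      have "(\<Sum>j<2 * N. syl N B k j * ?y j) = hank_rhs N A (coeff P) k"
        unfolding hank_sol_def by (rule linsolve[OF syl_nonsingular[OF N B] True])
      then show ?thesis unfolding syl_apply hank_rhs_def PP Hk_def .
    next
      case False
      have "degree (?C * ?R) < k" using degree_mult_le[of ?C ?R] dC degree_rev_cnj[of N B] False by linarith
      moreover have "degree (?D * B) < k" using degree_mult_le[of ?D B] dD B(1) False by linarith
      moreover have "degree ?rhs < k"
        using degree_mult_le[of A "rev_cnj (N - 1) P"] degree_rev_cnj[of "N - 1" P] A False degree_pCons_le[of 0 "A * rev_cnj (N - 1) P"] N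
        by linarith
      ultimately show ?thesis by (simp add: coeff_eq_0 del: coeff_pCons_Suc)
    qed
  qed
  \<comment> \<open>Reversing \<open>?D\<close> turns z^(-N) D / cnj B into the conjugate of a
    function that is analytic in the disc and zero at 0.\<close>
  let ?E = "rev_cnj (N - 1) ?D"
  show "\<exists>D. \<forall>z. cmod z = 1 \<longrightarrow> poly A z / poly B z * cnj (poly P z / poly B z) =
      poly ?C z / poly B z + cnj (z * poly D z / poly B z)"
  proof (intro exI[of _ ?E] allI impI)
    fix z :: complex assume z: "cmod z = 1"
    have z0: "z \<noteq> 0" using z by auto
    have zc: "z * cnj z = 1" using complex_norm_square[of z] z by simp
    define b where "b = poly B z"
    have b: "b \<noteq> 0" using B(3) z by (simp add: disc_free_def b_def)
    have R: "poly ?R z = z ^ N * cnj b" unfolding b_def by (rule poly_rev_cnj_circle[OF B(1) z])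
    have RP: "poly (rev_cnj (N - 1) P) z = z ^ (N - 1) * cnj (poly P z)"
      using P by (intro poly_rev_cnj_circle z) simp
    have RD: "poly ?E z = z ^ (N - 1) * cnj (poly ?D z)"
      using dD by (intro poly_rev_cnj_circle z) simp
    have zN: "z * z ^ (N - 1) = z ^ N" using N by (cases N) auto
    have "poly (?C * ?R + ?D * B) z = poly ?rhs z" by (simp only: eq)
    moreover have "poly ?rhs z = z ^ N * (poly A z * cnj (poly P z))"
    proof -
      have "poly ?rhs z = z * (poly A z * (z ^ (N - 1) * cnj (poly P z)))"
        by (simp only: poly_pCons poly_mult RP add_0)
      also have "\<dots> = (z * z ^ (N - 1)) * (poly A z * cnj (poly P z))" by (simp only: mult_ac)
      finally show ?thesis unfolding zN .
    qed
    ultimately have e: "poly ?C z * (z ^ N * cnj b) + poly ?D z * b = z ^ N * (poly A z * cnj (poly P z))"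
      by (simp only: poly_add poly_mult R b_def)
    have zz: "z ^ N * cnj z ^ N = 1" using zc by (simp add: power_mult_distrib[symmetric])
    have zN': "cnj z * cnj z ^ (N - 1) = cnj z ^ N" using N by (cases N) auto
    have "cnj (z * poly ?E z) = (cnj z * cnj z ^ (N - 1)) * poly ?D z"
      unfolding RD by (simp only: complex_cnj_mult complex_cnj_power complex_cnj_cnj mult.assoc)
    then have "poly ?C z / b + cnj (z * poly ?E z / b) = poly ?C z / b + (cnj z ^ N * poly ?D z) / cnj b"
      unfolding complex_cnj_divide zN' by simp
    also have "\<dots> = (poly ?C z * cnj b + cnj z ^ N * poly ?D z * b) / (b * cnj b)"
      using b by (intro add_frac_eq) simp_all
    also have "poly ?C z * cnj b + cnj z ^ N * poly ?D z * b = cnj z ^ N * (poly ?C z * (z ^ N * cnj b) + poly ?D z * b)"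
    proof -
      have "cnj z ^ N * (poly ?C z * (z ^ N * cnj b) + poly ?D z * b) = (z ^ N * cnj z ^ N) * (poly ?C z * cnj b) + cnj z ^ N * poly ?D z * b"
        by (simp only: distrib_left mult_ac)
      then show ?thesis by (simp only: zz mult_1)
    qed
    also have "\<dots> = poly A z * cnj (poly P z)"
    proof -
      have "cnj z ^ N * (z ^ N * (poly A z * cnj (poly P z))) = (z ^ N * cnj z ^ N) * (poly A z * cnj (poly P z))"
        by (simp only: mult_ac)
      then show ?thesis unfolding e by (simp only: zz mult_1)
    qed
    also have "poly A z * cnj (poly P z) / (b * cnj b) = poly A z / poly B z * cnj (poly P z / poly B z)"
      unfolding b_def by simp
    finally have "poly ?C z / b + cnj (z * poly ?E z / b) = poly A z / poly B z * cnj (poly P z / poly B z)" .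
    then show "poly A z / poly B z * cnj (poly P z / poly B z) = poly ?C z / poly B z + cnj (z * poly ?E z / poly B z)"
      unfolding b_def by (rule sym)
  qed
qed

section \<open>Rational functions on the circle and the backward shift\<close>

lemma poly_measurable [measurable]: "poly (p :: complex poly) \<in> borel_measurable borel"
  by (intro borel_measurable_continuous_onI continuous_intros)

definition qt :: "complex poly \<Rightarrow> complex poly \<Rightarrow> complex \<Rightarrow> complex" where
  "qt P B z = poly P z / poly B z"

lemma qt_measurable [measurable]: "qt P B \<in> borel_measurable borel"
  unfolding qt_def[abs_def] by measurable

lemma qt_mean:
  assumes "disc_free B" shows "(\<integral>z. qt P B z \<partial>circle) = qt P B 0"
proof (rule mean_value_circle[where S="{z. poly B z \<noteq> 0}"])
  show "qt P B holomorphic_on {z. poly B z \<noteq> 0}"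
    unfolding qt_def[abs_def] by (intro holomorphic_intros) auto
  show "cball 0 1 \<subseteq> {z. poly B z \<noteq> 0}" using assms by (auto simp: disc_free_def)
qed measurable

lemma qt_L2:
  assumes "disc_free B" shows "qt P B \<in> L2"
proof -
  have "continuous_on (sphere 0 1) (qt P B)"
    unfolding qt_def[abs_def] using assms by (intro continuous_intros) (auto simp: disc_free_def)
  then have "compact (qt P B ` sphere 0 1)" by (rule compact_continuous_image) simp
  then have "bounded (qt P B ` sphere 0 1)" by (rule compact_imp_bounded)
  then obtain b where "\<forall>w \<in> qt P B ` sphere 0 1. cmod w \<le> b" unfolding bounded_iff ..
  then have b: "\<And>z. z \<in> sphere 0 1 \<Longrightarrow> cmod (qt P B z) \<le> b" by simp
  show ?thesis
  proof (rule L2_bounded[where B=b])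
    show "AE z in circle. cmod (qt P B z) \<le> b"
      using AE_circle_norm by eventually_elim (rule b, simp)
  qed measurable
qed

lemma disc_free_mult: "disc_free A \<Longrightarrow> disc_free B \<Longrightarrow> disc_free (A * B)"
  by (simp add: disc_free_def)

lemma qt_diff: "qt (P - Q) B z = qt P B z - qt Q B z"
  by (simp add: qt_def diff_divide_distrib)
lemma qt_smult: "qt (Polynomial.smult c P) B z = c * qt P B z"
  by (simp add: qt_def)
lemma qt_pCons: "qt (pCons 0 P) B z = z * qt P B z"
  by (simp add: qt_def)

lemma qt_fourier_neg:
  assumes "disc_free B" "k < 0" shows "fourier (qt P B) k = 0"
proof -
  define n where "n = nat (- k) - 1"
  have k: "- k = int (Suc n)" using assms(2) by (simp add: n_def)
  have "fourier (qt P B) k = (\<integral>z. qt (pCons 0 (monom 1 n * P)) B z \<partial>circle)"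
    unfolding fourier_def cinner_def
  proof (rule integral_cong_AE)
    show "AE z in circle. qt P B z * cnj (z powi k) = qt (pCons 0 (monom 1 n * P)) B z"
      using AE_circle_norm
    proof eventually_elim
      case (elim z)
      have "cnj (z powi k) = z ^ Suc n" unfolding cnj_powi[OF elim] k by (rule power_int_of_nat)
      then show ?case by (simp add: qt_def poly_monom mult_ac)
    qed
  qed measurable
  also have "\<dots> = 0" unfolding qt_mean[OF assms(1)] by (simp add: qt_def)
  finally show ?thesis .
qed

lemma qt_plus: "disc_free B \<Longrightarrow> qt P B \<in> plus_part L2"
  unfolding plus_part_def using qt_L2 qt_fourier_neg by blast

text \<open>If \<open>B(0) = 1\<close>, then \<open>z * sh B P = P - P(0) B\<close>: the backward shift maps \<open>P / B\<close> to \<open>sh B P / B\<close>.\<close>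

definition sh :: "complex poly \<Rightarrow> complex poly \<Rightarrow> complex poly" where
  "sh B P = poly_shift 1 (P - Polynomial.smult (coeff P 0) B)"

lemma coeff_sh: "coeff (sh B P) n = coeff P (Suc n) - coeff P 0 * coeff B (Suc n)"
  by (simp add: sh_def coeff_poly_shift)

lemma degree_sh: "degree P < N \<Longrightarrow> degree B \<le> N \<Longrightarrow> degree (sh B P) < N"
  by (rule degree_lessI) (auto simp: coeff_sh coeff_eq_0)

lemma pCons_sh: "coeff B 0 = 1 \<Longrightarrow> pCons 0 (sh B P) = P - Polynomial.smult (coeff P 0) B"
  by (rule poly_eqI) (simp add: coeff_pCons coeff_sh split: nat.split)

lemma sh_qt:
  assumes "coeff B 0 = 1" "poly B z \<noteq> 0" "cmod z = 1"
  shows "qt (sh B P) B z = cnj z * (qt P B z - coeff P 0)"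
proof -
  have "z * qt (sh B P) B z = qt P B z - coeff P 0"
    unfolding qt_pCons[symmetric] pCons_sh[OF assms(1)] qt_diff qt_smult using assms(2) by (simp add: qt_def)
  then have "cnj z * z * qt (sh B P) B z = cnj z * (qt P B z - coeff P 0)" by (simp only: mult.assoc)
  moreover have "cnj z * z = 1" using complex_norm_square[of z] assms(3) by (simp add: mult.commute)
  ultimately show ?thesis by simp
qed

lemma AE_disc_free: "disc_free B \<Longrightarrow> AE z in circle. cmod z = 1 \<and> poly B z \<noteq> 0"
  using AE_circle_norm by eventually_elim (auto simp: disc_free_def)

text \<open>On the circle the shift removes the value at 0 and multiplies by cnj z
  (\<open>sh_qt\<close>). The second identity is the loss of norm under the shift, the source of
  \<open>T_defect\<close>.\<close>

lemma cinner_sh: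
  assumes B: "coeff B 0 = 1" "disc_free B"
  shows "cinner (qt (sh B P) B) (qt R B) = cinner (qt P B) (qt (pCons 0 R) B)"
    and "cinner (qt (sh B P) B) (qt (sh B R) B) = cinner (qt P B) (qt R B) - coeff P 0 * cnj (coeff R 0)"
    and "fourier (qt P B) (int (Suc n)) = fourier (qt (sh B P) B) (int n)"
proof -
  note L = qt_L2[OF B(2)]
  have c1: "(\<lambda>_. c) \<in> L2" for c by (rule L2_bounded[where B="cmod c"]) auto
  have m: "cinner (qt P B) (\<lambda>_. 1) = coeff P 0" for P
    unfolding cinner_def using qt_mean[OF B(2), of P] B(1) by (simp add: qt_def poly_0_coeff_0)
  have m': "cinner (\<lambda>_. 1) (qt P B) = cnj (coeff P 0)" for P
    using cinner_cnj[of "qt P B" "\<lambda>_. 1"] m[of P] by simp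
  have "cinner (qt (sh B P) B) (qt R B) = cinner (\<lambda>z. qt P B z - coeff P 0 * 1) (qt (pCons 0 R) B)"
    unfolding cinner_def
  proof (rule integral_cong_AE)
    show "AE z in circle. qt (sh B P) B z * cnj (qt R B z) = (qt P B z - coeff P 0 * 1) * cnj (qt (pCons 0 R) B z)"
      using AE_disc_free[OF B(2)]
      by eventually_elim (simp add: sh_qt[OF B(1)] qt_pCons)
  qed measurable
  also have "\<dots> = cinner (qt P B) (qt (pCons 0 R) B) - coeff P 0 * cinner (\<lambda>_. 1) (qt (pCons 0 R) B)"
    unfolding cinner_diff_left[OF L L2_scale[OF c1] L] cinner_scale_left ..
  finally show a: "cinner (qt (sh B P) B) (qt R B) = cinner (qt P B) (qt (pCons 0 R) B)"
    by (simp add: m')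
  have "cinner (qt (sh B P) B) (qt (sh B R) B) = cinner (\<lambda>z. qt P B z - coeff P 0 * 1) (\<lambda>z. qt R B z - coeff R 0 * 1)"
    unfolding cinner_def
  proof (rule integral_cong_AE)
    show "AE z in circle. qt (sh B P) B z * cnj (qt (sh B R) B z) = (qt P B z - coeff P 0 * 1) * cnj (qt R B z - coeff R 0 * 1)"
      using AE_disc_free[OF B(2)]
    proof eventually_elim
      case (elim z)
      have zz: "z * cnj z = 1" using complex_norm_square[of z] elim by simp
      have "qt (sh B P) B z * cnj (qt (sh B R) B z) = (z * cnj z) * ((qt P B z - coeff P 0) * cnj (qt R B z - coeff R 0))"
        unfolding sh_qt[OF B(1) conjunct2[OF elim] conjunct1[OF elim]] by (simp only: complex_cnj_mult complex_cnj_cnj mult_ac)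
      then show ?case unfolding zz by simp
    qed
  qed measurable
  also have "\<dots> = cinner (qt P B) (\<lambda>z. qt R B z - coeff R 0 * 1) - coeff P 0 * cinner (\<lambda>_. 1) (\<lambda>z. qt R B z - coeff R 0 * 1)"
    unfolding cinner_diff_left[OF L L2_scale[OF c1] L2_diff[OF L L2_scale[OF c1]]] cinner_scale_left ..
  also have "cinner (qt P B) (\<lambda>z. qt R B z - coeff R 0 * 1) = cnj (cinner (qt R B) (qt P B) - coeff R 0 * cinner (\<lambda>_. 1) (qt P B))"
    by (subst cinner_cnj[symmetric], subst cinner_diff_left[OF L L2_scale[OF c1] L]) (simp only: cinner_scale_left)
  also have "cinner (\<lambda>_. 1) (\<lambda>z. qt R B z - coeff R 0 * 1) = cnj (cinner (qt R B) (\<lambda>_. 1) - coeff R 0 * cinner (\<lambda>_. 1) (\<lambda>_. 1))"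
    by (subst cinner_cnj[symmetric], subst cinner_diff_left[OF L L2_scale[OF c1] c1]) (simp only: cinner_scale_left)
  also have "cinner (\<lambda>_. 1) (\<lambda>_. 1) = 1" by (simp add: cinner_def)
  finally show "cinner (qt (sh B P) B) (qt (sh B R) B) = cinner (qt P B) (qt R B) - coeff P 0 * cnj (coeff R 0)"
    by (simp add: m m' cinner_cnj)
  have "fourier (qt P B) (int (Suc n)) - coeff P 0 * fourier (\<lambda>_. 1) (int (Suc n)) = fourier (\<lambda>z. qt P B z - coeff P 0 * 1) (int (Suc n))"
    unfolding fourier_def cinner_diff_left[OF L L2_scale[OF c1] L2_powi] cinner_scale_left ..
  also have "\<dots> = fourier (qt (sh B P) B) (int n)"
    unfolding fourier_def cinner_def
  proof (rule integral_cong_AE)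
    show "AE z in circle. (qt P B z - coeff P 0 * 1) * cnj (z powi int (Suc n)) = qt (sh B P) B z * cnj (z powi int n)"
      using AE_disc_free[OF B(2)]
    proof eventually_elim
      case (elim z)
      have "cnj z powi int (Suc n) = cnj z * cnj z powi int n" by (simp only: power_int_of_nat power_Suc)
      then show ?case
        unfolding sh_qt[OF B(1) conjunct2[OF elim] conjunct1[OF elim]] by (simp add: mult_ac)
    qed
  qed measurable
  finally show "fourier (qt P B) (int (Suc n)) = fourier (qt (sh B P) B) (int n)"
    by (simp add: fourier_1)
qed

lemma fourier_qt_0: "coeff B 0 = 1 \<Longrightarrow> disc_free B \<Longrightarrow> fourier (qt P B) 0 = coeff P 0"
  unfolding fourier_def cinner_def using qt_mean[of B P] by (simp add: qt_def poly_0_coeff_0)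

lemma fourier_qt_iter:
  "coeff B 0 = 1 \<Longrightarrow> disc_free B \<Longrightarrow> fourier (qt P B) (int n) = coeff ((sh B ^^ n) P) 0"
proof (induct n arbitrary: P)
  case 0 then show ?case by (simp add: fourier_qt_0)
next
  case (Suc n)
  then show ?case unfolding cinner_sh(3)[OF Suc(2,3)] by (simp add: funpow_swap1)
qed

section \<open>The Hankel operator of a rational symbol and its moments\<close>

locale rational_data =
  fixes N :: nat and A B :: "complex poly"
  assumes N: "N > 0" and dA: "degree A < N" and dB: "degree B \<le> N" and B0: "poly B 0 = 1" and Bfree: "disc_free B"
begin

lemma cB0: "coeff B 0 = 1" using B0 by (simp add: poly_0_coeff_0)

abbreviation "H \<equiv> Hk N A B"

lemma degree_H: "degree P < N \<Longrightarrow> degree (H P) < N"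
  by (rule Hk_decomposition(1)[OF N dB B0 Bfree dA])

lemma product_bounded: "disc_free B' \<Longrightarrow> integrable circle (\<lambda>z. qt P B z * cnj (qt Q B z) * cnj (qt R B' z))"
proof -
  assume f: "disc_free B'"
  have "integrable circle (\<lambda>z. qt P B z * cnj (qt (Q * R) (B * B') z))"
    by (intro L2_mult_integrable qt_L2 disc_free_mult Bfree f)
  moreover have "qt P B z * cnj (qt (Q * R) (B * B') z) = qt P B z * cnj (qt Q B z) * cnj (qt R B' z)" for z
    by (simp add: qt_def mult.assoc)
  ultimately show ?thesis by simp
qed

text \<open>The antianalytic part in \<open>Hk_decomposition\<close> integrates to 0 against
  conjugates of analytic functions, by the mean value property. The separate denominator
  \<open>B'\<close> admits the constant 1 as test function.\<close>

lemma H_triple: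
  assumes P: "degree P < N" and f: "disc_free B'"
  shows "(\<integral>z. qt A B z * cnj (qt P B z) * cnj (qt R B' z) \<partial>circle) = cinner (qt (H P) B) (qt R B')"
proof -
  obtain D where D: "\<And>z. cmod z = 1 \<Longrightarrow> poly A z / poly B z * cnj (poly P z / poly B z) =
      poly (H P) z / poly B z + cnj (z * poly D z / poly B z)"
    using Hk_decomposition(2)[OF N dB B0 Bfree dA P] by blast
  have fB: "disc_free (B * B')" by (rule disc_free_mult[OF Bfree f])
  have "(\<integral>z. qt A B z * cnj (qt P B z) * cnj (qt R B' z) \<partial>circle) =
    (\<integral>z. qt (H P) B z * cnj (qt R B' z) + cnj (qt (pCons 0 (D * R)) (B * B') z) \<partial>circle)"
  proof (rule integral_cong_AE)
    show "AE z in circle. qt A B z * cnj (qt P B z) * cnj (qt R B' z) =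
        qt (H P) B z * cnj (qt R B' z) + cnj (qt (pCons 0 (D * R)) (B * B') z)"
      using AE_circle_norm
    proof eventually_elim
      case (elim z)
      have "qt A B z * cnj (qt P B z) = qt (H P) B z + cnj (z * poly D z / poly B z)"
        unfolding qt_def by (rule D[OF elim])
      moreover have "cnj (z * poly D z / poly B z) * cnj (qt R B' z) = cnj (qt (pCons 0 (D * R)) (B * B') z)"
        by (simp add: qt_def)
      ultimately show ?case by (simp only: distrib_right)
    qed
  qed measurable
  also have "\<dots> = cinner (qt (H P) B) (qt R B') + (\<integral>z. cnj (qt (pCons 0 (D * R)) (B * B') z) \<partial>circle)"
    unfolding cinner_def
  proof (rule Bochner_Integration.integral_add)
    show "integrable circle (\<lambda>z. qt (H P) B z * cnj (qt R B' z))" by (intro L2_mult_integrable qt_L2 Bfree f)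
    show "integrable circle (\<lambda>z. cnj (qt (pCons 0 (D * R)) (B * B') z))"
      using L2_integrable[OF qt_L2[OF fB]] by (rule integrable_cnj)
  qed
  also have "(\<integral>z. cnj (qt (pCons 0 (D * R)) (B * B') z) \<partial>circle) = cnj (qt (pCons 0 (D * R)) (B * B') 0)"
    unfolding Bochner_Integration.integral_cnj qt_mean[OF fB] ..
  also have "qt (pCons 0 (D * R)) (B * B') 0 = 0" by (simp add: qt_def)
  finally show ?thesis by simp
qed

lemma H_sym:
  assumes "degree P < N" "degree Q < N" "disc_free B'"
  shows "cinner (qt (H P) B) (qt Q B) = cinner (qt (H Q) B) (qt P B)"
  unfolding H_triple[OF assms(1) Bfree, symmetric] H_triple[OF assms(2) Bfree, symmetric]
  by (simp only: mult_ac)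

lemma H_0: "degree P < N \<Longrightarrow> coeff (H P) 0 = cinner (qt A B) (qt P B)"
proof -
  assume P: "degree P < N"
  have 1: "disc_free 1" by (simp add: disc_free_def)
  have "cinner (qt A B) (qt P B) = cinner (qt (H P) B) (qt 1 1)"
    unfolding H_triple[OF P 1, symmetric] by (simp add: cinner_def qt_def)
  also have "\<dots> = (\<integral>z. qt (H P) B z \<partial>circle)" by (simp add: cinner_def qt_def)
  also have "\<dots> = coeff (H P) 0" unfolding qt_mean[OF Bfree] by (simp add: qt_def B0 cB0 poly_0_coeff_0)
  finally show ?thesis by simp
qed

text \<open>\<open>szego_proj\<close> returns an arbitrary representative, so iteration requires an
  argument \<open>h\<close> that equals \<open>P / B\<close> only almost everywhere.\<close>

lemma hankel_qt:
  assumes P: "degree P < N" and h: "h \<in> L2" "AE z in circle. h z = qt P B z"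
  shows "hankel (qt A B) h \<in> L2" "AE z in circle. hankel (qt A B) h z = qt (H P) B z"
proof -
  have [measurable]: "h \<in> borel_measurable borel" using h(1) by (rule L2_D)
  let ?f = "\<lambda>z. qt A B z * cnj (h z)"
  obtain D where D: "\<And>z. cmod z = 1 \<Longrightarrow> poly A z / poly B z * cnj (poly P z / poly B z) =
      poly (H P) z / poly B z + cnj (z * poly D z / poly B z)"
    using Hk_decomposition(2)[OF N dB B0 Bfree dA P] by blast
  have AE: "AE z in circle. ?f z = qt (H P) B z + cnj (qt (pCons 0 D) B z)"
    using AE_circle_norm h(2)
  proof eventually_elim
    case (elim z)
    show ?case unfolding elim(2) using D[OF elim(1)] by (simp add: qt_def)
  qed
  have cL: "(\<lambda>z. cnj (qt (pCons 0 D) B z)) \<in> L2" using qt_L2[OF Bfree, of "pCons 0 D"] by (simp add: L2_def)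
  have gL: "(\<lambda>z. qt (H P) B z + cnj (qt (pCons 0 D) B z)) \<in> L2" by (rule L2_add[OF qt_L2[OF Bfree] cL])
  have fL: "?f \<in> L2" by (rule L2_cong_AE[OF _ gL AE]) measurable
  have ff: "fourier ?f k = fourier (qt (H P) B) k" if k: "0 \<le> k" for k
  proof -
    have "fourier ?f k = fourier (\<lambda>z. qt (H P) B z + cnj (qt (pCons 0 D) B z)) k"
      by (rule fourier_cong_AE[OF _ _ AE]) measurable
    also have "\<dots> = fourier (qt (H P) B) k + fourier (\<lambda>z. cnj (qt (pCons 0 D) B z)) k"
      unfolding fourier_def by (rule cinner_add_left[OF qt_L2[OF Bfree] cL L2_powi])
    also have "fourier (\<lambda>z. cnj (qt (pCons 0 D) B z)) k = cnj (fourier (qt (pCons 0 D) B) (- k))"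
      by (rule fourier_cnj) measurable
    also have "fourier (qt (pCons 0 D) B) (- k) = 0"
    proof (cases "k = 0")
      case True then show ?thesis using fourier_qt_0[OF cB0 Bfree, of "pCons 0 D"] by simp
    next
      case False then show ?thesis using k by (intro qt_fourier_neg Bfree) simp
    qed
    finally show ?thesis by simp
  qed
  have pL: "szego_proj ?f \<in> plus_part L2" by (rule szego_proj_L2(1)[OF fL])
  then have pL2: "szego_proj ?f \<in> L2" by (simp add: plus_part_def)
  show "hankel (qt A B) h \<in> L2" unfolding hankel_def by (rule pL2)
  have "fourier (\<lambda>z. szego_proj ?f z - qt (H P) B z) k = 0" for k
  proof (cases "0 \<le> k")
    case True
    then show ?thesis unfolding fourier_diff[OF pL2 qt_L2[OF Bfree]] using szego_proj_L2(2)[OF fL True] ff[OF True] by simp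
  next
    case False
    then show ?thesis unfolding fourier_diff[OF pL2 qt_L2[OF Bfree]]
      using pL qt_fourier_neg[OF Bfree, of k] by (simp add: plus_part_def)
  qed
  then have "AE z in circle. szego_proj ?f z - qt (H P) B z = 0"
    by (intro fourier_uniqueness L2_integrable L2_diff pL2 qt_L2 Bfree)
  then show "AE z in circle. hankel (qt A B) h z = qt (H P) B z"
    unfolding hankel_def by eventually_elim simp
qed

text \<open>The first application sends 1 to the symbol itself, which leaves \<open>n\<close>
  applications on polynomials. It is treated apart because 1 need not be of the form
  \<open>P / B\<close> with \<open>degree P < N\<close>.\<close>

lemma moment_qt: "moment (Suc n) (qt A B) = coeff ((H ^^ n) A) 0"
proof -
  have deg: "degree ((H ^^ n) A) < N" for n by (induct n) (auto intro: dA degree_H)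
  have "(hankel (qt A B) ^^ Suc n) (\<lambda>_. 1) \<in> L2 \<and> (AE z in circle. (hankel (qt A B) ^^ Suc n) (\<lambda>_. 1) z = qt ((H ^^ n) A) B z)"
  proof (induct n)
    case 0
    have AL: "qt A B \<in> plus_part L2" by (rule qt_plus[OF Bfree])
    have A2: "qt A B \<in> L2" by (rule qt_L2[OF Bfree])
    have pL: "szego_proj (qt A B) \<in> plus_part L2" by (rule szego_proj_L2(1)[OF A2])
    then have pL2: "szego_proj (qt A B) \<in> L2" by (simp add: plus_part_def)
    have "fourier (\<lambda>z. szego_proj (qt A B) z - qt A B z) k = 0" for k
      unfolding fourier_diff[OF pL2 A2] using szego_proj_L2(2)[OF A2, of k] pL AL
      by (cases "0 \<le> k") (auto simp: plus_part_def)
    then have "AE z in circle. szego_proj (qt A B) z - qt A B z = 0"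
      by (intro fourier_uniqueness L2_integrable L2_diff pL2 A2)
    then have "AE z in circle. szego_proj (qt A B) z = qt A B z" by eventually_elim simp
    moreover have "(hankel (qt A B) ^^ Suc 0) (\<lambda>_. 1) = szego_proj (qt A B)" by (simp add: hankel_def)
    ultimately show ?case using pL2 by simp
  next
    case (Suc n)
    from hankel_qt[OF deg[of n] conjunct1[OF Suc] conjunct2[OF Suc]] show ?case by simp
  qed
  note h = this
  let ?h = "(hankel (qt A B) ^^ Suc n) (\<lambda>_. 1)"
  have "moment (Suc n) (qt A B) = cinner ?h (\<lambda>_. 1)" by (simp only: moment_def)
  also have "\<dots> = cinner (qt ((H ^^ n) A) B) (\<lambda>_. 1)"
    by (rule cinner_cong_AE) (use h in \<open>auto dest: L2_D(1)\<close>)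
  also have "\<dots> = coeff ((H ^^ n) A) 0"
    unfolding cinner_def using qt_mean[OF Bfree, of "(H ^^ n) A"] by (simp add: qt_def B0 cB0 poly_0_coeff_0)
  finally show ?thesis .
qed

end

lemma qt_lincomb: "qt (\<Sum>i\<in>I. Polynomial.smult (y i) (p i)) B z = (\<Sum>i\<in>I. y i * qt (p i) B z)"
  by (simp add: qt_def poly_sum sum_divide_distrib)

lemma fourier_poly: "fourier (qt P 1) (int n) = coeff P n"
proof -
  have "coeff ((sh 1 ^^ n) P) 0 = coeff P n"
  proof (induct n arbitrary: P)
    case (Suc n) then show ?case by (simp only: funpow_Suc_right o_apply) (simp add: coeff_sh)
  qed simp
  then show ?thesis using fourier_qt_iter[of 1 P n] by (simp add: disc_free_def)
qed

lemma Psum_monom: "Psum y n = (\<Sum>j<n. Polynomial.smult (y j) (Polynomial.monom 1 j))"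
proof (rule poly_eqI)
  fix k
  have "coeff (\<Sum>j<n. Polynomial.smult (y j) (Polynomial.monom 1 j)) k = (\<Sum>j<n. if k = j then y j else 0)"
    unfolding coeff_sum by (rule sum.cong) auto
  then show "coeff (Psum y n) k = coeff (\<Sum>j<n. Polynomial.smult (y j) (Polynomial.monom 1 j)) k"
    by (simp add: coeff_Psum)
qed

lemma dt_zero_row:
  assumes "k < n" "\<And>i. i < n \<Longrightarrow> M k i = 0" shows "dt n M = 0"
proof (rule ccontr)
  assume "dt n M \<noteq> 0"
  from linsolve[OF this assms(1), of "\<lambda>_. 1"] show False using assms(2) by simp
qed

lemma dt_transpose: "dt n (\<lambda>i j. M j i) = dt n M"
proof -
  have "Matrix.mat n n (\<lambda>(i, j). M j i) = transpose_mat (Matrix.mat n n (\<lambda>(i, j). M i j))"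
    by (rule eq_matI) auto
  then show ?thesis unfolding dt_def by (simp only: det_transpose[OF mat_carrier])
qed

lemma dt_eq_0I:
  assumes "k < n" "y k \<noteq> 0" "\<And>i. i < n \<Longrightarrow> (\<Sum>j<n. M i j * y j) = 0" shows "dt n M = 0"
  unfolding dt_eq_0_iff using assms by blast

section \<open>Matrices of shift and Hankel operator in an orthonormal basis\<close>

context rational_data begin

definition E :: "complex poly \<Rightarrow> complex poly \<Rightarrow> complex" where
  "E P R = cinner (qt P B) (qt R B)"

lemma E_cnj: "cnj (E P R) = E R P"
  unfolding E_def by (rule cinner_cnj)

lemma E_lincomb: "E (\<Sum>i\<in>I. Polynomial.smult (y i) (p i)) R = (\<Sum>i\<in>I. y i * E (p i) R)"
proof -
  have "E (\<Sum>i\<in>I. Polynomial.smult (y i) (p i)) R = cinner (\<lambda>z. \<Sum>i\<in>I. y i * qt (p i) B z) (qt R B)"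
    unfolding E_def by (simp only: qt_lincomb[abs_def])
  also have "\<dots> = (\<Sum>i\<in>I. cinner (\<lambda>z. y i * qt (p i) B z) (qt R B))"
    by (intro cinner_sum_left L2_scale qt_L2 Bfree)
  finally show ?thesis unfolding cinner_scale_left E_def .
qed

lemma E_lincomb_right: "E R (\<Sum>i\<in>I. Polynomial.smult (y i) (p i)) = (\<Sum>i\<in>I. cnj (y i) * E R (p i))"
  unfolding E_cnj[of "\<Sum>i\<in>I. Polynomial.smult (y i) (p i)" R, symmetric] E_lincomb
  by (simp add: E_cnj)

lemma E_smult: "E (Polynomial.smult c P) R = c * E P R"
  using E_lincomb[of "\<lambda>_. c" "\<lambda>_. P" "{0::nat}" R] by simp

lemma E_definite: assumes "E P P = 0" shows "P = 0"
proof (rule poly_eqI)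
  fix n
  have L: "qt P B \<in> L2" by (rule qt_L2[OF Bfree])
  have "(\<integral>z. (cmod (qt P B z))\<^sup>2 \<partial>circle) = 0" using assms unfolding E_def cinner_self by simp
  then have "AE z in circle. (cmod (qt P B z))\<^sup>2 = 0"
    by (subst (asm) integral_nonneg_eq_0_iff_AE) (use L2_D[OF L] in auto)
  with AE_disc_free[OF Bfree] have "AE z in circle. qt P 1 z = 0"
    by eventually_elim (auto simp: qt_def)
  then have "fourier (qt P 1) (int n) = fourier (\<lambda>_. 0) (int n)"
    by (intro fourier_cong_AE) auto
  then show "coeff P n = coeff 0 n" unfolding fourier_poly by (simp add: fourier_def cinner_def)
qed

text \<open>A Gram-Schmidt step by counting: \<open>k < N\<close> orthogonality conditions on
  \<open>N\<close> coefficients have a nonzero solution, found as a kernel vector of a square matrix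
  padded with zero rows.\<close>

lemma orthonormal_exists:
  "k \<le> N \<Longrightarrow> \<exists>p. (\<forall>i<k. degree (p i) < N) \<and> (\<forall>i<k. \<forall>j<k. E (p i) (p j) = (if i = j then 1 else 0))"
proof (induct k)
  case 0 show ?case by simp
next
  case (Suc k)
  then obtain p where p: "\<And>i. i < k \<Longrightarrow> degree (p i) < N"
    "\<And>i j. i < k \<Longrightarrow> j < k \<Longrightarrow> E (p i) (p j) = (if i = j then 1 else 0)" by auto
  have k: "k < N" using Suc by simp
  let ?M = "\<lambda>i j. if i < k then E (Polynomial.monom 1 j) (p i) else 0"
  have "dt N ?M = 0" by (rule dt_zero_row[OF k]) simp
  then obtain y i where y: "i < N" "y i \<noteq> 0" "\<And>l. l < N \<Longrightarrow> (\<Sum>j<N. ?M l j * y j) = 0"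
    unfolding dt_eq_0_iff by blast
  define w where "w = Psum y N"
  have "coeff w i \<noteq> 0" using y(1,2) by (simp add: w_def coeff_Psum)
  then have "w \<noteq> 0" by auto
  then have w0: "E w w \<noteq> 0" using E_definite by blast
  define c where "c = (\<integral>z. (cmod (qt w B z))\<^sup>2 \<partial>circle)"
  have c: "E w w = of_real c" unfolding E_def cinner_self c_def ..
  have "c \<ge> 0" unfolding c_def by simp
  with w0 c have c0: "c > 0" by (simp add: order_less_le)
  have wp: "E w (p l) = 0" if "l < k" for l
  proof -
    have "E w (p l) = (\<Sum>j<N. ?M l j * y j)"
      unfolding w_def Psum_monom E_lincomb using that by (simp add: mult.commute)
    then show ?thesis using y(3)[of l] that k by simp
  qed
  have pw: "E (p l) w = 0" if "l < k" for l
    using E_cnj[of w "p l"] wp[OF that] by simp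
  let ?a = "of_real (1 / sqrt c) :: complex"
  have ww: "E (Polynomial.smult ?a w) (Polynomial.smult ?a w) = 1"
  proof -
    have "E (Polynomial.smult ?a w) (Polynomial.smult ?a w) = ?a * cnj (E (Polynomial.smult ?a w) w)"
      unfolding E_smult[of _ w "Polynomial.smult ?a w"] E_cnj ..
    also have "\<dots> = of_real (1 / sqrt c * (1 / sqrt c) * c)" by (simp only: E_smult c of_real_mult complex_cnj_mult complex_cnj_complex_of_real mult.assoc)
    also have "1 / sqrt c * (1 / sqrt c) * c = 1" using c0 by simp
    finally show ?thesis by simp
  qed
  have wp': "E (Polynomial.smult ?a w) (p l) = 0" if "l < k" for l unfolding E_smult wp[OF that] by simp
  have pw': "E (p l) (Polynomial.smult ?a w) = 0" if "l < k" for l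
    using E_cnj[of "Polynomial.smult ?a w" "p l"] wp'[OF that] by simp
  have dw: "degree (Polynomial.smult ?a w) < N"
    using degree_Psum_less[OF N, of y] degree_smult_le[of ?a w] by (simp only: w_def)
  show ?case
  proof (intro exI[of _ "p(k := Polynomial.smult ?a w)"] conjI allI impI)
    fix i assume "i < Suc k" then show "degree ((p(k := Polynomial.smult ?a w)) i) < N" using p(1)[of i] dw by (cases "i = k") auto
  next
    fix i j assume "i < Suc k" "j < Suc k"
    then show "E ((p(k := Polynomial.smult ?a w)) i) ((p(k := Polynomial.smult ?a w)) j) = (if i = j then 1 else 0)"
      using p(2)[of i j] ww wp'[of j] pw'[of i] by (cases "i = k"; cases "j = k") auto
  qed
qed

definition p where
  "p = (SOME p. (\<forall>i<N. degree (p i) < N) \<and> (\<forall>i<N. \<forall>j<N. E (p i) (p j) = (if i = j then 1 else 0)))"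

lemma degree_p: "i < N \<Longrightarrow> degree (p i) < N"
  and p_orth: "i < N \<Longrightarrow> j < N \<Longrightarrow> E (p i) (p j) = (if i = j then 1 else 0)"
  using someI_ex[OF orthonormal_exists[OF order_refl]] unfolding p_def[symmetric] by auto

lemma E_lincomb_p: "j < N \<Longrightarrow> E (\<Sum>i<N. Polynomial.smult (y i) (p i)) (p j) = y j"
proof -
  assume j: "j < N"
  have "(\<Sum>i<N. y i * E (p i) (p j)) = (\<Sum>i<N. if i = j then y i else 0)"
    by (rule sum.cong) (auto simp: p_orth j)
  then show ?thesis unfolding E_lincomb using j by simp
qed

text \<open>Orthonormality makes the matrix of the coefficients of the \<open>p i\<close> injective,
  hence invertible. Solving for \<open>P\<close> and pairing with \<open>p i\<close> identifies the
  solution.\<close>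

lemma expansion: assumes P: "degree P < N" shows "P = (\<Sum>i<N. Polynomial.smult (E P (p i)) (p i))"
proof -
  let ?M = "\<lambda>l i. coeff (p i) l"
  have cl: "coeff (\<Sum>i<N. Polynomial.smult (y i) (p i)) l = (\<Sum>i<N. ?M l i * y i)" for y l
    by (simp add: coeff_sum mult.commute)
  have deg: "degree (\<Sum>i<N. Polynomial.smult (y i) (p i)) < N" for y
    by (rule degree_lessI) (auto simp: N coeff_sum coeff_eq_0 less_le_trans[OF degree_p])
  have "dt N ?M \<noteq> 0"
  proof
    assume "dt N ?M = 0"
    then obtain y i where y: "i < N" "y i \<noteq> 0" "\<And>l. l < N \<Longrightarrow> (\<Sum>j<N. ?M l j * y j) = 0"
      unfolding dt_eq_0_iff by blast
    have "(\<Sum>i<N. Polynomial.smult (y i) (p i)) = 0"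
    proof (rule poly_eqI)
      fix l show "coeff (\<Sum>i<N. Polynomial.smult (y i) (p i)) l = coeff 0 l"
        using y(3)[of l] deg[of y] cl[of y l] by (cases "l < N") (auto simp: coeff_eq_0)
    qed
    then have "y i = E 0 (p i)" using E_lincomb_p[OF y(1), of y] by simp
    then show False using y(2) E_smult[of 0 0 "p i"] by simp
  qed
  note nz = this
  define y where "y = linsolve N ?M (coeff P)"
  have Py: "P = (\<Sum>i<N. Polynomial.smult (y i) (p i))"
  proof (rule poly_eqI)
    fix l show "coeff P l = coeff (\<Sum>i<N. Polynomial.smult (y i) (p i)) l"
      using linsolve[OF nz, of l "coeff P"] deg[of y] cl[of y l] P by (cases "l < N") (auto simp: coeff_eq_0 y_def)
  qed
  have "E P (p i) = y i" if "i < N" for i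
    using E_lincomb_p[OF that, of y] by (simp only: Py[symmetric])
  then have "(\<Sum>i<N. Polynomial.smult (E P (p i)) (p i)) = (\<Sum>i<N. Polynomial.smult (y i) (p i))"
    by (intro sum.cong) auto
  then show ?thesis using Py by simp
qed

definition vc where "vc P = (\<lambda>i. if i < N then E P (p i) else 0)"
definition Tm where "Tm = (\<lambda>i j. if i < N \<and> j < N then E (sh B (p j)) (p i) else 0)"
definition Gm where "Gm = (\<lambda>i j. if i < N \<and> j < N then E (H (p j)) (p i) else 0)"
text \<open>Conjugated because \<open>ip\<close> is antilinear in its second argument; pairing with
  \<open>ev0\<close> is then evaluation at 0 (\<open>coeff_vc\<close>).\<close>

definition ev0 where "ev0 = (\<lambda>i. if i < N then cnj (coeff (p i) 0) else 0)"

lemma suppv_vc: "suppv N (vc P)" by (auto simp: suppv_def vc_def)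
lemma supp_Tm: "supp N Tm" by (auto simp: supp_def Tm_def)
lemma supp_Gm: "supp N Gm" by (auto simp: supp_def Gm_def)
lemma suppv_ev0: "suppv N ev0" by (auto simp: suppv_def ev0_def)

lemma E_vc: assumes P: "degree P < N" shows "E P R = (\<Sum>i<N. vc P i * E (p i) R)"
proof -
  have "E P R = E (\<Sum>i<N. Polynomial.smult (E P (p i)) (p i)) R"
    using expansion[OF P] by simp
  also have "\<dots> = (\<Sum>i<N. E P (p i) * E (p i) R)" by (rule E_lincomb)
  finally show ?thesis by (simp add: vc_def)
qed

lemma E_ip: assumes P: "degree P < N" shows "E P R = ip N (vc P) (vc R)"
  unfolding E_vc[OF P] ip_def by (rule sum.cong) (auto simp: vc_def E_cnj)

lemma coeff_vc: assumes P: "degree P < N" shows "coeff P 0 = ip N (vc P) ev0"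
proof -
  have "coeff P 0 = coeff (\<Sum>i<N. Polynomial.smult (E P (p i)) (p i)) 0"
    using expansion[OF P] by simp
  also have "\<dots> = ip N (vc P) ev0"
    unfolding ip_def by (simp add: coeff_sum vc_def ev0_def)
  finally show ?thesis .
qed

lemma sh_lincomb: "sh B (\<Sum>i\<in>I. Polynomial.smult (y i) (q i)) = (\<Sum>i\<in>I. Polynomial.smult (y i) (sh B (q i)))"
  by (rule poly_eqI) (simp add: coeff_sh coeff_sum sum_distrib_right sum_subtractf right_diff_distrib mult.assoc)

lemma vc_sh: assumes P: "degree P < N" shows "vc (sh B P) = mv N Tm (vc P)"
proof
  fix i
  show "vc (sh B P) i = mv N Tm (vc P) i"
  proof (cases "i < N")
    case True
    have "E (sh B P) (p i) = E (sh B (\<Sum>j<N. Polynomial.smult (E P (p j)) (p j))) (p i)"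
      using expansion[OF P] by simp
    also have "\<dots> = (\<Sum>j<N. E P (p j) * E (sh B (p j)) (p i))" unfolding sh_lincomb E_lincomb ..
    finally show ?thesis using True by (simp add: vc_def mv_def Tm_def mult.commute)
  qed (simp add: vc_def mv_def Tm_def)
qed

lemma E_H: "degree P < N \<Longrightarrow> E (H P) R = (\<integral>z. qt A B z * cnj (qt P B z) * cnj (qt R B z) \<partial>circle)"
  unfolding E_def by (rule H_triple[OF _ Bfree, symmetric])

lemma E_H_vc: assumes P: "degree P < N" shows "E (H P) R = (\<Sum>j<N. cnj (vc P j) * E (H (p j)) R)"
proof -
  have Pz: "qt P B z = (\<Sum>j<N. E P (p j) * qt (p j) B z)" for z
    using arg_cong[OF expansion[OF P], of "\<lambda>P. qt P B z"] unfolding qt_lincomb .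
  have "E (H P) R = (\<integral>z. (\<Sum>j<N. cnj (vc P j) * (qt A B z * cnj (qt (p j) B z) * cnj (qt R B z))) \<partial>circle)"
    unfolding E_H[OF P] unfolding Pz
    by (simp add: sum_distrib_left sum_distrib_right vc_def mult_ac)
  also have "\<dots> = (\<Sum>j<N. \<integral>z. cnj (vc P j) * (qt A B z * cnj (qt (p j) B z) * cnj (qt R B z)) \<partial>circle)"
    by (intro Bochner_Integration.integral_sum integrable_mult_right product_bounded Bfree)
  also have "\<dots> = (\<Sum>j<N. cnj (vc P j) * E (H (p j)) R)"
    by (intro sum.cong refl) (simp add: E_H degree_p)
  finally show ?thesis .
qed

lemma vc_H: assumes P: "degree P < N" shows "vc (H P) = mv N Gm (cv (vc P))"
proof
  fix i
  show "vc (H P) i = mv N Gm (cv (vc P)) i"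
    using E_H_vc[OF P, of "p i"]
    by (cases "i < N") (auto simp: vc_def mv_def cv_def Gm_def mult.commute)
qed

lemma E_sh_swap: "E (sh B P) R = E P (pCons 0 R)"
  unfolding E_def by (rule cinner_sh(1)[OF cB0 Bfree])

text \<open>The triple integral of \<open>E_H\<close> is symmetric in its two conjugated factors,
  and a factor z may move from one to the other. In the basis this becomes the relation
  \<open>TG\<close>.\<close>

lemma E_H_shift_sym: "degree P < N \<Longrightarrow> degree Q < N \<Longrightarrow> E (H P) (pCons 0 Q) = E (H Q) (pCons 0 P)"
  unfolding E_H qt_pCons by (simp add: mult_ac)

lemma model: "szego_model N Tm Gm ev0"
proof
  show "N > 0" by (rule N)
  show "supp N Tm" "supp N Gm" "suppv N ev0" by (rule supp_Tm supp_Gm suppv_ev0)+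
  show "mm N (adj Tm) Tm = (\<lambda>i j. idm N i j - ev0 i * cnj (ev0 j))"
  proof (intro ext)
    fix i j
    show "mm N (adj Tm) Tm i j = idm N i j - ev0 i * cnj (ev0 j)"
    proof (cases "i < N \<and> j < N")
      case True
      then have i: "i < N" and j: "j < N" by auto
      have "mm N (adj Tm) Tm i j = (\<Sum>k<N. vc (sh B (p j)) k * cnj (vc (sh B (p i)) k))"
        unfolding mm_def by (rule sum.cong) (auto simp: adj_def Tm_def vc_def i j mult.commute)
      also have "\<dots> = E (sh B (p j)) (sh B (p i))"
        unfolding E_ip[OF degree_sh[OF degree_p[OF j] dB]] ip_def ..
      also have "\<dots> = E (p j) (p i) - coeff (p j) 0 * cnj (coeff (p i) 0)"
        unfolding E_def by (rule cinner_sh(2)[OF cB0 Bfree])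
      finally show ?thesis by (simp add: p_orth i j idm_def ev0_def)
    next
      case False
      then show ?thesis by (auto simp: mm_def adj_def Tm_def idm_def ev0_def)
    qed
  qed
  show "tp Gm = Gm"
    unfolding tp_def by (intro ext) (auto simp: Gm_def E_def intro: H_sym[OF degree_p degree_p Bfree])
  show "mm N Tm Gm = mm N Gm (tp Tm)"
  proof (intro ext)
    fix i j
    show "mm N Tm Gm i j = mm N Gm (tp Tm) i j"
    proof (cases "i < N \<and> j < N")
      case True
      then have i: "i < N" and j: "j < N" by auto
      have dHi: "degree (H (p i)) < N" and dHj: "degree (H (p j)) < N" by (rule degree_H, rule degree_p, fact)+
      have "mm N Tm Gm i j = mv N Tm (vc (H (p j))) i"
        unfolding mm_def mv_def by (rule sum.cong) (auto simp: Gm_def vc_def i j)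
      also have "\<dots> = E (sh B (H (p j))) (p i)" unfolding vc_sh[OF dHj, symmetric] by (simp add: vc_def i)
      also have "\<dots> = E (H (p i)) (pCons 0 (p j))"
        unfolding E_sh_swap by (rule E_H_shift_sym[OF degree_p[OF j] degree_p[OF i]])
      also have "\<dots> = (\<Sum>k<N. vc (H (p i)) k * E (sh B (p k)) (p j))"
        unfolding E_vc[OF dHi] E_sh_swap ..
      also have "\<dots> = mm N Gm (tp Tm) i j"
        unfolding mm_def
        by (rule sum.cong) (auto simp: Gm_def Tm_def tp_def vc_def i j E_def intro: H_sym[OF degree_p[OF i] degree_p Bfree])
      finally show ?thesis .
    next
      case False
      then show ?thesis by (auto simp: mm_def Tm_def Gm_def tp_def)
    qed
  qed
qed

text \<open>The symbol is the Hankel operator applied to 1, but 1 may lie outside the space. Its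
  projection is represented by \<open>ev0\<close>, and the symmetry of the operator transfers the
  identity to the matrix.\<close>

lemma vc_A: "vc A = mv N Gm (cv ev0)"
proof
  fix i
  show "vc A i = mv N Gm (cv ev0) i"
  proof (cases "i < N")
    case True
    have dH: "degree (H (p i)) < N" by (rule degree_H[OF degree_p[OF True]])
    have "vc A i = coeff (H (p i)) 0"
      unfolding H_0[OF degree_p[OF True]] using True by (simp add: vc_def E_def)
    also have "\<dots> = ip N (vc (H (p i))) ev0" by (rule coeff_vc[OF dH])
    also have "\<dots> = mv N Gm (cv ev0) i"
      unfolding ip_def mv_def
      by (rule sum.cong) (auto simp: Gm_def vc_def cv_def True E_def intro: H_sym[OF degree_p[OF True] degree_p Bfree])
    finally show ?thesis .
  qed (simp add: vc_def mv_def Gm_def)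
qed

lemma fourier_model: "fourier (qt A B) (int n) = ip N (mv N (mpow N Tm n) (szego_model.b N Gm ev0)) ev0"
proof -
  have "degree ((sh B ^^ n) A) < N \<and> vc ((sh B ^^ n) A) = (mv N Tm ^^ n) (vc A)"
    by (induct n) (auto simp: dA degree_sh dB vc_sh)
  then show ?thesis
    unfolding fourier_qt_iter[OF cB0 Bfree] szego_model.b_def[OF model] vc_A[symmetric] mv_mpow[OF suppv_vc]
    using coeff_vc[of "(sh B ^^ n) A"] by simp
qed

abbreviation "AA \<equiv> szego_model.A N Gm"

lemma moment_model: "moment (2 * Suc m) (qt A B) = ip N (mv N (mpow N AA (Suc m)) ev0) ev0"
proof -
  have cc: "mv N Gm (cv (mv N Gm (cv x))) = mv N AA x" for x
    unfolding szego_model.A_def[OF model] mv_mm cv_mv cv_cv ..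
  have "degree ((H ^^ Suc (2 * m)) A) < N \<and> vc ((H ^^ Suc (2 * m)) A) = (mv N AA ^^ Suc m) ev0"
  proof (induct m)
    case 0 show ?case by (simp add: degree_H dA vc_H vc_A cc)
  next
    case (Suc m)
    have "(H ^^ Suc (2 * Suc m)) A = H (H ((H ^^ Suc (2 * m)) A))" by simp
    with Suc show ?case by (simp only: vc_H degree_H cc funpow.simps o_apply)
  qed
  moreover have "moment (2 * Suc m) (qt A B) = coeff ((H ^^ Suc (2 * m)) A) 0"
    using moment_qt[of "Suc (2 * m)"] by simp
  ultimately show ?thesis unfolding mv_mpow[OF suppv_ev0] using coeff_vc[of "(H ^^ Suc (2 * m)) A"] by simp
qed

text \<open>The moment matrix factors as f f* with rows \<open>f i\<close>, the iterates of
  \<open>ev0\<close> under \<open>AA\<close>. A nonzero vector orthogonal to all iterates makes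
  \<open>f\<close> singular, hence its rows dependent, and the conjugate of such a relation is a
  kernel vector of f f*.\<close>

lemma cyclicI:
  assumes "dt N (\<lambda>i j. moment (2 * ((i + 1) + (j + 1))) (qt A B)) \<noteq> 0"
  shows "szego_model.cyclic N Gm ev0"
  unfolding szego_model.cyclic_def[OF model]
proof (intro allI impI, rule ccontr)
  fix h assume h: "suppv N h \<and> (\<forall>m. ip N (mv N (mpow N AA m) ev0) h = 0)" and h0: "h \<noteq> (\<lambda>_. 0)"
  have sA: "supp N AA" by (rule szego_model.supp_A[OF model])
  define f where "f i = (mv N AA ^^ Suc i) ev0" for i
  have swap: "ip N ((mv N AA ^^ i) x) y = ip N x ((mv N AA ^^ i) y)" for i x y
  proof (induct i arbitrary: y)
    case (Suc i)
    have "ip N ((mv N AA ^^ Suc i) x) y = ip N ((mv N AA ^^ i) x) (mv N AA y)"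
      unfolding funpow.simps o_apply by (subst ip_adj) (simp only: szego_model.adj_A[OF model])
    also have "\<dots> = ip N x ((mv N AA ^^ Suc i) y)" unfolding Suc by (simp add: funpow_swap1)
    finally show ?case .
  qed simp
  have mom: "moment (2 * ((i + 1) + (j + 1))) (qt A B) = (\<Sum>k<N. f i k * cnj (f j k))" for i j
  proof -
    have "moment (2 * ((i + 1) + (j + 1))) (qt A B) = ip N ((mv N AA ^^ (Suc j + Suc i)) ev0) ev0"
      using moment_model[of "Suc (i + j)"] unfolding mv_mpow[OF suppv_ev0] by (simp add: add.commute)
    also have "\<dots> = ip N (f i) (f j)" unfolding funpow_add o_apply swap f_def ..
    finally show ?thesis unfolding ip_def .
  qed
  from h0 obtain k where "h k \<noteq> 0" by auto
  with h have k: "k < N" "h k \<noteq> 0" by (auto simp: suppv_def)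
  have fh: "(\<Sum>k<N. f i k * cnj (h k)) = 0" for i
  proof -
    have "ip N (mv N (mpow N AA (Suc i)) ev0) h = 0" using h by blast
    then have "ip N (f i) h = 0" by (simp only: mv_mpow[OF suppv_ev0] f_def)
    then show ?thesis by (simp only: ip_def)
  qed
  have "dt N f = 0"
    by (rule dt_eq_0I[where k=k and y="\<lambda>k. cnj (h k)", OF k(1) _ fh]) (simp add: k(2))
  then have "dt N (\<lambda>i j. f j i) = 0" by (rule trans[OF dt_transpose])
  then obtain x i where x: "i < N" "x i \<noteq> 0" "\<And>k. k < N \<Longrightarrow> (\<Sum>j<N. f j k * x j) = 0"
    unfolding dt_eq_0_iff by blast
  have fx: "(\<Sum>j<N. (\<Sum>k<N. f l k * cnj (f j k)) * cnj (x j)) = 0" for l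
  proof -
    have "(\<Sum>j<N. (\<Sum>k<N. f l k * cnj (f j k)) * cnj (x j)) = (\<Sum>j<N. \<Sum>k<N. f l k * cnj (f j k * x j))"
      by (simp add: sum_distrib_right mult.assoc)
    also have "\<dots> = (\<Sum>k<N. \<Sum>j<N. f l k * cnj (f j k * x j))" by (rule sum.swap)
    also have "\<dots> = (\<Sum>k<N. f l k * cnj (\<Sum>j<N. f j k * x j))" by (simp only: sum_distrib_left cnj_sum)
    also have "\<dots> = 0" by (simp add: x(3))
    finally show ?thesis .
  qed
  have "dt N (\<lambda>i j. \<Sum>k<N. f i k * cnj (f j k)) = 0"
    by (rule dt_eq_0I[where k=i and y="\<lambda>k. cnj (x k)", OF x(1) _ fx]) (simp add: x(2))
  with assms show False unfolding mom by simp
qed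

theorem bounded_solution:
  assumes "dt N (\<lambda>i j. moment (2 * ((i + 1) + (j + 1))) (qt A B)) \<noteq> 0"
  shows "solution_bounded_from s (qt A B)"
  unfolding solution_bounded_from_def
proof (intro allI impI)
  fix u assume "szego_solution u \<and> (AE z in circle. u 0 z = qt A B z)"
  then have sol: "szego_solution u" and u0: "AE z in circle. u 0 z = qt A B z" by auto
  obtain q v K where v: "0 < q" "q < 1" "\<And>t k. cmod (v t k) \<le> K * q ^ k"
    "\<And>k. v 0 k = ip N (mv N (mpow N Tm k) (szego_model.b N Gm ev0)) ev0"
    "\<And>t n. ((\<lambda>t. v t n) has_vector_derivative - \<i> *
       ((\<Sum>k. v t (n + k) * cnj (\<Sum>j. v t (k + j) * cnj (v t j))) +
        (\<Sum>k<n. v t k * (\<Sum>j. v t (n - k + j) * cnj (v t j))))) (at t)"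
    by (rule szego_model.explicit_flow[OF model cyclicI[OF assms]], rule that, assumption+)
  have uL: "u t \<in> plus_part L2" for t
    using sol unfolding szego_solution_def plus_part_def sobolev_def by blast
  have um: "u 0 \<in> borel_measurable borel" using uL[of 0] by (auto simp: plus_part_def dest: L2_D(1))
  have init: "fourier (u 0) (int k) = v 0 k" for k
    unfolding v(4) fourier_model[symmetric] by (rule fourier_cong_AE[OF um qt_measurable u0])
  have der: "((\<lambda>t. v t n) has_vector_derivative - \<i> * szego_rhs (v t) n) (at t)" for t n
    unfolding szego_rhs_def by (rule v(5))
  have eq: "fourier (u t) (int k) = v t k" for t k
    by (rule weak_strong_uniqueness[OF sol v(1,2,3) der init])
  show "sobolev_bounded s u"
    by (rule sobolev_bounded_of_decay[where K=K, OF uL v(1,2)]) (simp only: eq v(3))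
qed

end

section \<open>Rational dependence on the coordinates\<close>

text \<open>Complex-valued polynomials in the real and imaginary parts of the coordinates.\<close>

inductive polyfun :: "nat \<Rightarrow> ((nat \<Rightarrow> complex) \<Rightarrow> complex) \<Rightarrow> bool" for d where
  polyfun_const: "polyfun d (\<lambda>x. c)"
| polyfun_coord: "i < d \<Longrightarrow> polyfun d (\<lambda>x. x i)"
| polyfun_cnj: "polyfun d f \<Longrightarrow> polyfun d (\<lambda>x. cnj (f x))"
| polyfun_add: "polyfun d f \<Longrightarrow> polyfun d g \<Longrightarrow> polyfun d (\<lambda>x. f x + g x)"
| polyfun_mult: "polyfun d f \<Longrightarrow> polyfun d g \<Longrightarrow> polyfun d (\<lambda>x. f x * g x)"

text \<open>One quotient valid on all of \<open>S\<close>: the zeros of \<open>f\<close> are those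
  of a single polynomial numerator, which both the null set and the closedness arguments
  use.\<close>

definition ratf :: "nat \<Rightarrow> (nat \<Rightarrow> complex) set \<Rightarrow> ((nat \<Rightarrow> complex) \<Rightarrow> complex) \<Rightarrow> bool" where
  "ratf d S f \<longleftrightarrow> (\<exists>P Q. polyfun d P \<and> polyfun d Q \<and> (\<forall>x\<in>S. Q x \<noteq> 0 \<and> f x = P x / Q x))"

lemma ratf_cong: "ratf d S f \<Longrightarrow> (\<And>x. x \<in> S \<Longrightarrow> g x = f x) \<Longrightarrow> ratf d S g"
  unfolding ratf_def by fastforce

lemma ratf_polyfun: "polyfun d f \<Longrightarrow> ratf d S f"
  unfolding ratf_def by (intro exI[of _ f] exI[of _ "\<lambda>x. 1"]) (auto intro: polyfun_const)

lemma ratf_const [intro]: "ratf d S (\<lambda>x. c)"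
  by (intro ratf_polyfun polyfun_const)

lemma ratf_if: "(b \<Longrightarrow> ratf d S f) \<Longrightarrow> (\<not> b \<Longrightarrow> ratf d S g) \<Longrightarrow> ratf d S (\<lambda>x. if b then f x else g x)"
  by (cases b) auto

lemma ratf_coord: "i < d \<Longrightarrow> ratf d S (\<lambda>x. x i)"
  by (intro ratf_polyfun polyfun_coord)

lemma ratf_cnj: assumes "ratf d S f" shows "ratf d S (\<lambda>x. cnj (f x))"
proof -
  obtain P Q where "polyfun d P" "polyfun d Q" "\<And>x. x \<in> S \<Longrightarrow> Q x \<noteq> 0" "\<And>x. x \<in> S \<Longrightarrow> f x = P x / Q x"
    using assms unfolding ratf_def by blast
  then show ?thesis unfolding ratf_def
    by (intro exI[of _ "\<lambda>x. cnj (P x)"] exI[of _ "\<lambda>x. cnj (Q x)"]) (auto intro: polyfun_cnj)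
qed

lemma ratf_mult: assumes "ratf d S f" "ratf d S g" shows "ratf d S (\<lambda>x. f x * g x)"
proof -
  obtain P Q P' Q' where "polyfun d P" "polyfun d Q" "\<And>x. x \<in> S \<Longrightarrow> Q x \<noteq> 0" "\<And>x. x \<in> S \<Longrightarrow> f x = P x / Q x"
    "polyfun d P'" "polyfun d Q'" "\<And>x. x \<in> S \<Longrightarrow> Q' x \<noteq> 0" "\<And>x. x \<in> S \<Longrightarrow> g x = P' x / Q' x"
    using assms unfolding ratf_def by metis
  then show ?thesis unfolding ratf_def
    by (intro exI[of _ "\<lambda>x. P x * P' x"] exI[of _ "\<lambda>x. Q x * Q' x"]) (auto intro: polyfun_mult)
qed

lemma ratf_add: assumes "ratf d S f" "ratf d S g" shows "ratf d S (\<lambda>x. f x + g x)"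
proof -
  obtain P Q P' Q' where "polyfun d P" "polyfun d Q" "\<And>x. x \<in> S \<Longrightarrow> Q x \<noteq> 0" "\<And>x. x \<in> S \<Longrightarrow> f x = P x / Q x"
    "polyfun d P'" "polyfun d Q'" "\<And>x. x \<in> S \<Longrightarrow> Q' x \<noteq> 0" "\<And>x. x \<in> S \<Longrightarrow> g x = P' x / Q' x"
    using assms unfolding ratf_def by metis
  then show ?thesis unfolding ratf_def
    by (intro exI[of _ "\<lambda>x. P x * Q' x + P' x * Q x"] exI[of _ "\<lambda>x. Q x * Q' x"])
      (auto intro!: polyfun_mult polyfun_add simp: add_frac_eq)
qed

lemma ratf_inverse: assumes "ratf d S f" "\<And>x. x \<in> S \<Longrightarrow> f x \<noteq> 0" shows "ratf d S (\<lambda>x. inverse (f x))"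
proof -
  obtain P Q where "polyfun d P" "polyfun d Q" "\<And>x. x \<in> S \<Longrightarrow> Q x \<noteq> 0" "\<And>x. x \<in> S \<Longrightarrow> f x = P x / Q x"
    using assms(1) unfolding ratf_def by blast
  then show ?thesis using assms(2) unfolding ratf_def
    by (intro exI[of _ Q] exI[of _ P]) auto
qed

lemma ratf_divide: "ratf d S f \<Longrightarrow> ratf d S g \<Longrightarrow> (\<And>x. x \<in> S \<Longrightarrow> g x \<noteq> 0) \<Longrightarrow> ratf d S (\<lambda>x. f x / g x)"
  unfolding divide_inverse by (intro ratf_mult ratf_inverse)

lemma ratf_sum: "(\<And>i. i \<in> I \<Longrightarrow> ratf d S (\<lambda>x. f x i)) \<Longrightarrow> ratf d S (\<lambda>x. \<Sum>i\<in>I. f x i)"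
  by (induct I rule: infinite_finite_induct) (simp_all add: ratf_const ratf_add)

lemma ratf_prod: "(\<And>i. i \<in> I \<Longrightarrow> ratf d S (\<lambda>x. f x i)) \<Longrightarrow> ratf d S (\<lambda>x. \<Prod>i\<in>I. f x i)"
  by (induct I rule: infinite_finite_induct) (simp_all add: ratf_const ratf_mult)

lemma dt_leibniz: "dt n M = (\<Sum>q\<in>{q. q permutes {0..<n}}. signof q * (\<Prod>i\<in>{0..<n}. M i (q i)))"
proof -
  have "dt n M = (\<Sum>q\<in>{q. q permutes {0..<n}}. signof q * (\<Prod>i\<in>{0..<n}. Matrix.mat n n (\<lambda>(i, j). M i j) $$ (i, q i)))"
    unfolding dt_def by (simp add: Determinant.det_def)
  also have "\<dots> = (\<Sum>q\<in>{q. q permutes {0..<n}}. signof q * (\<Prod>i\<in>{0..<n}. M i (q i)))"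
  proof (rule sum.cong[OF refl], goal_cases)
    case (1 q)
    then have "q i < n" if "i < n" for i using permutes_in_image[of q "{0..<n}" i] that by simp
    then show ?case by simp
  qed
  finally show ?thesis .
qed

lemma ratf_dt:
  assumes "\<And>i j. i < n \<Longrightarrow> j < n \<Longrightarrow> ratf d S (\<lambda>x. M x i j)" shows "ratf d S (\<lambda>x. dt n (M x))"
  unfolding dt_leibniz
proof (intro ratf_sum ratf_mult ratf_const ratf_prod)
  fix q i assume "q \<in> {q. q permutes {0..<n}}" "i \<in> {0..<n}"
  then show "ratf d S (\<lambda>x. M x i (q i))" using permutes_in_image[of q "{0..<n}" i] by (intro assms) auto
qed

lemma cofactor_dt:
  assumes "i < n" "j < n"
  shows "cofactor (Matrix.mat n n (\<lambda>(i, j). M i j)) i j =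
    (-1) ^ (i + j) * dt (n - 1) (\<lambda>k l. M (if k < i then k else Suc k) (if l < j then l else Suc l))"
proof -
  have "mat_delete (Matrix.mat n n (\<lambda>(i, j). M i j)) i j =
      Matrix.mat (n - 1) (n - 1) (\<lambda>(k, l). M (if k < i then k else Suc k) (if l < j then l else Suc l))"
    unfolding mat_delete_def by (rule eq_matI) auto
  then show ?thesis by (simp add: cofactor_def dt_def)
qed

lemma ratf_linsolve:
  assumes M: "\<And>i j. i < n \<Longrightarrow> j < n \<Longrightarrow> ratf d S (\<lambda>x. M x i j)" and r: "\<And>i. i < n \<Longrightarrow> ratf d S (\<lambda>x. r x i)"
    and nz: "\<And>x. x \<in> S \<Longrightarrow> dt n (M x) \<noteq> 0" and i: "i < n"
  shows "ratf d S (\<lambda>x. linsolve n (M x) (r x) i)"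
  unfolding linsolve_def
proof (intro ratf_divide ratf_sum ratf_mult ratf_dt nz M)
  fix j assume "j \<in> {..<n}"
  then have j: "j < n" by simp
  show "ratf d S (\<lambda>x. r x j)" by (rule r[OF j])
  show "ratf d S (\<lambda>x. cofactor (Matrix.mat n n (\<lambda>(i, j). M x i j)) j i)"
    unfolding cofactor_dt[OF j i] by (intro ratf_mult ratf_const ratf_dt M) (use j i in auto)
qed

definition pratf :: "nat \<Rightarrow> (nat \<Rightarrow> complex) set \<Rightarrow> ((nat \<Rightarrow> complex) \<Rightarrow> complex poly) \<Rightarrow> bool" where
  "pratf d S F \<longleftrightarrow> (\<forall>k. ratf d S (\<lambda>x. coeff (F x) k))"

lemma pratf_mult: "pratf d S F \<Longrightarrow> pratf d S G \<Longrightarrow> pratf d S (\<lambda>x. F x * G x)"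
  unfolding pratf_def coeff_mult by (intro allI ratf_sum ratf_mult) auto

lemma pratf_rev_cnj: "pratf d S F \<Longrightarrow> pratf d S (\<lambda>x. rev_cnj n (F x))"
  unfolding pratf_def coeff_rev_cnj by (auto intro!: ratf_cnj ratf_if)

lemma pratf_Hk:
  assumes A: "pratf d S A" and B: "pratf d S B" and P: "pratf d S P"
    and nz: "\<And>x. x \<in> S \<Longrightarrow> dt (2 * N) (syl N (B x)) \<noteq> 0"
  shows "pratf d S (\<lambda>x. Hk N (A x) (B x) (P x))"
  unfolding pratf_def
proof
  fix k
  have PP: "pratf d S (\<lambda>x. Psum (coeff (P x)) N)"
    using P unfolding pratf_def coeff_Psum by (auto intro!: ratf_if)
  have "ratf d S (\<lambda>x. hank_sol N (A x) (B x) (coeff (P x)) k)" if "k < N"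
    unfolding hank_sol_def
  proof (rule ratf_linsolve[OF _ _ nz])
    fix i j
    show "ratf d S (\<lambda>x. syl N (B x) i j)"
      using pratf_rev_cnj[OF B, of N] B unfolding syl_def pratf_def by (intro ratf_if) auto
    show "ratf d S (\<lambda>x. hank_rhs N (A x) (coeff (P x)) i)"
      using pratf_mult[OF A pratf_rev_cnj[OF PP, of "N - 1"]] unfolding hank_rhs_def pratf_def
      by (cases i) auto
  qed (use that in auto)
  then show "ratf d S (\<lambda>x. coeff (Hk N (A x) (B x) (P x)) k)"
    unfolding Hk_def coeff_Psum by (intro ratf_if) auto
qed

text \<open>Contains \<open>coord_dom\<close> and is open for a simple reason, since
  \<open>denom\<close> is bounded away from 0 on the closed disc; the rational formulas are valid on
  all of it.\<close>

definition disc_coords :: "nat \<Rightarrow> nat \<Rightarrow> (nat \<Rightarrow> complex) set" where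
  "disc_coords N d = {x. disc_free (denom N d x)}"

lemma coeff_numer: "coeff (numer N x) k = (if k < N then x k else 0)"
  by (simp add: numer_def coeff_Poly_eq nth_default_def)

lemma coeff_denom: "coeff (denom N d x) k = (if k = 0 then 1 else if N + (k - 1) < d then x (N + (k - 1)) else 0)"
  by (cases k) (auto simp: denom_def coeff_Poly_eq nth_default_def)

lemma coords_rational_data:
  assumes "N > 0" "d \<le> 2 * N" "x \<in> disc_coords N d"
  shows "rational_data N (numer N x) (denom N d x)"
proof
  show "degree (numer N x) < N" using assms(1) by (intro degree_lessI) (auto simp: coeff_numer)
  show "degree (denom N d x) \<le> N" using degree_denom[of N d x] assms(2) by linarith
  show "poly (denom N d x) 0 = 1" by (simp add: denom_def)
qed (use assms in \<open>auto simp: disc_coords_def\<close>)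

lemma ratf_det:
  assumes "N > 0" "N \<le> d" "d \<le> 2 * N"
  shows "ratf d (disc_coords N d) (\<lambda>x. dt N (\<lambda>i j. moment (2 * ((i + 1) + (j + 1))) (param N d x)))"
proof (intro ratf_dt)
  fix i j
  let ?A = "numer N" and ?B = "denom N d" and ?S = "disc_coords N d"
  have A: "pratf d ?S ?A" unfolding pratf_def coeff_numer using assms(2) by (auto intro!: ratf_coord ratf_if)
  have B: "pratf d ?S ?B" unfolding pratf_def coeff_denom by (auto intro!: ratf_coord ratf_if)
  have nz: "dt (2 * N) (syl N (?B x)) \<noteq> 0" if "x \<in> ?S" for x
  proof -
    interpret rational_data N "?A x" "?B x" by (rule coords_rational_data[OF assms(1,3) that])
    show ?thesis by (rule syl_nonsingular[OF N dB B0 Bfree])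
  qed
  have "pratf d ?S (\<lambda>x. (Hk N (?A x) (?B x) ^^ n) (?A x))" for n
    by (induct n) (auto intro: A pratf_Hk[OF A B _ nz])
  then have "ratf d ?S (\<lambda>x. coeff ((Hk N (?A x) (?B x) ^^ Suc (2 * (i + j + 1))) (?A x)) 0)"
    unfolding pratf_def by blast
  then show "ratf d ?S (\<lambda>x. moment (2 * ((i + 1) + (j + 1))) (param N d x))"
  proof (rule ratf_cong)
    fix x assume x: "x \<in> ?S"
    interpret rational_data N "?A x" "?B x" by (rule coords_rational_data[OF assms(1,3) x])
    have "param N d x = qt (?A x) (?B x)" by (simp add: param_def qt_def[abs_def])
    moreover have "2 * ((i + 1) + (j + 1)) = Suc (Suc (2 * (i + j + 1)))" by simp
    ultimately show "moment (2 * ((i + 1) + (j + 1))) (param N d x) =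
        coeff ((Hk N (?A x) (?B x) ^^ Suc (2 * (i + j + 1))) (?A x)) 0"
      by (simp only: moment_qt)
  qed
qed

section \<open>Real analyticity\<close>

definition mono :: "nat \<Rightarrow> (nat \<Rightarrow> nat) \<times> (nat \<Rightarrow> nat) \<Rightarrow> (nat \<Rightarrow> complex) \<Rightarrow> real" where
  "mono d k y = (\<Prod>i<d. Re (y i) ^ fst k i * Im (y i) ^ snd k i)"

definition mono_deg :: "nat \<Rightarrow> (nat \<Rightarrow> nat) \<times> (nat \<Rightarrow> nat) \<Rightarrow> nat" where
  "mono_deg d k = (\<Sum>i<d. fst k i + snd k i)"

definition mono_add :: "(nat \<Rightarrow> nat) \<times> (nat \<Rightarrow> nat) \<Rightarrow> (nat \<Rightarrow> nat) \<times> (nat \<Rightarrow> nat) \<Rightarrow> (nat \<Rightarrow> nat) \<times> (nat \<Rightarrow> nat)" where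
  "mono_add k l = (\<lambda>i. fst k i + fst l i, \<lambda>i. snd k i + snd l i)"

definition near :: "nat \<Rightarrow> (nat \<Rightarrow> complex) \<Rightarrow> real \<Rightarrow> (nat \<Rightarrow> complex) set" where
  "near d p r = {w. \<forall>i<d. cmod (w i - p i) < r}"

text \<open>\<open>f\<close> has a power series expansion at \<open>p\<close>, in some enumeration of its terms, whose
  majorant at radius \<open>r\<close> is at most \<open>C\<close>.\<close>

definition majorized :: "nat \<Rightarrow> (nat \<Rightarrow> complex) \<Rightarrow> real \<Rightarrow> ((nat \<Rightarrow> complex) \<Rightarrow> complex) \<Rightarrow> real \<Rightarrow> bool" where
  "majorized d p r f C \<longleftrightarrow> (\<exists>a k S. ((\<lambda>n::nat. cmod (a n) * r ^ mono_deg d (k n)) has_sum S) UNIV \<and> S \<le> C \<and>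
     (\<forall>w\<in>near d p r. ((\<lambda>n. a n * of_real (mono d (k n) (\<lambda>i. w i - p i))) has_sum f w) UNIV))"

lemma mono_add: "mono d (mono_add k l) y = mono d k y * mono d l y"
  unfolding mono_def mono_add_def prod.distrib[symmetric] by (rule prod.cong) (simp_all add: power_add)

lemma mono_deg_add: "mono_deg d (mono_add k l) = mono_deg d k + mono_deg d l"
  unfolding mono_deg_def mono_add_def sum.distrib[symmetric] by (rule sum.cong) simp_all

lemma mono_bound:
  assumes "w \<in> near d p r" "r > 0" shows "\<bar>mono d k (\<lambda>i. w i - p i)\<bar> \<le> r ^ mono_deg d k"
proof -
  have "\<bar>mono d k (\<lambda>i. w i - p i)\<bar> = (\<Prod>i<d. \<bar>Re (w i - p i)\<bar> ^ fst k i * \<bar>Im (w i - p i)\<bar> ^ snd k i)"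
    by (simp add: mono_def abs_prod abs_mult power_abs)
  also have "\<dots> \<le> (\<Prod>i<d. r ^ (fst k i + snd k i))"
  proof (rule prod_mono, safe)
    fix i assume "i < d"
    then have w: "cmod (w i - p i) < r" using assms(1) by (simp add: near_def)
    have "\<bar>Re (w i - p i)\<bar> \<le> r" "\<bar>Im (w i - p i)\<bar> \<le> r"
      using abs_Re_le_cmod[of "w i - p i"] abs_Im_le_cmod[of "w i - p i"] w by linarith+
    then show "\<bar>Re (w i - p i)\<bar> ^ fst k i * \<bar>Im (w i - p i)\<bar> ^ snd k i \<le> r ^ (fst k i + snd k i)"
      unfolding power_add using assms(2) by (intro mult_mono power_mono) auto
  qed simp
  also have "\<dots> = r ^ mono_deg d k" by (simp only: mono_deg_def power_sum)
  finally show ?thesis .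
qed

lemma majorized_mono: "majorized d p r f C \<Longrightarrow> C \<le> C' \<Longrightarrow> majorized d p r f C'"
  unfolding majorized_def by (meson order_trans)

lemma majorized_cong: "majorized d p r f C \<Longrightarrow> (\<And>w. w \<in> near d p r \<Longrightarrow> g w = f w) \<Longrightarrow> majorized d p r g C"
  unfolding majorized_def by simp

lemma has_sum_single: "((\<lambda>n::nat. if n = m then c else 0) has_sum c) UNIV" for c :: "'a :: {comm_monoid_add, topological_space}"
  using has_sum_cong_neutral[of UNIV "{m}" "\<lambda>n. if n = m then c else 0" "\<lambda>n. if n = m then c else 0" c]
    has_sum_finite[of "{m}" "\<lambda>n. if n = m then c else 0"] by auto

lemma majorized_term: "majorized d p r (\<lambda>w. c * of_real (mono d k (\<lambda>i. w i - p i))) (cmod c * r ^ mono_deg d k)"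
  unfolding majorized_def
proof (intro exI[of _ "\<lambda>n. if n = 0 then c else 0"] exI[of _ "\<lambda>_. k"] exI[of _ "cmod c * r ^ mono_deg d k"] conjI ballI order_refl)
  show "((\<lambda>n::nat. cmod (if n = 0 then c else 0) * r ^ mono_deg d k) has_sum cmod c * r ^ mono_deg d k) UNIV"
    using has_sum_single[of 0 "cmod c * r ^ mono_deg d k"] by (simp add: if_distrib[of "\<lambda>x. _ x * _"] if_distrib[of cmod] if_distrib[of "\<lambda>x. x * _"] cong: if_cong)
  fix w
  show "((\<lambda>n::nat. (if n = 0 then c else 0) * of_real (mono d k (\<lambda>i. w i - p i))) has_sum c * of_real (mono d k (\<lambda>i. w i - p i))) UNIV"
    using has_sum_single[of 0 "c * of_real (mono d k (\<lambda>i. w i - p i))"] by (simp add: if_distrib[of "\<lambda>x. x * _"] cong: if_cong)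
qed

text \<open>The majorants make the double series absolutely convergent, so its terms may be
  re-enumerated by \<open>prod_decode\<close>. Sums, products and the geometric series are
  instances.\<close>

lemma majorized_has_sum:
  assumes r: "r > 0" and F: "\<And>n::nat. majorized d p r (F n) (C n)" and C: "(C has_sum S) UNIV"
    and f: "\<And>w. w \<in> near d p r \<Longrightarrow> ((\<lambda>n. F n w) has_sum f w) UNIV"
  shows "majorized d p r f S"
proof -
  define R where "R n a k s \<longleftrightarrow> ((\<lambda>m::nat. cmod (a m) * r ^ mono_deg d (k m)) has_sum s) UNIV \<and> s \<le> C n \<and>
     (\<forall>w\<in>near d p r. ((\<lambda>m. a m * of_real (mono d (k m) (\<lambda>i. w i - p i))) has_sum F n w) UNIV)" for n a k s
  have "\<exists>a k s. R n a k s" for n using F[of n] unfolding majorized_def R_def .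
  then obtain a k s where ks: "\<And>n. R n (a n) (k n) (s n)" by metis
  have 1: "((\<lambda>m::nat. cmod (a n m) * r ^ mono_deg d (k n m)) has_sum s n) UNIV" and 2: "s n \<le> C n" and
    3: "\<And>w. w \<in> near d p r \<Longrightarrow> ((\<lambda>m. a n m * of_real (mono d (k n m) (\<lambda>i. w i - p i))) has_sum F n w) UNIV" for n
    using ks[of n] unfolding R_def by blast+
  let ?N = "\<lambda>(n, m). cmod (a n m) * r ^ mono_deg d (k n m)"
  have s0: "0 \<le> s n" for n by (rule has_sum_nonneg[OF 1]) (use r in auto)
  have "s summable_on UNIV"
    by (rule summable_on_comparison_test[of C]) (use C 2 s0 in \<open>auto simp: summable_on_def\<close>)
  then obtain S' where S': "(s has_sum S') UNIV" by (auto simp: summable_on_def)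
  have le: "S' \<le> S" by (rule has_sum_mono[OF S' C 2])
  have sN: "?N summable_on (UNIV \<times> UNIV)"
    by (rule summable_on_SigmaI[where g=s]) (use 1 \<open>s summable_on UNIV\<close> r in auto)
  have hN: "(?N has_sum S') (UNIV \<times> UNIV)"
    by (rule has_sum_SigmaI[where g=s, OF _ S' sN]) (simp add: 1)
  have bij: "bij_betw prod_decode UNIV (UNIV \<times> UNIV)" using bij_prod_decode by simp
  show ?thesis
    unfolding majorized_def
  proof (intro exI[of _ "\<lambda>n. case_prod a (prod_decode n)"] exI[of _ "\<lambda>n. case_prod k (prod_decode n)"] exI[of _ S'] conjI le ballI)
    have "((\<lambda>n. ?N (prod_decode n)) has_sum S') UNIV" using hN by (simp only: has_sum_reindex_bij_betw[OF bij])
    then show "((\<lambda>n. cmod (case_prod a (prod_decode n)) * r ^ mono_deg d (case_prod k (prod_decode n))) has_sum S') UNIV"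
      by (simp add: case_prod_beta)
    fix w assume w: "w \<in> near d p r"
    let ?T = "\<lambda>(n, m). a n m * of_real (mono d (k n m) (\<lambda>i. w i - p i))"
    have "(\<lambda>x. cmod (?T x)) summable_on (UNIV \<times> UNIV)"
      by (rule Infinite_Sum.abs_summable_on_comparison_test'[OF sN])
        (auto simp: norm_mult intro!: mult_left_mono mono_bound[OF w r])
    then have "?T summable_on (UNIV \<times> UNIV)" by (rule abs_summable_summable)
    then have "(?T has_sum f w) (UNIV \<times> UNIV)"
      by (intro has_sum_SigmaI[where g="\<lambda>n. F n w", OF _ f[OF w]]) (simp_all add: 3[OF w])
    then have "((\<lambda>n. ?T (prod_decode n)) has_sum f w) UNIV" by (simp only: has_sum_reindex_bij_betw[OF bij])
    then show "((\<lambda>n. case_prod a (prod_decode n) * of_real (mono d (case_prod k (prod_decode n)) (\<lambda>i. w i - p i))) has_sum f w) UNIV"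
      by (simp add: case_prod_beta)
  qed
qed

lemma mono_0: "mono d (\<lambda>_. 0, \<lambda>_. 0) y = 1" "mono_deg d (\<lambda>_. 0, \<lambda>_. 0) = 0"
  by (simp_all add: mono_def mono_deg_def)

lemma majorized_const: "majorized d p r (\<lambda>_. c) (cmod c)"
  using majorized_term[of d p r c "(\<lambda>_. 0, \<lambda>_. 0)"] by (simp add: mono_0)

lemma has_sum_two: "((\<lambda>n::nat. if n = 0 then a else if n = 1 then b else 0) has_sum (a + b)) UNIV" for a b :: "'a :: topological_comm_monoid_add"
proof -
  have "((\<lambda>n::nat. (if n = 0 then a else 0) + (if n = 1 then b else 0)) has_sum (a + b)) UNIV"
    by (intro has_sum_add has_sum_single)
  also have "(\<lambda>n::nat. (if n = 0 then a else 0) + (if n = 1 then b else 0)) = (\<lambda>n. if n = 0 then a else if n = 1 then b else 0)"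
    by auto
  finally show ?thesis .
qed

lemma majorized_add:
  assumes "r > 0" "majorized d p r f C" "majorized d p r g D"
  shows "majorized d p r (\<lambda>w. f w + g w) (C + D)"
proof (rule majorized_has_sum[where F="\<lambda>n w. if n = 0 then f w else if n = 1 then g w else 0"
      and C="\<lambda>n. if n = 0 then C else if n = 1 then D else 0", OF assms(1)])
  fix n :: nat
  show "majorized d p r (\<lambda>w. if n = 0 then f w else if n = 1 then g w else 0) (if n = 0 then C else if n = 1 then D else 0)"
    using assms(2,3) majorized_const[of d p r 0] by simp
qed (rule has_sum_two)+

lemma majorized_term_mult:
  assumes r: "r > 0" and f: "majorized d p r f C"
  shows "majorized d p r (\<lambda>w. c * of_real (mono d l (\<lambda>i. w i - p i)) * f w) (cmod c * r ^ mono_deg d l * C)"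
proof -
  obtain a k S where 1: "((\<lambda>n::nat. cmod (a n) * r ^ mono_deg d (k n)) has_sum S) UNIV" "S \<le> C"
     "\<And>w. w\<in>near d p r \<Longrightarrow> ((\<lambda>n. a n * of_real (mono d (k n) (\<lambda>i. w i - p i))) has_sum f w) UNIV"
    using f unfolding majorized_def by blast
  have "majorized d p r (\<lambda>w. c * of_real (mono d l (\<lambda>i. w i - p i)) * f w) (cmod c * r ^ mono_deg d l * S)"
    unfolding majorized_def
  proof (intro exI[of _ "\<lambda>n. c * a n"] exI[of _ "\<lambda>n. mono_add l (k n)"] exI[of _ "cmod c * r ^ mono_deg d l * S"] conjI ballI order_refl)
    show "((\<lambda>n. cmod (c * a n) * r ^ mono_deg d (mono_add l (k n))) has_sum cmod c * r ^ mono_deg d l * S) UNIV"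
      using has_sum_cmult_right[OF 1(1), of "cmod c * r ^ mono_deg d l"]
      by (simp add: mono_deg_add power_add norm_mult mult_ac)
    fix w assume "w \<in> near d p r"
    from has_sum_cmult_right[OF 1(3)[OF this], of "c * of_real (mono d l (\<lambda>i. w i - p i))"]
    show "((\<lambda>n. c * a n * of_real (mono d (mono_add l (k n)) (\<lambda>i. w i - p i))) has_sum c * of_real (mono d l (\<lambda>i. w i - p i)) * f w) UNIV"
      by (simp add: mono_add mult_ac)
  qed
  then show ?thesis
    by (rule majorized_mono) (use 1(2) r in \<open>auto intro!: mult_left_mono\<close>)
qed

lemma majorized_nonneg: assumes "r > 0" "majorized d p r f C" shows "0 \<le> C"
proof -
  obtain a k S where 1: "((\<lambda>n::nat. cmod (a n) * r ^ mono_deg d (k n)) has_sum S) UNIV" "S \<le> C"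
    using assms(2) unfolding majorized_def by blast
  have "0 \<le> S" by (rule has_sum_nonneg[OF 1(1)]) (use assms(1) in auto)
  with 1(2) show ?thesis by simp
qed

lemma majorized_mult:
  assumes r: "r > 0" and g: "majorized d p r g D" and f: "majorized d p r f C"
  shows "majorized d p r (\<lambda>w. g w * f w) (D * C)"
proof -
  obtain a k S where 1: "((\<lambda>n::nat. cmod (a n) * r ^ mono_deg d (k n)) has_sum S) UNIV" "S \<le> D"
     "\<And>w. w\<in>near d p r \<Longrightarrow> ((\<lambda>n. a n * of_real (mono d (k n) (\<lambda>i. w i - p i))) has_sum g w) UNIV"
    using g unfolding majorized_def by blast
  have "majorized d p r (\<lambda>w. g w * f w) (S * C)"
    by (rule majorized_has_sum[OF r majorized_term_mult[OF r f] has_sum_cmult_left[OF 1(1)] has_sum_cmult_left[OF 1(3)]])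
  then show ?thesis by (rule majorized_mono) (intro mult_right_mono 1(2) majorized_nonneg[OF r f])
qed

lemma majorized_bound:
  assumes r: "r > 0" and f: "majorized d p r f C" and w: "w \<in> near d p r"
  shows "cmod (f w) \<le> C"
proof -
  obtain a k S where 1: "((\<lambda>n::nat. cmod (a n) * r ^ mono_deg d (k n)) has_sum S) UNIV" "S \<le> C"
     "((\<lambda>n. a n * of_real (mono d (k n) (\<lambda>i. w i - p i))) has_sum f w) UNIV"
    using f w unfolding majorized_def by blast
  let ?t = "\<lambda>n. a n * of_real (mono d (k n) (\<lambda>i. w i - p i))"
  have le: "cmod (?t n) \<le> cmod (a n) * r ^ mono_deg d (k n)" for n
    unfolding norm_mult by (rule mult_left_mono) (use mono_bound[OF w r, of "k n"] in auto)
  have "(\<lambda>n. cmod (?t n)) summable_on UNIV"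
    by (rule Infinite_Sum.abs_summable_on_comparison_test'[where g="\<lambda>n. cmod (a n) * r ^ mono_deg d (k n)"])
      (use le 1(1) in \<open>auto simp: summable_on_def\<close>)
  then have h: "((\<lambda>n. cmod (?t n)) has_sum infsum (\<lambda>n. cmod (?t n)) UNIV) UNIV" by (rule has_sum_infsum)
  have "cmod (f w) \<le> infsum (\<lambda>n. cmod (?t n)) UNIV" by (rule norm_has_sum_bound[OF h 1(3)])
  also have "\<dots> \<le> S" by (rule has_sum_mono[OF h 1(1) le])
  finally have "cmod (f w) \<le> S" .
  with 1(2) show ?thesis by simp
qed

lemma majorized_geometric:
  assumes r: "r > 0" and f: "majorized d p r f C" and C: "C < 1"
  shows "majorized d p r (\<lambda>w. inverse (1 - f w)) (inverse (1 - C))"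
proof -
  have C0: "0 \<le> C" by (rule majorized_nonneg[OF r f])
  have p: "majorized d p r (\<lambda>w. f w ^ n) (C ^ n)" for n
    by (induct n) (use majorized_const[of d p r 1] majorized_mult[OF r f] in auto)
  have geo: "((\<lambda>n. z ^ n) has_sum inverse (1 - z)) UNIV" if "norm z < 1" for z :: "'b :: {real_normed_field, banach}"
  proof (rule norm_summable_imp_has_sum)
    show "summable (\<lambda>n. norm (z ^ n))" using that by (simp add: norm_power summable_geometric)
    show "(\<lambda>n. z ^ n) sums inverse (1 - z)" using geometric_sums[OF that] by (simp add: inverse_eq_divide)
  qed
  show ?thesis
  proof (rule majorized_has_sum[OF r p])
    show "((\<lambda>n. C ^ n) has_sum inverse (1 - C)) UNIV" using geo[of C] C C0 by simp
    fix w assume "w \<in> near d p r"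
    then have "cmod (f w) < 1" using majorized_bound[OF r f] C by force
    then show "((\<lambda>n. f w ^ n) has_sum inverse (1 - f w)) UNIV" by (rule geo)
  qed
qed

text \<open>Real and imaginary part are two monomials of degree one, each with majorant
  \<open>r\<close>.\<close>

lemma majorized_coord: assumes "i < d" "r > 0" shows "majorized d p r (\<lambda>w. w i - p i) (2 * r)"
proof -
  let ?k = "\<lambda>j. if j = i then (1::nat) else 0" and ?z = "\<lambda>_::nat. 0::nat"
  have pr: "(\<Prod>j<d. if j = i then x else (1::real)) = x" for x using assms(1) by simp
  have m: "mono d (?k, ?z) y = Re (y i)" "mono d (?z, ?k) y = Im (y i)" for y
  proof -
    have "(\<Prod>j<d. Re (y j) ^ ?k j) = (\<Prod>j<d. if j = i then Re (y i) else 1)" by (rule prod.cong) auto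
    then show "mono d (?k, ?z) y = Re (y i)" by (simp add: mono_def pr)
    have "(\<Prod>j<d. Im (y j) ^ ?k j) = (\<Prod>j<d. if j = i then Im (y i) else 1)" by (rule prod.cong) auto
    then show "mono d (?z, ?k) y = Im (y i)" by (simp add: mono_def pr)
  qed
  have "mono_deg d (?k, ?z) = 1" "mono_deg d (?z, ?k) = 1"
    using assms(1) by (simp_all add: mono_deg_def)
  then have m2: "majorized d p r (\<lambda>w. 1 * of_real (Re (w i - p i)) + \<i> * of_real (Im (w i - p i))) (r + r)"
    using majorized_add[OF assms(2) majorized_term[of d p r 1 "(?k, ?z)"] majorized_term[of d p r \<i> "(?z, ?k)"]]
    unfolding m by simp
  have e: "1 * of_real (Re z) + \<i> * of_real (Im z) = z" for z by (simp add: complex_eq_iff)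
  show ?thesis using m2 unfolding e mult_2 .
qed

lemma majorized_cnj: assumes f: "majorized d p r f C" shows "majorized d p r (\<lambda>w. cnj (f w)) C"
proof -
  obtain a k S where 1: "((\<lambda>n::nat. cmod (a n) * r ^ mono_deg d (k n)) has_sum S) UNIV" "S \<le> C"
     "\<And>w. w\<in>near d p r \<Longrightarrow> ((\<lambda>n. a n * of_real (mono d (k n) (\<lambda>i. w i - p i))) has_sum f w) UNIV"
    using f unfolding majorized_def by blast
  show ?thesis unfolding majorized_def
  proof (intro exI[of _ "\<lambda>n. cnj (a n)"] exI[of _ k] exI[of _ S] conjI ballI 1(2))
    fix w assume "w \<in> near d p r"
    from has_sum_bounded_linear[OF bounded_linear_cnj 1(3)[OF this]]
    show "((\<lambda>n. cnj (a n) * of_real (mono d (k n) (\<lambda>i. w i - p i))) has_sum cnj (f w)) UNIV" by (simp add: o_def)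
  qed (simp add: 1(1))
qed

text \<open>The majorant of the increment is linear in \<open>r\<close>, so that it can be made
  small by shrinking \<open>r\<close>; \<open>r\<close> at most 1 absorbs the quadratic term of a
  product.\<close>

lemma polyfun_majorized:
  "polyfun d f \<Longrightarrow> \<exists>C\<ge>0. \<forall>r\<in>{0<..1}. majorized d p r (\<lambda>w. f w - f p) (C * r)"
proof (induct rule: polyfun.induct)
  case (polyfun_const c)
  show ?case using majorized_const[of d p _ 0] by (intro exI[of _ 0]) auto
next
  case (polyfun_coord i)
  then show ?case using majorized_coord[of i d _ p] by (intro exI[of _ 2]) auto
next
  case (polyfun_cnj f)
  then obtain C where "C \<ge> 0" "\<And>r. r \<in> {0<..1} \<Longrightarrow> majorized d p r (\<lambda>w. f w - f p) (C * r)" by blast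
  then show ?case using majorized_cnj[of d p _ "\<lambda>w. f w - f p"] by (intro exI[of _ C]) auto
next
  case (polyfun_add f g)
  then obtain C D where CD: "C \<ge> 0" "\<And>r. r \<in> {0<..1} \<Longrightarrow> majorized d p r (\<lambda>w. f w - f p) (C * r)"
    "D \<ge> 0" "\<And>r. r \<in> {0<..1} \<Longrightarrow> majorized d p r (\<lambda>w. g w - g p) (D * r)" by blast
  show ?case
  proof (intro exI[of _ "C + D"] conjI ballI)
    fix r :: real assume r: "r \<in> {0<..1}"
    then have "majorized d p r (\<lambda>w. (f w - f p) + (g w - g p)) (C * r + D * r)"
      by (intro majorized_add CD) auto
    then show "majorized d p r (\<lambda>w. f w + g w - (f p + g p)) ((C + D) * r)"
      by (simp add: algebra_simps)
  qed (use CD in simp)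
next
  case (polyfun_mult f g)
  then obtain C D where CD: "C \<ge> 0" "\<And>r. r \<in> {0<..1} \<Longrightarrow> majorized d p r (\<lambda>w. f w - f p) (C * r)"
    "D \<ge> 0" "\<And>r. r \<in> {0<..1} \<Longrightarrow> majorized d p r (\<lambda>w. g w - g p) (D * r)" by blast
  show ?case
  proof (intro exI[of _ "C * D + cmod (f p) * D + cmod (g p) * C"] conjI ballI)
    fix r :: real assume r: "r \<in> {0<..1}"
    then have r0: "r > 0" by simp
    note f = CD(2)[OF r] and g = CD(4)[OF r]
    have "majorized d p r (\<lambda>w. (f w - f p) * (g w - g p) + f p * (g w - g p) + g p * (f w - f p))
        (C * r * (D * r) + cmod (f p) * (D * r) + cmod (g p) * (C * r))"
      by (intro majorized_add majorized_mult majorized_const f g r0)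
    moreover have "(f w - f p) * (g w - g p) + f p * (g w - g p) + g p * (f w - f p) = f w * g w - f p * g p" for w
      by (simp add: algebra_simps)
    moreover have "C * r * (D * r) + cmod (f p) * (D * r) + cmod (g p) * (C * r) \<le> (C * D + cmod (f p) * D + cmod (g p) * C) * r"
    proof -
      have "C * D * (r * r) \<le> C * D * r" using r CD(1,3) by (intro mult_left_mono) (auto simp: mult_le_cancel_left1)
      then show ?thesis by (simp add: algebra_simps)
    qed
    ultimately show "majorized d p r (\<lambda>w. f w * g w - f p * g p) ((C * D + cmod (f p) * D + cmod (g p) * C) * r)"
      using majorized_mono by simp
  qed (use CD in simp)
qed

text \<open>1 / Q = (1 / Q p) / (1 - h) with h = 1 - Q / Q p. The radius \<open>e\<close> makes the
  majorant of h less than 1, so the geometric series applies; the 1 added to \<open>C\<close> guards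
  against division by 0.\<close>

lemma ratf_majorized:
  assumes P: "polyfun d P" and Q: "polyfun d Q" and nz: "Q p \<noteq> 0"
  shows "\<exists>e>0. \<forall>r. 0 < r \<and> r \<le> e \<longrightarrow> (\<exists>C. majorized d p r (\<lambda>w. P w / Q w) C) \<and> (\<forall>w\<in>near d p r. Q w \<noteq> 0)"
proof -
  obtain C where C: "C \<ge> 0" "\<And>r. r \<in> {0<..1} \<Longrightarrow> majorized d p r (\<lambda>w. Q w - Q p) (C * r)"
    using polyfun_majorized[OF Q, of p] by blast
  obtain D where D: "D \<ge> 0" "\<And>r. r \<in> {0<..1} \<Longrightarrow> majorized d p r (\<lambda>w. P w - P p) (D * r)"
    using polyfun_majorized[OF P, of p] by blast
  let ?c = "cmod (Q p)"
  have c: "?c > 0" using nz by simp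
  define e where "e = min 1 (?c / (2 * (C + 1)))"
  have e: "e > 0" "e \<le> 1" using c C(1) by (auto simp: e_def)
  show ?thesis
  proof (intro exI[of _ e] conjI[OF e(1)] allI impI)
    fix r assume r: "0 < r \<and> r \<le> e"
    then have r1: "r \<in> {0<..1}" "r > 0" using e by auto
    have "r \<le> ?c / (2 * (C + 1))" using r by (simp add: e_def)
    then have "r * (C + 1) \<le> ?c / 2" using C(1) by (simp add: field_simps)
    then have "C * r + r \<le> ?c / 2" by (simp add: algebra_simps)
    then have "C * r < ?c" using c r1(2) by linarith
    then have Cr: "C * r / ?c < 1" using c by simp
    have m: "majorized d p r (\<lambda>w. (- (1 / Q p)) * (Q w - Q p)) (cmod (- (1 / Q p)) * (C * r))"
      by (intro majorized_mult majorized_const C(2) r1)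
    then have m: "majorized d p r (\<lambda>w. (- (1 / Q p)) * (Q w - Q p)) (C * r / ?c)"
      by (simp add: norm_divide)
    have q: "1 - (- (1 / Q p)) * (Q w - Q p) = Q w / Q p" for w using nz by (simp add: field_simps)
    have "majorized d p r (\<lambda>w. inverse (Q w / Q p)) (inverse (1 - C * r / ?c))"
      using majorized_geometric[OF r1(2) m Cr] unfolding q .
    then have "majorized d p r (\<lambda>w. ((P w - P p) + P p) * ((1 / Q p) * inverse (Q w / Q p)))
        ((D * r + cmod (P p)) * (cmod (1 / Q p) * inverse (1 - C * r / ?c)))"
      by (intro majorized_mult majorized_add majorized_const D(2) r1)
    then have "majorized d p r (\<lambda>w. P w / Q w)
        ((D * r + cmod (P p)) * (cmod (1 / Q p) * inverse (1 - C * r / ?c)))"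
      by (rule majorized_cong) (use nz in simp)
    then have "\<exists>C. majorized d p r (\<lambda>w. P w / Q w) C" by (rule exI)
    moreover have "Q w \<noteq> 0" if "w \<in> near d p r" for w
      using majorized_bound[OF r1(2) m that] Cr nz by auto
    ultimately show "(\<exists>C. majorized d p r (\<lambda>w. P w / Q w) C) \<and> (\<forall>w\<in>near d p r. Q w \<noteq> 0)" by blast
  qed
qed

text \<open>\<open>real_analytic_at\<close> wants one coefficient for each pair of exponents on the
  first \<open>d\<close> indices. Terms of the enumerated series with the same restricted exponents
  are therefore collected in fibres, which absolute convergence permits.\<close>

lemma majorized_real_analytic:
  assumes r: "r > 0" and f: "majorized d p r f C"
    and g: "\<And>w. w \<in> {..<d} \<rightarrow>\<^sub>E UNIV \<Longrightarrow> w \<in> near d p r \<Longrightarrow> g w = Re (f w)"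
  shows "real_analytic_at d g p"
proof -
  obtain a k S where 1: "((\<lambda>n::nat. cmod (a n) * r ^ mono_deg d (k n)) has_sum S) UNIV"
     "\<And>w. w\<in>near d p r \<Longrightarrow> ((\<lambda>n. a n * of_real (mono d (k n) (\<lambda>i. w i - p i))) has_sum f w) UNIV"
    using f unfolding majorized_def by blast
  define rk where "rk n = (restrict (fst (k n)) {..<d}, restrict (snd (k n)) {..<d})" for n
  let ?K = "({..<d} \<rightarrow>\<^sub>E (UNIV :: nat set)) \<times> ({..<d} \<rightarrow>\<^sub>E (UNIV :: nat set))"
  have rk: "rk n \<in> ?K" for n by (auto simp: rk_def)
  have mrk: "mono d (k n) y = mono d (rk n) y" for n y
    unfolding mono_def rk_def fst_conv snd_conv by (rule prod.cong) simp_all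
  have drk: "mono_deg d (k n) = mono_deg d (rk n)" for n
    unfolding mono_deg_def rk_def fst_conv snd_conv by (rule sum.cong) simp_all
  define fib where "fib \<kappa> = {n. rk n = \<kappa>}" for \<kappa>
  define c where "c \<kappa> = infsum a (fib \<kappa>)" for \<kappa>
  have bij: "bij_betw snd (Sigma ?K fib) UNIV"
  proof (rule bij_betwI[where g="\<lambda>n. (rk n, n)"])
    show "(\<lambda>n. (rk n, n)) \<in> UNIV \<rightarrow> Sigma ?K fib"
    proof
      fix n show "(rk n, n) \<in> Sigma ?K fib" by (rule SigmaI[OF rk]) (simp add: fib_def)
    qed
    fix x assume "x \<in> Sigma ?K fib"
    then have "snd x \<in> fib (fst x)" by (rule SigmaE) simp
    then show "(rk (snd x), snd x) = x" by (simp add: fib_def prod_eq_iff)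
  qed simp_all
  have sfib: "a summable_on fib \<kappa>" for \<kappa>
  proof -
    have "(\<lambda>n. cmod (a n) * r ^ mono_deg d (k n)) summable_on UNIV"
      unfolding summable_on_def by (rule exI[of _ S], rule 1(1))
    then have "(\<lambda>n. cmod (a n) * r ^ mono_deg d (k n)) summable_on fib \<kappa>"
      by (rule summable_on_subset_banach) simp
    then have s: "(\<lambda>n. cmod (a n) * r ^ mono_deg d (k n) * inverse (r ^ mono_deg d \<kappa>)) summable_on fib \<kappa>"
      by (rule summable_on_cmult_left)
    have "cmod (a n) = cmod (a n) * r ^ mono_deg d (k n) * inverse (r ^ mono_deg d \<kappa>)" if "n \<in> fib \<kappa>" for n
    proof -
      have "rk n = \<kappa>" using that by (simp add: fib_def)
      then show ?thesis using r by (simp add: drk)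
    qed
    then have "(\<lambda>n. cmod (a n)) summable_on fib \<kappa>" using s by (subst summable_on_cong)
    then show ?thesis by (rule abs_summable_summable)
  qed
  show ?thesis
    unfolding real_analytic_at_def
  proof (intro exI[of _ r] conjI r exI[of _ "\<lambda>\<alpha> \<beta>. Re (c (\<alpha>, \<beta>))"] ballI impI)
    fix w assume wE: "w \<in> {..<d} \<rightarrow>\<^sub>E UNIV" and "\<forall>i<d. cmod (w i - p i) < r"
    then have w: "w \<in> near d p r" by (simp add: near_def)
    let ?y = "\<lambda>i. w i - p i"
    have "((\<lambda>x. a (snd x) * of_real (mono d (k (snd x)) ?y)) has_sum f w) (Sigma ?K fib)"
      using has_sum_reindex_bij_betw[OF bij, of "\<lambda>n. a n * of_real (mono d (k n) ?y)" "f w"] 1(2)[OF w] by (rule iffD2)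
    then have "((\<lambda>\<kappa>. c \<kappa> * of_real (mono d \<kappa> ?y)) has_sum f w) ?K"
    proof (rule has_sum_SigmaD[where g="\<lambda>\<kappa>. c \<kappa> * of_real (mono d \<kappa> ?y)"])
      fix \<kappa>
      have "((\<lambda>n. a n * of_real (mono d \<kappa> ?y)) has_sum c \<kappa> * of_real (mono d \<kappa> ?y)) (fib \<kappa>)"
        unfolding c_def by (intro has_sum_cmult_left has_sum_infsum sfib)
      then have "((\<lambda>n. a n * of_real (mono d (k n) ?y)) has_sum c \<kappa> * of_real (mono d \<kappa> ?y)) (fib \<kappa>)"
        by (subst has_sum_cong[where g="\<lambda>n. a n * of_real (mono d \<kappa> ?y)"]) (simp_all add: mrk fib_def)
      then show "((\<lambda>n. a (snd (\<kappa>, n)) * of_real (mono d (k (snd (\<kappa>, n))) ?y)) has_sum c \<kappa> * of_real (mono d \<kappa> ?y)) (fib \<kappa>)"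
        unfolding snd_conv .
    qed
    from has_sum_bounded_linear[OF bounded_linear_Re this]
    have "((\<lambda>\<kappa>. Re (c \<kappa>) * mono d \<kappa> ?y) has_sum Re (f w)) ?K" by (simp add: o_def)
    moreover have "(\<lambda>\<kappa>. Re (c \<kappa>) * mono d \<kappa> ?y) =
        (\<lambda>(\<alpha>, \<beta>). Re (c (\<alpha>, \<beta>)) * (\<Prod>i<d. Re (w i - p i) ^ \<alpha> i * Im (w i - p i) ^ \<beta> i))"
      by (auto simp only: fun_eq_iff mono_def prod.case fst_conv snd_conv split_paired_all)
    ultimately show "((\<lambda>(\<alpha>, \<beta>). Re (c (\<alpha>, \<beta>)) * (\<Prod>i<d. Re (w i - p i) ^ \<alpha> i * Im (w i - p i) ^ \<beta> i)) has_sum g w) ?K"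
      unfolding g[OF wE w] by (simp only:)
  qed
qed

section \<open>Zeros of the Gram determinant\<close>

text \<open>The modulus of \<open>denom\<close> has a positive minimum \<delta> on the closed disc.
  Changing at most \<open>d\<close> coefficients by at most \<delta> / (d + 1) each moves the values
  there by less than \<delta>.\<close>

lemma disc_coords_near:
  assumes x: "x \<in> disc_coords N d" shows "\<exists>e>0. near d x e \<subseteq> disc_coords N d"
proof -
  let ?B = "denom N d x"
  have "continuous_on (cball 0 1) (\<lambda>z. cmod (poly ?B z))" by (intro continuous_intros)
  then obtain z0 where z0: "z0 \<in> cball 0 1" "\<And>z. z \<in> cball 0 1 \<Longrightarrow> cmod (poly ?B z0) \<le> cmod (poly ?B z)"
    using continuous_attains_inf[of "cball (0::complex) 1" "\<lambda>z. cmod (poly ?B z)"] by auto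
  define \<delta> where "\<delta> = cmod (poly ?B z0)"
  have \<delta>: "\<delta> > 0" using x z0(1) by (auto simp: disc_coords_def disc_free_def \<delta>_def)
  define e where "e = \<delta> / (real d + 1)"
  have e: "e > 0" using \<delta> by (simp add: e_def)
  have de: "real d * e < \<delta>" using \<delta> by (simp add: e_def field_simps)
  show ?thesis
  proof (intro exI[of _ e] conjI e subsetI)
    fix w assume w: "w \<in> near d x e"
    have "poly (denom N d w) z \<noteq> 0" if z: "cmod z \<le> 1" for z
    proof
      assume 0: "poly (denom N d w) z = 0"
      let ?P = "denom N d w - ?B"
      have dg: "degree ?P < Suc d"
        using degree_denom[of N d w] degree_denom[of N d x] degree_diff_le_max[of "denom N d w" ?B] by linarith
      have c: "cmod (coeff ?P k) \<le> (if k = 0 then 0 else e)" for k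
      proof -
        have "cmod (w (N + (k - 1)) - x (N + (k - 1))) \<le> e" if "N + (k - 1) < d"
          using w that by (auto simp: near_def less_imp_le)
        then show ?thesis using e by (cases k) (auto simp: coeff_denom)
      qed
      have "cmod (poly ?P z) = cmod (\<Sum>k<Suc d. coeff ?P k * z ^ k)" by (simp only: poly_eq_trig[OF dg])
      also have "\<dots> \<le> (\<Sum>k<Suc d. cmod (coeff ?P k * z ^ k))" by (rule norm_sum)
      also have "\<dots> \<le> (\<Sum>k<Suc d. if k = 0 then 0 else e)"
      proof (rule sum_mono)
        fix k
        have "cmod (coeff ?P k * z ^ k) \<le> cmod (coeff ?P k) * 1"
          unfolding norm_mult norm_power using z by (intro mult_left_mono power_le_one) auto
        then show "cmod (coeff ?P k * z ^ k) \<le> (if k = 0 then 0 else e)" using c[of k] by linarith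
      qed
      also have "\<dots> = real d * e" unfolding sum.lessThan_Suc_shift by simp
      finally have "cmod (poly ?P z) < \<delta>" using de by linarith
      moreover have "cmod (poly ?P z) = cmod (poly ?B z)" using 0 by simp
      ultimately show False using z0(2)[of z] z by (simp add: \<delta>_def)
    qed
    then show "w \<in> disc_coords N d" by (simp add: disc_coords_def disc_free_def)
  qed
qed

definition gram_det :: "nat \<Rightarrow> (complex \<Rightarrow> complex) \<Rightarrow> complex" where
  "gram_det N u = dt N (\<lambda>i j. moment (2 * ((i + 1) + (j + 1))) u)"

lemma coord_dom_disc: "x \<in> coord_dom N d \<Longrightarrow> x \<in> disc_coords N d"
  by (simp add: coord_dom_def rat_pair_def disc_coords_def disc_free_def)

text \<open>The factor \<open>c\<close> serves to obtain the real part with c = 1 and the imaginary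
  part with c = - \<i>.\<close>

lemma gram_det_analytic:
  assumes N: "N > 0" "N \<le> d" "d \<le> 2 * N"
  shows "real_analytic_on N d (\<lambda>u. Re (c * gram_det N u)) U"
  unfolding real_analytic_on_def
proof (intro ballI impI)
  fix x assume "x \<in> coord_dom N d"
  then have x: "x \<in> disc_coords N d" by (rule coord_dom_disc)
  obtain P Q where P: "polyfun d P" and Q: "polyfun d Q" and nz: "\<And>x. x \<in> disc_coords N d \<Longrightarrow> Q x \<noteq> 0"
    and eq: "\<And>x. x \<in> disc_coords N d \<Longrightarrow> gram_det N (param N d x) = P x / Q x"
    using ratf_det[OF N] unfolding ratf_def gram_det_def by blast
  from ratf_majorized[OF P Q nz[OF x]]
  obtain e1 where "0 < e1 \<and> (\<forall>r. 0 < r \<and> r \<le> e1 \<longrightarrow> (\<exists>C. majorized d x r (\<lambda>w. P w / Q w) C) \<and> (\<forall>w\<in>near d x r. Q w \<noteq> 0))" ..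
  then have e1: "0 < e1" "\<And>r. 0 < r \<Longrightarrow> r \<le> e1 \<Longrightarrow> \<exists>C. majorized d x r (\<lambda>w. P w / Q w) C" by simp_all
  obtain e2 where e2: "e2 > 0" "near d x e2 \<subseteq> disc_coords N d" using disc_coords_near[OF x] by blast
  define r where "r = min e1 e2"
  have r: "r > 0" using e1(1) e2(1) by (simp add: r_def)
  obtain C where C: "majorized d x r (\<lambda>w. P w / Q w) C" using e1(2)[of r, OF r] unfolding r_def by fastforce
  show "real_analytic_at d ((\<lambda>u. Re (c * gram_det N u)) \<circ> param N d) x"
  proof (rule majorized_real_analytic[OF r majorized_mult[OF r majorized_const[of d x r c] C]])
    fix w assume "w \<in> near d x r"
    then have "w \<in> near d x e2" unfolding near_def r_def by auto
    then have "w \<in> disc_coords N d" using e2(2) by blast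
    then show "((\<lambda>u. Re (c * gram_det N u)) \<circ> param N d) w = Re (c * (P w / Q w))" by (simp only: o_apply eq)
  qed
qed

lemma gram_det_subvariety:
  assumes N: "N > 0" "N \<le> d" "d \<le> 2 * N"
    and cl: "l2_closed_in (manifold N d) {u \<in> manifold N d. gram_det N u = 0}"
  shows "real_analytic_subvariety N d {u \<in> manifold N d. gram_det N u = 0}"
  unfolding real_analytic_subvariety_def
proof (intro conjI ballI cl)
  fix p assume p: "p \<in> manifold N d"
  let ?M = "manifold N d" and ?F = "{\<lambda>u. Re (1 * gram_det N u), \<lambda>u. Re (- \<i> * gram_det N u)}"
  have "l2_open_in ?M ?M" unfolding l2_open_in_def by (auto intro: exI[of _ 1])
  moreover have "finite ?F" by simp
  moreover have "\<forall>f\<in>?F. real_analytic_on N d f ?M" using gram_det_analytic[OF N] by blast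
  moreover have "{u \<in> ?M. gram_det N u = 0} \<inter> ?M = {u \<in> ?M. \<forall>f\<in>?F. f u = 0}"
    by (auto simp: complex_eq_iff)
  ultimately show "\<exists>U F. l2_open_in ?M U \<and> p \<in> U \<and> finite F \<and> (\<forall>f\<in>F. real_analytic_on N d f U) \<and>
      {u \<in> ?M. gram_det N u = 0} \<inter> U = {u \<in> U. \<forall>f\<in>F. f u = 0}"
    using p by (intro exI[of _ ?M] exI[of _ ?F]) simp
qed

section \<open>Zero sets of nonzero polynomial functions are null\<close>

lemma polyfun_line: "polyfun d f \<Longrightarrow> \<exists>q. \<forall>t::real. f (x(i := z + of_real t * c)) = poly q (of_real t)"
proof (induct rule: polyfun.induct)
  case (polyfun_const a) show ?case by (rule exI[of _ "[:a:]"]) simp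
next
  case (polyfun_coord j)
  show ?case by (rule exI[of _ "if j = i then [:z, c:] else [:x j:]"]) simp
next
  case (polyfun_cnj f)
  then obtain q where "\<And>t::real. f (x(i := z + of_real t * c)) = poly q (of_real t)" by blast
  then show ?case by (intro exI[of _ "map_poly cnj q"]) (simp only: poly_cnj complex_cnj_complex_of_real simp_thms)
next
  case (polyfun_add f g)
  then obtain q q' where "\<And>t::real. f (x(i := z + of_real t * c)) = poly q (of_real t)"
    "\<And>t::real. g (x(i := z + of_real t * c)) = poly q' (of_real t)" by blast
  then show ?case by (intro exI[of _ "q + q'"]) (simp only: poly_add simp_thms)
next
  case (polyfun_mult f g)
  then obtain q q' where "\<And>t::real. f (x(i := z + of_real t * c)) = poly q (of_real t)"
    "\<And>t::real. g (x(i := z + of_real t * c)) = poly q' (of_real t)" by blast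
  then show ?case by (intro exI[of _ "q * q'"]) (simp only: poly_mult simp_thms)
qed

lemma polyfun_measurable:
  assumes "polyfun d f" "\<And>j. j < d \<Longrightarrow> (\<lambda>x. F x j) \<in> borel_measurable M"
  shows "(\<lambda>x. f (F x)) \<in> borel_measurable M"
  using assms(1) by induct (auto intro: assms(2) borel_measurable_cnj[THEN measurable_compose[rotated]])

lemma AE_poly_real_line:
  assumes "poly q (of_real t0) \<noteq> (0::complex)" shows "AE t in lborel. poly q (of_real (t - s)) \<noteq> 0"
proof -
  have "q \<noteq> 0" using assms by auto
  then have "finite {z. poly q z = 0}" by (rule poly_roots_finite)
  then have "finite ((\<lambda>t::real. complex_of_real (t - s)) -` {z. poly q z = 0})"
    by (rule finite_vimageI) (simp add: inj_on_def)
  then have "(\<lambda>t::real. complex_of_real (t - s)) -` {z. poly q z = 0} \<in> null_sets lborel"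
    by (rule finite_imp_null_set_lborel)
  then show ?thesis by (rule AE_I') auto
qed

text \<open>Fubini's theorem, one coordinate at a time: coordinates outside \<open>J\<close> are
  frozen at \<open>x0\<close>, and \<open>one\<close> keeps the value nonzero for almost every
  change of one coordinate. It is applied to the two real components of a complex number and then to
  the complex coordinates.\<close>

lemma AE_PiM_nonzero:
  fixes g :: "('i \<Rightarrow> 'a) \<Rightarrow> complex"
  assumes psf: "product_sigma_finite M" and J: "finite J"
    and meas: "\<And>J. finite J \<Longrightarrow> (\<lambda>x. g (\<lambda>j. if j \<in> J then x j else x0 j)) \<in> borel_measurable (PiM J M)"
    and one: "\<And>x i. g x \<noteq> 0 \<Longrightarrow> AE y in M i. g (x(i := y)) \<noteq> 0"
    and g0: "g x0 \<noteq> 0"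
  shows "AE x in PiM J M. g (\<lambda>j. if j \<in> J then x j else x0 j) \<noteq> 0"
  using J
proof induct
  case empty
  show ?case using g0 by (simp add: PiM_empty AE_count_space)
next
  case (insert i J)
  interpret product_sigma_finite M by (rule psf)
  let ?f = "\<lambda>J x. if g (\<lambda>j. if j \<in> J then x j else x0 j) = 0 then 1 else 0 :: ennreal"
  have m: "?f J \<in> borel_measurable (PiM J M)" if "finite J" for J
    using meas[OF that] by measurable
  have upd: "(\<lambda>j. if j \<in> insert i J then (x(i := y)) j else x0 j) = (\<lambda>j. if j \<in> J then x j else x0 j)(i := y)" for x y
    using insert(2) by auto
  have "integral\<^sup>N (PiM (insert i J) M) (?f (insert i J)) = (\<integral>\<^sup>+ x. (\<integral>\<^sup>+ y. ?f (insert i J) (x(i := y)) \<partial>(M i)) \<partial>(PiM J M))"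
    by (rule product_nn_integral_insert[OF insert(1,2) m]) (simp add: insert(1))
  also have "\<dots> = (\<integral>\<^sup>+ x. 0 \<partial>(PiM J M))"
  proof (rule nn_integral_cong_AE)
    show "AE x in PiM J M. (\<integral>\<^sup>+ y. ?f (insert i J) (x(i := y)) \<partial>(M i)) = 0"
      using insert(3)
    proof eventually_elim
      case (elim x)
      have "(\<integral>\<^sup>+ y. ?f (insert i J) (x(i := y)) \<partial>(M i)) = (\<integral>\<^sup>+ y. 0 \<partial>(M i))"
        using one[OF elim, of i] unfolding upd by (intro nn_integral_cong_AE) (auto elim: eventually_mono)
      then show ?case by simp
    qed
  qed
  also have "\<dots> = 0" by simp
  finally have "AE x in PiM (insert i J) M. ?f (insert i J) x = 0"
    by (subst (asm) nn_integral_0_iff_AE[OF m]) (simp_all add: insert(1))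
  then show ?case by (auto elim: eventually_mono split: if_splits)
qed

text \<open>Lebesgue measure on the plane is a product over \<open>Basis\<close>, so real lines
  suffice. There conjugation affects coefficients only: \<open>polyfun_line\<close> gives a
  polynomial in one variable, with finitely many zeros.\<close>

lemma AE_polyfun_update:
  assumes f: "polyfun d f" and nz: "f x \<noteq> 0" shows "AE z in lborel. f (x(i := z)) \<noteq> 0"
proof -
  let ?s = "\<lambda>v. \<Sum>b\<in>Basis. v b *\<^sub>R b :: complex"
  define v0 where "v0 b = x i \<bullet> b" for b
  have psf: "product_sigma_finite (\<lambda>_. lborel :: real measure)"
    by (simp add: product_sigma_finite_def sigma_finite_lborel)
  have "AE v in PiM Basis (\<lambda>_::complex. lborel :: real measure). f (x(i := ?s (\<lambda>b. if b \<in> Basis then v b else v0 b))) \<noteq> 0"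
  proof (rule AE_PiM_nonzero[where g="\<lambda>v. f (x(i := ?s v))", OF psf])
    show "finite (Basis :: complex set)" by simp
    show "f (x(i := ?s v0)) \<noteq> 0" unfolding v0_def euclidean_representation using nz by simp
    fix J :: "complex set" assume "finite J"
    show "(\<lambda>v. f (x(i := ?s (\<lambda>b. if b \<in> J then v b else v0 b)))) \<in> borel_measurable (PiM J (\<lambda>_. lborel))"
    proof (rule polyfun_measurable[OF f])
      fix j
      show "(\<lambda>v. (x(i := ?s (\<lambda>b. if b \<in> J then v b else v0 b))) j) \<in> borel_measurable (PiM J (\<lambda>_. lborel))"
      proof (cases "j = i")
        case True
        have "(\<lambda>v. (if b \<in> J then v b else v0 b) *\<^sub>R b) \<in> borel_measurable (PiM J (\<lambda>_. lborel))" for b :: complex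
        proof (cases "b \<in> J")
          case True
          have "(\<lambda>v. v b) \<in> measurable (PiM J (\<lambda>_. lborel :: real measure)) lborel"
            by (rule measurable_component_singleton[OF True])
          then have "(\<lambda>v. v b) \<in> borel_measurable (PiM J (\<lambda>_. lborel :: real measure))" by simp
          then show ?thesis using True by simp
        qed simp
        then show ?thesis using True by (simp add: borel_measurable_sum)
      qed simp
    qed
  next
    fix v and b :: complex assume v: "f (x(i := ?s v)) \<noteq> 0"
    show "AE y in lborel. f (x(i := ?s (v(b := y)))) \<noteq> 0"
    proof (cases "b \<in> Basis")
      case True
      have s: "?s (v(b := y)) = ?s v + of_real (y - v b) * b" for y
      proof -
        have "?s (v(b := y)) = y *\<^sub>R b + (\<Sum>b'\<in>Basis - {b}. v b' *\<^sub>R b')"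
          using True by (subst sum.remove[of _ b]) (auto intro!: sum.cong)
        also have "(\<Sum>b'\<in>Basis - {b}. v b' *\<^sub>R b') = ?s v - v b *\<^sub>R b"
          using True by (subst (2) sum.remove[of _ b]) auto
        finally show ?thesis by (simp add: scaleR_conv_of_real algebra_simps)
      qed
      from polyfun_line[OF f, of x i "?s v" b]
      obtain q where "\<forall>t::real. f (x(i := ?s v + of_real t * b)) = poly q (of_real t)" ..
      then have q: "f (x(i := ?s v + of_real t * b)) = poly q (of_real t)" for t :: real ..
      have "poly q (of_real 0) \<noteq> 0" using v unfolding q[symmetric] by simp
      from AE_poly_real_line[OF this, of "v b"] show ?thesis unfolding s q .
    next
      case False
      then have "?s (v(b := y)) = ?s v" for y by (intro sum.cong) auto
      then show ?thesis using v by simp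
    qed
  qed
  moreover have "?s (\<lambda>b. if b \<in> Basis then v b else v0 b) = ?s v" for v by (rule sum.cong) auto
  ultimately have AE: "AE v in PiM Basis (\<lambda>_::complex. lborel :: real measure). f (x(i := ?s v)) \<noteq> 0" by simp
  have meas: "(\<lambda>z. f (x(i := z))) \<in> borel_measurable borel"
  proof (rule polyfun_measurable[OF f])
    fix j show "(\<lambda>z. (x(i := z)) j) \<in> borel_measurable borel" by (cases "j = i") auto
  qed
  have d: "lborel = distr (PiM Basis (\<lambda>_::complex. lborel :: real measure)) borel ?s"
    unfolding lborel_def lborel_eq_real[unfolded lborel_def] ..
  show ?thesis
    unfolding d
  proof (subst AE_distr_iff)
    show "?s \<in> measurable (PiM Basis (\<lambda>_::complex. lborel :: real measure)) borel" by measurable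
    show "{z \<in> space borel. f (x(i := z)) \<noteq> 0} \<in> sets borel" using meas by measurable
  qed (rule AE)
qed

lemma polyfun_zeros_null:
  assumes f: "polyfun d f" and x0: "x0 \<in> {..<d} \<rightarrow>\<^sub>E UNIV" "f x0 \<noteq> 0"
  shows "\<exists>Z\<in>null_sets (\<Pi>\<^sub>M i\<in>{..<d}. (lborel :: complex measure)). {x \<in> {..<d} \<rightarrow>\<^sub>E UNIV. f x = 0} \<subseteq> Z"
proof -
  let ?L = "\<Pi>\<^sub>M i\<in>{..<d}. (lborel :: complex measure)"
  have psf: "product_sigma_finite (\<lambda>_. lborel :: complex measure)"
    by (simp add: product_sigma_finite_def sigma_finite_lborel)
  have "AE x in ?L. f (\<lambda>j. if j \<in> {..<d} then x j else x0 j) \<noteq> 0"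
  proof (rule AE_PiM_nonzero[OF psf])
    fix J :: "nat set" assume "finite J"
    show "(\<lambda>x. f (\<lambda>j. if j \<in> J then x j else x0 j)) \<in> borel_measurable (PiM J (\<lambda>_. lborel))"
    proof (rule polyfun_measurable[OF f])
      fix j
      show "(\<lambda>x. if j \<in> J then x j else x0 j) \<in> borel_measurable (PiM J (\<lambda>_. lborel))"
      proof (cases "j \<in> J")
        case True
        have "(\<lambda>v. v j) \<in> measurable (PiM J (\<lambda>_. lborel :: complex measure)) lborel"
          by (rule measurable_component_singleton[OF True])
        then show ?thesis using True by simp
      qed simp
    qed
  next
    fix x :: "nat \<Rightarrow> complex" and i assume "f x \<noteq> 0"
    then show "AE y in lborel. f (x(i := y)) \<noteq> 0" by (rule AE_polyfun_update[OF f])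
  qed (use x0(2) in simp_all)
  then obtain Z where Z: "Z \<in> null_sets ?L" "{x \<in> space ?L. \<not> f (\<lambda>j. if j \<in> {..<d} then x j else x0 j) \<noteq> 0} \<subseteq> Z"
    by (auto elim!: eventually_ae_filter[THEN iffD1, THEN bexE])
  have sp: "space ?L = {..<d} \<rightarrow>\<^sub>E UNIV" by (simp add: space_PiM)
  have "(\<lambda>j. if j \<in> {..<d} then x j else x0 j) = x" if "x \<in> {..<d} \<rightarrow>\<^sub>E UNIV" for x
  proof
    fix j show "(if j \<in> {..<d} then x j else x0 j) = x j"
      using that x0(1) by (auto simp: PiE_def extensional_def)
  qed
  then have "{x \<in> {..<d} \<rightarrow>\<^sub>E UNIV. f x = 0} \<subseteq> Z" using Z(2) unfolding sp by auto
  with Z(1) show ?thesis by blast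
qed

lemma gram_det_measure_zero:
  assumes N: "N > 0" "N \<le> d" "d \<le> 2 * N" and x0: "x0 \<in> coord_dom N d" "gram_det N (param N d x0) \<noteq> 0"
  shows "measure_zero N d {u \<in> manifold N d. gram_det N u = 0}"
proof -
  obtain P Q where P: "polyfun d P" and Q: "polyfun d Q" and nz: "\<And>x. x \<in> disc_coords N d \<Longrightarrow> Q x \<noteq> 0"
    and eq: "\<And>x. x \<in> disc_coords N d \<Longrightarrow> gram_det N (param N d x) = P x / Q x"
    using ratf_det[OF N] unfolding ratf_def gram_det_def by blast
  have nz0: "P x0 \<noteq> 0"
  proof
    assume "P x0 = 0"
    with x0(2) show False unfolding eq[OF coord_dom_disc[OF x0(1)]] by simp
  qed
  have dom: "x \<in> {..<d} \<rightarrow>\<^sub>E UNIV" if "x \<in> coord_dom N d" for x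
    using that by (simp only: coord_dom_def mem_Collect_eq)
  from polyfun_zeros_null[OF P dom[OF x0(1)] nz0]
  obtain Z where Z: "Z\<in>null_sets (\<Pi>\<^sub>M i\<in>{..<d}. (lborel :: complex measure))" "{x \<in> {..<d} \<rightarrow>\<^sub>E UNIV. P x = 0} \<subseteq> Z"
    by (rule bexE)
  have "{x \<in> coord_dom N d. param N d x \<in> {u \<in> manifold N d. gram_det N u = 0}} \<subseteq> {x \<in> {..<d} \<rightarrow>\<^sub>E UNIV. P x = 0}"
  proof
    fix x assume "x \<in> {x \<in> coord_dom N d. param N d x \<in> {u \<in> manifold N d. gram_det N u = 0}}"
    then have x: "x \<in> coord_dom N d" "gram_det N (param N d x) = 0" by simp_all
    have "P x / Q x = 0" using x(2) unfolding eq[OF coord_dom_disc[OF x(1)]] .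
    then have "P x = 0" using nz[OF coord_dom_disc[OF x(1)]] by simp
    then show "x \<in> {x \<in> {..<d} \<rightarrow>\<^sub>E UNIV. P x = 0}" using dom[OF x(1)] by simp
  qed
  then show ?thesis unfolding measure_zero_def by (intro bexI[OF _ Z(1)]) (rule order_trans[OF _ Z(2)])
qed

section \<open>Recovering the coordinates from Fourier coefficients, and closedness in L2\<close>

lemma sh_expansion:
  assumes "coeff B 0 = 1"
  shows "P = Psum (\<lambda>m. coeff ((sh B ^^ m) P) 0) n * B + Polynomial.monom 1 n * (sh B ^^ n) P"
proof (induct n)
  case 0
  then show ?case by (simp add: Psum_def)
next
  case (Suc n)
  let ?R = "(sh B ^^ n) P" and ?a = "\<lambda>m. coeff ((sh B ^^ m) P) 0"
  have s: "Psum ?a (Suc n) = Psum ?a n + Polynomial.smult (?a n) (Polynomial.monom 1 n)"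
    by (rule poly_eqI) (auto simp: coeff_Psum less_Suc_eq)
  have R: "?R = Polynomial.smult (?a n) B + pCons 0 (sh B ?R)"
    unfolding pCons_sh[OF assms] by simp
  have m: "Polynomial.monom 1 n * pCons 0 (sh B ?R) = Polynomial.monom 1 (Suc n) * sh B ?R"
    by (simp add: monom_Suc)
  have "Polynomial.monom 1 n * ?R = Polynomial.monom 1 n * (Polynomial.smult (?a n) B + pCons 0 (sh B ?R))"
    using R by simp
  also have "\<dots> = Polynomial.smult (?a n) (Polynomial.monom 1 n) * B + Polynomial.monom 1 (Suc n) * sh B ?R"
    unfolding distrib_left m by simp
  finally have "P = Psum ?a n * B + (Polynomial.smult (?a n) (Polynomial.monom 1 n) * B + Polynomial.monom 1 (Suc n) * sh B ?R)"
    using Suc by simp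
  then show ?case unfolding s distrib_right by (simp only: add.assoc funpow.simps o_apply)
qed

text \<open>By \<open>sh_expansion\<close>, \<open>A\<close> equals \<open>B\<close> times the
  truncated series up to a multiple of z^n, which does not reach the coefficients below
  \<open>n\<close>.\<close>

lemma coeff_from_fourier:
  assumes "coeff B 0 = 1" "disc_free B" "k < n"
  shows "coeff A k = coeff (Psum (\<lambda>m. fourier (qt A B) (int m)) n * B) k"
proof -
  have "coeff A k = coeff (Psum (\<lambda>m. coeff ((sh B ^^ m) A) 0) n * B + Polynomial.monom 1 n * (sh B ^^ n) A) k"
    using sh_expansion[OF assms(1), of A n] by simp
  then show ?thesis
    using assms(3) by (simp add: coeff_monom_mult fourier_qt_iter[OF assms(1,2)])
qed

text \<open>If \<open>a\<close> are the Fourier coefficients of \<open>A / B\<close>, the nonconstant coefficients of \<open>B\<close> solve a linear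
  system with this matrix, as \<open>(A / B) B\<close> has no coefficients of index \<open>N, \<dots>, 2 N - 1\<close>.\<close>

definition hankel_mat :: "nat \<Rightarrow> (nat \<Rightarrow> complex) \<Rightarrow> nat \<Rightarrow> nat \<Rightarrow> complex" where
  "hankel_mat N a k j = a (N - 1 + k - j)"

text \<open>A kernel vector \<open>y\<close> makes the coefficients N - 1, ..., 2 N - 2 of
  \<open>?Y * ?U\<close> vanish, so A Y and B R agree below index 2 N - 1 and hence everywhere. Here
  \<open>R\<close> is 0 or has degree at most N - 2. Coprimality refutes both alternatives of
  \<open>rat_pair\<close>: \<open>A\<close> of degree N - 1 would divide \<open>R\<close>, or
  \<open>B\<close> of degree \<open>N\<close> would divide \<open>?Y\<close>.\<close>

lemma hankel_mat_nonsingular: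
  assumes N: "N > 0" and AB: "rat_pair N A B" and a: "\<And>m. a m = fourier (qt A B) (int m)"
  shows "dt N (hankel_mat N a) \<noteq> 0"
proof
  assume "dt N (hankel_mat N a) = 0"
  then obtain y i where y: "i < N" "y i \<noteq> 0" "\<And>k. k < N \<Longrightarrow> (\<Sum>j<N. hankel_mat N a k j * y j) = 0"
    unfolding dt_eq_0_iff by blast
  have B: "coeff B 0 = 1" "disc_free B" "degree B \<le> N" "degree A \<le> N - 1" "coprime A B"
    "A \<noteq> 0 \<and> degree A = N - 1 \<or> degree B = N"
    using AB by (auto simp: rat_pair_def disc_free_def poly_0_coeff_0)
  let ?Y = "Psum y N" and ?U = "Psum a (2 * N)"
  define R where "R = Psum (coeff (?Y * ?U)) (N - 1)"
  have UY: "coeff (?Y * ?U) (N - 1 + k) = 0" if "k < N" for k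
  proof -
    have "coeff (?Y * ?U) (N - 1 + k) = (\<Sum>j<N. hankel_mat N a k j * y j)"
      unfolding coeff_mult_Psum using that by (intro sum.cong) (auto simp: coeff_Psum hankel_mat_def)
    then show ?thesis using y(3)[OF that] by simp
  qed
  have dY: "degree ?Y < N" by (rule degree_Psum_less[OF N])
  have diff: "coeff (?Y * ?U - R) k = 0" if "k < 2 * N - 1" for k
  proof (cases "k < N - 1")
    case True then show ?thesis by (simp add: R_def coeff_Psum)
  next
    case False
    then have "k - (N - 1) < N" "N - 1 + (k - (N - 1)) = k" using that by linarith+
    then show ?thesis using UY[of "k - (N - 1)"] False by (simp add: R_def coeff_Psum)
  qed
  have eq: "A * ?Y = B * R"
  proof (rule poly_eqI)
    fix k show "coeff (A * ?Y) k = coeff (B * R) k"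
    proof (cases "k < 2 * N - 1")
      case True
      have cA: "coeff A i = coeff (?U * B) i" if "i \<le> k" for i
        using coeff_from_fourier[OF B(1,2), of i "2 * N" A] that True by (simp add: a[symmetric])
      have "coeff (A * ?Y) k = coeff (?U * B * ?Y) k"
        unfolding coeff_mult[of A] coeff_mult[of "?U * B"] by (rule sum.cong) (simp_all add: cA)
      also have "?U * B * ?Y = B * (?Y * ?U - R) + B * R" by (simp add: algebra_simps)
      also have "coeff (B * (?Y * ?U - R) + B * R) k = coeff (B * R) k"
      proof -
        have "(\<Sum>i\<le>k. coeff B i * coeff (?Y * ?U - R) (k - i)) = (\<Sum>i\<le>k. coeff B i * 0)"
        proof (rule sum.cong[OF refl])
          fix i
          have "coeff (?Y * ?U - R) (k - i) = 0" by (rule diff) (use True in linarith)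
          then show "coeff B i * coeff (?Y * ?U - R) (k - i) = coeff B i * 0" by (simp only:)
        qed
        then show ?thesis unfolding coeff_add coeff_mult[of B "?Y * ?U - R"] by (simp only: mult_zero_right sum.neutral_const add_0)
      qed
      finally show ?thesis .
    next
      case False
      have "degree (A * ?Y) < k" using degree_mult_le[of A ?Y] B(4) dY False by linarith
      moreover have "degree R \<le> N - 2" by (rule degree_le) (auto simp: R_def coeff_Psum)
      then have "B * R = 0 \<or> degree (B * R) < k"
        using degree_mult_le[of B R] B(3) False N
        by (cases "N = 1") (auto simp: R_def Psum_def)
      ultimately show ?thesis by (auto simp: coeff_eq_0)
    qed
  qed
  have Y0: "?Y \<noteq> 0"
  proof
    assume "?Y = 0"
    then have "coeff ?Y i = 0" by simp
    with y(1,2) show False by (simp add: coeff_Psum)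
  qed
  from B(6) show False
  proof
    assume A: "A \<noteq> 0 \<and> degree A = N - 1"
    then have "A * ?Y \<noteq> 0" using Y0 by simp
    then have R0: "R \<noteq> 0" using eq by auto
    then have "N \<noteq> 1" by (auto simp: R_def Psum_def)
    then have "degree R < N - 1" unfolding R_def using N by (intro degree_Psum_less) simp
    moreover have "A dvd B * R" unfolding eq[symmetric] by simp
    then have "A dvd R" using B(5) by (simp add: coprime_dvd_mult_right_iff)
    then have "degree A \<le> degree R" using R0 by (rule dvd_imp_degree_le)
    ultimately show False using A by simp
  next
    assume dB: "degree B = N"
    have "B dvd A * ?Y" unfolding eq by simp
    then have "B dvd ?Y" using B(5) by (simp add: coprime_dvd_mult_right_iff coprime_commute)
    then have "degree B \<le> degree ?Y" using Y0 by (rule dvd_imp_degree_le)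
    then show False using dY dB by simp
  qed
qed

lemma linsolve_unique:
  assumes nz: "dt n M \<noteq> 0" and y: "\<And>k. k < n \<Longrightarrow> (\<Sum>i<n. M k i * y i) = r k" and i: "i < n"
  shows "y i = linsolve n M r i"
proof (rule ccontr)
  assume "y i \<noteq> linsolve n M r i"
  then have "y i - linsolve n M r i \<noteq> 0" by simp
  then have "dt n M = 0"
  proof (rule dt_eq_0I[where y="\<lambda>i. y i - linsolve n M r i", OF i])
    fix k assume k: "k < n"
    show "(\<Sum>j<n. M k j * (y j - linsolve n M r j)) = 0"
      using y[OF k] linsolve[OF nz k, of r] by (simp add: right_diff_distrib sum_subtractf)
  qed
  with nz show False by simp
qed

definition recon_den :: "nat \<Rightarrow> (nat \<Rightarrow> complex) \<Rightarrow> nat \<Rightarrow> complex" where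
  "recon_den N a j = (if j = 0 then 1 else linsolve N (hankel_mat N a) (\<lambda>k. - a (N + k)) (j - 1))"

text \<open>Uses the layout of \<open>param\<close>: first the coefficients of the numerator, as the
  convolution of the denominator with the series, then those of the denominator from index 1
  on.\<close>

definition recon :: "nat \<Rightarrow> (nat \<Rightarrow> complex) \<Rightarrow> nat \<Rightarrow> complex" where
  "recon N a i = (if i < N then \<Sum>j\<le>i. recon_den N a j * a (i - j) else recon_den N a (Suc (i - N)))"

lemma recon:
  assumes N: "N > 0" and AB: "rat_pair N A B" and a: "\<And>m. a m = fourier (qt A B) (int m)"
  shows "numer N (recon N a) = A" "denom N (2 * N) (recon N a) = B"
proof -
  have B: "coeff B 0 = 1" "disc_free B" "degree B \<le> N" "degree A \<le> N - 1"
    using AB by (auto simp: rat_pair_def disc_free_def poly_0_coeff_0)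
  have cA: "coeff A k = (\<Sum>i\<le>k. coeff B i * a (k - i))" if "k < 2 * N" for k
  proof -
    have "coeff A k = coeff (B * Psum a (2 * N)) k"
      using coeff_from_fourier[OF B(1,2) that, of A] by (simp add: a[symmetric] mult.commute)
    also have "\<dots> = (\<Sum>i\<le>k. coeff B i * a (k - i))"
      unfolding coeff_mult using that by (intro sum.cong) (auto simp: coeff_Psum)
    finally show ?thesis .
  qed
  have bs: "coeff B (Suc i) = linsolve N (hankel_mat N a) (\<lambda>k. - a (N + k)) i" if i: "i < N" for i
  proof (rule linsolve_unique[OF hankel_mat_nonsingular[OF N AB a] _ i])
    fix k assume k: "k < N"
    have "0 = coeff A (N + k)" using B(4) N by (simp add: coeff_eq_0)
    also have "\<dots> = (\<Sum>i\<le>N + k. coeff B i * a (N + k - i))" using k by (intro cA) simp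
    also have "\<dots> = (\<Sum>i<Suc N. coeff B i * a (N + k - i))"
      using B(3) by (intro sum.mono_neutral_right) (auto simp: coeff_eq_0)
    also have "\<dots> = a (N + k) + (\<Sum>j<N. coeff B (Suc j) * a (N + k - Suc j))"
      unfolding sum.lessThan_Suc_shift by (simp add: B(1))
    also have "(\<Sum>j<N. coeff B (Suc j) * a (N + k - Suc j)) = (\<Sum>j<N. hankel_mat N a k j * coeff B (Suc j))"
    proof (rule sum.cong[OF refl])
      fix j assume "j \<in> {..<N}"
      then have "N + k - Suc j = N - 1 + k - j" by auto
      then show "coeff B (Suc j) * a (N + k - Suc j) = hankel_mat N a k j * coeff B (Suc j)"
        by (simp only: hankel_mat_def mult.commute)
    qed
    finally have "a (N + k) + (\<Sum>j<N. hankel_mat N a k j * coeff B (Suc j)) = 0" by (rule sym)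
    then show "(\<Sum>j<N. hankel_mat N a k j * coeff B (Suc j)) = - a (N + k)"
      by (simp only: add_eq_0_iff)
  qed
  have rd: "recon_den N a j = coeff B j" if "j \<le> N" for j
  proof (cases j)
    case (Suc i) then show ?thesis using bs[of i] that by (simp add: recon_den_def)
  qed (simp add: recon_den_def B(1))
  show "numer N (recon N a) = A"
  proof (rule numer_coeffs)
    fix i assume i: "i < N"
    have "(\<Sum>j\<le>i. recon_den N a j * a (i - j)) = (\<Sum>j\<le>i. coeff B j * a (i - j))"
      using i by (intro sum.cong) (auto simp: rd)
    then show "recon N a i = coeff A i" using i cA[of i] by (simp add: recon_def)
  qed (use N B in auto)
  show "denom N (2 * N) (recon N a) = B"
    by (rule denom_coeffs) (use B rd in \<open>auto simp: recon_def\<close>)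
qed

lemma ratf_recon:
  assumes "i < 2 * N" shows "ratf (2 * N) {a. dt N (hankel_mat N a) \<noteq> 0} (\<lambda>a. recon N a i)"
proof -
  let ?S = "{a. dt N (hankel_mat N a) \<noteq> 0}"
  have m: "ratf (2 * N) ?S (\<lambda>a. - a (N + k))" if "k < N" for k
    using ratf_mult[OF ratf_const[of _ _ "-1"] ratf_coord[of "N + k" "2 * N"]] that by simp
  have d: "ratf (2 * N) ?S (\<lambda>a. recon_den N a j)" if "j \<le> N" for j
    unfolding recon_den_def
  proof (intro ratf_if ratf_const ratf_linsolve)
    fix k l assume "k < N" "l < N"
    then show "ratf (2 * N) ?S (\<lambda>a. hankel_mat N a k l)" unfolding hankel_mat_def by (intro ratf_coord) auto
  qed (use that m in auto)
  show ?thesis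
    unfolding recon_def using assms by (intro ratf_if ratf_sum ratf_mult d ratf_coord) auto
qed

lemma ratf_compose:
  "polyfun d P \<Longrightarrow> (\<And>i. i < d \<Longrightarrow> ratf e S (\<lambda>a. X a i)) \<Longrightarrow> ratf e S (\<lambda>a. P (X a))"
  by (induct rule: polyfun.induct) (auto intro: ratf_const ratf_cnj ratf_add ratf_mult)

lemma polyfun_nonzero_near:
  assumes "polyfun d f" "f p \<noteq> 0" shows "\<exists>e>0. \<forall>w\<in>near d p e. f w \<noteq> 0"
proof -
  from ratf_majorized[OF polyfun_const[of d 0] assms]
  obtain e where "0 < e \<and> (\<forall>r. 0 < r \<and> r \<le> e \<longrightarrow> (\<exists>C. majorized d p r (\<lambda>w. 0 / f w) C) \<and> (\<forall>w\<in>near d p r. f w \<noteq> 0))" ..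
  note e = this
  show ?thesis using e[THEN conjunct1] e[THEN conjunct2, THEN spec, of e] by blast
qed

lemma fourier_l2_dist:
  assumes "u \<in> L2" "v \<in> L2" shows "cmod (fourier u k - fourier v k) \<le> l2_dist u v"
proof -
  have L: "(\<lambda>z. u z - v z) \<in> L2" by (rule L2_diff[OF assms])
  have "cinner (\<lambda>z. z powi k) (\<lambda>z. z powi k) = 1" by (simp add: cinner_powi)
  then have n: "(\<integral>z. (cmod (z powi k))\<^sup>2 \<partial>circle) = 1" unfolding cinner_self of_real_eq_1_iff .
  have "(cmod (fourier (\<lambda>z. u z - v z) k))\<^sup>2 \<le> (\<integral>z. (cmod (u z - v z))\<^sup>2 \<partial>circle)"
    using cauchy_cinner[OF L L2_powi[of k]] unfolding n fourier_def by simp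
  then have "cmod (fourier (\<lambda>z. u z - v z) k) \<le> sqrt (\<integral>z. (cmod (u z - v z))\<^sup>2 \<partial>circle)"
    by (rule real_le_rsqrt)
  then show ?thesis unfolding fourier_diff[OF assms] l2_dist_def .
qed

text \<open>Composing with \<open>recon\<close> shows that on \<open>ratM N\<close> the determinant
  vanishes exactly when one polynomial in 2 N Fourier coefficients and their conjugates does. These
  depend on the function in a Lipschitz way for \<open>l2_dist\<close>, so nonvanishing is open. A
  general subset \<open>M\<close> covers the hypersurface with the same coefficients.\<close>

lemma gram_det_closed:
  assumes N: "N > 0" and M: "M \<subseteq> ratM N"
  shows "l2_closed_in M {u \<in> M. gram_det N u = 0}"
proof -
  let ?d = "2 * N" and ?a = "\<lambda>u m. fourier u (int m)"
  obtain P Q where P: "polyfun ?d P" and Q: "polyfun ?d Q" and nz: "\<And>x. x \<in> disc_coords N ?d \<Longrightarrow> Q x \<noteq> 0"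
    and eq: "\<And>x. x \<in> disc_coords N ?d \<Longrightarrow> gram_det N (param N ?d x) = P x / Q x"
    using ratf_det[OF N, of ?d] unfolding ratf_def gram_det_def by auto
  let ?S = "{a. dt N (hankel_mat N a) \<noteq> 0}"
  obtain P' Q' where P': "polyfun ?d P'" and nz': "\<And>a. a \<in> ?S \<Longrightarrow> Q' a \<noteq> 0"
    and eq': "\<And>a. a \<in> ?S \<Longrightarrow> P (recon N a) = P' a / Q' a"
  proof -
    have "ratf ?d ?S (\<lambda>a. P (recon N a))" by (rule ratf_compose[OF P ratf_recon])
    then show ?thesis using that unfolding ratf_def by blast
  qed
  have "ratf ?d UNIV (\<lambda>a. dt N (hankel_mat N a))"
    unfolding hankel_mat_def by (intro ratf_dt ratf_coord) auto
  then obtain P2 Q2 where P2: "polyfun ?d P2" and nz2: "\<And>a. Q2 a \<noteq> 0" and eq2: "\<And>a. dt N (hankel_mat N a) = P2 a / Q2 a"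
    unfolding ratf_def by auto
  have key: "u \<in> L2 \<and> ?a u \<in> ?S \<and> (gram_det N u = 0 \<longleftrightarrow> P' (?a u) = 0)" if um: "u \<in> ratM N" for u
  proof -
    obtain A B where u: "u = (\<lambda>z. poly A z / poly B z)" and AB: "rat_pair N A B" using um unfolding ratM_def by blast
    have uq: "u = qt A B" unfolding u by (simp add: qt_def[abs_def])
    have fB: "disc_free B" using AB by (simp add: rat_pair_def disc_free_def)
    have ne: "?a u \<in> ?S" using hankel_mat_nonsingular[OF N AB, of "?a u"] by (simp add: uq)
    note r = recon[OF N AB, of "?a u", unfolded uq, OF refl]
    have x: "recon N (?a u) \<in> disc_coords N ?d" using fB r(2) by (simp add: disc_coords_def uq)
    have "param N ?d (recon N (?a u)) = u" using r by (simp add: param_def u uq qt_def[abs_def])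
    then have "gram_det N u = P (recon N (?a u)) / Q (recon N (?a u))" using eq[OF x] by simp
    then have "gram_det N u = 0 \<longleftrightarrow> P' (?a u) = 0" unfolding eq'[OF ne] using nz[OF x] nz'[OF ne] by simp
    moreover have "u \<in> L2" unfolding uq by (rule qt_L2[OF fB])
    ultimately show ?thesis using ne by blast
  qed
  show ?thesis
    unfolding l2_closed_in_def l2_open_in_def
  proof (intro conjI ballI)
    fix u assume "u \<in> M - {u \<in> M. gram_det N u = 0}"
    then have u: "u \<in> ratM N" "gram_det N u \<noteq> 0" using M by auto
    have "P' (?a u) \<noteq> 0" using key[OF u(1)] u(2) by blast
    from polyfun_nonzero_near[OF P' this] obtain e where e: "e > 0 \<and> (\<forall>w\<in>near ?d (?a u) e. P' w \<noteq> 0)" ..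
    show "\<exists>e>0. \<forall>v\<in>M. l2_dist u v < e \<longrightarrow> v \<in> M - {u \<in> M. gram_det N u = 0}"
    proof (intro exI[of _ e] conjI ballI impI)
      fix v assume v: "v \<in> M" "l2_dist u v < e"
      then have vM: "v \<in> ratM N" using M by auto
      have "cmod (?a v m - ?a u m) < e" for m
        using fourier_l2_dist[of u v "int m"] key[OF u(1)] key[OF vM] v(2) by (simp add: norm_minus_commute)
      then have "?a v \<in> near ?d (?a u) e" by (simp add: near_def)
      then have "P' (?a v) \<noteq> 0" using e by blast
      then show "v \<in> M - {u \<in> M. gram_det N u = 0}" using key[OF vM] v(1) by blast
    qed (use e in blast)
  qed auto
qed

section \<open>A nondegenerate example\<close>

lemma E_monom_1:
  assumes "rational_data N A 1" shows "rational_data.E 1 R (Polynomial.monom 1 i) = coeff R i"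
proof -
  have "qt (Polynomial.monom 1 i) 1 = (\<lambda>z. z powi int i)" by (simp add: qt_def[abs_def] poly_monom fun_eq_iff)
  then show ?thesis
    unfolding rational_data.E_def[OF assms] fourier_poly[of R i, symmetric] fourier_def by simp
qed

text \<open>The index set is {N - 2, N - 1}, and {0} if \<open>N = 1\<close>, so a single formula
  covers both cases.\<close>

locale example =
  fixes N :: nat and A :: "complex poly"
  assumes N0: "N > 0" and A_eq: "A = (\<Sum>i\<in>{i. i < N \<and> N \<le> i + 2}. Polynomial.monom 1 i)"
begin

lemma coeff_A: "coeff A k = (if k < N \<and> N \<le> k + 2 then 1 else 0)"
  by (simp add: A_eq coeff_sum)

sublocale rational_data N A 1
proof
  show "degree A < N" using N0 by (intro degree_lessI) (auto simp: coeff_A)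
qed (use N0 in \<open>auto simp: disc_free_def\<close>)

lemma E_monom: "E R (Polynomial.monom 1 i) = coeff R i"
  by (rule E_monom_1) unfold_locales

lemma E_one: "E R 1 = coeff R 0"
  using E_monom[of R 0] by (simp add: monom_0 one_pCons)

lemma coeff_H_E: assumes "degree P < N" shows "coeff (H P) k = E A (Polynomial.monom 1 k * P)"
proof -
  have "coeff (H P) k = E (H P) (Polynomial.monom 1 k)" by (rule E_monom[symmetric])
  also have "\<dots> = E A (Polynomial.monom 1 k * P)"
    unfolding E_H[OF assms] unfolding E_def cinner_def by (simp add: qt_def mult_ac)
  finally show ?thesis .
qed

text \<open>For a polynomial symbol the Hankel matrix is constant along antidiagonals; here it has
  ones where the index sum is N - 1 or N - 2.\<close>

lemma coeff_H: assumes "degree P < N"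
  shows "coeff (H P) k = (if k < N then cnj (coeff P (N - 1 - k)) else 0) + (if k + 1 < N then cnj (coeff P (N - 2 - k)) else 0)"
proof -
  let ?I = "{i. i < N \<and> N \<le> i + 2}" and ?R = "Polynomial.monom 1 k * P"
  have "coeff (H P) k = E (\<Sum>i\<in>?I. Polynomial.smult 1 (Polynomial.monom 1 i)) ?R"
  proof -
    have "A = (\<Sum>i\<in>?I. Polynomial.smult 1 (Polynomial.monom 1 i))" by (simp add: A_eq)
    then have "E A ?R = E (\<Sum>i\<in>?I. Polynomial.smult 1 (Polynomial.monom 1 i)) ?R" by (rule arg_cong[where f="\<lambda>X. E X ?R"])
    then show ?thesis unfolding coeff_H_E[OF assms] .
  qed
  also have "\<dots> = (\<Sum>i\<in>?I. cnj (coeff ?R i))"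
    unfolding E_lincomb E_monom[symmetric] by (simp add: E_cnj)
  also have "\<dots> = (\<Sum>i\<in>?I. if i < k then 0 else cnj (coeff P (i - k)))"
    by (rule sum.cong) (auto simp: coeff_monom_mult)
  also have "\<dots> = (if k < N then cnj (coeff P (N - 1 - k)) else 0) + (if k + 1 < N then cnj (coeff P (N - 2 - k)) else 0)"
  proof (cases "N = 1")
    case True
    then have "?I = {0}" by auto
    then show ?thesis using True by simp
  next
    case False
    then have "?I = {N - 1, N - 2}" "N - 1 \<noteq> N - 2" using N0 by auto
    moreover have "N - 1 < k \<longleftrightarrow> \<not> k < N" "N - 2 < k \<longleftrightarrow> \<not> k + 1 < N" using False N0 by auto
    ultimately show ?thesis by simp
  qed
  finally show ?thesis .
qed

lemma H_one: "H 1 = A"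
proof (rule poly_eqI)
  fix k
  have "coeff (H 1) k = E A (Polynomial.monom 1 k)" using coeff_H_E[of 1 k] N0 by simp
  then show "coeff (H 1) k = coeff A k" by (simp only: E_monom)
qed

lemma H_lincomb:
  assumes "\<And>j. j < n \<Longrightarrow> degree (q j) < N"
  shows "H (\<Sum>j<n. Polynomial.smult (y j) (q j)) = (\<Sum>j<n. Polynomial.smult (cnj (y j)) (H (q j)))"
proof (rule poly_eqI)
  fix k
  have d: "degree (\<Sum>j<n. Polynomial.smult (y j) (q j)) < N"
  proof (rule degree_lessI[OF disjI2[OF N0]], intro allI impI)
    fix k assume k: "N \<le> k"
    have "coeff (q j) k = 0" if "j < n" for j using assms[OF that] k by (intro coeff_eq_0) simp
    then show "coeff (\<Sum>j<n. Polynomial.smult (y j) (q j)) k = 0" by (simp add: coeff_sum)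
  qed
  have "coeff (\<Sum>j<n. Polynomial.smult (cnj (y j)) (H (q j))) k = (\<Sum>j<n. cnj (y j) * coeff (H (q j)) k)"
    by (simp add: coeff_sum)
  also have "\<dots> = (\<Sum>j<n. (if k < N then cnj (y j * coeff (q j) (N - 1 - k)) else 0) + (if k + 1 < N then cnj (y j * coeff (q j) (N - 2 - k)) else 0))"
    by (rule sum.cong) (auto simp: coeff_H assms distrib_left)
  also have "\<dots> = coeff (H (\<Sum>j<n. Polynomial.smult (y j) (q j))) k"
    unfolding coeff_H[OF d] sum.distrib by (simp add: coeff_sum)
  finally show "coeff (H (\<Sum>j<n. Polynomial.smult (y j) (q j))) k = coeff (\<Sum>j<n. Polynomial.smult (cnj (y j)) (H (q j))) k" by simp
qed

text \<open>Coefficient N - 1 - n of \<open>H P\<close> involves only the coefficients n and n - 1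
  of \<open>P\<close>, so these vanish successively from index 0 upwards.\<close>

lemma H_inj: assumes P: "degree P < N" and 0: "H P = 0" shows "P = 0"
proof -
  have "n < N \<longrightarrow> coeff P n = 0" for n
  proof (induct n rule: less_induct)
    case (less n)
    show ?case
    proof
      assume n: "n < N"
      have "coeff (H P) (N - 1 - n) = 0" using 0 by simp
      moreover have "N - 1 - (N - 1 - n) = n" "N - 1 - n < N" using n by auto
      moreover have "coeff P (N - 2 - (N - 1 - n)) = 0" if "N - 1 - n + 1 < N"
      proof -
        have "N - 2 - (N - 1 - n) < n" "N - 2 - (N - 1 - n) < N" using that n by auto
        then show ?thesis using less by blast
      qed
      ultimately show "coeff P n = 0" unfolding coeff_H[OF P] by (auto split: if_splits)
    qed
  qed
  then show ?thesis using P by (intro poly_eqI) (metis coeff_0 coeff_eq_0 not_less order_less_le_trans)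
qed

definition K where "K P = H (H P)"

lemma degree_K: "degree P < N \<Longrightarrow> degree (K P) < N"
  unfolding K_def by (intro degree_H)

text \<open>The two reversals cancel and leave a tridiagonal matrix: ones beside the diagonal, and
  on it 2 except for 1 in the last place.\<close>

lemma coeff_K:
  assumes Y: "degree Y < N" and m: "m < N"
  shows "coeff (K Y) m = coeff Y m + (if m \<ge> 1 then coeff Y (m - 1) else 0) + (if m + 1 < N then coeff Y (m + 1) + coeff Y m else 0)"
proof -
  have 1: "coeff (H Y) (N - 1 - m) = cnj (coeff Y m) + (if m \<ge> 1 then cnj (coeff Y (m - 1)) else 0)"
  proof -
    have "N - 1 - (N - 1 - m) = m" "N - 1 - m < N" "N - 1 - m + 1 < N \<longleftrightarrow> m \<ge> 1" "m \<ge> 1 \<Longrightarrow> N - 2 - (N - 1 - m) = m - 1"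
      using m by auto
    then show ?thesis unfolding coeff_H[OF Y] by simp
  qed
  have 2: "coeff (H Y) (N - 2 - m) = cnj (coeff Y (m + 1)) + cnj (coeff Y m)" if "m + 1 < N"
  proof -
    have "N - 1 - (N - 2 - m) = m + 1" "N - 2 - m < N" "N - 2 - m + 1 < N" "N - 2 - (N - 2 - m) = m"
      using that by auto
    then show ?thesis unfolding coeff_H[OF Y] by simp
  qed
  show ?thesis unfolding K_def coeff_H[OF degree_H[OF Y], of m] using m 1 2 by simp
qed

text \<open>The ones below the diagonal raise the degree by exactly one per step, so the first
  \<open>N\<close> iterates of 1 are monic of increasing degree and therefore independent.\<close>

lemma K_power: "j < N \<Longrightarrow> coeff ((K ^^ j) 1) j = 1 \<and> (\<forall>m>j. coeff ((K ^^ j) 1) m = 0)"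
  and degree_K_power: "degree ((K ^^ j) 1) < N"
proof -
  show d: "degree ((K ^^ j) 1) < N" for j by (induct j) (auto simp: N0 degree_K)
  show "j < N \<Longrightarrow> coeff ((K ^^ j) 1) j = 1 \<and> (\<forall>m>j. coeff ((K ^^ j) 1) m = 0)"
  proof (induct j)
    case 0 show ?case by (simp add: coeff_1)
  next
    case (Suc j)
    have z: "coeff ((K ^^ Suc j) 1) m = 0" if "m \<ge> N" for m using d[of "Suc j"] that by (intro coeff_eq_0) simp
    have "coeff ((K ^^ Suc j) 1) m = 0" if "m > Suc j" for m
      using that z[of m] Suc coeff_K[OF d[of j], of m] by (cases "m < N") auto
    moreover have "coeff ((K ^^ Suc j) 1) (Suc j) = 1"
      using Suc coeff_K[OF d[of j], of "Suc j"] by auto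
    ultimately show ?case by blast
  qed
qed

lemma E_K_swap: "degree P < N \<Longrightarrow> degree Q < N \<Longrightarrow> E (K P) Q = E P (K Q)"
proof -
  assume P: "degree P < N" and Q: "degree Q < N"
  have s: "E (H X) Y = E (H Y) X" if "degree X < N" "degree Y < N" for X Y
    unfolding E_def by (rule H_sym[OF that Bfree])
  have "E (K P) Q = E (H Q) (H P)" unfolding K_def by (rule s[OF degree_H[OF P] Q])
  also have "\<dots> = cnj (E (H P) (H Q))" by (rule E_cnj[symmetric])
  also have "E (H P) (H Q) = E (K Q) P" unfolding K_def by (rule s[OF P degree_H[OF Q]])
  finally show ?thesis by (simp only: E_cnj)
qed

lemma moment_K: "moment (2 * ((i + 1) + (j + 1))) (qt A 1) = E ((K ^^ Suc i) 1) ((K ^^ Suc j) 1)"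
proof -
  have sw: "E ((K ^^ n) P) Q = E P ((K ^^ n) Q)" if "degree P < N" "degree Q < N" for n P Q
    using that
  proof (induct n arbitrary: Q)
    case (Suc n)
    have dn: "degree ((K ^^ n) P) < N" by (induct n) (auto simp: Suc degree_K)
    have "E ((K ^^ Suc n) P) Q = E ((K ^^ n) P) (K Q)" using E_K_swap[OF dn Suc(3)] by simp
    also have "\<dots> = E P ((K ^^ n) (K Q))" by (rule Suc(1)[OF Suc(2) degree_K[OF Suc(3)]])
    finally show ?case by (simp add: funpow_swap1)
  qed simp
  have KH: "(H ^^ (2 * n)) P = (K ^^ n) P" for n P by (induct n) (auto simp: K_def)
  have "2 * ((i + 1) + (j + 1)) = Suc (Suc (2 * (i + j + 1)))" by simp
  then have "moment (2 * ((i + 1) + (j + 1))) (qt A 1) = coeff ((H ^^ Suc (2 * (i + j + 1))) (H 1)) 0"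
    by (simp only: moment_qt H_one)
  also have "(H ^^ Suc (2 * (i + j + 1))) (H 1) = (H ^^ (2 * (i + j + 2))) 1"
    by (simp add: funpow_swap1)
  also have "\<dots> = (K ^^ (Suc j + Suc i)) 1" unfolding KH by (simp add: add.commute)
  also have "coeff \<dots> 0 = E ((K ^^ Suc j) ((K ^^ Suc i) 1)) 1" unfolding E_one funpow_add o_apply ..
  also have "\<dots> = E ((K ^^ Suc i) 1) ((K ^^ Suc j) 1)"
    by (rule sw[OF degree_K_power]) (simp add: N0)
  finally show ?thesis .
qed

text \<open>A singular Gram matrix gives a combination \<open>Z\<close> of the iterates with E Z Z =
  0. As the exponents start at 1, Z = K Y; injectivity of \<open>H\<close> removes the factor
  \<open>K\<close>, and independence of the iterates excludes Y = 0.\<close>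

lemma gram_det_nonzero: "gram_det N (qt A 1) \<noteq> 0"
proof
  assume "gram_det N (qt A 1) = 0"
  then have "dt N (\<lambda>i j. E ((K ^^ Suc i) 1) ((K ^^ Suc j) 1)) = 0"
    unfolding gram_det_def moment_K .
  then obtain x i where x: "i < N" "x i \<noteq> 0"
    "\<And>i. i < N \<Longrightarrow> (\<Sum>j<N. E ((K ^^ Suc i) 1) ((K ^^ Suc j) 1) * x j) = 0"
    unfolding dt_eq_0_iff by blast
  define Z where "Z = (\<Sum>j<N. Polynomial.smult (cnj (x j)) ((K ^^ Suc j) 1))"
  define Y where "Y = (\<Sum>j<N. Polynomial.smult (cnj (x j)) ((K ^^ j) 1))"
  have "E ((K ^^ Suc i) 1) Z = 0" if "i < N" for i
    unfolding Z_def E_lincomb_right using x(3)[OF that] by (simp add: mult.commute)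
  then have "E Z Z = 0" unfolding Z_def E_lincomb by (simp add: Z_def[symmetric])
  then have Z0: "Z = 0" by (rule E_definite)
  have KY: "K Y = Z"
  proof -
    have "H Y = (\<Sum>j<N. Polynomial.smult (cnj (cnj (x j))) (H ((K ^^ j) 1)))"
      unfolding Y_def by (rule H_lincomb[OF degree_K_power])
    then have "H (H Y) = H (\<Sum>j<N. Polynomial.smult (cnj (cnj (x j))) (H ((K ^^ j) 1)))" by (simp only:)
    also have "\<dots> = (\<Sum>j<N. Polynomial.smult (cnj (cnj (cnj (x j)))) (H (H ((K ^^ j) 1))))"
      by (rule H_lincomb[OF degree_H[OF degree_K_power]])
    finally show ?thesis unfolding Z_def K_def[symmetric] funpow.simps o_apply complex_cnj_cnj .
  qed
  have dY: "degree Y < N"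
    unfolding Y_def using N0 by (intro degree_lessI) (auto simp: coeff_sum coeff_eq_0 less_le_trans[OF degree_K_power])
  have "E (H Y) (H Y) = E (K Y) Y"
    unfolding K_def E_def by (rule H_sym[OF dY degree_H[OF dY] Bfree])
  also have "\<dots> = 0" unfolding KY Z0 using E_smult[of 0 0 Y] by simp
  finally have "Y = 0" by (intro H_inj[OF dY] E_definite)
  \<comment> \<open>At the largest index of the relation only one iterate contributes to the
    coefficient \<open>j0\<close> of \<open>Y\<close>.\<close>
  define j0 where "j0 = Max {j. j < N \<and> x j \<noteq> 0}"
  have "j0 \<in> {j. j < N \<and> x j \<noteq> 0}" unfolding j0_def by (rule Max_in) (use x in auto)
  then have j0: "j0 < N" "x j0 \<noteq> 0" by auto
  have big: "x j = 0" if "j < N" "j0 < j" for j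
    using Max_ge[of "{j. j < N \<and> x j \<noteq> 0}" j] that unfolding j0_def by fastforce
  have "coeff Y j0 = (\<Sum>j<N. cnj (x j) * coeff ((K ^^ j) 1) j0)" by (simp add: Y_def coeff_sum)
  also have "\<dots> = (\<Sum>j<N. if j = j0 then cnj (x j0) else 0)"
  proof (rule sum.cong[OF refl])
    fix j assume "j \<in> {..<N}"
    then have "j < N" by simp
    then show "cnj (x j) * coeff ((K ^^ j) 1) j0 = (if j = j0 then cnj (x j0) else 0)"
      using K_power[of j] big[of j] by (cases j j0 rule: linorder_cases) auto
  qed
  also have "\<dots> = cnj (x j0)" using j0(1) by simp
  finally show False using j0(2) \<open>Y = 0\<close> by simp
qed

lemma rat_pair_example: "rat_pair N A 1"
proof -
  have "coeff A (N - 1) \<noteq> 0" using N0 by (simp add: coeff_A)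
  then have "N - 1 \<le> degree A" by (rule le_degree)
  then have "degree A = N - 1" using dA by simp
  moreover have "A \<noteq> 0" using \<open>coeff A (N - 1) \<noteq> 0\<close> by auto
  ultimately show ?thesis by (simp add: rat_pair_def)
qed

end

lemma example_exists:
  assumes "N > 0"
  obtains A where "rat_pair N A 1" "gram_det N (qt A 1) \<noteq> 0"
proof -
  interpret example N "\<Sum>i\<in>{i. i < N \<and> N \<le> i + 2}. Polynomial.monom 1 i"
    by unfold_locales (use assms in auto)
  show ?thesis by (rule that[OF rat_pair_example gram_det_nonzero])
qed

lemma variety_V_gram_det: "variety_V N = {u \<in> ratM N. gram_det N u = 0}"
  by (simp add: variety_V_def gram_det_def dt_def)

lemma ratM_tilde_subset: assumes "N \<ge> 1" shows "ratM_tilde (N - 1) \<subseteq> ratM N"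
  using assms unfolding ratM_tilde_def ratM_def by fastforce

lemma variety_V_tilde_gram_det:
  assumes "N \<ge> 1" shows "variety_V_tilde (N - 1) = {u \<in> ratM_tilde (N - 1). gram_det N u = 0}"
proof -
  have "Suc (N - 1) = N" using assms by simp
  then show ?thesis
    using ratM_tilde_subset[OF assms] unfolding variety_V_tilde_def variety_V_gram_det by auto
qed

lemma bounded_outside_variety:
  assumes N: "N \<ge> 1" and u: "u0 \<in> ratM N" "gram_det N u0 \<noteq> 0"
  shows "solution_bounded_from s u0"
proof -
  obtain A B where AB: "u0 = (\<lambda>z. poly A z / poly B z)" "rat_pair N A B" using u(1) unfolding ratM_def by blast
  have eq: "u0 = qt A B" unfolding AB(1) by (simp add: qt_def[abs_def])
  interpret rational_data N A B
    using N AB(2) by unfold_locales (auto simp: rat_pair_def disc_free_def)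
  show ?thesis using bounded_solution[of s] u(2) unfolding eq gram_det_def by blast
qed

theorem theorem7p1:
  fixes N :: nat
  assumes "N \<ge> 1"
  shows
    "real_analytic_subvariety N (2 * N) (variety_V N) \<and> variety_V N \<subset> ratM N \<and>
     (\<forall>u0 \<in> ratM N - variety_V N. \<forall>s\<ge>0. solution_bounded_from s u0) \<and>
     (\<exists>F. l2_closed_in (ratM N) F \<and> measure_zero N (2 * N) F \<and>
        (\<forall>u0 \<in> ratM N - F. \<forall>s\<ge>0. solution_bounded_from s u0)) \<and>
     real_analytic_subvariety N (2 * N - 1) (variety_V_tilde (N - 1)) \<and>
     variety_V_tilde (N - 1) \<subset> ratM_tilde (N - 1) \<and>
     (\<forall>u0 \<in> ratM_tilde (N - 1) - variety_V_tilde (N - 1). \<forall>s\<ge>0. solution_bounded_from s u0) \<and>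
     (\<exists>F. l2_closed_in (ratM_tilde (N - 1)) F \<and> measure_zero N (2 * N - 1) F \<and>
        (\<forall>u0 \<in> ratM_tilde (N - 1) - F. \<forall>s\<ge>0. solution_bounded_from s u0))"
proof -
  have N: "N > 0" using assms by simp
  note V = variety_V_gram_det[of N] and V' = variety_V_tilde_gram_det[OF assms]
  note M = ratM_eq_manifold[OF assms] and M' = ratM_tilde_eq_manifold[OF assms]
  note sub = ratM_tilde_subset[OF assms]
  have cl: "l2_closed_in (ratM N) (variety_V N)" "l2_closed_in (ratM_tilde (N - 1)) (variety_V_tilde (N - 1))"
    unfolding V V' by (intro gram_det_closed N order_refl sub)+
  obtain A where A: "rat_pair N A 1" "gram_det N (qt A 1) \<noteq> 0" using example_exists[OF N] .
  \<comment> \<open>The denominator 1 has degree 0, so the same example lies in both manifolds and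
    shows that both varieties are proper and null.\<close>
  have ex: "\<exists>x\<in>coord_dom N d. param N d x = qt A 1" if d: "N \<le> d" for d
  proof -
    obtain x where x: "x \<in> coord_dom N d" "numer N x = A" "denom N d x = 1"
      by (rule rat_pair_coords[OF assms d A(1)]) simp
    then have "param N d x = qt A 1" by (simp add: param_def qt_def[abs_def])
    with x(1) show ?thesis by blast
  qed
  have d: "N \<le> 2 * N" "2 * N \<le> 2 * N" "N \<le> 2 * N - 1" "2 * N - 1 \<le> 2 * N" using N by auto
  have proper: "variety_V N \<subset> ratM N"
  proof -
    obtain x where x: "x \<in> coord_dom N (2 * N)" "param N (2 * N) x = qt A 1" using ex[OF d(1)] by blast
    have "qt A 1 \<in> ratM N" unfolding M x(2)[symmetric] by (rule imageI[OF x(1)])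
    then show ?thesis unfolding V using A(2) by blast
  qed
  have proper': "variety_V_tilde (N - 1) \<subset> ratM_tilde (N - 1)"
  proof -
    obtain x where x: "x \<in> coord_dom N (2 * N - 1)" "param N (2 * N - 1) x = qt A 1" using ex[OF d(3)] by blast
    have "qt A 1 \<in> ratM_tilde (N - 1)" unfolding M' x(2)[symmetric] by (rule imageI[OF x(1)])
    then show ?thesis unfolding V' using A(2) by blast
  qed
  have sv: "real_analytic_subvariety N (2 * N) (variety_V N)"
    using gram_det_subvariety[OF N d(1,2)] cl(1) unfolding V M by blast
  have sv': "real_analytic_subvariety N (2 * N - 1) (variety_V_tilde (N - 1))"
    using gram_det_subvariety[OF N d(3,4)] cl(2) unfolding V' M' by blast
  have mz: "measure_zero N (2 * N) (variety_V N)"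
  proof -
    obtain x where "x \<in> coord_dom N (2 * N)" "param N (2 * N) x = qt A 1" using ex[OF d(1)] by blast
    then show ?thesis unfolding V M using gram_det_measure_zero[OF N d(1,2), of x] A(2) by simp
  qed
  have mz': "measure_zero N (2 * N - 1) (variety_V_tilde (N - 1))"
  proof -
    obtain x where "x \<in> coord_dom N (2 * N - 1)" "param N (2 * N - 1) x = qt A 1" using ex[OF d(3)] by blast
    then show ?thesis unfolding V' M' using gram_det_measure_zero[OF N d(3,4), of x] A(2) by simp
  qed
  have bd: "\<forall>u0 \<in> ratM N - variety_V N. \<forall>s\<ge>0. solution_bounded_from s u0"
    unfolding V using bounded_outside_variety[OF assms] by blast
  have bd': "\<forall>u0 \<in> ratM_tilde (N - 1) - variety_V_tilde (N - 1). \<forall>s\<ge>0. solution_bounded_from s u0"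
    unfolding V' using bounded_outside_variety[OF assms] sub by blast
  \<comment> \<open>The variety itself is the closed exceptional set of measure 0.\<close>
  have "\<exists>F. l2_closed_in (ratM N) F \<and> measure_zero N (2 * N) F \<and>
      (\<forall>u0 \<in> ratM N - F. \<forall>s\<ge>0. solution_bounded_from s u0)"
    by (intro exI[of _ "variety_V N"] conjI cl(1) mz bd)
  moreover have "\<exists>F. l2_closed_in (ratM_tilde (N - 1)) F \<and> measure_zero N (2 * N - 1) F \<and>
      (\<forall>u0 \<in> ratM_tilde (N - 1) - F. \<forall>s\<ge>0. solution_bounded_from s u0)"
    by (intro exI[of _ "variety_V_tilde (N - 1)"] conjI cl(2) mz' bd')
  ultimately show ?thesis
    by (intro conjI sv proper bd sv' proper' bd')
qed

end
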